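(* There exists a constant $C>0$ such that the following two assertions hold. (i) For every integer $N\geq 2$ and every $R\in[(\log N)^{-1/2},\,N(\log N)^{-1/2}]$, $$\mathbb{P}_{N}\left(\mathrm{wce}(\boldsymbol{x}_{N};2)\leq R\,\frac{(\log N)^{1/2}}{N}\right)\geq 1-\frac{1}{N^{R^{2}/C-C}}.$$ (ii) For every $s\in(1,2]$ there exists a constant $C(s)>0$ such that for every integer $N\geq 2$ and every $R\in[(\log N)^{-1/2},\,N(\log N)^{-1/2}]$, $$\mathbb{P}_{N}\left(\mathrm{wce}(\boldsymbol{x}_{N};s)\leq R^{s/2}\,\frac{(\log N)^{s/4}}{N^{s/2}}\right)\geq 1-\frac{1}{N^{R^{2}/C(s)-C}}.$$
   Context: $X$ is the unit sphere in $\mathbb{R}^3$ with the Riemannian metric $g$ induced from the Euclidean metric, $dV_g$ is its area form (total mass $4\pi$) and $d\sigma=dV_g/(4\pi)$. $\log$ is the natural logarithm. Spherical ensemble: for a positive integer $N$, $\mathbb{P}_N$ is the probability measure on $X^N$ given by $d\mathbb{P}_N=\frac{1}{Z_N}\prod_{1\le i<j\le N}|x_i-x_j|^2\,d\sigma^{\otimes N}$, where $|\cdot|$ is the Euclidean norm on $\mathbb{R}^3$ and $Z_N$ is the normalizing constant. $\boldsymbol{x}_N=(x_1,\dots,x_N)$ denotes a random configuration with law $\mathbb{P}_N$. Sobolev norm: $\Delta_g$ is the Laplace operator on $X$ with the sign convention making it nonnegative. For $s>0$, $\|f\|_{H^s(X)}^2:=\int_X f\,\Delta_g^{s}f\,dV_g$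 (with $\Delta_g^s$ defined spectrally), a seminorm on functions that is a norm modulo constants. $H^s(X)$ is the corresponding Sobolev space; for $s>1$ its elements are continuous. Worst-case error: for $s>1$ and $\boldsymbol{x}_N\in X^N$, $$\mathrm{wce}(\boldsymbol{x}_N;s):=\sup_{f:\ \|f\|_{H^s(X)}\le 1}\left|\int_X f\,d\sigma-\frac1N\sum_{i=1}^N f(x_i)\right|.$$ *)

theory Defs
  imports "HOL-Analysis.Analysis"
begin

abbreviation X :: "(real^3) set" where
  "X \<equiv> sphere 0 1"

text \<open>The Riemannian geometry of \<^term>\<open>X\<close> is described in the two stereographic parametrizations
  below. For \<open>\<epsilon> = 1\<close> the north pole is omitted, for \<open>\<epsilon> = -1\<close> the south pole.\<close>

definition stereo :: "real \<Rightarrow> real^2 \<Rightarrow> real^3" where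
  "stereo \<epsilon> u = (1 / (1 + (norm u)\<^sup>2)) *\<^sub>R
     vector [2 * u $ 1, 2 * u $ 2, \<epsilon> * ((norm u)\<^sup>2 - 1)]"

definition partial :: "2 \<Rightarrow> (real^2 \<Rightarrow> 'b::real_normed_vector) \<Rightarrow> real^2 \<Rightarrow> 'b" where
  "partial i F u = vector_derivative (\<lambda>t. F (u + t *\<^sub>R axis i 1)) (at 0)"

text \<open>The metric coefficients $g_{ij}$ of the metric induced from the Euclidean one.\<close>

definition metric :: "(real^2 \<Rightarrow> real^3) \<Rightarrow> real^2 \<Rightarrow> real^2^2" where
  "metric \<psi> u = (\<chi> i j. partial i \<psi> u \<bullet> partial j \<psi> u)"

definition area_density :: "(real^2 \<Rightarrow> real^3) \<Rightarrow> real^2 \<Rightarrow> real" where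
  "area_density \<psi> u = sqrt (det (metric \<psi> u))"

text \<open>The omitted pole is a null set, so one parametrization determines the area form.\<close>

definition dVg :: "(real^3) measure" where
  "dVg = distr (density lborel (\<lambda>u. ennreal (area_density (stereo 1) u)))
           (restrict_space borel X) (stereo 1)"

definition sigma_X :: "(real^3) measure" where
  "sigma_X = scale_measure (ennreal (1 / (4 * pi))) dVg"

text \<open>The local coordinate expression
  $-|g|^{-1/2} \sum_i \partial_i (|g|^{1/2} \sum_j g^{ij} \partial_j f)$
  of the nonnegative Laplace operator.\<close>

definition laplace_chart :: "(real^2 \<Rightarrow> real^3) \<Rightarrow> (real^3 \<Rightarrow> real) \<Rightarrow> real^2 \<Rightarrow> real" where
  "laplace_chart \<psi> f u =
     - (1 / area_density \<psi> u) *
       (\<Sum>i\<in>UNIV. partial i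
          (\<lambda>v. area_density \<psi> v *
                (\<Sum>j\<in>UNIV. matrix_inv (metric \<psi> v) $ i $ j * partial j (f \<circ> \<psi>) v)) u)"

definition laplace_X :: "(real^3 \<Rightarrow> real) \<Rightarrow> real^3 \<Rightarrow> real" where
  "laplace_X f x =
     (if x \<in> range (stereo 1) then laplace_chart (stereo 1) f (inv (stereo 1) x)
      else laplace_chart (stereo (-1)) f (inv (stereo (-1)) x))"

primrec C_k :: "nat \<Rightarrow> (real^2 \<Rightarrow> real) \<Rightarrow> bool" where
  "C_k 0 F \<longleftrightarrow> continuous_on UNIV F"
| "C_k (Suc k) F \<longleftrightarrow> (\<forall>u. F differentiable (at u)) \<and> (\<forall>i. C_k k (partial i F))"

definition smooth_X :: "(real^3 \<Rightarrow> real) \<Rightarrow> bool" where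
  "smooth_X f \<longleftrightarrow> (\<forall>k. C_k k (f \<circ> stereo 1) \<and> C_k k (f \<circ> stereo (-1)))"

text \<open>Functions on \<^term>\<open>X\<close> are total functions on the ambient space; their values outside
  \<^term>\<open>X\<close> play no role.\<close>

definition L2_X :: "(real^3 \<Rightarrow> real) set" where
  "L2_X = {f. f \<in> borel_measurable dVg \<and> integrable dVg (\<lambda>x. (f x)\<^sup>2)}"

definition inner_X :: "(real^3 \<Rightarrow> real) \<Rightarrow> (real^3 \<Rightarrow> real) \<Rightarrow> real" where
  "inner_X f h = (\<integral>x. f x * h x \<partial>dVg)"

definition eigenspace :: "real \<Rightarrow> (real^3 \<Rightarrow> real) set" where
  "eigenspace l = {\<phi>. smooth_X \<phi> \<and> (\<forall>x\<in>X. laplace_X \<phi> x = l * \<phi> x)}"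

definition spectrum_X :: "real set" where
  "spectrum_X = {l. \<exists>\<phi>\<in>eigenspace l. \<exists>x\<in>X. \<phi> x \<noteq> 0}"

text \<open>The orthogonal projection of $f \in L^2(X)$ to an eigenspace; it is unique on \<^term>\<open>X\<close>.\<close>

definition eigenproj :: "real \<Rightarrow> (real^3 \<Rightarrow> real) \<Rightarrow> real^3 \<Rightarrow> real" where
  "eigenproj l f =
     (SOME h. h \<in> eigenspace l \<and> (\<forall>\<phi>\<in>eigenspace l. inner_X (\<lambda>x. f x - h x) \<phi> = 0))"

text \<open>Spectrally $\Delta_g^s f = \sum_\lambda \lambda^s P_\lambda f$, where $P_\lambda$ is the
  projection to the eigenspace of $\lambda$, so
  $\int_X f \Delta_g^s f \, dV_g = \sum_\lambda \lambda^s \int_X f P_\lambda f \, dV_g$.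
  All terms are nonnegative; the eigenvalue $0$ does not contribute, as
  \<^term>\<open>(0::real) powr s = 0\<close>.\<close>

definition sobolev_space :: "real \<Rightarrow> (real^3 \<Rightarrow> real) set" where
  "sobolev_space s =
     {f \<in> L2_X. (\<lambda>l. l powr s * inner_X f (eigenproj l f)) summable_on spectrum_X}"

definition sobolev_norm :: "real \<Rightarrow> (real^3 \<Rightarrow> real) \<Rightarrow> real" where
  "sobolev_norm s f = sqrt (\<Sum>\<^sub>\<infinity>l\<in>spectrum_X. l powr s * inner_X f (eigenproj l f))"

text \<open>For $s > 1$ every class in $H^s(X)$ has exactly one continuous representative, and point
  values refer to it; hence the supremum runs over the continuous functions in
  \<^term>\<open>sobolev_space s\<close>.\<close>

definition wce :: "nat \<Rightarrow> (nat \<Rightarrow> real^3) \<Rightarrow> real \<Rightarrow> ereal" where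
  "wce N x s =
     (SUP f\<in>{f \<in> sobolev_space s. continuous_on X f \<and> sobolev_norm s f \<le> 1}.
        ereal \<bar>(\<integral>y. f y \<partial>sigma_X) - 1 / real N * (\<Sum>i=1..N. f (x i))\<bar>)"

definition pair_product :: "nat \<Rightarrow> (nat \<Rightarrow> real^3) \<Rightarrow> real" where
  "pair_product N x = (\<Prod>(i, j)\<in>{(i, j). 1 \<le> i \<and> i < j \<and> j \<le> N}. (norm (x i - x j))\<^sup>2)"

definition Z_N :: "nat \<Rightarrow> real" where
  "Z_N N = (\<integral>x. pair_product N x \<partial>(\<Pi>\<^sub>M i\<in>{1..N}. sigma_X))"

definition spherical_ensemble :: "nat \<Rightarrow> (nat \<Rightarrow> real^3) measure" where
  "spherical_ensemble N =
     density (\<Pi>\<^sub>M i\<in>{1..N}. sigma_X) (\<lambda>x. ennreal (1 / Z_N N * pair_product N x))"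

end

theory Submission
  imports Defs "Jordan_Normal_Form.Schur_Decomposition"
begin

text \<open>Let $q(x,y) = (1 + x \cdot y)/2 = 1 - |x-y|^2/4$ and let $E_n$ be the average of $q(x_i,x_j)^n$ over all pairs
  $(i,j)$, minus its mean $1/(n+1)$ under $\sigma \otimes \sigma$. The kernels $q^n$ are diagonal in the spherical harmonics
  with explicit eigenvalues, whence $\mathrm{wce}(x;s)^2 \le C \sum_n E_n n^{-s}$; since $E_n \le E_m + 1/(m+1)$ for $m \le n$,
  the case $s = 2$ controls all $s \in (1,2]$, and it remains to bound the tail of $\sum_n E_n n^{-2}$.

  In spinor coordinates the density is $|\det \psi_k(x_i)|^2 / N!$ with orthonormal $\psi_k$ and
  $|\sum_k \psi_k(x) \overline{\psi_k(y)}|^2 = N^2 q(x,y)^{N-1}$. Hence $E \exp \sum_i u(x_i)$ is a determinant; comparing it with the one for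
  $-u$ gives $E \exp (\sum_i u(x_i) - N \int u \, d\sigma) \le \exp J(u)$ with
  $J(u) = N^2 \int \int q^{N-1} (\cosh (u(x) - u(y)) - 1)$.
  Take $u = \sum_i \xi_i f_i$ with random signs $\xi_i$ and small features $f_i$ of the kernel $e \sum_{n \le N^2} q^n/n^2$. Averaging over the
  signs, tilted towards the discrepancies of the $f_i$, bounds $E \exp (c N^2 \sum_n E_n n^{-2})$ by a power of $N$ on the event
  that $N \sum_{n \le N} E_n / n$ is bounded. Outside of it the density itself is small, because
  $1 - q \le \exp (- \sum_n q^n/n)$ and $Z_N$ is known.\<close>

text \<open>The obstacle is that \<open>J\<close> contains \<open>cosh\<close>. It can be replaced
  by a quadratic cost only if the tilting function oscillates by at most about sqrt (N (1 - q)),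
  because part of the weight q^(N-1) then absorbs the exponential growth. For the tilt by the
  discrepancies of the configuration itself, such an oscillation bound follows from a bound on
  \<open>Energy\<close>; this is why the argument runs on an event. The quadratic cost has two
  parts. The mean of the tilt costs a fraction of the gain, small because the kernel coefficient e
  is small. The variance of the signs costs the sum over m <= T of m * 1/m^2, about ln T. Truncation
  at T = N^2 keeps exp (ln T) a power of N and leaves a remainder of at most 1/N^2. Powers of q
  replace a basis of spherical harmonics because the Laplacian is triangular on them: eigenvalues,
  reproducing kernels and moments all come from one recursion. All kernels involved have finite
  rank, so Laplacians and integrals pass through finite sums, and only continuous integrands on a
  compact set occur in the double integrals.\<close>

no_notation vec_index (infixl "$" 100)
no_notation scalar_prod (infix "\<bullet>" 70)
no_notation transpose_mat ("(_\<^sup>T)" [1000])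
hide_const (open) Matrix.vec Determinant.det Matrix.mat Matrix.row Matrix.col

section \<open>Eigenvalues of the kernels $q^n$\<close>

text \<open>\<open>kap l n\<close> is the eigenvalue of the kernel $q(x,y)^n$, $q(x,y) = (1 + x \cdot y)/2$, on the
  spherical harmonics of degree \<open>l\<close>.\<close>

definition kap :: "nat \<Rightarrow> nat \<Rightarrow> real" where
  "kap l n = (\<Prod>j=1..l. (real n - real j + 1) / (real n + 1 + real j)) / (real n + 1)"

lemma kap_0 [simp]: "kap 0 n = 1 / (real n + 1)"
  by (simp add: kap_def)

lemma kap_Suc: "kap (Suc l) n = kap l n * ((real n - real l) / (real n + real l + 2))"
  by (simp add: kap_def algebra_simps)

lemma kap_eq_0: "n < l \<Longrightarrow> kap l n = 0"
proof (induction l)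
  case (Suc l) then show ?case by (cases "n = l") (auto simp: kap_Suc)
qed simp

text \<open>This is the recursion that Green's identity imposes on the moments of q^n against an
  eigenfunction of degree l, compare \<open>green\<close>; it is also what makes \<open>Zl\<close>
  an eigenfunction. For n + 1 = l both sides vanish.\<close>

lemma kap_rec:
  "kap l (Suc n) * (real (Suc n) * (real (Suc n) + 1) - real l * (real l + 1)) = (real (Suc n))\<^sup>2 * kap l n"
proof (induction l)
  case 0
  then show ?case by (simp add: field_simps power2_eq_square)
next
  case (Suc l)
  have ne: "real n + real l + 2 \<noteq> 0" "real n + real l + 3 \<noteq> 0" by linarith+
  have IH: "kap l (Suc n) * ((real n + 1 - real l) * (real n + 2 + real l)) = (real n + 1)\<^sup>2 * kap l n"
    using Suc by (simp add: algebra_simps)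
  have "kap (Suc l) (Suc n) * (real (Suc n) * (real (Suc n) + 1) - real (Suc l) * (real (Suc l) + 1))
      = kap l (Suc n) * ((real n + 1 - real l) / (real n + real l + 3)) * ((real n - real l) * (real n + real l + 3))"
    by (simp add: kap_Suc algebra_simps)
  also have "\<dots> = kap l (Suc n) * (real n + 1 - real l) * (real n - real l)"
    using ne by (simp add: field_simps)
  also have "\<dots> = kap l (Suc n) * ((real n + 1 - real l) * (real n + 2 + real l)) * ((real n - real l) / (real n + real l + 2))"
    using ne by (simp add: divide_simps)
  also have "\<dots> = (real n + 1)\<^sup>2 * (kap l n * ((real n - real l) / (real n + real l + 2)))"
    unfolding IH by simp
  finally show ?case by (simp add: kap_Suc algebra_simps)
qed

lemma kap_nonneg: "0 \<le> kap l n"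
proof (induction l)
  case (Suc l)
  show ?case
  proof (cases "l \<le> n")
    case True then show ?thesis using Suc by (auto simp: kap_Suc intro!: mult_nonneg_nonneg divide_nonneg_nonneg)
  qed (simp add: kap_eq_0)
qed simp

lemma kap_pos: "l \<le> n \<Longrightarrow> 0 < kap l n"
proof (induction l)
  case (Suc l)
  then show ?case by (auto simp: kap_Suc intro!: mult_pos_pos divide_pos_pos)
qed simp

lemma kap_Suc_le: "kap (Suc l) n \<le> kap l n"
proof (cases "l \<le> n")
  case True
  have "(real n - real l) / (real n + real l + 2) \<le> 1" by simp
  then show ?thesis unfolding kap_Suc using kap_nonneg[of l n] mult_left_le by blast
qed (use kap_nonneg in \<open>simp add: kap_eq_0\<close>)

lemma kap_le: "kap l n \<le> 1 / (real n + 1)"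
proof (induction l)
  case (Suc l)
  then show ?case using kap_Suc_le[of l n] by linarith
qed simp

text \<open>Passing from l to l + 1 costs at most (2l + 2)/(n + 2), and these losses add up to l(l +
  1)/(n + 2). Hence \<open>kap l n\<close> is comparable to 1/n as soon as n exceeds a suitable
  multiple of l(l + 1).\<close>

lemma kap_lower: "1 - real l * (real l + 1) / (real n + 2) \<le> (real n + 1) * kap l n"
proof (induction l)
  case 0 then show ?case by simp
next
  case (Suc l)
  have K: "0 \<le> (real n + 1) * kap l n" "(real n + 1) * kap l n \<le> 1"
    using kap_nonneg[of l n] kap_le[of l n] by (auto simp: field_simps)
  have "(real n + 1) * kap (Suc l) n = (real n + 1) * kap l n - (real n + 1) * kap l n * ((2 * real l + 2) / (real n + real l + 2))"
  proof -
    have "(real n - real l) / (real n + real l + 2) = 1 - (2 * real l + 2) / (real n + real l + 2)"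
      by (simp add: field_simps)
    then show ?thesis unfolding kap_Suc by (simp only: right_diff_distrib mult_1_right mult.assoc)
  qed
  moreover have "(real n + 1) * kap l n * ((2 * real l + 2) / (real n + real l + 2)) \<le> 1 * ((2 * real l + 2) / (real n + 2))"
    using K by (intro mult_mono frac_le) auto
  ultimately have "(real n + 1) * kap (Suc l) n \<ge> (1 - real l * (real l + 1) / (real n + 2)) - (2 * real l + 2) / (real n + 2)"
    using Suc by linarith
  also have "(1 - real l * (real l + 1) / (real n + 2)) - (2 * real l + 2) / (real n + 2) = 1 - real (Suc l) * (real (Suc l) + 1) / (real n + 2)"
  proof -
    have "real (Suc l) * (real (Suc l) + 1) = real l * (real l + 1) + (2 * real l + 2)"
      by (simp add: algebra_simps)
    then show ?thesis by (simp only: add_divide_distrib)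
  qed
  finally show ?case .
qed

text \<open>The bound 1/(1 + l(l + 1)/(2n + 1)) is chosen because it survives multiplication by the
  next factor of the product: (n - l)(2n + 2l + 3) <= (n + l + 2)(2n + 1).\<close>

lemma kap_upper_aux:
  "(real n + 1) * kap l n * (1 + real l * (real l + 1) / (2 * real n + 1)) \<le> 1"
proof (induction l)
  case 0 then show ?case by simp
next
  case (Suc l)
  show ?case
  proof (cases "l < n")
    case False
    then show ?thesis by (simp add: kap_eq_0)
  next
    case True
    define K where "K = (real n + 1) * kap l n"
    have K: "0 \<le> K" "K \<le> 1" unfolding K_def
      using kap_nonneg[of l n] kap_le[of l n] by (auto simp: field_simps)
    have IH: "K * (1 + real l * (real l + 1) / (2 * real n + 1)) \<le> 1" using Suc by (simp add: K_def)
    let ?r = "(real n - real l) / (real n + real l + 2)"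
    have r: "0 \<le> ?r" using True by auto
    have "(real n + 1) * kap (Suc l) n * (1 + real (Suc l) * (real (Suc l) + 1) / (2 * real n + 1))
       = ?r * (K * (1 + real l * (real l + 1) / (2 * real n + 1)) + K * ((2 * real l + 2) / (2 * real n + 1)))"
    proof -
      have e: "1 + real (Suc l) * (real (Suc l) + 1) / (2 * real n + 1)
          = (1 + real l * (real l + 1) / (2 * real n + 1)) + (2 * real l + 2) / (2 * real n + 1)"
        by (simp add: add_divide_distrib[symmetric]) (simp add: algebra_simps)
      have "a * (k * r) * (x + y) = r * ((a * k) * x + (a * k) * y)" for a k r x y :: real
        by (simp add: algebra_simps)
      then show ?thesis unfolding e kap_Suc K_def by blast
    qed
    also have "\<dots> \<le> ?r * (1 + 1 * ((2 * real l + 2) / (2 * real n + 1)))"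
      using K IH r by (intro mult_left_mono add_mono mult_right_mono) auto
    also have "\<dots> \<le> 1"
    proof -
      have "(real n - real l) * (2 * real n + 2 * real l + 3) \<le> (real n + real l + 2) * (2 * real n + 1)"
        by (simp add: algebra_simps)
      then show ?thesis by (simp add: divide_simps) (simp add: algebra_simps)
    qed
    finally show ?thesis .
  qed
qed

text \<open>Integration against q^n gains two derivatives, uniformly in n. This bounds the
  coefficients of the tilting function in \<open>potential_integral\<close>.\<close>

lemma lam_kap_le: "real l * (real l + 1) * kap l n \<le> 2"
proof -
  let ?L = "real l * (real l + 1)"
  have "0 \<le> (real n + 1) * kap l n" using kap_nonneg[of l n] by simp
  then have "(real n + 1) * kap l n * (?L / (2 * real n + 1)) \<le> 1"
    using kap_upper_aux[of n l] unfolding distrib_left by linarith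
  then have "(real n + 1) * kap l n * ?L \<le> 2 * real n + 1"
    by (simp add: pos_divide_le_eq)
  also have "\<dots> \<le> (real n + 1) * 2" by simp
  finally have "(real n + 1) * (?L * kap l n) \<le> (real n + 1) * 2"
    by (simp only: ac_simps)
  then show ?thesis
    by (rule mult_left_le_imp_le) simp
qed

text \<open>The spectral gap of averaging with q^m: it limits what a component of degree l
  contributes to the double integral of q^m times a squared increment, see
  \<open>Bl_combination_quadratic\<close>.\<close>

lemma one_minus_K_le: "1 / (real m + 1) - kap l m \<le> real l * (real l + 1) / ((real m + 1) * (real m + 2))"
proof -
  have "(1 - real l * (real l + 1) / (real m + 2)) / (real m + 1) \<le> kap l m"
    using kap_lower[of l m] by (simp add: pos_divide_le_eq mult.commute)
  then show ?thesis
    by (simp add: diff_divide_distrib mult.commute)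
qed

text \<open>As a function of $q(x,y)$ this is the zonal function $(2l+1) P_l(2q-1)$, here obtained by solving
  $t^n = \sum_{l \le n}$ \<open>kap l n * Zl l t\<close> for the top term.\<close>

fun Zl :: "nat \<Rightarrow> real \<Rightarrow> real" where
  "Zl l t = (t ^ l - (\<Sum>j<l. kap j l * Zl j t)) / kap l l"

declare Zl.simps [simp del]

lemma power_eq_sum_Zl: "t ^ n = (\<Sum>l\<le>n. kap l n * Zl l t)"
proof -
  have "kap n n * Zl n t = t ^ n - (\<Sum>j<n. kap j n * Zl j t)"
    using kap_pos[of n n] by (subst Zl.simps) simp
  then show ?thesis by (simp add: lessThan_Suc_atMost[symmetric])
qed

lemma Zl_0 [simp]: "Zl 0 t = 1"
  by (subst Zl.simps) simp

lemma Zl_continuous: "continuous_on UNIV (Zl l)"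
proof (induction l rule: less_induct)
  case (less l)
  have "Zl l = (\<lambda>t. (t ^ l - (\<Sum>j<l. kap j l * Zl j t)) / kap l l)"
    by (subst Zl.simps[abs_def]) simp
  moreover have "continuous_on UNIV (\<lambda>t. (t ^ l - (\<Sum>j<l. kap j l * Zl j t)) / kap l l)"
    using less kap_pos[of l l] by (intro continuous_intros) auto
  ultimately show ?case by simp
qed

section \<open>The Laplace operator in stereographic coordinates\<close>

text \<open>The metric in either chart is \<open>4 * (rw u)\<^sup>2\<close> times the Euclidean one,
  and the third coordinate is affine in \<open>rw\<close>. All chart computations are done in
  \<open>rw\<close> and the plane coordinates, modulo the relation \<open>rw_eq\<close>.\<close>

definition rw :: "real^2 \<Rightarrow> real" where
  "rw u = 1 / (1 + (norm u)\<^sup>2)"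

lemma norm2: "(norm (u::real^2))\<^sup>2 = (u$1)\<^sup>2 + (u$2)\<^sup>2"
  by (simp add: norm_vec_def L2_set_def sum_2 sum_nonneg)

lemma rw_pos: "0 < rw u" and rw_le_1: "rw u \<le> 1"
  by (auto simp: rw_def add_pos_nonneg divide_simps)

lemma rw_eq: "(1 + (u$1)\<^sup>2 + (u$2)\<^sup>2) * rw u = 1"
  unfolding rw_def norm2 by (simp add: add_nonneg_eq_0_iff add_pos_nonneg divide_simps)

section \<open>Partial derivatives and a class of chart expressions closed under them\<close>

lemma partial_eq:
  assumes "(F has_derivative D) (at u)"
  shows "partial i F u = D (axis i 1)"
proof -
  have "((\<lambda>t. u + t *\<^sub>R axis i 1) has_derivative (\<lambda>t. t *\<^sub>R axis i (1::real))) (at 0)"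
    by (auto intro!: derivative_eq_intros)
  then have "((F \<circ> (\<lambda>t. u + t *\<^sub>R axis i 1)) has_derivative (D \<circ> (\<lambda>t. t *\<^sub>R axis i 1))) (at 0)"
    using assms by (intro diff_chain_at) auto
  then have "((\<lambda>t. F (u + t *\<^sub>R axis i 1)) has_vector_derivative D (axis i 1)) (at 0)"
    unfolding has_vector_derivative_def o_def
    using linear_scale[OF has_derivative_linear[OF assms]] by simp
  then show ?thesis unfolding partial_def by (rule vector_derivative_at)
qed

lemma partial_frechet:
  assumes "F differentiable at u"
  shows "partial i F u = frechet_derivative F (at u) (axis i 1)"
  using assms partial_eq frechet_derivative_works by blast

lemma has_derivative_partial:
  fixes F :: "real^2 \<Rightarrow> 'b::real_normed_vector"
  assumes "F differentiable at u"
  shows "(F has_derivative (\<lambda>h. \<Sum>i\<in>UNIV. (h$i) *\<^sub>R partial i F u)) (at u)"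
proof -
  obtain D where D: "(F has_derivative D) (at u)" using assms unfolding differentiable_def by blast
  have "D h = (\<Sum>i\<in>UNIV. (h$i) *\<^sub>R partial i F u)" for h
  proof -
    have "h = (\<Sum>i\<in>UNIV. (h$i) *\<^sub>R axis i 1)"
      using basis_expansion[of h] by (simp add: scalar_mult_eq_scaleR)
    then have "D h = D (\<Sum>i\<in>UNIV. (h$i) *\<^sub>R axis i 1)" by simp
    also have "\<dots> = (\<Sum>i\<in>UNIV. (h$i) *\<^sub>R D (axis i 1))"
      using has_derivative_linear[OF D] by (simp add: linear_sum linear_scale)
    finally show ?thesis using partial_eq[OF D] by simp
  qed
  then have "D = (\<lambda>h. \<Sum>i\<in>UNIV. (h$i) *\<^sub>R partial i F u)" by blast
  then show ?thesis using D by simp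
qed

lemma partial_const [simp]: "partial i (\<lambda>u. c) u = 0"
  using partial_eq[OF has_derivative_const] by auto

lemma partial_coord: "partial i (\<lambda>u. u $ j) u = (if i = j then 1 else 0)"
proof -
  have "((\<lambda>u::real^2. u $ j) has_derivative (\<lambda>u. u $ j)) (at u)"
    by (rule bounded_linear_imp_has_derivative) (rule bounded_linear_vec_nth)
  from partial_eq[OF this] show ?thesis by (auto simp: axis_def)
qed

lemma partial_add:
  assumes "F differentiable at u" "G differentiable at u"
  shows "partial i (\<lambda>u. F u + G u) u = partial i F u + partial i G u"
  using has_derivative_add[OF has_derivative_partial[OF assms(1)] has_derivative_partial[OF assms(2)]]
  by (subst partial_eq, assumption) (simp add: axis_def if_distrib[of "\<lambda>x. x *\<^sub>R _"] cong: if_cong)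

lemma partial_mult:
  fixes F G :: "real^2 \<Rightarrow> real"
  assumes "F differentiable at u" "G differentiable at u"
  shows "partial i (\<lambda>u. F u * G u) u = F u * partial i G u + partial i F u * G u"
  using has_derivative_mult[OF has_derivative_partial[OF assms(1)] has_derivative_partial[OF assms(2)]]
  by (subst partial_eq, assumption) (simp add: axis_def if_distrib[of "\<lambda>x. x * _"] cong: if_cong)

lemma has_derivative_rw: "(rw has_derivative (\<lambda>h. - (rw u)\<^sup>2 * (2 * (u$1) * (h$1) + 2 * (u$2) * (h$2)))) (at u)"
proof -
  have c: "((\<lambda>u::real^2. u $ j) has_derivative (\<lambda>u. u $ j)) (at u)" for j
    by (rule bounded_linear_imp_has_derivative) (rule bounded_linear_vec_nth)
  have ne: "1 + ((u$1)\<^sup>2 + (u$2)\<^sup>2) \<noteq> 0" by (smt (verit) sum_power2_ge_zero)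
  have "((\<lambda>u. 1 / (1 + ((u$1)\<^sup>2 + (u$2)\<^sup>2))) has_derivative
      (\<lambda>h. - (1 / (1 + ((u$1)\<^sup>2 + (u$2)\<^sup>2)))\<^sup>2 * (2 * (u$1) * (h$1) + 2 * (u$2) * (h$2)))) (at u)"
    by (rule derivative_eq_intros c ne refl | simp)+ (auto simp: fun_eq_iff divide_simps power2_eq_square)
  then show ?thesis unfolding rw_def[abs_def] norm2 .
qed

lemma differentiable_rw: "rw differentiable at u"
  using has_derivative_rw unfolding differentiable_def by blast

lemma differentiable_coord: "(\<lambda>u::real^2. u $ j) differentiable at u"
  by (rule bounded_linear_imp_differentiable) (rule bounded_linear_vec_nth)

lemma partial_rw: "partial i rw u = - 2 * (u $ i) * (rw u)\<^sup>2"
  using partial_eq[OF has_derivative_rw, of i u] exhaust_2[of i] by (auto simp: axis_def)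

text \<open>Polynomials in the coordinates and \<^term>\<open>rw\<close>: a class of chart expressions that is closed under
  differentiation, so smoothness on the sphere needs no further argument.\<close>

inductive ratf :: "(real^2 \<Rightarrow> real) \<Rightarrow> bool" where
  ratf_const: "ratf (\<lambda>u. c)"
| ratf_coord: "ratf (\<lambda>u. u $ j)"
| ratf_rw: "ratf rw"
| ratf_add: "ratf F \<Longrightarrow> ratf G \<Longrightarrow> ratf (\<lambda>u. F u + G u)"
| ratf_mult: "ratf F \<Longrightarrow> ratf G \<Longrightarrow> ratf (\<lambda>u. F u * G u)"

lemma ratf_power: "ratf F \<Longrightarrow> ratf (\<lambda>u. F u ^ n)"
  by (induction n) (auto intro: ratf.intros)

lemma ratf_sum: "(\<And>i. i \<in> I \<Longrightarrow> ratf (F i)) \<Longrightarrow> ratf (\<lambda>u. \<Sum>i\<in>I. F i u)"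
  by (induction I rule: infinite_finite_induct) (auto intro: ratf.intros)

lemma ratf_differentiable: "ratf F \<Longrightarrow> F differentiable at u"
  by (induction rule: ratf.induct)
     (auto intro: differentiable_coord differentiable_rw differentiable_add differentiable_mult)

lemma ratf_partial: "ratf F \<Longrightarrow> ratf (partial i F)"
proof (induction rule: ratf.induct)
  case (ratf_const c)
  then show ?case using ratf.ratf_const[of 0] by (simp add: partial_const[abs_def])
next
  case (ratf_coord j)
  then show ?case using ratf.ratf_const by (simp add: partial_coord[abs_def])
next
  case ratf_rw
  have "ratf (\<lambda>u. (-2) * (u $ i) * (rw u)\<^sup>2)"
    by (intro ratf_power ratf.intros)
  then show ?case by (simp add: partial_rw[abs_def])
next
  case (ratf_add F G)
  then have "partial i (\<lambda>u. F u + G u) = (\<lambda>u. partial i F u + partial i G u)"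
    by (auto simp: partial_add ratf_differentiable)
  then show ?case using ratf_add ratf.ratf_add by simp
next
  case (ratf_mult F G)
  then have "partial i (\<lambda>u. F u * G u) = (\<lambda>u. F u * partial i G u + partial i F u * G u)"
    by (auto simp: partial_mult ratf_differentiable)
  then show ?case using ratf_mult ratf.ratf_add ratf.ratf_mult by simp
qed

lemma ratf_C_k: "ratf F \<Longrightarrow> C_k k F"
proof (induction k arbitrary: F)
  case 0
  then show ?case
    by (auto intro!: differentiable_imp_continuous_on simp: differentiable_on_def ratf_differentiable differentiable_at_withinI)
next
  case (Suc k)
  then show ?case by (auto simp: ratf_differentiable ratf_partial)
qed

section \<open>The round metric in the stereographic charts\<close>

lemma stereo_components:
  "stereo \<epsilon> u $ 1 = 2 * (u$1) * rw u"
  "stereo \<epsilon> u $ 2 = 2 * (u$2) * rw u"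
  "stereo \<epsilon> u $ 3 = \<epsilon> * (1 - 2 * rw u)"
proof -
  show "stereo \<epsilon> u $ 1 = 2 * (u$1) * rw u" "stereo \<epsilon> u $ 2 = 2 * (u$2) * rw u"
    by (simp_all add: stereo_def rw_def)
  have "1 + (norm u)\<^sup>2 \<noteq> 0" by (smt (verit) zero_le_power2)
  then show "stereo \<epsilon> u $ 3 = \<epsilon> * (1 - 2 * rw u)"
    by (simp add: stereo_def rw_def field_simps)
qed

lemma ratf_stereo: "ratf (\<lambda>u. stereo \<epsilon> u $ k)"
proof -
  have "ratf (\<lambda>u. 2 * (u$1) * rw u)" "ratf (\<lambda>u. 2 * (u$2) * rw u)" "ratf (\<lambda>u. \<epsilon> * (1 + (-2) * rw u))"
    by (intro ratf.intros)+
  then show ?thesis using exhaust_3[of k] by (auto simp: stereo_components)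
qed

lemma partial_stereo:
  "partial i (\<lambda>u. stereo \<epsilon> u $ 1) u = 2 * (if i = 1 then rw u else 0) - 4 * (u$1) * (u$i) * (rw u)\<^sup>2"
  "partial i (\<lambda>u. stereo \<epsilon> u $ 2) u = 2 * (if i = 2 then rw u else 0) - 4 * (u$2) * (u$i) * (rw u)\<^sup>2"
  "partial i (\<lambda>u. stereo \<epsilon> u $ 3) u = 4 * \<epsilon> * (u$i) * (rw u)\<^sup>2"
proof -
  have a: "partial i (\<lambda>u. 2 * (u$j) * rw u) u = 2 * (if i = j then rw u else 0) - 4 * (u$j) * (u$i) * (rw u)\<^sup>2" for j
    by (subst partial_mult, simp_all add: partial_mult partial_coord partial_rw differentiable_coord differentiable_rw differentiable_mult)
  show "partial i (\<lambda>u. stereo \<epsilon> u $ 1) u = 2 * (if i = 1 then rw u else 0) - 4 * (u$1) * (u$i) * (rw u)\<^sup>2"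
    "partial i (\<lambda>u. stereo \<epsilon> u $ 2) u = 2 * (if i = 2 then rw u else 0) - 4 * (u$2) * (u$i) * (rw u)\<^sup>2"
    using a by (simp_all add: stereo_components)
  have "partial i (\<lambda>u. \<epsilon> + (\<lambda>u. (- 2 * \<epsilon>) * rw u) u) u = partial i (\<lambda>u. (- 2 * \<epsilon>) * rw u) u"
    by (subst partial_add) (auto intro!: differentiable_rw differentiable_mult differentiable_minus)
  also have "\<dots> = 4 * \<epsilon> * (u$i) * (rw u)\<^sup>2"
    by (subst partial_mult) (auto simp: partial_rw intro: differentiable_rw)
  finally show "partial i (\<lambda>u. stereo \<epsilon> u $ 3) u = 4 * \<epsilon> * (u$i) * (rw u)\<^sup>2"
    by (simp add: stereo_components algebra_simps)
qed

lemma stereo_differentiable: "stereo \<epsilon> differentiable at u"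
proof -
  have "stereo \<epsilon> = (\<lambda>u. \<Sum>k\<in>UNIV. (stereo \<epsilon> u $ k) *\<^sub>R axis k 1)"
    using basis_expansion[of "stereo \<epsilon> _"] by (simp add: scalar_mult_eq_scaleR)
  moreover have "(\<lambda>u. \<Sum>k\<in>UNIV. (stereo \<epsilon> u $ k) *\<^sub>R axis k 1) differentiable at u"
    by (intro differentiable_sum differentiable_scaleR ballI) (auto simp: ratf_differentiable ratf_stereo)
  ultimately show ?thesis by (rule ssubst[where P = "\<lambda>f. f differentiable at u"])
qed

lemma partial_stereo_nth: "partial i (stereo \<epsilon>) u $ k = partial i (\<lambda>u. stereo \<epsilon> u $ k) u"
proof -
  have "((\<lambda>u. stereo \<epsilon> u $ k) has_derivative (\<lambda>h. frechet_derivative (stereo \<epsilon>) (at u) h $ k)) (at u)"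
    using bounded_linear.has_derivative[OF bounded_linear_vec_nth] stereo_differentiable[of \<epsilon> u]
    unfolding frechet_derivative_works by blast
  from partial_eq[OF this] show ?thesis using partial_frechet[OF stereo_differentiable] by metis
qed

text \<open>In each claim the difference of the two sides is an explicit combination of (1 + a^2 +
  b^2) w - 1 and e^2 - 1, which the assumptions set to zero.\<close>

lemma metric_stereo_aux:
  fixes a b w e :: real
  assumes "(1 + a\<^sup>2 + b\<^sup>2) * w = 1" "e\<^sup>2 = 1"
  shows "(2 * w - 4 * a * a * w\<^sup>2) * (2 * w - 4 * a * a * w\<^sup>2) + (4 * b * a * w\<^sup>2) * (4 * b * a * w\<^sup>2)
     + (4 * e * a * w\<^sup>2) * (4 * e * a * w\<^sup>2) = 4 * w\<^sup>2"
    and "(2 * w - 4 * a * a * w\<^sup>2) * (4 * a * b * w\<^sup>2) + (4 * b * a * w\<^sup>2) * (2 * w - 4 * b * b * w\<^sup>2)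
     = (4 * e * a * w\<^sup>2) * (4 * e * b * w\<^sup>2)"
proof -
  have "(2 * w - 4 * a * a * w\<^sup>2) * (2 * w - 4 * a * a * w\<^sup>2) + (4 * b * a * w\<^sup>2) * (4 * b * a * w\<^sup>2)
     + (4 * e * a * w\<^sup>2) * (4 * e * a * w\<^sup>2)
     = 4 * w\<^sup>2 + 16 * a\<^sup>2 * w ^ 3 * ((1 + a\<^sup>2 + b\<^sup>2) * w - 1) + 16 * a\<^sup>2 * w ^ 4 * (e\<^sup>2 - 1)"
    by (simp add: algebra_simps power2_eq_square power3_eq_cube power4_eq_xxxx)
  then show "(2 * w - 4 * a * a * w\<^sup>2) * (2 * w - 4 * a * a * w\<^sup>2) + (4 * b * a * w\<^sup>2) * (4 * b * a * w\<^sup>2)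
     + (4 * e * a * w\<^sup>2) * (4 * e * a * w\<^sup>2) = 4 * w\<^sup>2" using assms by simp
  have "(2 * w - 4 * a * a * w\<^sup>2) * (4 * a * b * w\<^sup>2) + (4 * b * a * w\<^sup>2) * (2 * w - 4 * b * b * w\<^sup>2)
     - (4 * e * a * w\<^sup>2) * (4 * e * b * w\<^sup>2)
     = - 16 * a * b * w ^ 3 * ((1 + a\<^sup>2 + b\<^sup>2) * w - 1) - 16 * a * b * w ^ 4 * (e\<^sup>2 - 1)"
    by (simp add: algebra_simps power2_eq_square power3_eq_cube power4_eq_xxxx)
  then show "(2 * w - 4 * a * a * w\<^sup>2) * (4 * a * b * w\<^sup>2) + (4 * b * a * w\<^sup>2) * (2 * w - 4 * b * b * w\<^sup>2)
     = (4 * e * a * w\<^sup>2) * (4 * e * b * w\<^sup>2)" using assms by simp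
qed

lemma metric_stereo:
  assumes "\<epsilon>\<^sup>2 = 1"
  shows "metric (stereo \<epsilon>) u $ i $ j = (if i = j then 4 * (rw u)\<^sup>2 else 0)"
proof -
  have "metric (stereo \<epsilon>) u $ i $ j =
    (2 * (if i = 1 then rw u else 0) - 4 * (u$1) * (u$i) * (rw u)\<^sup>2) * (2 * (if j = 1 then rw u else 0) - 4 * (u$1) * (u$j) * (rw u)\<^sup>2)
    + (2 * (if i = 2 then rw u else 0) - 4 * (u$2) * (u$i) * (rw u)\<^sup>2) * (2 * (if j = 2 then rw u else 0) - 4 * (u$2) * (u$j) * (rw u)\<^sup>2)
    + (4 * \<epsilon> * (u$i) * (rw u)\<^sup>2) * (4 * \<epsilon> * (u$j) * (rw u)\<^sup>2)"
    by (simp add: metric_def inner_vec_def sum_3 partial_stereo_nth partial_stereo)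
  also have "\<dots> = (if i = j then 4 * (rw u)\<^sup>2 else 0)"
  proof -
    have w: "(1 + (u$1)\<^sup>2 + (u$2)\<^sup>2) * rw u = 1" by (rule rw_eq)
    then have w': "(1 + (u$2)\<^sup>2 + (u$1)\<^sup>2) * rw u = 1" by (simp add: algebra_simps)
    note m = metric_stereo_aux[OF w assms] metric_stereo_aux[OF w' assms]
    have "i = 1 \<or> i = 2" "j = 1 \<or> j = 2" using exhaust_2 by auto
    then consider "i = 1" "j = 1" | "i = 1" "j = 2" | "i = 2" "j = 1" | "i = 2" "j = 2" by blast
    then show ?thesis
    proof cases
      case 1 then show ?thesis using m(1) by simp
    next
      case 2 then show ?thesis using m(2) by simp
    next
      case 3 then show ?thesis using m(4) by simp
    next
      case 4 then show ?thesis using m(3) by (simp add: add.commute)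
    qed
  qed
  finally show ?thesis .
qed

lemma area_density_stereo:
  assumes "\<epsilon>\<^sup>2 = 1"
  shows "area_density (stereo \<epsilon>) u = 4 * (rw u)\<^sup>2"
proof -
  have "area_density (stereo \<epsilon>) u = sqrt ((4 * (rw u)\<^sup>2)\<^sup>2)"
    unfolding area_density_def using assms by (simp only: det_2 metric_stereo) (simp add: power2_eq_square)
  then show ?thesis by (simp only: real_sqrt_abs) simp
qed

lemma matrix_inv_metric:
  assumes "\<epsilon>\<^sup>2 = 1"
  shows "matrix_inv (metric (stereo \<epsilon>) u) $ i $ j = (if i = j then 1 / (4 * (rw u)\<^sup>2) else 0)"
proof -
  let ?B = "(\<chi> i j. if i = j then 1 / (4 * (rw u)\<^sup>2) else 0) :: real^2^2"
  have ne: "rw u \<noteq> 0" using rw_pos[of u] by simp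
  have "metric (stereo \<epsilon>) u ** ?B = Finite_Cartesian_Product.mat 1" "?B ** metric (stereo \<epsilon>) u = Finite_Cartesian_Product.mat 1"
    using assms ne
    by (auto simp: vec_eq_iff fun_eq_iff matrix_matrix_mult_def metric_stereo Finite_Cartesian_Product.mat_def
          if_distrib[of "\<lambda>x. _ * x"] cong: if_cong)
  then have "matrix_inv (metric (stereo \<epsilon>) u) = ?B"
    unfolding matrix_inv_def
  proof (intro some_equality conjI)
    fix A' assume A: "metric (stereo \<epsilon>) u ** A' = Finite_Cartesian_Product.mat 1 \<and> A' ** metric (stereo \<epsilon>) u = Finite_Cartesian_Product.mat 1"
      and B: "metric (stereo \<epsilon>) u ** ?B = Finite_Cartesian_Product.mat 1"
    have "A' = A' ** (metric (stereo \<epsilon>) u ** ?B)" unfolding B by (simp add: matrix_mul_rid)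
    also have "\<dots> = ?B" unfolding matrix_mul_assoc using A by (simp add: matrix_mul_lid)
    finally show "A' = ?B" .
  qed auto
  then show ?thesis by simp
qed

text \<open>Conformal invariance in dimension two: the area density times the inverse metric is the
  identity matrix, so only the flat Laplacian and a scalar prefactor remain.\<close>

lemma laplace_chart_eq:
  assumes "\<epsilon>\<^sup>2 = 1"
  shows "laplace_chart (stereo \<epsilon>) f u
    = - (1 / (4 * (rw u)\<^sup>2)) * (\<Sum>i\<in>UNIV. partial i (partial i (f \<circ> stereo \<epsilon>)) u)"
proof -
  have "area_density (stereo \<epsilon>) v * (\<Sum>j\<in>UNIV. matrix_inv (metric (stereo \<epsilon>) v) $ i $ j * partial j (f \<circ> stereo \<epsilon>) v)
     = partial i (f \<circ> stereo \<epsilon>) v" for i v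
  proof -
    have ne: "rw v \<noteq> 0" using rw_pos[of v] by simp
    show ?thesis using assms ne
      by (simp add: area_density_stereo matrix_inv_metric if_distrib[of "\<lambda>x. x * _"] cong: if_cong)
  qed
  then show ?thesis unfolding laplace_chart_def using assms by (simp add: area_density_stereo)
qed

section \<open>Zonal functions and the action of the Laplacian on them\<close>

definition qq :: "real^3 \<Rightarrow> real^3 \<Rightarrow> real" where
  "qq x y = (1 + x \<bullet> y) / 2"

definition lap2 :: "(real^2 \<Rightarrow> real) \<Rightarrow> real^2 \<Rightarrow> real" where
  "lap2 F u = (\<Sum>i\<in>UNIV. partial i (partial i F) u)"

lemma qq_commute: "qq x y = qq y x"
  by (simp add: qq_def inner_commute)

lemma qq_eq_norm: "x \<in> X \<Longrightarrow> y \<in> X \<Longrightarrow> 1 - qq x y = (norm (x - y))\<^sup>2 / 4"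
  unfolding qq_def power2_norm_eq_inner by (simp add: inner_diff inner_commute norm_eq_1 field_simps)

lemma qq_bounds: assumes "x \<in> X" "y \<in> X" shows "0 \<le> qq x y" "qq x y \<le> 1"
proof -
  have "\<bar>x \<bullet> y\<bar> \<le> 1" using Cauchy_Schwarz_ineq2[of x y] assms by simp
  then show "0 \<le> qq x y" "qq x y \<le> 1" by (auto simp: qq_def)
qed

lemma qq_self [simp]: "x \<in> X \<Longrightarrow> qq x x = 1"
  by (simp add: qq_def norm_eq_1)

lemma norm_stereo: assumes "\<epsilon>\<^sup>2 = 1" shows "stereo \<epsilon> u \<in> X"
proof -
  have w: "(1 + (u$1)\<^sup>2 + (u$2)\<^sup>2) * rw u = 1" by (rule rw_eq)
  have "(2 * (u$1) * rw u)\<^sup>2 + (2 * (u$2) * rw u)\<^sup>2 + (\<epsilon> * (1 - 2 * rw u))\<^sup>2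
     = \<epsilon>\<^sup>2 + 4 * rw u * ((1 + (u$1)\<^sup>2 + (u$2)\<^sup>2) * rw u - 1) + 4 * (rw u - (rw u)\<^sup>2) * (1 - \<epsilon>\<^sup>2)"
    by (simp add: algebra_simps power2_eq_square)
  then have "(norm (stereo \<epsilon> u))\<^sup>2 = 1"
    using w assms by (simp add: norm_vec_def L2_set_def sum_3 stereo_components sum_nonneg)
  then show ?thesis by (simp add: power2_eq_1_iff) (smt (verit) norm_ge_zero)
qed

definition chart :: "real \<Rightarrow> real^3 \<Rightarrow> real^2" where
  "chart \<epsilon> x = vector [x$1 / (1 - \<epsilon> * x$3), x$2 / (1 - \<epsilon> * x$3)]"

lemma chart_stereo: assumes "\<epsilon>\<^sup>2 = 1" shows "chart \<epsilon> (stereo \<epsilon> u) = u"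
proof -
  have "1 - \<epsilon> * stereo \<epsilon> u $ 3 = 2 * rw u"
    using assms by (simp add: stereo_components algebra_simps power2_eq_square)
  then show ?thesis using rw_pos[of u]
    by (simp add: chart_def Finite_Cartesian_Product.vec_eq_iff forall_2 stereo_components)
qed

lemma stereo_chart:
  assumes "\<epsilon>\<^sup>2 = 1" "x \<in> X" "\<epsilon> * x$3 \<noteq> 1"
  shows "stereo \<epsilon> (chart \<epsilon> x) = x"
proof -
  have n: "(x$1)\<^sup>2 + (x$2)\<^sup>2 + (x$3)\<^sup>2 = 1"
    using assms(2) by (simp add: norm_vec_def L2_set_def sum_3)
  define t where "t = \<epsilon> * x$3"
  have t: "t \<noteq> 1" "x$3 = \<epsilon> * t" "(x$1)\<^sup>2 + (x$2)\<^sup>2 = (1 - t) * (1 + t)"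
  proof -
    show "t \<noteq> 1" using assms(3) by (simp add: t_def)
    have "\<epsilon> * t = \<epsilon>\<^sup>2 * x$3" by (simp add: t_def power2_eq_square)
    then show "x$3 = \<epsilon> * t" using assms(1) by simp
    have "t\<^sup>2 = (x$3)\<^sup>2" using assms(1) by (simp add: t_def power_mult_distrib)
    then show "(x$1)\<^sup>2 + (x$2)\<^sup>2 = (1 - t) * (1 + t)"
      using n by (simp add: algebra_simps power2_eq_square)
  qed
  have r: "rw (chart \<epsilon> x) = (1 - t) / 2"
  proof -
    have "(norm (chart \<epsilon> x))\<^sup>2 = ((x$1)\<^sup>2 + (x$2)\<^sup>2) / (1 - t)\<^sup>2"
      by (simp add: norm2 chart_def t_def power_divide add_divide_distrib)
    also have "\<dots> = (1 + t) / (1 - t)" unfolding t(3) using t(1) by (simp add: power2_eq_square)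
    finally have "1 + (norm (chart \<epsilon> x))\<^sup>2 = 2 / (1 - t)" using t(1) by (simp add: field_simps)
    then show ?thesis unfolding rw_def by simp
  qed
  have "stereo \<epsilon> (chart \<epsilon> x) $ 1 = x$1" "stereo \<epsilon> (chart \<epsilon> x) $ 2 = x$2" "stereo \<epsilon> (chart \<epsilon> x) $ 3 = x$3"
    using t(1) t(2)[symmetric] unfolding stereo_components r by (simp_all add: chart_def t_def[symmetric] field_simps)
  then show ?thesis by (simp add: Finite_Cartesian_Product.vec_eq_iff forall_3)
qed

lemma inj_stereo: "\<epsilon>\<^sup>2 = 1 \<Longrightarrow> inj (stereo \<epsilon>)"
  by (metis chart_stereo injI)

lemma stereo_surj: assumes "x \<in> X" obtains "x = stereo 1 (chart 1 x)" | "x = stereo (-1) 0" "x \<notin> range (stereo 1)"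
proof (cases "x$3 = 1")
  case False
  then show ?thesis using stereo_chart[of 1 x] assms that by auto
next
  case True
  have "(x$1)\<^sup>2 + (x$2)\<^sup>2 + (x$3)\<^sup>2 = 1"
    using assms by (simp add: norm_vec_def L2_set_def sum_3)
  then have "x$1 = 0" "x$2 = 0" using True by (auto simp: sum_power2_eq_zero_iff)
  moreover have "rw 0 = 1" by (simp add: rw_def)
  ultimately have "x = stereo (-1) 0" using True by (simp add: Finite_Cartesian_Product.vec_eq_iff forall_3 stereo_components)
  moreover have "x \<notin> range (stereo 1)"
    using True rw_pos by (auto simp: stereo_components) (metis less_irrefl)
  ultimately show ?thesis using that by blast
qed

lemma laplace_X_stereo: "laplace_X f (stereo 1 u) = laplace_chart (stereo 1) f u"
  by (simp add: laplace_X_def inj_stereo inv_f_f)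

text \<open>The chart depends on the point only, not on f. Linearity and the pointwise formulas for
  \<open>laplace_X\<close> can therefore be checked in one chart at a time, the exceptional pole
  included.\<close>

lemma laplace_X_chart:
  assumes "x \<in> X"
  obtains \<epsilon> u where "\<epsilon> = 1 \<or> \<epsilon> = -1" "x = stereo \<epsilon> u" "\<And>f. laplace_X f x = laplace_chart (stereo \<epsilon>) f u"
proof (rule stereo_surj[OF assms])
  assume "x = stereo 1 (chart 1 x)"
  then show ?thesis using that laplace_X_stereo by metis
next
  assume "x = stereo (-1) 0" "x \<notin> range (stereo 1)"
  then show ?thesis using that[of "-1" 0] inv_f_f[OF inj_stereo[of "-1"]]
    by (simp add: laplace_X_def)
qed

text \<open>A stand-in for polynomials restricted to the sphere: membership in \<open>ratf\<close>
  in both charts gives smoothness at once and lets \<open>laplace_X\<close> be computed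
  termwise.\<close>

definition spoly :: "(real^3 \<Rightarrow> real) \<Rightarrow> bool" where
  "spoly f \<longleftrightarrow> ratf (f \<circ> stereo 1) \<and> ratf (f \<circ> stereo (-1))"

lemma spoly_const: "spoly (\<lambda>x. c)"
  by (auto simp: spoly_def o_def intro: ratf.intros)

lemma spoly_coord: "spoly (\<lambda>x. x $ k)"
  by (auto simp: spoly_def o_def intro: ratf_stereo)

lemma spoly_add: "spoly f \<Longrightarrow> spoly g \<Longrightarrow> spoly (\<lambda>x. f x + g x)"
  by (auto simp: spoly_def o_def intro: ratf.intros)

lemma spoly_mult: "spoly f \<Longrightarrow> spoly g \<Longrightarrow> spoly (\<lambda>x. f x * g x)"
  by (auto simp: spoly_def o_def intro: ratf.intros)

lemma spoly_power: "spoly f \<Longrightarrow> spoly (\<lambda>x. f x ^ n)"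
  by (auto simp: spoly_def o_def intro: ratf_power)

lemma spoly_sum: "(\<And>i. i \<in> I \<Longrightarrow> spoly (f i)) \<Longrightarrow> spoly (\<lambda>x. \<Sum>i\<in>I. f i x)"
  by (auto simp: spoly_def o_def intro!: ratf_sum)

lemma spoly_smooth: "spoly f \<Longrightarrow> smooth_X f"
  by (auto simp: spoly_def smooth_X_def intro: ratf_C_k)

lemma spoly_qq: "spoly (qq x)"
proof -
  have "spoly (\<lambda>y. 1/2 + (\<Sum>k\<in>UNIV. (x$k / 2) * y$k))"
    by (intro spoly_add spoly_sum spoly_mult spoly_const spoly_coord)
  moreover have "qq x = (\<lambda>y. 1/2 + (\<Sum>k\<in>UNIV. (x$k / 2) * y$k))"
    by (auto simp: qq_def inner_vec_def fun_eq_iff sum_divide_distrib add_divide_distrib)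
  ultimately show ?thesis by simp
qed

lemma lap2_add: "ratf F \<Longrightarrow> ratf G \<Longrightarrow> lap2 (\<lambda>u. F u + G u) u = lap2 F u + lap2 G u"
proof -
  assume F: "ratf F" and G: "ratf G"
  have "partial i (\<lambda>u. F u + G u) = (\<lambda>u. partial i F u + partial i G u)" for i
    using F G by (auto simp: partial_add ratf_differentiable)
  then show ?thesis using F G
    by (simp add: lap2_def partial_add ratf_differentiable ratf_partial sum.distrib)
qed

lemma lap2_cmult: "ratf F \<Longrightarrow> lap2 (\<lambda>u. c * F u) u = c * lap2 F u"
proof -
  assume F: "ratf F"
  have p: "partial i (\<lambda>u. c * G u) = (\<lambda>u. c * partial i G u)" if "ratf G" for i G
    using that by (auto simp: partial_mult ratf_differentiable)
  show ?thesis using F by (simp add: lap2_def p ratf_partial sum_distrib_left)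
qed

text \<open>The truncated exponents n - 1 and n - 2 are harmless, since their coefficients n and n(n
  - 1) vanish exactly where the truncation occurs.\<close>

lemma lap2_power:
  assumes F: "ratf F"
  shows "lap2 (\<lambda>u. F u ^ n) u = real n * F u ^ (n-1) * lap2 F u
     + real n * real (n-1) * F u ^ (n-2) * (\<Sum>i\<in>UNIV. (partial i F u)\<^sup>2)"
proof -
  have p: "partial i (\<lambda>u. F u ^ m) u = real m * F u ^ (m-1) * partial i F u" for i m u
  proof -
    have "(F has_derivative (\<lambda>h. \<Sum>i\<in>UNIV. (h$i) *\<^sub>R partial i F u)) (at u)"
      using F by (intro has_derivative_partial ratf_differentiable)
    from partial_eq[OF has_derivative_power[OF this]]
    show ?thesis by (simp add: axis_def if_distrib[of "\<lambda>x. x * _"] cong: if_cong)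
  qed
  have "partial i (\<lambda>u. real n * F u ^ (n-1) * partial i F u) u
    = real n * F u ^ (n-1) * partial i (partial i F) u + real n * real (n-1) * F u ^ (n-2) * (partial i F u)\<^sup>2" for i
  proof -
    have r: "ratf (\<lambda>u. real n * F u ^ (n-1))" using F by (intro ratf.intros ratf_power)
    have "partial i (\<lambda>u. real n * F u ^ (n-1)) u = real n * (real (n-1) * F u ^ (n-1-1) * partial i F u)"
      using ratf_power[OF F] p[of i "n-1" u] by (simp only: partial_mult ratf_differentiable ratf_const partial_const)
    moreover have "n - 1 - 1 = n - 2" by simp
    moreover have "partial i (\<lambda>u. real n * F u ^ (n-1) * partial i F u) u
      = real n * F u ^ (n-1) * partial i (partial i F) u + partial i (\<lambda>u. real n * F u ^ (n-1)) u * partial i F u"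
      using r F by (intro partial_mult ratf_differentiable ratf_partial)
    ultimately show ?thesis
      by (simp only: power2_eq_square mult.assoc mult_zero_left add_0_right add_0_left)
  qed
  then show ?thesis
    by (simp add: lap2_def p[abs_def] sum.distrib sum_distrib_left)
qed

text \<open>Intrinsically the squared gradient of q is q (1 - q) and its Laplacian is 2 q - 1; the
  conformal factor translates both to the flat chart. There q = A + rw * L with L affine, and the
  sign of the omitted pole is hidden in the coefficient c, so both charts are handled
  together.\<close>

lemma zonal_chart:
  fixes x :: "real^3"
  assumes \<epsilon>: "\<epsilon>\<^sup>2 = 1" and x: "x \<in> X"
  defines "Q \<equiv> \<lambda>u. qq x (stereo \<epsilon> u)"
  shows "(\<Sum>i\<in>UNIV. (partial i Q u)\<^sup>2) = 4 * (rw u)\<^sup>2 * (Q u * (1 - Q u))"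
    and "lap2 Q u = - (4 * (rw u)\<^sup>2) * (2 * Q u - 1)"
proof -
  define a b c A where "a = x$1" and "b = x$2" and "c = - \<epsilon> * x$3" and "A = (1 - c) / 2"
  have abc: "a\<^sup>2 + b\<^sup>2 + c\<^sup>2 = 1"
    using x \<epsilon> by (simp add: a_def b_def c_def norm_vec_def L2_set_def sum_3 power_mult_distrib)
  define L where "L = (\<lambda>u::real^2. a * (u$1) + b * (u$2) + c)"
  have rL: "ratf L" unfolding L_def by (intro ratf.intros)
  have Q: "Q = (\<lambda>u. A + rw u * L u)"
    using \<epsilon> by (auto simp: Q_def qq_def inner_vec_def sum_3 stereo_components L_def A_def a_def b_def c_def field_simps)
  have pL: "partial i L u = (if i = 1 then a else b)" for i u
    unfolding L_def using exhaust_2[of i]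
    by (auto simp: partial_add partial_mult partial_coord ratf_differentiable ratf.intros)
  have pQ: "partial i Q = (\<lambda>u. rw u * (if i = 1 then a else b) + (-2 * (u $ i)) * ((rw u)\<^sup>2 * L u))" for i
    unfolding Q using rL
    by (auto simp: fun_eq_iff partial_add partial_mult partial_rw pL ratf_differentiable ratf.intros)
  have prw2: "partial i (\<lambda>u. (rw u)\<^sup>2) u = - 4 * (u $ i) * rw u ^ 3" for i u
    unfolding power2_eq_square
    by (simp add: partial_mult partial_rw differentiable_rw power2_eq_square power3_eq_cube)
  have ppQ: "partial i (partial i Q) u = -2 * (u$i) * (rw u)\<^sup>2 * (if i = 1 then a else b)
      + ((-2) * ((rw u)\<^sup>2 * L u) + (-2 * (u$i)) * ((rw u)\<^sup>2 * (if i = 1 then a else b) + (- 4 * (u$i) * rw u ^ 3) * L u))" for i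
  proof -
    have r2: "ratf (\<lambda>u. (rw u)\<^sup>2)" by (intro ratf_power ratf.intros)
    have r1: "ratf (\<lambda>u. (rw u)\<^sup>2 * L u)" by (intro ratf_mult r2 rL)
    have r3: "ratf (\<lambda>u. rw u * (if i = 1 then a else b))" by (intro ratf_mult ratf_rw ratf_const)
    have r4: "ratf (\<lambda>u. -2 * (u $ i))" by (intro ratf_mult ratf_const ratf_coord)
    note r = r1 r2 r3 r4
    have "partial i (\<lambda>u. rw u * (if i = 1 then a else b)) u = -2 * (u$i) * (rw u)\<^sup>2 * (if i = 1 then a else b)"
      by (simp add: partial_mult partial_rw differentiable_rw)
    moreover have "partial i (\<lambda>u. (rw u)\<^sup>2 * L u) u = (rw u)\<^sup>2 * (if i = 1 then a else b) + (- 4 * (u$i) * rw u ^ 3) * L u"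
      using partial_mult[OF ratf_differentiable[OF r(2)] ratf_differentiable[OF rL], of i u] by (simp only: pL prw2)
    moreover have "partial i (\<lambda>u. -2 * (u $ i)) u = -2"
      by (subst partial_mult) (auto simp: partial_coord differentiable_coord)
    moreover have "ratf (\<lambda>u. (-2 * (u $ i)) * ((rw u)\<^sup>2 * L u))" by (intro ratf_mult[OF r4 r1])
    ultimately show ?thesis unfolding pQ using r
      by (simp only: partial_add ratf_differentiable)
        (simp only: partial_mult ratf_differentiable)
  qed
  have w: "(1 + (u$1)\<^sup>2 + (u$2)\<^sup>2) * rw u = 1" by (rule rw_eq)
  then have w: "(1 + (u$1)\<^sup>2 + (u$2)\<^sup>2) * rw u - 1 = 0" by simp
  define s t v l where "s = u$1" and "t = u$2" and "v = rw u" and "l = L u"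
  have w': "(1 + s\<^sup>2 + t\<^sup>2) * v - 1 = 0" and l: "l = a * s + b * t + c"
    using w by (simp_all add: s_def t_def v_def l_def L_def)
  have "(\<Sum>i\<in>UNIV. (partial i Q u)\<^sup>2) = (v * a - 2 * s * (v\<^sup>2 * l))\<^sup>2 + (v * b - 2 * t * (v\<^sup>2 * l))\<^sup>2"
    by (simp add: sum_2 pQ s_def t_def v_def l_def)
  also have "\<dots> = v\<^sup>2 * (a\<^sup>2 + b\<^sup>2) - 4 * v ^ 3 * l * (a * s + b * t) + 4 * v ^ 3 * l\<^sup>2 * ((1 + s\<^sup>2 + t\<^sup>2) * v - 1) + 4 * v ^ 3 * l\<^sup>2 * (1 - v)"
    by (simp add: algebra_simps power2_eq_square power3_eq_cube)
  also have "\<dots> = v\<^sup>2 * (1 - c\<^sup>2) - 4 * v ^ 3 * l * (l - c) + 4 * v ^ 3 * l\<^sup>2 * (1 - v)"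
    using abc l by (simp add: w' eq_diff_eq)
  also have "\<dots> = 4 * v\<^sup>2 * ((A + v * l) * (1 - (A + v * l)))"
    by (simp add: A_def field_simps power2_eq_square power3_eq_cube)
  finally show "(\<Sum>i\<in>UNIV. (partial i Q u)\<^sup>2) = 4 * (rw u)\<^sup>2 * (Q u * (1 - Q u))"
    by (simp add: Q v_def l_def)
  have "lap2 Q u = -2 * s * v\<^sup>2 * a + ((-2) * (v\<^sup>2 * l) + (-2 * s) * (v\<^sup>2 * a + (- 4 * s * v ^ 3) * l))
      + (-2 * t * v\<^sup>2 * b + ((-2) * (v\<^sup>2 * l) + (-2 * t) * (v\<^sup>2 * b + (- 4 * t * v ^ 3) * l)))"
    unfolding lap2_def sum_2 ppQ by (simp add: s_def t_def v_def l_def)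
  also have "\<dots> = - 4 * v\<^sup>2 * (a * s + b * t) - 4 * v\<^sup>2 * l + 8 * v\<^sup>2 * l * ((1 + s\<^sup>2 + t\<^sup>2) * v - 1) + 8 * v\<^sup>2 * l * (1 - v)"
    by (simp add: algebra_simps power2_eq_square power3_eq_cube)
  also have "\<dots> = - (4 * v\<^sup>2) * (2 * (A + v * l) - 1)"
    unfolding w' by (simp add: l A_def field_simps)
  finally show "lap2 Q u = - (4 * (rw u)\<^sup>2) * (2 * Q u - 1)"
    by (simp add: Q v_def l_def)
qed

lemma lap2_zonal_power:
  fixes x :: "real^3"
  assumes \<epsilon>: "\<epsilon> = 1 \<or> \<epsilon> = -1" and x: "x \<in> X"
  shows "lap2 (\<lambda>u. qq x (stereo \<epsilon> u) ^ n) u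
    = - (4 * (rw u)\<^sup>2) * (real n * (real n + 1) * qq x (stereo \<epsilon> u) ^ n - (real n)\<^sup>2 * qq x (stereo \<epsilon> u) ^ (n - 1))"
proof -
  have e2: "\<epsilon>\<^sup>2 = 1" using \<epsilon> by auto
  define Q where "Q = (\<lambda>u. qq x (stereo \<epsilon> u))"
  have "ratf Q" using spoly_qq[of x] \<epsilon> by (auto simp: spoly_def Q_def o_def)
  from lap2_power[OF this, of n u]
  have "lap2 (\<lambda>u. Q u ^ n) u = real n * Q u ^ (n-1) * (- (4 * (rw u)\<^sup>2) * (2 * Q u - 1))
     + real n * real (n-1) * Q u ^ (n-2) * (4 * (rw u)\<^sup>2 * (Q u * (1 - Q u)))"
    using zonal_chart[OF e2 x, of u] unfolding Q_def by simp
  also have "\<dots> = - (4 * (rw u)\<^sup>2) * (real n * (real n + 1) * Q u ^ n - (real n)\<^sup>2 * Q u ^ (n - 1))"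
  proof -
    consider "n = 0" | "n = 1" | m where "n = m + 2" by (metis add_2_eq_Suc' One_nat_def not0_implies_Suc)
    then show ?thesis
    proof cases
      case 3
      then show ?thesis by (simp add: algebra_simps power2_eq_square)
    qed (simp_all add: algebra_simps)
  qed
  finally show ?thesis by (simp add: Q_def)
qed

text \<open>The Laplacian is triangular on the powers of q(x, .), with diagonal entries n(n + 1).
  The spectral facts below all rest on this formula.\<close>

lemma laplace_X_zonal_power:
  assumes "x \<in> X" "y \<in> X"
  shows "laplace_X (\<lambda>y. qq x y ^ n) y = real n * (real n + 1) * qq x y ^ n - (real n)\<^sup>2 * qq x y ^ (n - 1)"
proof -
  obtain \<epsilon> u where e: "\<epsilon> = 1 \<or> \<epsilon> = -1" "y = stereo \<epsilon> u" "\<And>f. laplace_X f y = laplace_chart (stereo \<epsilon>) f u"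
    using laplace_X_chart[OF assms(2)] by metis
  have e2: "\<epsilon>\<^sup>2 = 1" using e(1) by auto
  have "rw u \<noteq> 0" using rw_pos[of u] by simp
  moreover have "laplace_X (\<lambda>y. qq x y ^ n) y = - (1 / (4 * (rw u)\<^sup>2)) * lap2 (\<lambda>u. qq x (stereo \<epsilon> u) ^ n) u"
    unfolding e(3) laplace_chart_eq[OF e2] lap2_def o_def ..
  ultimately show ?thesis
    unfolding lap2_zonal_power[OF e(1) assms(1), of n u] e(2) by simp
qed

lemma laplace_X_add:
  assumes "spoly f" "spoly g" "x \<in> X"
  shows "laplace_X (\<lambda>x. f x + g x) x = laplace_X f x + laplace_X g x"
proof -
  obtain \<epsilon> u where e: "\<epsilon> = 1 \<or> \<epsilon> = -1" "x = stereo \<epsilon> u" "\<And>f. laplace_X f x = laplace_chart (stereo \<epsilon>) f u"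
    using laplace_X_chart[OF assms(3)] by metis
  have e2: "\<epsilon>\<^sup>2 = 1" using e(1) by auto
  have "ratf (f \<circ> stereo \<epsilon>)" "ratf (g \<circ> stereo \<epsilon>)" using assms e(1) by (auto simp: spoly_def)
  from lap2_add[OF this, of u] show ?thesis
    unfolding e(3) laplace_chart_eq[OF e2] lap2_def o_def by (simp add: distrib_left)
qed

lemma laplace_X_cmult:
  assumes "spoly f" "x \<in> X"
  shows "laplace_X (\<lambda>x. c * f x) x = c * laplace_X f x"
proof -
  obtain \<epsilon> u where e: "\<epsilon> = 1 \<or> \<epsilon> = -1" "x = stereo \<epsilon> u" "\<And>f. laplace_X f x = laplace_chart (stereo \<epsilon>) f u"
    using laplace_X_chart[OF assms(2)] by metis
  have e2: "\<epsilon>\<^sup>2 = 1" using e(1) by auto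
  have "ratf (f \<circ> stereo \<epsilon>)" using assms e(1) by (auto simp: spoly_def)
  from lap2_cmult[OF this, of c u] show ?thesis
    unfolding e(3) laplace_chart_eq[OF e2] lap2_def o_def by simp
qed

lemma laplace_X_const: assumes "x \<in> X" shows "laplace_X (\<lambda>x. c) x = 0"
  using laplace_X_zonal_power[OF assms assms, of 0] laplace_X_cmult[OF spoly_const[of 1] assms, of c] by simp

lemma laplace_X_sum:
  assumes "finite I" "\<And>i. i \<in> I \<Longrightarrow> spoly (f i)" "x \<in> X"
  shows "laplace_X (\<lambda>x. \<Sum>i\<in>I. c i * f i x) x = (\<Sum>i\<in>I. c i * laplace_X (f i) x)"
  using assms(1,2)
proof (induction I rule: finite_induct)
  case empty
  then show ?case using laplace_X_const[OF assms(3)] by simp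
next
  case (insert i I)
  have "spoly (\<lambda>x. c i * f i x)" "spoly (\<lambda>x. \<Sum>i\<in>I. c i * f i x)"
    using insert by (auto intro!: spoly_mult spoly_const spoly_sum)
  then show ?case using insert assms(3) by (simp add: laplace_X_add laplace_X_cmult)
qed

lemma spoly_Zl: "spoly (\<lambda>y. Zl l (qq x y))"
proof (induction l rule: less_induct)
  case (less l)
  have "(\<lambda>y. Zl l (qq x y)) = (\<lambda>y. (1 / kap l l) * (qq x y ^ l + (-1) * (\<Sum>j<l. kap j l * Zl j (qq x y))))"
    by (subst Zl.simps) (simp add: fun_eq_iff)
  moreover have "spoly (\<lambda>y. (1 / kap l l) * (qq x y ^ l + (-1) * (\<Sum>j<l. kap j l * Zl j (qq x y))))"
    using less by (intro spoly_mult spoly_const spoly_add spoly_power spoly_qq spoly_sum) auto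
  ultimately show ?case by simp
qed

text \<open>Strong induction: apply the Laplacian to q^l, the sum of the
  \<open>kap j l * Zl j\<close>. By \<open>kap_rec\<close> the lower-order term l^2 q^(l-1) is the
  combination of the \<open>Zl j\<close> with j < l that turns their eigenvalues j(j + 1) into l(l +
  1); solving for \<open>Zl l\<close> gives the claim.\<close>

lemma laplace_X_Zl:
  assumes "x \<in> X" "y \<in> X"
  shows "laplace_X (\<lambda>y. Zl l (qq x y)) y = real l * (real l + 1) * Zl l (qq x y)"
proof (induction l rule: less_induct)
  case (less l)
  have "laplace_X (\<lambda>y. \<Sum>j\<in>{..l}. kap j l * Zl j (qq x y)) y = (\<Sum>j\<in>{..l}. kap j l * laplace_X (\<lambda>y. Zl j (qq x y)) y)"
    using assms by (intro laplace_X_sum) (auto intro: spoly_Zl)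
  also have "(\<lambda>y. \<Sum>j\<in>{..l}. kap j l * Zl j (qq x y)) = (\<lambda>y. qq x y ^ l)"
    by (simp add: power_eq_sum_Zl[symmetric])
  also have "(\<Sum>j\<in>{..l}. kap j l * laplace_X (\<lambda>y. Zl j (qq x y)) y)
      = kap l l * laplace_X (\<lambda>y. Zl l (qq x y)) y + (\<Sum>j<l. kap j l * (real j * (real j + 1) * Zl j (qq x y)))"
    using less by (simp add: lessThan_Suc_atMost[symmetric])
  finally have 1: "kap l l * laplace_X (\<lambda>y. Zl l (qq x y)) y
      = real l * (real l + 1) * qq x y ^ l - (real l)\<^sup>2 * qq x y ^ (l - 1) - (\<Sum>j<l. kap j l * (real j * (real j + 1) * Zl j (qq x y)))"
    unfolding laplace_X_zonal_power[OF assms] by simp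
  have e: "(real l)\<^sup>2 * qq x y ^ (l - 1) = (\<Sum>j<l. kap j l * (real l * (real l + 1) - real j * (real j + 1)) * Zl j (qq x y))"
  proof (cases l)
    case (Suc m)
    have "(real l)\<^sup>2 * qq x y ^ (l - 1) = (\<Sum>j<l. (real l)\<^sup>2 * kap j m * Zl j (qq x y))"
      unfolding Suc power_eq_sum_Zl[of "qq x y" m] lessThan_Suc_atMost[symmetric]
      by (simp add: power_eq_sum_Zl sum_distrib_left lessThan_Suc_atMost mult.assoc)
    then show ?thesis using kap_rec[of _ m] by (simp add: Suc)
  qed simp
  have 2: "kap l l * laplace_X (\<lambda>y. Zl l (qq x y)) y
      = real l * (real l + 1) * qq x y ^ l - (\<Sum>j<l. kap j l * (real l * (real l + 1)) * Zl j (qq x y))"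
  proof -
    have "(\<Sum>j<l. kap j l * (real l * (real l + 1) - real j * (real j + 1)) * Zl j (qq x y))
        + (\<Sum>j<l. kap j l * (real j * (real j + 1) * Zl j (qq x y)))
        = (\<Sum>j<l. kap j l * (real l * (real l + 1)) * Zl j (qq x y))"
      unfolding sum.distrib[symmetric] by (intro sum.cong) (auto simp: algebra_simps)
    then show ?thesis using 1 e by linarith
  qed
  have "qq x y ^ l - (\<Sum>j<l. kap j l * Zl j (qq x y)) = kap l l * Zl l (qq x y)"
    by (subst power_eq_sum_Zl) (simp add: lessThan_Suc_atMost[symmetric])
  then have "kap l l * (real l * (real l + 1) * Zl l (qq x y))
     = real l * (real l + 1) * (qq x y ^ l - (\<Sum>j<l. kap j l * Zl j (qq x y)))"
    by (simp only: mult.left_commute)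
  also have "\<dots> = kap l l * laplace_X (\<lambda>y. Zl l (qq x y)) y"
    unfolding 2 by (simp only: right_diff_distrib sum_distrib_left) (simp add: ac_simps)
  finally show ?case using kap_pos[of l l] by simp
qed

lemma eigenspace_Zl: "x \<in> X \<Longrightarrow> (\<lambda>y. Zl l (qq x y)) \<in> eigenspace (real l * (real l + 1))"
  using laplace_X_Zl spoly_Zl spoly_smooth by (auto simp: eigenspace_def)

lemma eigenspace_const: "(\<lambda>y. c) \<in> eigenspace 0"
  using laplace_X_const spoly_const spoly_smooth by (auto simp: eigenspace_def)

section \<open>Lebesgue integrals over the plane and the total area\<close>

definition v2 :: "real \<Rightarrow> real \<Rightarrow> real^2" where
  "v2 a b = a *\<^sub>R axis 1 1 + b *\<^sub>R axis 2 1"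

lemma v2_nth [simp]: "v2 a b $ 1 = a" "v2 a b $ 2 = b"
  by (simp_all add: v2_def axis_def)

lemma continuous_v2: "continuous_on UNIV (\<lambda>p. v2 (fst p) (snd p))"
  unfolding v2_def by (intro continuous_intros)

lemma measurable_v2 [measurable]: "(\<lambda>p. v2 (fst p) (snd p)) \<in> borel \<rightarrow>\<^sub>M borel"
  using continuous_v2 by (rule borel_measurable_continuous_onI)

lemma lborel_real2: "(lborel :: (real^2) measure) = distr (lborel \<Otimes>\<^sub>M lborel) borel (\<lambda>p. v2 (fst p) (snd p))"
proof (rule lborel_eqI)
  fix l u :: "real^2" assume lu: "\<And>b. b \<in> Basis \<Longrightarrow> l \<bullet> b \<le> u \<bullet> b"
  have le: "l $ i \<le> u $ i" for i using lu[of "axis i 1"] by (auto simp: Basis_vec_def inner_axis)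
  have "(\<lambda>p. v2 (fst p) (snd p)) -` box l u \<inter> space (lborel \<Otimes>\<^sub>M lborel) = {l$1<..<u$1} \<times> {l$2<..<u$2}"
    by (auto simp: mem_box_cart forall_2 space_pair_measure)
  then have "emeasure (distr (lborel \<Otimes>\<^sub>M lborel) borel (\<lambda>p. v2 (fst p) (snd p))) (box l u)
    = emeasure (lborel \<Otimes>\<^sub>M lborel) ({l$1<..<u$1} \<times> {l$2<..<u$2})"
    by (subst emeasure_distr) (auto simp: lborel_prod)
  also have "\<dots> = ennreal ((u$1 - l$1) * (u$2 - l$2))"
    using le by (simp add: lborel.emeasure_pair_measure_Times ennreal_mult)
  also have "(u$1 - l$1) * (u$2 - l$2) = (\<Prod>i\<in>UNIV. (u - l) \<bullet> axis i 1)"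
    by (simp add: UNIV_2 inner_axis)
  also have "\<dots> = (\<Prod>b\<in>Basis. (u - l) \<bullet> b)"
  proof -
    have B: "Basis = range (\<lambda>i::2. axis i (1::real))" by (auto simp: Basis_vec_def)
    have "inj (\<lambda>i::2. axis i (1::real))" by (auto simp: inj_on_def axis_eq_axis)
    then show ?thesis unfolding B by (simp add: prod.reindex)
  qed
  finally show "emeasure (distr (lborel \<Otimes>\<^sub>M lborel) borel (\<lambda>p. v2 (fst p) (snd p))) (box l u) = ennreal (\<Prod>b\<in>Basis. (u - l) \<bullet> b)" .
qed (simp)

lemma nn_integral_real2:
  fixes f :: "real^2 \<Rightarrow> ennreal" assumes [measurable]: "f \<in> borel_measurable borel"
  shows "(\<integral>\<^sup>+u. f u \<partial>lborel) = (\<integral>\<^sup>+a. \<integral>\<^sup>+b. f (v2 a b) \<partial>lborel \<partial>lborel)"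
proof -
  have "(\<integral>\<^sup>+u. f u \<partial>lborel) = (\<integral>\<^sup>+p. f (v2 (fst p) (snd p)) \<partial>(lborel \<Otimes>\<^sub>M lborel))"
    by (subst lborel_real2, subst nn_integral_distr) (auto simp: lborel_prod)
  also have "\<dots> = (\<integral>\<^sup>+a. \<integral>\<^sup>+b. f (v2 (fst (a,b)) (snd (a,b))) \<partial>lborel \<partial>lborel)"
    by (rule lborel.nn_integral_fst[symmetric]) (simp add: lborel_prod)
  finally show ?thesis by simp
qed

lemma nn_integral_even:
  fixes f F :: "real \<Rightarrow> real"
  assumes f: "f \<in> borel_measurable borel" and nn: "\<And>x. 0 \<le> f x" and even: "\<And>x. f (- x) = f x"
    and D: "\<And>x. DERIV F x :> f x" and lim: "(F \<longlongrightarrow> T) at_top" and F0: "F 0 = 0"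
  shows "(\<integral>\<^sup>+x. ennreal (f x) \<partial>lborel) = ennreal (2 * T)"
proof -
  have h: "(\<integral>\<^sup>+x. ennreal (f x) * indicator {0..} x \<partial>lborel) = ennreal (T - F 0)"
    using f nn D lim by (intro nn_integral_FTC_atLeast) auto
  have "0 \<le> T"
  proof (rule tendsto_lowerbound[OF lim])
    have "F 0 \<le> F x" if "0 \<le> x" for x
      using D nn that by (intro DERIV_nonneg_imp_nondecreasing[of 0 x F]) auto
    then show "\<forall>\<^sub>F x in at_top. 0 \<le> F x" using F0 eventually_at_top_linorder by metis
  qed simp
  have "(\<integral>\<^sup>+x. ennreal (f x) \<partial>lborel) = (\<integral>\<^sup>+x. ennreal (f x) * indicator {0..} x + ennreal (f x) * indicator {..<0} x \<partial>lborel)"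
    by (intro nn_integral_cong) (auto simp: indicator_def)
  also have "\<dots> = (\<integral>\<^sup>+x. ennreal (f x) * indicator {0..} x \<partial>lborel) + (\<integral>\<^sup>+x. ennreal (f x) * indicator {..<0} x \<partial>lborel)"
    using f by (intro nn_integral_add) auto
  also have "(\<integral>\<^sup>+x. ennreal (f x) * indicator {..<0} x \<partial>lborel) = (\<integral>\<^sup>+x. ennreal (f x) * indicator {..<0} x \<partial>(distr lborel borel uminus))"
    by (simp add: lborel_distr_uminus)
  also have "\<dots> = (\<integral>\<^sup>+x. ennreal (f x) * indicator {0<..} x \<partial>lborel)"
    using f by (subst nn_integral_distr) (auto simp: even indicator_def intro!: nn_integral_cong)
  also have "\<dots> = (\<integral>\<^sup>+x. ennreal (f x) * indicator {0..} x \<partial>lborel)"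
  proof (rule nn_integral_cong_AE)
    show "AE x in lborel. ennreal (f x) * indicator {0<..} x = ennreal (f x) * indicator {0..} x"
      using AE_lborel_singleton[of "0::real"] by eventually_elim (auto simp: indicator_def)
  qed
  finally show ?thesis using h F0 \<open>0 \<le> T\<close> by (simp add: ennreal_plus[symmetric] del: ennreal_plus)
qed

lemma continuous_rw: "continuous_on S rw"
  by (meson continuous_on_subset differentiable_at_imp_differentiable_on differentiable_imp_continuous_on differentiable_rw subset_UNIV)

lemma measurable_rw [measurable]: "rw \<in> borel_measurable borel"
  using continuous_rw by (rule borel_measurable_continuous_onI)

text \<open>The total area is computed by iterated integration in Cartesian coordinates; this is the
  integral over the second coordinate, with c^2 = 1 + a^2 for the first coordinate a.\<close>

lemma nn_integral_inner:
  assumes c: "0 < (c::real)"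
  shows "(\<integral>\<^sup>+b. ennreal (1 / (c\<^sup>2 + b\<^sup>2)\<^sup>2) \<partial>lborel) = ennreal (pi / (2 * c ^ 3))"
proof -
  let ?F = "\<lambda>b. b / (2 * c\<^sup>2 * (c\<^sup>2 + b\<^sup>2)) + arctan (b / c) / (2 * c ^ 3)"
  have pos: "0 < c\<^sup>2 + b\<^sup>2" for b using c by (simp add: add_pos_nonneg)
  have "(\<integral>\<^sup>+b. ennreal (1 / (c\<^sup>2 + b\<^sup>2)\<^sup>2) \<partial>lborel) = ennreal (2 * (pi / (4 * c ^ 3)))"
  proof (rule nn_integral_even[where F = ?F])
    fix x
    have ne: "c\<^sup>2 + x\<^sup>2 \<noteq> 0" "c \<noteq> 0" using pos[of x] c by auto
    have "DERIV (\<lambda>b. b / (2 * c\<^sup>2 * (c\<^sup>2 + b\<^sup>2))) x :> (c\<^sup>2 - x\<^sup>2) / (2 * c\<^sup>2 * (c\<^sup>2 + x\<^sup>2)\<^sup>2)"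
    proof -
      have "DERIV (\<lambda>b. b / (2 * c\<^sup>2 * (c\<^sup>2 + b\<^sup>2))) x :>
        (1 * (2 * c\<^sup>2 * (c\<^sup>2 + x\<^sup>2)) - x * (2 * c\<^sup>2 * (2 * x))) / ((2 * c\<^sup>2 * (c\<^sup>2 + x\<^sup>2)) * (2 * c\<^sup>2 * (c\<^sup>2 + x\<^sup>2)))"
        using ne by (intro DERIV_divide) (auto intro!: derivative_eq_intros)
      also have "1 * (2 * c\<^sup>2 * (c\<^sup>2 + x\<^sup>2)) - x * (2 * c\<^sup>2 * (2 * x)) = 2 * c\<^sup>2 * (c\<^sup>2 - x\<^sup>2)"
        by (simp add: algebra_simps power2_eq_square)
      also have "2 * c\<^sup>2 * (c\<^sup>2 - x\<^sup>2) / ((2 * c\<^sup>2 * (c\<^sup>2 + x\<^sup>2)) * (2 * c\<^sup>2 * (c\<^sup>2 + x\<^sup>2))) = (c\<^sup>2 - x\<^sup>2) / (2 * c\<^sup>2 * (c\<^sup>2 + x\<^sup>2)\<^sup>2)"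
      proof -
        have "s * d / ((s * P) * (s * P)) = d / (s * P\<^sup>2)" if "s \<noteq> 0" for s d P :: real
          using that unfolding power2_eq_square by (simp add: mult.assoc)
        note G = this
        have "2 * c\<^sup>2 \<noteq> 0" using ne by simp
        then show ?thesis by (rule G)
      qed
      finally show ?thesis .
    qed
    moreover have "DERIV (\<lambda>b. arctan (b / c) / (2 * c ^ 3)) x :> 1 / (2 * c\<^sup>2 * (c\<^sup>2 + x\<^sup>2))"
    proof -
      have i: "inverse (1 + (x / c)\<^sup>2) = c\<^sup>2 / (c\<^sup>2 + x\<^sup>2)" using ne by (simp add: field_simps power_divide)
      have "DERIV (\<lambda>b. arctan (b / c)) x :> inverse (1 + (x / c)\<^sup>2) * (1 / c)"
        using ne by (auto intro!: derivative_eq_intros)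
      from DERIV_cdivide[OF this, of "2 * c ^ 3"]
      have "DERIV (\<lambda>b. arctan (b / c) / (2 * c ^ 3)) x :> c\<^sup>2 / (c\<^sup>2 + x\<^sup>2) * (1 / c) / (2 * c ^ 3)" unfolding i .
      also have "c\<^sup>2 / (c\<^sup>2 + x\<^sup>2) * (1 / c) / (2 * c ^ 3) = 1 / (2 * c\<^sup>2 * (c\<^sup>2 + x\<^sup>2))"
        using ne by (simp add: power2_eq_square power3_eq_cube divide_simps)
      finally show ?thesis .
    qed
    ultimately have "DERIV ?F x :> (c\<^sup>2 - x\<^sup>2) / (2 * c\<^sup>2 * (c\<^sup>2 + x\<^sup>2)\<^sup>2) + 1 / (2 * c\<^sup>2 * (c\<^sup>2 + x\<^sup>2))"
      by (rule DERIV_add)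
    also have "(c\<^sup>2 - x\<^sup>2) / (2 * c\<^sup>2 * (c\<^sup>2 + x\<^sup>2)\<^sup>2) + 1 / (2 * c\<^sup>2 * (c\<^sup>2 + x\<^sup>2)) = 1 / (c\<^sup>2 + x\<^sup>2)\<^sup>2"
    proof -
      have "1 / (2 * c\<^sup>2 * (c\<^sup>2 + x\<^sup>2)) = (c\<^sup>2 + x\<^sup>2) / (2 * c\<^sup>2 * (c\<^sup>2 + x\<^sup>2)\<^sup>2)"
        using ne by (simp add: power2_eq_square)
      then show ?thesis using ne by (simp add: add_divide_distrib[symmetric])
    qed
    finally show "DERIV ?F x :> 1 / (c\<^sup>2 + x\<^sup>2)\<^sup>2" .
  next
    have "((\<lambda>b. b / (2 * c\<^sup>2 * (c\<^sup>2 + b\<^sup>2))) \<longlongrightarrow> 0) at_top"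
    proof (rule tendsto_sandwich[of "\<lambda>_. 0" _ _ "\<lambda>b. (1 / (2 * c\<^sup>2)) * inverse b"])
      show "\<forall>\<^sub>F b in at_top. 0 \<le> b / (2 * c\<^sup>2 * (c\<^sup>2 + b\<^sup>2))"
        using eventually_ge_at_top[of 0] by eventually_elim auto
      show "\<forall>\<^sub>F b in at_top. b / (2 * c\<^sup>2 * (c\<^sup>2 + b\<^sup>2)) \<le> (1 / (2 * c\<^sup>2)) * inverse b"
        using eventually_gt_at_top[of 0]
      proof eventually_elim
        case (elim b)
        have "b / (c\<^sup>2 + b\<^sup>2) \<le> b / b\<^sup>2" using elim by (intro divide_left_mono mult_pos_pos pos) auto
        also have "\<dots> = inverse b" using elim by (simp add: power2_eq_square field_simps)
        finally have "(1 / (2 * c\<^sup>2)) * (b / (c\<^sup>2 + b\<^sup>2)) \<le> (1 / (2 * c\<^sup>2)) * inverse b"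
          using c by (intro mult_left_mono) auto
        then show ?case by simp
      qed
      have "((\<lambda>b. (1 / (2 * c\<^sup>2)) * inverse b) \<longlongrightarrow> (1 / (2 * c\<^sup>2)) * 0) at_top"
        by (intro tendsto_mult tendsto_const tendsto_inverse_0_at_top filterlim_ident)
      then show "((\<lambda>b. (1 / (2 * c\<^sup>2)) * inverse b) \<longlongrightarrow> 0) at_top" by simp
    qed simp
    moreover have "filterlim (\<lambda>b. inverse c * b) at_top at_top"
      using c by (intro filterlim_tendsto_pos_mult_at_top[OF tendsto_const] filterlim_ident) auto
    then have "((\<lambda>b. arctan (inverse c * b)) \<longlongrightarrow> pi / 2) at_top"
      by (rule filterlim_compose[OF tendsto_arctan_at_top])
    then have "((\<lambda>b. arctan (b / c) / (2 * c ^ 3)) \<longlongrightarrow> (pi / 2) / (2 * c ^ 3)) at_top"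
      using c by (intro tendsto_divide tendsto_const) (auto simp: field_simps)
    ultimately have "(?F \<longlongrightarrow> 0 + (pi / 2) / (2 * c ^ 3)) at_top" by (rule tendsto_add)
    then show "(?F \<longlongrightarrow> pi / (4 * c ^ 3)) at_top" by simp
  qed auto
  then show ?thesis by simp
qed

lemma nn_integral_outer:
  "(\<integral>\<^sup>+a. ennreal (2 * pi / (sqrt (1 + a\<^sup>2)) ^ 3) \<partial>lborel) = ennreal (4 * pi)"
proof -
  let ?F = "\<lambda>a. 2 * pi * (a / sqrt (1 + a\<^sup>2))"
  have pos: "0 < 1 + a\<^sup>2" for a :: real by (simp add: add_pos_nonneg)
  have "(\<integral>\<^sup>+a. ennreal (2 * pi / (sqrt (1 + a\<^sup>2)) ^ 3) \<partial>lborel) = ennreal (2 * (2 * pi))"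
  proof (rule nn_integral_even[where F = ?F])
    fix x :: real
    define r where "r = sqrt (1 + x\<^sup>2)"
    have r: "r > 0" "r\<^sup>2 = 1 + x\<^sup>2" using pos[of x] by (auto simp: r_def)
    have "DERIV (\<lambda>a. sqrt (1 + a\<^sup>2)) x :> x / r"
      using pos[of x] by (auto intro!: derivative_eq_intros simp: r_def field_simps)
    then have "DERIV (\<lambda>a. a / sqrt (1 + a\<^sup>2)) x :> (1 * r - x * (x / r)) / (r * r)"
      using r unfolding r_def by (intro DERIV_divide) (auto intro!: derivative_eq_intros)
    also have "(1 * r - x * (x / r)) / (r * r) = 1 / r ^ 3"
    proof -
      have "1 * r - x * (x / r) = (r\<^sup>2 - x\<^sup>2) / r" using r(1) by (simp add: field_simps power2_eq_square)
      also have "\<dots> = 1 / r" using r(2) by simp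
      finally show ?thesis using r(1) by (simp add: power3_eq_cube)
    qed
    finally have "DERIV (\<lambda>a. a / sqrt (1 + a\<^sup>2)) x :> 1 / r ^ 3" .
    from DERIV_cmult[OF this, of "2 * pi"]
    show "DERIV ?F x :> 2 * pi / (sqrt (1 + x\<^sup>2)) ^ 3" by (simp add: r_def)
  next
    have "((\<lambda>a::real. a / sqrt (1 + a\<^sup>2)) \<longlongrightarrow> 1) at_top"
    proof (rule tendsto_sandwich[of "\<lambda>a. 1 - inverse a"  _ _ "\<lambda>_. 1"])
      show "\<forall>\<^sub>F a::real in at_top. 1 - inverse a \<le> a / sqrt (1 + a\<^sup>2)"
        using eventually_gt_at_top[of 0]
      proof eventually_elim
        case (elim a)
        have "sqrt (1 + a\<^sup>2) \<le> a + 1" using elim by (intro real_le_lsqrt) (auto simp: power2_eq_square algebra_simps)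
        then have "a / (a + 1) \<le> a / sqrt (1 + a\<^sup>2)" using elim pos[of a] by (intro divide_left_mono) auto
        moreover have "1 - inverse a \<le> a / (a + 1)" using elim by (simp add: field_simps)
        ultimately show ?case by linarith
      qed
      show "\<forall>\<^sub>F a::real in at_top. a / sqrt (1 + a\<^sup>2) \<le> 1"
        using eventually_gt_at_top[of 0]
      proof eventually_elim
        case (elim a)
        have "a \<le> sqrt (1 + a\<^sup>2)" by (intro real_le_rsqrt) auto
        then show ?case using pos[of a] by simp
      qed
      have "((\<lambda>a::real. 1 - inverse a) \<longlongrightarrow> 1 - 0) at_top"
        by (intro tendsto_diff tendsto_const tendsto_inverse_0_at_top filterlim_ident)
      then show "((\<lambda>a::real. 1 - inverse a) \<longlongrightarrow> 1) at_top" by simp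
    qed simp
    from tendsto_mult[OF tendsto_const[of "2 * pi"] this] show "(?F \<longlongrightarrow> 2 * pi) at_top" by simp
  qed (auto simp: less_imp_le[OF pos])
  then show ?thesis by simp
qed

lemma nn_integral_area: "(\<integral>\<^sup>+u. ennreal (4 * (rw u)\<^sup>2) \<partial>lborel) = ennreal (4 * pi)"
proof -
  have pos: "0 < 1 + a\<^sup>2" for a :: real by (simp add: add_pos_nonneg)
  have "(\<integral>\<^sup>+u. ennreal (4 * (rw u)\<^sup>2) \<partial>lborel) = (\<integral>\<^sup>+a. \<integral>\<^sup>+b. ennreal (4 * (rw (v2 a b))\<^sup>2) \<partial>lborel \<partial>lborel)"
    by (rule nn_integral_real2) simp
  also have "\<dots> = (\<integral>\<^sup>+a. ennreal (2 * pi / (sqrt (1 + a\<^sup>2)) ^ 3) \<partial>lborel)"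
  proof (rule nn_integral_cong)
    fix a :: real
    define c where "c = sqrt (1 + a\<^sup>2)"
    have c: "0 < c" "c\<^sup>2 = 1 + a\<^sup>2" using pos[of a] by (auto simp: c_def)
    have "ennreal (4 * (rw (v2 a b))\<^sup>2) = ennreal 4 * ennreal (1 / (c\<^sup>2 + b\<^sup>2)\<^sup>2)" for b
      unfolding ennreal_mult[OF zero_le_numeral zero_le_divide_1_iff[THEN iffD2, OF zero_le_power2], symmetric] c(2)
      by (simp add: rw_def norm2 power_divide add.assoc)
    then have "(\<integral>\<^sup>+b. ennreal (4 * (rw (v2 a b))\<^sup>2) \<partial>lborel) = (\<integral>\<^sup>+b. ennreal 4 * ennreal (1 / (c\<^sup>2 + b\<^sup>2)\<^sup>2) \<partial>lborel)"
      by (simp only:)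
    also have "\<dots> = ennreal 4 * ennreal (pi / (2 * c ^ 3))"
      unfolding nn_integral_inner[OF c(1), symmetric] by (rule nn_integral_cmult) simp
    also have "\<dots> = ennreal (4 * (pi / (2 * c ^ 3)))"
      using c(1) by (intro ennreal_mult[symmetric]) auto
    also have "\<dots> = ennreal (2 * pi / (sqrt (1 + a\<^sup>2)) ^ 3)"
      by (simp add: c_def)
    finally show "(\<integral>\<^sup>+b. ennreal (4 * (rw (v2 a b))\<^sup>2) \<partial>lborel) = ennreal (2 * pi / (sqrt (1 + a\<^sup>2)) ^ 3)" .
  qed
  also have "\<dots> = ennreal (4 * pi)" by (rule nn_integral_outer)
  finally show ?thesis .
qed

lemma integral_real2:
  fixes f :: "real^2 \<Rightarrow> real" assumes [measurable]: "f \<in> borel_measurable borel"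
  shows "(\<integral>u. f u \<partial>lborel) = (\<integral>p. f (v2 (fst p) (snd p)) \<partial>(lborel \<Otimes>\<^sub>M lborel))"
  by (subst lborel_real2, subst integral_distr) (auto simp: lborel_prod)

lemma integrable_real2:
  fixes f :: "real^2 \<Rightarrow> real" assumes [measurable]: "f \<in> borel_measurable borel"
  assumes "integrable lborel f"
  shows "integrable (lborel \<Otimes>\<^sub>M lborel) (\<lambda>p. f (v2 (fst p) (snd p)))"
proof -
  have "integrable (distr (lborel \<Otimes>\<^sub>M lborel) borel (\<lambda>p. v2 (fst p) (snd p))) f"
    using assms(2) lborel_real2 by metis
  then show ?thesis by (subst (asm) integrable_distr_eq) (auto simp: lborel_prod)
qed

section \<open>The divergence theorem in the plane for decaying fields\<close>

lemma strip_bound: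
  fixes h W :: "real \<Rightarrow> real \<Rightarrow> real"
  assumes R: "0 < R" and h: "\<And>b. continuous_on UNIV (\<lambda>a. h a b)"
    and d: "\<And>a b. DERIV (\<lambda>a. W a b) a :> h a b"
    and c: "\<And>b. \<bar>W R b\<bar> \<le> c" "\<And>b. \<bar>W (- R) b\<bar> \<le> c"
  shows "\<bar>\<integral>b. \<integral>a. indicator {- R..R} a * (indicator {- R..R} b * h a b) \<partial>lborel \<partial>lborel\<bar> \<le> 4 * R * c"
proof -
  \<comment> \<open>The fundamental theorem of calculus leaves two boundary values of W, each at
    most c; integration over an interval of length 2 R gives 4 R c.\<close>
  have inner: "(\<integral>a. indicator {- R..R} a * (indicator {- R..R} b * h a b) \<partial>lborel) = indicator {- R..R} b * (W R b - W (- R) b)" for b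
  proof -
    have "(\<integral>a. indicator {- R..R} a *\<^sub>R h a b \<partial>lborel) = W R b - W (- R) b"
      using R d[of b] h[of b]
      by (intro integral_FTC_atLeastAtMost)
         (auto simp: has_real_derivative_iff_has_vector_derivative[symmetric]
           intro: has_field_derivative_at_within continuous_on_subset)
    moreover have "(\<integral>a. indicator {- R..R} a * (indicator {- R..R} b * h a b) \<partial>lborel)
       = (\<integral>a. indicator {- R..R} b * (indicator {- R..R} a *\<^sub>R h a b) \<partial>lborel)"
      by (intro Bochner_Integration.integral_cong) auto
    ultimately show ?thesis by simp
  qed
  have "\<bar>\<integral>b. indicator {- R..R} b * (W R b - W (- R) b) \<partial>lborel\<bar> \<le> (\<integral>b. \<bar>indicator {- R..R} b * (W R b - W (- R) b)\<bar> \<partial>lborel)"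
    by (rule integral_abs_bound)
  also have "\<dots> \<le> (\<integral>b. indicator {- R..R} b * (2 * c) \<partial>lborel)"
  proof (rule integral_mono')
    show "integrable lborel (\<lambda>b. indicator {- R..R} b * (2 * c))"
      using R by (intro integrable_mult_left integrable_real_indicator) simp_all
    have c0: "0 \<le> c" using c(1) abs_ge_zero order_trans by blast
    show "\<bar>indicator {- R..R} b * (W R b - W (- R) b)\<bar> \<le> indicator {- R..R} b * (2 * c)" for b
      using c(1)[of b] c(2)[of b] by (cases "b \<in> {-R..R}") auto
    show "0 \<le> indicator {- R..R} b * (2 * c)" for b :: real using c0 by (simp add: indicator_def)
  qed
  also have "\<dots> = 4 * R * c" using R by simp
  finally show ?thesis unfolding inner .
qed

definition sq :: "real \<Rightarrow> (real^2) set" where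
  "sq R = {u. \<bar>u$1\<bar> \<le> R \<and> \<bar>u$2\<bar> \<le> R}"

lemma sq_cbox: "sq R = cbox (v2 (- R) (- R)) (v2 R R)"
  by (auto simp: sq_def mem_box_cart forall_2)

lemma indicator_sq: "indicator (sq R) (v2 a b) = (indicator {- R..R} a * indicator {- R..R} b :: real)"
  by (auto simp: sq_def indicator_def)

lemma norm_v2_ge: "\<bar>a\<bar> \<le> norm (v2 a b)" "\<bar>b\<bar> \<le> norm (v2 a b)"
  using component_le_norm_cart[of "v2 a b" 1] component_le_norm_cart[of "v2 a b" 2] by auto

lemma integrable_sq:
  fixes g :: "real^2 \<Rightarrow> real"
  shows "continuous_on UNIV g \<Longrightarrow> integrable lborel (\<lambda>u. indicator (sq R) u * g u)"
  using borel_integrable_compact[of "sq R" g] continuous_on_subset by (auto simp: sq_cbox)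

text \<open>The disjunction allows a derivative in either direction, so that both terms of a
  divergence are covered. Only values of V on the boundary of the square enter, where the norm is at
  least R.\<close>

lemma rect_bound:
  fixes g V :: "real^2 \<Rightarrow> real"
  assumes R: "0 < R" and g: "continuous_on UNIV g" and V: "\<And>u. R \<le> norm u \<Longrightarrow> \<bar>V u\<bar> \<le> c"
    and d: "(\<forall>a b. DERIV (\<lambda>a. V (v2 a b)) a :> g (v2 a b)) \<or> (\<forall>a b. DERIV (\<lambda>b. V (v2 a b)) b :> g (v2 a b))"
  shows "\<bar>\<integral>u. indicator (sq R) u * g u \<partial>lborel\<bar> \<le> 4 * R * c"
proof -
  have [measurable]: "sq R \<in> sets borel" by (simp add: sq_cbox)
  have gm [measurable]: "g \<in> borel_measurable borel" using g by (rule borel_measurable_continuous_onI)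
  have m: "(\<lambda>u. indicator (sq R) u * g u) \<in> borel_measurable borel" by measurable
  have i: "integrable (lborel \<Otimes>\<^sub>M lborel) (\<lambda>(a, b). indicator {- R..R} a * (indicator {- R..R} b * g (v2 a b)))"
    using integrable_real2[OF m integrable_sq[OF g]] by (simp add: indicator_sq case_prod_unfold mult.assoc)
  have e: "(\<integral>u. indicator (sq R) u * g u \<partial>lborel) = (\<integral>p. (case p of (a, b) \<Rightarrow> indicator {- R..R} a * (indicator {- R..R} b * g (v2 a b))) \<partial>(lborel \<Otimes>\<^sub>M lborel))"
    unfolding integral_real2[OF m] by (simp add: indicator_sq case_prod_unfold mult.assoc)
  have ca: "continuous_on UNIV (\<lambda>a. g (v2 a b))" "continuous_on UNIV (\<lambda>b. g (v2 a b))" for a b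
    unfolding v2_def by (rule continuous_on_compose2[OF g]; (intro continuous_intros)?; simp)+
  have c: "\<bar>V (v2 R b)\<bar> \<le> c" "\<bar>V (v2 (-R) b)\<bar> \<le> c" "\<bar>V (v2 b R)\<bar> \<le> c" "\<bar>V (v2 b (-R))\<bar> \<le> c" for b
    using norm_v2_ge(1)[of R b] norm_v2_ge(1)[of "-R" b] norm_v2_ge(2)[of R b] norm_v2_ge(2)[of "-R" b] R
    by (auto intro!: V)
  from d show ?thesis
  proof
    assume d: "\<forall>a b. DERIV (\<lambda>a. V (v2 a b)) a :> g (v2 a b)"
    have "(\<integral>p. (case p of (a, b) \<Rightarrow> indicator {- R..R} a * (indicator {- R..R} b * g (v2 a b))) \<partial>(lborel \<Otimes>\<^sub>M lborel))
      = (\<integral>b. \<integral>a. indicator {- R..R} a * (indicator {- R..R} b * g (v2 a b)) \<partial>lborel \<partial>lborel)"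
      by (rule lborel_pair.integral_snd[symmetric]) (rule i)
    then show ?thesis unfolding e
      using strip_bound[OF R, of "\<lambda>a b. g (v2 a b)" "\<lambda>a b. V (v2 a b)" c] ca c d by simp
  next
    assume d: "\<forall>a b. DERIV (\<lambda>b. V (v2 a b)) b :> g (v2 a b)"
    have "(\<integral>p. (case p of (a, b) \<Rightarrow> indicator {- R..R} a * (indicator {- R..R} b * g (v2 a b))) \<partial>(lborel \<Otimes>\<^sub>M lborel))
      = (\<integral>a. \<integral>b. indicator {- R..R} b * (indicator {- R..R} a * g (v2 a b)) \<partial>lborel \<partial>lborel)"
      using lborel_pair.integral_fst[OF i] by (simp add: mult.left_commute)
    then show ?thesis unfolding e
      using strip_bound[OF R, of "\<lambda>a b. g (v2 b a)" "\<lambda>a b. V (v2 b a)" c] ca c d by simp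
  qed
qed

lemma partial_DERIV:
  fixes V :: "real^2 \<Rightarrow> real"
  assumes "\<And>u. V differentiable at u"
  shows "DERIV (\<lambda>a. V (v2 a b)) a :> partial 1 V (v2 a b)"
    and "DERIV (\<lambda>b. V (v2 a b)) b :> partial 2 V (v2 a b)"
proof -
  have "((\<lambda>a. v2 a b) has_derivative (\<lambda>h. v2 h 0)) (at a)"
    unfolding v2_def by (auto intro!: derivative_eq_intros)
  from diff_chain_at[OF this has_derivative_partial[OF assms]]
  show "DERIV (\<lambda>a. V (v2 a b)) a :> partial 1 V (v2 a b)"
    by (simp add: o_def sum_2 has_field_derivative_def mult_commute_abs)
  have "((\<lambda>b. v2 a b) has_derivative (\<lambda>h. v2 0 h)) (at b)"
    unfolding v2_def by (auto intro!: derivative_eq_intros)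
  from diff_chain_at[OF this has_derivative_partial[OF assms]]
  show "DERIV (\<lambda>b. V (v2 a b)) b :> partial 2 V (v2 a b)"
    by (simp add: o_def sum_2 has_field_derivative_def mult_commute_abs)
qed

text \<open>On the square of half side R the field is at most B/R^2 on the boundary, whose length is
  8 R, so the flux is O(1/R). Dominated convergence identifies the limit of the integrals over the
  squares.\<close>

lemma integral_divergence_zero:
  fixes V1 V2 :: "real^2 \<Rightarrow> real"
  assumes diff: "\<And>u. V1 differentiable at u" "\<And>u. V2 differentiable at u"
    and cont: "continuous_on UNIV (partial 1 V1)" "continuous_on UNIV (partial 2 V2)"
    and B: "\<And>u. \<bar>V1 u\<bar> \<le> B * rw u" "\<And>u. \<bar>V2 u\<bar> \<le> B * rw u"
    and int: "integrable lborel (\<lambda>u. partial 1 V1 u + partial 2 V2 u)"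
  shows "(\<integral>u. partial 1 V1 u + partial 2 V2 u \<partial>lborel) = 0"
proof -
  let ?D = "\<lambda>u. partial 1 V1 u + partial 2 V2 u"
  have [measurable]: "sq R \<in> sets borel" for R by (simp add: sq_cbox)
  have [measurable]: "partial 1 V1 \<in> borel_measurable borel" "partial 2 V2 \<in> borel_measurable borel"
    using cont by (auto intro: borel_measurable_continuous_onI)
  have lim: "(\<lambda>n. \<integral>u. indicator (sq (real (Suc n))) u * ?D u \<partial>lborel) \<longlonglongrightarrow> (\<integral>u. ?D u \<partial>lborel)"
  proof (rule integral_dominated_convergence[where w = "\<lambda>u. \<bar>?D u\<bar>"])
    show "integrable lborel (\<lambda>u. \<bar>?D u\<bar>)" using int by simp
    show "AE u in lborel. (\<lambda>n. indicator (sq (real (Suc n))) u * ?D u) \<longlonglongrightarrow> ?D u"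
    proof (rule AE_I2)
      fix u :: "real^2"
      obtain m where m: "norm u \<le> real m" using real_arch_simple by blast
      have "indicator (sq (real (Suc n))) u * ?D u = ?D u" if "m \<le> n" for n
      proof -
        have "norm u \<le> real (Suc n)" using m that by simp
        then have "u \<in> sq (real (Suc n))"
          using component_le_norm_cart[of u 1] component_le_norm_cart[of u 2] by (auto simp: sq_def simp del: of_nat_Suc)
        then show ?thesis by simp
      qed
      then show "(\<lambda>n. indicator (sq (real (Suc n))) u * ?D u) \<longlonglongrightarrow> ?D u"
        by (intro tendsto_eventually) (auto simp: eventually_sequentially)
    qed
    show "AE u in lborel. norm (indicator (sq (real (Suc n))) u * ?D u) \<le> \<bar>?D u\<bar>" for n
      by (rule AE_I2) (auto simp: indicator_def)
  qed auto
  have bound: "\<bar>\<integral>u. indicator (sq (real (Suc n))) u * ?D u \<partial>lborel\<bar> \<le> 8 * B * inverse (real (Suc n))" for n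
  proof -
    let ?R = "real (Suc n)"
    have B0: "0 \<le> B" using B(1)[of 0] rw_pos[of 0] by (smt (verit) mult_nonneg_nonneg mult_neg_pos)
    have V: "\<bar>V1 u\<bar> \<le> B / ?R\<^sup>2" "\<bar>V2 u\<bar> \<le> B / ?R\<^sup>2" if "?R \<le> norm u" for u
    proof -
      have "?R\<^sup>2 \<le> (norm u)\<^sup>2" using that by (intro power_mono) auto
      then have "?R\<^sup>2 \<le> 1 + (norm u)\<^sup>2" by linarith
      then have "rw u \<le> 1 / ?R\<^sup>2" unfolding rw_def by (rule frac_le[rotated 3]) (auto simp del: of_nat_Suc)
      then have "B * rw u \<le> B * (1 / ?R\<^sup>2)" using B0 by (intro mult_left_mono)
      then show "\<bar>V1 u\<bar> \<le> B / ?R\<^sup>2" "\<bar>V2 u\<bar> \<le> B / ?R\<^sup>2" using B[of u] by auto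
    qed
    have r1: "\<bar>\<integral>u. indicator (sq ?R) u * partial 1 V1 u \<partial>lborel\<bar> \<le> 4 * ?R * (B / ?R\<^sup>2)"
      using partial_DERIV[OF diff(1)] by (intro rect_bound[where V = V1] cont V) auto
    have r2: "\<bar>\<integral>u. indicator (sq ?R) u * partial 2 V2 u \<partial>lborel\<bar> \<le> 4 * ?R * (B / ?R\<^sup>2)"
      using partial_DERIV[OF diff(2)] by (intro rect_bound[where V = V2] cont V) auto
    have "(\<integral>u. indicator (sq ?R) u * ?D u \<partial>lborel)
      = (\<integral>u. indicator (sq ?R) u * partial 1 V1 u \<partial>lborel) + (\<integral>u. indicator (sq ?R) u * partial 2 V2 u \<partial>lborel)"
      using integrable_sq[OF cont(1)] integrable_sq[OF cont(2)]
      by (simp add: distrib_left del: of_nat_Suc)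
    moreover have "4 * ?R * (B / ?R\<^sup>2) = 4 * B * inverse ?R"
      by (simp add: power2_eq_square field_simps del: of_nat_Suc)
    ultimately show ?thesis using r1 r2 by (simp del: of_nat_Suc)
  qed
  have "(\<lambda>n. \<integral>u. indicator (sq (real (Suc n))) u * ?D u \<partial>lborel) \<longlonglongrightarrow> 0"
  proof (rule Lim_null_comparison)
    show "\<forall>\<^sub>F n in sequentially. norm (\<integral>u. indicator (sq (real (Suc n))) u * ?D u \<partial>lborel) \<le> 8 * B * inverse (real (Suc n))"
      using bound by (intro always_eventually allI) (simp del: of_nat_Suc)
    from tendsto_mult[OF tendsto_const[of "8 * B"] LIMSEQ_inverse_real_of_nat]
    show "(\<lambda>n. 8 * B * inverse (real (Suc n))) \<longlonglongrightarrow> 0" by simp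
  qed
  with lim show ?thesis by (rule LIMSEQ_unique)
qed

section \<open>Boundedness and decay of smooth functions near the omitted pole\<close>

lemma C_k_continuous: "C_k k F \<Longrightarrow> continuous_on UNIV F"
  by (cases k) (auto intro!: differentiable_imp_continuous_on simp: differentiable_on_def differentiable_at_withinI)

text \<open>The transition map between the charts is inversion in the unit circle: what lies outside
  the unit disc in the first chart lies in the compact unit disc of the second.\<close>

lemma stereo_inversion:
  assumes "u \<noteq> 0"
  shows "stereo 1 u = stereo (-1) ((1 / (norm u)\<^sup>2) *\<^sub>R u)"
proof -
  have n: "(norm u)\<^sup>2 > 0" using assms by simp
  have "(norm ((1 / (norm u)\<^sup>2) *\<^sub>R u))\<^sup>2 = 1 / (norm u)\<^sup>2"
    using assms by (simp add: power_divide power2_eq_square)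
  then have r: "rw ((1 / (norm u)\<^sup>2) *\<^sub>R u) = (norm u)\<^sup>2 * rw u"
    unfolding rw_def
  proof -
    assume e: "(norm ((1 / (norm u)\<^sup>2) *\<^sub>R u))\<^sup>2 = 1 / (norm u)\<^sup>2"
    have "1 / (1 + 1 / a) = a * (1 / (1 + a))" if "0 < a" for a :: real
      using that by (simp add: field_simps)
    from this[OF n] show "1 / (1 + (norm ((1 / (norm u)\<^sup>2) *\<^sub>R u))\<^sup>2) = (norm u)\<^sup>2 * (1 / (1 + (norm u)\<^sup>2))"
      unfolding e .
  qed
  have "1 + (norm u)\<^sup>2 \<noteq> 0" using n by linarith
  then have w: "(1 + (norm u)\<^sup>2) * rw u = 1" unfolding rw_def by simp
  then have w': "(norm u)\<^sup>2 * rw u = 1 - rw u" by (simp add: algebra_simps)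
  show ?thesis
    using n w' unfolding Finite_Cartesian_Product.vec_eq_iff forall_3 stereo_components r
    by (simp add: algebra_simps)
qed

lemma continuous_bounded_ball:
  fixes F :: "real^2 \<Rightarrow> real"
  assumes "continuous_on UNIV F"
  obtains B where "\<And>u. norm u \<le> 1 \<Longrightarrow> \<bar>F u\<bar> \<le> B"
proof -
  have "compact (F ` cball 0 1)"
    using assms by (intro compact_continuous_image continuous_on_subset[OF assms]) auto
  then have "bounded (F ` cball 0 1)" by (rule compact_imp_bounded)
  then obtain B where "\<forall>x\<in>F ` cball 0 1. norm x \<le> B" by (auto simp: bounded_iff)
  then show ?thesis using that[of B] by auto
qed

lemma smooth_bounded:
  assumes "smooth_X \<phi>"
  obtains B where "\<And>u. \<bar>\<phi> (stereo 1 u)\<bar> \<le> B"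
proof -
  have "continuous_on UNIV (\<phi> \<circ> stereo 1)" "continuous_on UNIV (\<phi> \<circ> stereo (-1))"
    using assms unfolding smooth_X_def by (blast intro: C_k_continuous)+
  then obtain B1 B2 where B: "\<And>u. norm u \<le> 1 \<Longrightarrow> \<bar>\<phi> (stereo 1 u)\<bar> \<le> B1" "\<And>u. norm u \<le> 1 \<Longrightarrow> \<bar>\<phi> (stereo (-1) u)\<bar> \<le> B2"
    by (metis continuous_bounded_ball comp_apply)
  have "\<bar>\<phi> (stereo 1 u)\<bar> \<le> max B1 B2" for u
  proof (cases "norm u \<le> 1")
    case True then show ?thesis using B(1)[of u] by simp
  next
    case False
    then have "u \<noteq> 0" by auto
    have "norm ((1 / (norm u)\<^sup>2) *\<^sub>R u) \<le> 1" using False by (simp add: power2_eq_square)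
    then show ?thesis using B(2) unfolding stereo_inversion[OF \<open>u \<noteq> 0\<close>] by (meson max.coboundedI2)
  qed
  then show ?thesis using that by blast
qed

text \<open>Outside the unit disc the derivative is computed through the second chart: the inversion
  has derivatives O(1/|u|^2), which is comparable to \<open>rw u\<close> there, and the partial
  derivatives in the second chart are bounded on the unit disc.\<close>

lemma smooth_partial_decay:
  assumes "smooth_X \<phi>"
  obtains B where "\<And>u. \<bar>partial i (\<phi> \<circ> stereo 1) u\<bar> \<le> B * rw u"
proof -
  define F where "F = \<phi> \<circ> stereo (-1)"
  have C: "C_k 1 (\<phi> \<circ> stereo 1)" "C_k 1 F" using assms by (auto simp: smooth_X_def F_def)
  then have "continuous_on UNIV (partial i (\<phi> \<circ> stereo 1))" "\<And>j. continuous_on UNIV (partial j F)"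
    by (auto intro: C_k_continuous)
  then obtain B0 B1 B2 where B: "\<And>u. norm u \<le> 1 \<Longrightarrow> \<bar>partial i (\<phi> \<circ> stereo 1) u\<bar> \<le> B0"
     "\<And>u. norm u \<le> 1 \<Longrightarrow> \<bar>partial 1 F u\<bar> \<le> B1" "\<And>u. norm u \<le> 1 \<Longrightarrow> \<bar>partial 2 F u\<bar> \<le> B2"
    by (metis continuous_bounded_ball)
  have nn: "0 \<le> B0" "0 \<le> B1" "0 \<le> B2" using B[of 0] by (auto intro: order_trans[OF abs_ge_zero])
  \<comment> \<open>The factor 2 for B0 is due to rw >= 1/2 on the unit disc. The factor 6 is 3 * 2:
    outside the disc the Jacobian entries of the inversion are at most 3/|u|^2, and 1/|u|^2 <= 2
    rw.\<close>
  let ?B = "2 * B0 + 6 * B1 + 6 * B2"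
  have "\<bar>partial i (\<phi> \<circ> stereo 1) u\<bar> \<le> ?B * rw u" for u
  proof (cases "norm u \<le> 1")
    case True
    then have "(norm u)\<^sup>2 \<le> 1" by (simp add: power_le_one)
    then have "1 / 2 \<le> rw u" unfolding rw_def by (intro frac_le) (auto simp: add_pos_nonneg)
    then have "B0 \<le> 2 * B0 * rw u" using nn(1) mult_left_mono[of "1/2" "rw u" "2 * B0"] by simp
    also have "\<dots> \<le> ?B * rw u" using nn rw_pos[of u] by (intro mult_right_mono) auto
    finally show ?thesis using B(1)[OF True] by linarith
  next
    case False
    then have u: "u \<noteq> 0" by auto
    define N where "N = (\<lambda>u::real^2. (u$1)\<^sup>2 + (u$2)\<^sup>2)"
    have N: "N u = (norm u)\<^sup>2" for u by (simp add: N_def norm2)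
    have Nu: "N u > 1" unfolding N using False by (simp add: one_less_power)
    define I where "I = (\<lambda>u::real^2. (1 / N u) *\<^sub>R u)"
    have co: "((\<lambda>u::real^2. u $ j) has_derivative (\<lambda>u. u $ j)) (at u)" for j
      by (rule bounded_linear_imp_has_derivative) (rule bounded_linear_vec_nth)
    define L where "L = (\<lambda>h::real^2. 2 * (u$1) * (h$1) + 2 * (u$2) * (h$2))"
    have dN: "(N has_derivative L) (at u)"
      unfolding N_def L_def by (auto intro!: derivative_eq_intros co simp: fun_eq_iff algebra_simps)
    have dI: "(I has_derivative (\<lambda>h. (1 / N u) *\<^sub>R h - (L h / (N u)\<^sup>2) *\<^sub>R u)) (at u)"
    proof -
      have "((\<lambda>u. 1 / N u) has_derivative (\<lambda>h. - L h / (N u)\<^sup>2)) (at u)"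
        using Nu by (auto intro!: derivative_eq_intros dN simp: fun_eq_iff field_simps power2_eq_square)
      from has_derivative_scaleR[OF this has_derivative_ident]
      show ?thesis unfolding I_def by simp
    qed
    have dF: "(F has_derivative (\<lambda>h. \<Sum>j\<in>UNIV. (h$j) *\<^sub>R partial j F (I u))) (at (I u))"
      using C(2) by (intro has_derivative_partial) auto
    have "((F \<circ> I) has_derivative ((\<lambda>h. \<Sum>j\<in>UNIV. (h$j) *\<^sub>R partial j F (I u)) \<circ> (\<lambda>h. (1 / N u) *\<^sub>R h - (L h / (N u)\<^sup>2) *\<^sub>R u))) (at u)"
      by (rule diff_chain_at[OF dI dF])
    then have "((\<phi> \<circ> stereo 1) has_derivative ((\<lambda>h. \<Sum>j\<in>UNIV. (h$j) *\<^sub>R partial j F (I u)) \<circ> (\<lambda>h. (1 / N u) *\<^sub>R h - (L h / (N u)\<^sup>2) *\<^sub>R u))) (at u)"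
    proof (rule has_derivative_transform_within_open[of _ _ _ _ "- {0}"])
      fix v :: "real^2" assume "v \<in> - {0}"
      then show "(F \<circ> I) v = (\<phi> \<circ> stereo 1) v" using stereo_inversion[of v] by (simp add: F_def I_def N)
    qed (use u in auto)
    from partial_eq[OF this, of i]
    have p: "partial i (\<phi> \<circ> stereo 1) u
      = ((axis i 1 $ 1) / N u - 2 * (u$i) * (u$1) / (N u)\<^sup>2) * partial 1 F (I u)
        + ((axis i 1 $ 2) / N u - 2 * (u$i) * (u$2) / (N u)\<^sup>2) * partial 2 F (I u)"
      using exhaust_2[of i] by (auto simp: sum_2 axis_def L_def)
    have coef: "\<bar>(axis i 1 $ j) / N u - 2 * (u$i) * (u$j) / (N u)\<^sup>2\<bar> \<le> 3 / N u" for j :: 2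
    proof -
      have "\<bar>u$i\<bar> * \<bar>u$j\<bar> \<le> norm u * norm u" by (intro mult_mono component_le_norm_cart) auto
      then have "\<bar>2 * (u$i) * (u$j)\<bar> \<le> 2 * N u"
        by (simp add: abs_mult N power2_eq_square)
      then have "\<bar>2 * (u$i) * (u$j) / (N u)\<^sup>2\<bar> \<le> 2 * N u / (N u)\<^sup>2"
        unfolding abs_divide abs_power2 by (rule divide_right_mono) simp
      also have "\<dots> = 2 / N u" using Nu by (simp add: power2_eq_square)
      finally have 1: "\<bar>2 * (u$i) * (u$j) / (N u)\<^sup>2\<bar> \<le> 2 / N u" .
      have 2: "\<bar>(axis i 1 $ j) / N u\<bar> \<le> 1 / N u" using Nu by (auto simp: axis_def)
      have "3 / N u = 1 / N u + 2 / N u" by (simp add: add_divide_distrib[symmetric])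
      then show ?thesis using 1 2 abs_triangle_ineq4[of "(axis i 1 $ j) / N u" "2 * (u$i) * (u$j) / (N u)\<^sup>2"] by linarith
    qed
    have "norm (I u) \<le> 1" using False by (simp add: I_def N power2_eq_square)
    then have "\<bar>partial i (\<phi> \<circ> stereo 1) u\<bar> \<le> 3 / N u * B1 + 3 / N u * B2"
      unfolding p using Nu
      by (intro order_trans[OF abs_triangle_ineq] add_mono order_trans[OF eq_refl[OF abs_mult]]
          mult_mono coef B(2,3)) auto
    also have "\<dots> = (6 * B1 + 6 * B2) * (1 / (2 * N u))" using Nu by (simp add: field_simps)
    also have "\<dots> \<le> (6 * B1 + 6 * B2) * rw u"
      unfolding rw_def N[symmetric] using Nu nn by (intro mult_left_mono frac_le) auto
    also have "\<dots> \<le> ?B * rw u" using nn rw_pos[of u] by (intro mult_right_mono) auto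
    finally show ?thesis .
  qed
  then show ?thesis using that by blast
qed

section \<open>The Funk--Hecke formula\<close>

lemma measurable_stereo [measurable]: "stereo 1 \<in> borel \<rightarrow>\<^sub>M restrict_space borel X"
proof (rule measurable_restrict_space2)
  show "stereo 1 \<in> borel \<rightarrow>\<^sub>M borel"
    by (rule borel_measurable_continuous_onI)
       (meson differentiable_at_imp_differentiable_on differentiable_imp_continuous_on stereo_differentiable)
  show "stereo 1 \<in> space borel \<rightarrow> X" using norm_stereo[of 1] by auto
qed

lemma area_density_1: "area_density (stereo 1) u = 4 * (rw u)\<^sup>2"
  by (rule area_density_stereo) simp

lemma dVg_eq: "dVg = distr (density lborel (\<lambda>u. ennreal (4 * (rw u)\<^sup>2))) (restrict_space borel X) (stereo 1)"
  unfolding dVg_def area_density_1 ..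

lemma sets_dVg [measurable_cong]: "sets dVg = sets (restrict_space borel X)"
  by (simp add: dVg_eq)

lemma space_dVg [simp]: "space dVg = X"
  by (simp add: dVg_eq space_restrict_space)

lemma sets_sigma_X [measurable_cong]: "sets sigma_X = sets (restrict_space borel X)"
  by (simp add: sigma_X_def sets_dVg)

lemma space_sigma_X [simp]: "space sigma_X = X"
  by (simp add: sigma_X_def space_scale_measure)

lemma emeasure_dVg: "emeasure dVg X = ennreal (4 * pi)"
proof -
  have "stereo 1 -` X = UNIV" using norm_stereo[of 1] by auto
  moreover have "X \<in> sets (restrict_space borel X)" by (simp add: sets_restrict_space_iff)
  ultimately show ?thesis
    unfolding dVg_eq by (subst emeasure_distr) (auto simp: emeasure_density nn_integral_area)
qed

lemma prob_sigma_X: "emeasure sigma_X X = 1"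
proof -
  have "emeasure sigma_X X = ennreal (1 / (4 * pi)) * ennreal (4 * pi)"
    by (simp add: sigma_X_def emeasure_dVg)
  also have "\<dots> = ennreal (1 / (4 * pi) * (4 * pi))" by (rule ennreal_mult[symmetric]) auto
  finally show ?thesis by simp
qed

interpretation sigma: finite_measure sigma_X
  by standard (simp add: prob_sigma_X)

lemma measure_sigma_X [simp]: "measure sigma_X X = 1"
  by (simp add: measure_def prob_sigma_X)

lemma scale_measure_eq_density: "scale_measure (ennreal c) M = density M (\<lambda>_. ennreal c)"
  by (rule measure_eqI) (auto simp: emeasure_density nn_integral_cmult_indicator)

lemma integral_dVg:
  fixes f :: "real^3 \<Rightarrow> real"
  shows "f \<in> borel_measurable (restrict_space borel X) \<Longrightarrow> (\<integral>x. f x \<partial>dVg) = (\<integral>u. 4 * (rw u)\<^sup>2 * f (stereo 1 u) \<partial>lborel)"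
  unfolding dVg_eq by (subst integral_distr) (auto simp: integral_density)

lemma integral_sigma_X:
  fixes f :: "real^3 \<Rightarrow> real"
  assumes "f \<in> borel_measurable (restrict_space borel X)"
  shows "(\<integral>x. f x \<partial>dVg) = 4 * pi * (\<integral>x. f x \<partial>sigma_X)"
proof -
  have "f \<in> borel_measurable dVg" using assms sets_dVg measurable_cong_sets by blast
  then have "(\<integral>x. f x \<partial>sigma_X) = (\<integral>x. (1 / (4 * pi)) *\<^sub>R f x \<partial>dVg)"
    unfolding sigma_X_def scale_measure_eq_density by (subst integral_density) auto
  then show ?thesis by simp
qed

lemma integral_sigma_X_chart:
  fixes f :: "real^3 \<Rightarrow> real"
  assumes "f \<in> borel_measurable (restrict_space borel X)"
  shows "4 * pi * (\<integral>x. f x \<partial>sigma_X) = (\<integral>u. 4 * (rw u)\<^sup>2 * f (stereo 1 u) \<partial>lborel)"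
  using integral_sigma_X[OF assms] integral_dVg[OF assms] by simp

lemma integrable_area: "integrable lborel (\<lambda>u. 4 * (rw u)\<^sup>2)"
  by (rule integrableI_nn_integral_finite[where x = "4 * pi"]) (auto simp: nn_integral_area)

lemma measurable_contX: "continuous_on X f \<Longrightarrow> f \<in> borel_measurable (restrict_space borel X)"
  for f :: "real^3 \<Rightarrow> 'b::topological_space"
  by (rule borel_measurable_continuous_on_restrict)

lemma measurable_contX_sigma: "continuous_on X f \<Longrightarrow> f \<in> borel_measurable sigma_X"
  for f :: "real^3 \<Rightarrow> 'b::topological_space"
  using measurable_contX measurable_cong_sets[OF sets_sigma_X refl] by blast

lemma contX_bounded:
  fixes f :: "real^3 \<Rightarrow> 'b::real_normed_vector"
  assumes "continuous_on X f"
  obtains B where "0 \<le> B" "\<And>x. x \<in> X \<Longrightarrow> norm (f x) \<le> B"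
proof -
  have "bounded (f ` X)" using assms by (intro compact_imp_bounded compact_continuous_image) auto
  then obtain B where B: "\<forall>y\<in>f ` X. norm y \<le> B" by (auto simp: bounded_iff)
  show ?thesis by (rule that[of "max B 0"]) (use B in \<open>auto simp: le_max_iff_disj\<close>)
qed

lemma integrable_contX:
  fixes f :: "real^3 \<Rightarrow> 'b::{banach, second_countable_topology}"
  assumes "continuous_on X f"
  shows "integrable sigma_X f"
proof -
  obtain B where B: "\<And>x. x \<in> X \<Longrightarrow> norm (f x) \<le> B" using contX_bounded[OF assms] by metis
  show ?thesis
    by (rule sigma.integrable_const_bound[where B = B]) (use B measurable_contX_sigma[OF assms] in auto)
qed

lemma continuous_chart: assumes "\<epsilon>\<^sup>2 = 1" shows "continuous_on {x \<in> X. \<epsilon> * x$3 \<noteq> 1} (chart \<epsilon>)"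
proof -
  have "continuous_on {x \<in> X. \<epsilon> * x$3 \<noteq> 1} (\<lambda>x. v2 (x$1 / (1 - \<epsilon> * x$3)) (x$2 / (1 - \<epsilon> * x$3)))"
    unfolding v2_def by (intro continuous_intros) auto
  moreover have "chart \<epsilon> = (\<lambda>x. v2 (x$1 / (1 - \<epsilon> * x$3)) (x$2 / (1 - \<epsilon> * x$3)))"
    by (auto simp: chart_def Finite_Cartesian_Product.vec_eq_iff forall_2)
  ultimately show ?thesis by (rule ssubst[rotated])
qed

lemma smooth_continuous: assumes "smooth_X \<phi>" shows "continuous_on X \<phi>"
proof -
  let ?U = "\<lambda>\<epsilon>. {x \<in> X. \<epsilon> * x$3 \<noteq> 1}"
  have c: "continuous_on (?U \<epsilon>) \<phi>" if e: "\<epsilon> = 1 \<or> \<epsilon> = -1" for \<epsilon>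
  proof -
    have e2: "\<epsilon>\<^sup>2 = 1" using e by auto
    have "continuous_on UNIV (\<phi> \<circ> stereo \<epsilon>)"
      using assms e unfolding smooth_X_def by (blast intro: C_k_continuous)
    then have "continuous_on (?U \<epsilon>) (\<lambda>x. (\<phi> \<circ> stereo \<epsilon>) (chart \<epsilon> x))"
      by (rule continuous_on_compose2) (intro continuous_chart e2, simp)
    then show ?thesis
      by (rule continuous_on_eq) (use stereo_chart[OF e2] in auto)
  qed
  have op: "openin (top_of_set X) (?U \<epsilon>)" for \<epsilon>
  proof -
    have "open {x::real^3. \<epsilon> * x$3 \<noteq> 1}" by (intro open_Collect_neq continuous_intros)
    then show ?thesis by (auto simp: openin_open)
  qed
  have U: "X = ?U 1 \<union> ?U (-1)" by auto
  have o: "openin (top_of_set (?U 1 \<union> ?U (-1))) (?U \<epsilon>)" for \<epsilon> using op[of \<epsilon>] U by metis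
  have "continuous_on (?U 1 \<union> ?U (-1)) \<phi>"
    by (rule continuous_on_Un_local_open[OF o o c c]) simp_all
  then show ?thesis using U by metis
qed

lemma spoly_continuous: "spoly f \<Longrightarrow> continuous_on X f"
  by (intro smooth_continuous spoly_smooth)

lemma continuous_qq: "continuous_on X (qq x)"
  by (intro spoly_continuous spoly_qq)

section \<open>Green's identity, moments and the spectrum\<close>

lemma green:
  assumes x: "x \<in> X" and \<phi>: "\<phi> \<in> eigenspace lam"
  shows "(\<integral>y. qq x y ^ n * \<phi> y \<partial>sigma_X) * (real n * (real n + 1) - lam)
       = (real n)\<^sup>2 * (\<integral>y. qq x y ^ (n - 1) * \<phi> y \<partial>sigma_X)"
proof -
  have sm: "smooth_X \<phi>" and ev: "\<And>y. y \<in> X \<Longrightarrow> laplace_X \<phi> y = lam * \<phi> y"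
    using \<phi> by (auto simp: eigenspace_def)
  define F where "F = \<phi> \<circ> stereo 1"
  define g where "g = (\<lambda>m y. qq x y ^ m)"
  define G where "G = (\<lambda>m u. qq x (stereo 1 u) ^ m)"
  have spg: "spoly (g m)" for m unfolding g_def by (intro spoly_power spoly_qq)
  have Gg: "G m = g m \<circ> stereo 1" for m by (auto simp: G_def g_def)
  have rG: "ratf (G m)" for m using spg[of m] by (simp add: spoly_def Gg)
  have CF: "C_k k F" for k using sm by (simp add: smooth_X_def F_def)
  have CG: "C_k k (G m)" for k m by (intro ratf_C_k rG)
  have dF: "F differentiable at u" "partial i F differentiable at u" for u i
    using CF[of "Suc (Suc 0)"] by auto
  have dG: "G m differentiable at u" "partial i (G m) differentiable at u" for u i m
    using CG[of "Suc (Suc 0)"] by auto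
  have lapF: "lap2 F u = - (4 * (rw u)\<^sup>2) * (lam * F u)" for u
  proof -
    have "laplace_chart (stereo 1) \<phi> u = lam * F u"
      using ev[of "stereo 1 u"] norm_stereo[of 1 u] laplace_X_stereo[of \<phi> u] by (simp add: F_def)
    then have "- (1 / (4 * (rw u)\<^sup>2)) * lap2 F u = lam * F u"
      using laplace_chart_eq[of 1 \<phi> u] by (simp add: lap2_def F_def)
    then show ?thesis using rw_pos[of u] by (simp add: field_simps)
  qed
  have lapG: "lap2 (G n) u = - (4 * (rw u)\<^sup>2) * (real n * (real n + 1) * G n u - (real n)\<^sup>2 * G (n-1) u)" for u
    using lap2_zonal_power[of 1, OF _ x] by (simp add: G_def)
  \<comment> \<open>The field of Green's second identity: its divergence is G times the Laplacian of
    F minus F times the Laplacian of G. Boundedness of F and G and the decay of their derivatives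
    make it O(rw), as \<open>integral_divergence_zero\<close> requires.\<close>
  define V where "V = (\<lambda>i u. G n u * partial i F u + (-1) * (F u * partial i (G n) u))"
  have pV: "partial i (V i) u = G n u * partial i (partial i F) u - F u * partial i (partial i (G n)) u" for i u
  proof -
    have "partial i (V i) u = partial i (\<lambda>u. G n u * partial i F u) u + partial i (\<lambda>u. (-1) * (F u * partial i (G n) u)) u"
      unfolding V_def using dF dG by (intro partial_add differentiable_mult differentiable_const)
    also have "partial i (\<lambda>u. (-1) * (F u * partial i (G n) u)) u = (-1) * partial i (\<lambda>u. F u * partial i (G n) u) u"
      using dF dG by (subst partial_mult) (auto intro: differentiable_mult)
    finally show ?thesis using dF dG by (simp add: partial_mult)
  qed
  have D: "partial 1 (V 1) u + partial 2 (V 2) u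
     = 4 * (rw u)\<^sup>2 * (F u * ((real n * (real n + 1) - lam) * G n u - (real n)\<^sup>2 * G (n-1) u))" for u
  proof -
    have "partial 1 (V 1) u + partial 2 (V 2) u = G n u * lap2 F u - F u * lap2 (G n) u"
      by (simp add: pV lap2_def sum_2 algebra_simps)
    then show ?thesis unfolding lapF lapG by (simp add: algebra_simps)
  qed
  have cF: "continuous_on UNIV F" using CF by (rule C_k_continuous)
  have cG: "continuous_on UNIV (G m)" for m using CG by (rule C_k_continuous)
  obtain BF where BF: "\<And>u. \<bar>F u\<bar> \<le> BF" using smooth_bounded[OF sm] by (auto simp: F_def)
  have BG: "\<bar>G m u\<bar> \<le> 1" for m u
    using qq_bounds[OF x norm_stereo[of 1 u]] by (simp add: G_def power_le_one)
  have zero: "(\<integral>u. partial 1 (V 1) u + partial 2 (V 2) u \<partial>lborel) = 0"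
  proof -
    have "\<exists>B. \<forall>u. \<bar>partial i F u\<bar> \<le> B * rw u" for i
      using smooth_partial_decay[OF sm, of i] unfolding F_def by metis
    then obtain B1 where B1: "\<And>i u. \<bar>partial i F u\<bar> \<le> B1 i * rw u" by metis
    have "\<exists>B. \<forall>u. \<bar>partial i (G n) u\<bar> \<le> B * rw u" for i
      using smooth_partial_decay[OF spoly_smooth[OF spg], of i n] unfolding Gg by metis
    then obtain B2 where B2: "\<And>i u. \<bar>partial i (G n) u\<bar> \<le> B2 i * rw u" by metis
    have VB: "\<bar>V i u\<bar> \<le> (B1 i + BF * B2 i) * rw u" for i u
    proof -
      have nn: "0 \<le> BF" "0 \<le> B2 i * rw u" using BF[of 0] B2[of i u] by (meson abs_ge_zero order_trans)+
      have "\<bar>V i u\<bar> \<le> \<bar>G n u\<bar> * \<bar>partial i F u\<bar> + \<bar>F u\<bar> * \<bar>partial i (G n) u\<bar>"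
        unfolding V_def by (rule order_trans[OF abs_triangle_ineq]) (simp add: abs_mult)
      also have "\<dots> \<le> 1 * (B1 i * rw u) + BF * (B2 i * rw u)"
        using nn by (intro add_mono mult_mono BG B1 BF B2) auto
      finally show ?thesis by (simp add: algebra_simps)
    qed
    define B where "B = max (B1 1 + BF * B2 1) (B1 2 + BF * B2 2)"
    have B: "\<bar>V 1 u\<bar> \<le> B * rw u" "\<bar>V 2 u\<bar> \<le> B * rw u" for u
      using rw_pos[of u] by (auto intro!: order_trans[OF VB] mult_right_mono simp: B_def)
    have cont: "continuous_on UNIV (partial i (V i))" for i
    proof -
      have "continuous_on UNIV (partial i (partial i F))" "continuous_on UNIV (partial i (partial i (G n)))"
        using CF[of "Suc (Suc 0)"] CG[of "Suc (Suc 0)"] by (auto intro: C_k_continuous)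
      then show ?thesis unfolding pV[abs_def] using cF cG by (intro continuous_intros)
    qed
    have diff: "V i differentiable at u" for i u
      unfolding V_def using dF dG by (intro differentiable_add differentiable_mult differentiable_const)
    have int: "integrable lborel (\<lambda>u. partial 1 (V 1) u + partial 2 (V 2) u)"
    proof (rule Bochner_Integration.integrable_bound)
      let ?C = "BF * (\<bar>real n * (real n + 1) - lam\<bar> + (real n)\<^sup>2)"
      show "integrable lborel (\<lambda>u. 4 * (rw u)\<^sup>2 * ?C)" by (intro integrable_mult_left integrable_area)
      show "(\<lambda>u. partial 1 (V 1) u + partial 2 (V 2) u) \<in> borel_measurable lborel"
        by (simp, intro borel_measurable_add borel_measurable_continuous_onI cont)
      show "AE u in lborel. norm (partial 1 (V 1) u + partial 2 (V 2) u) \<le> norm (4 * (rw u)\<^sup>2 * ?C)"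
      proof (rule AE_I2)
        fix u
        have nn: "0 \<le> BF" using BF[of 0] by (meson abs_ge_zero order_trans)
        have "\<bar>(real n * (real n + 1) - lam) * G n u - (real n)\<^sup>2 * G (n-1) u\<bar>
          \<le> \<bar>real n * (real n + 1) - lam\<bar> * \<bar>G n u\<bar> + (real n)\<^sup>2 * \<bar>G (n-1) u\<bar>"
          by (rule order_trans[OF abs_triangle_ineq4]) (simp add: abs_mult)
        also have "\<dots> \<le> \<bar>real n * (real n + 1) - lam\<bar> * 1 + (real n)\<^sup>2 * 1"
          by (intro add_mono mult_left_mono BG) auto
        finally have "\<bar>F u * ((real n * (real n + 1) - lam) * G n u - (real n)\<^sup>2 * G (n-1) u)\<bar> \<le> ?C"
          unfolding abs_mult[of "F u"] using nn by (intro mult_mono BF) auto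
        then have "4 * (rw u)\<^sup>2 * \<bar>F u * ((real n * (real n + 1) - lam) * G n u - (real n)\<^sup>2 * G (n-1) u)\<bar> \<le> 4 * (rw u)\<^sup>2 * ?C"
          by (intro mult_left_mono) auto
        then show "norm (partial 1 (V 1) u + partial 2 (V 2) u) \<le> norm (4 * (rw u)\<^sup>2 * ?C)"
          unfolding D using nn by (simp add: abs_mult)
      qed
    qed
    show ?thesis by (rule integral_divergence_zero[OF diff diff cont cont B int])
  qed
  let ?h = "\<lambda>y. (real n * (real n + 1) - lam) * (qq x y ^ n * \<phi> y) - (real n)\<^sup>2 * (qq x y ^ (n - 1) * \<phi> y)"
  have ch: "continuous_on X (\<lambda>y. qq x y ^ m * \<phi> y)" for m
    using smooth_continuous[OF sm] continuous_qq by (intro continuous_intros)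
  have ch': "continuous_on X ?h" by (intro continuous_on_diff continuous_on_mult_left ch)
  have "4 * pi * (\<integral>y. ?h y \<partial>sigma_X) = (\<integral>u. 4 * (rw u)\<^sup>2 * ?h (stereo 1 u) \<partial>lborel)"
    by (intro integral_sigma_X_chart measurable_contX ch')
  also have "\<dots> = 0"
    using zero unfolding D by (simp add: F_def G_def algebra_simps)
  finally have "(\<integral>y. ?h y \<partial>sigma_X) = 0" by simp
  also have "(\<integral>y. ?h y \<partial>sigma_X) = (real n * (real n + 1) - lam) * (\<integral>y. qq x y ^ n * \<phi> y \<partial>sigma_X)
     - (real n)\<^sup>2 * (\<integral>y. qq x y ^ (n - 1) * \<phi> y \<partial>sigma_X)"
    using integrable_contX[OF ch] by simp
  finally show ?thesis by (simp add: mult.commute)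
qed

text \<open>Green's identity for the constant eigenfunction, of eigenvalue 0, gives the ratio n/(n +
  1) of consecutive moments.\<close>

lemma moments:
  assumes "x \<in> X"
  shows "(\<integral>y. qq x y ^ n \<partial>sigma_X) = 1 / (real n + 1)"
proof (induction n)
  case 0
  then show ?case by simp
next
  case (Suc n)
  have "(\<integral>y. qq x y ^ Suc n \<partial>sigma_X) * (real (Suc n) * (real (Suc n) + 1)) = (real (Suc n))\<^sup>2 * (1 / (real n + 1))"
    using green[OF assms eigenspace_const[of 1], of "Suc n"] Suc by simp
  moreover have "(real (Suc n))\<^sup>2 * (1 / (real n + 1)) = real n + 1"
  proof -
    have "a\<^sup>2 * (1 / a) = a" for a :: real by (simp add: power2_eq_square)
    from this[of "real n + 1"] show ?thesis by (simp add: add.commute)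
  qed
  ultimately have "((\<integral>y. qq x y ^ Suc n \<partial>sigma_X) * (real n + 2)) * (real n + 1) = 1 * (real n + 1)"
    by (simp add: mult.assoc mult.commute[of "real n + 2"] del: power_Suc) (simp add: add.commute del: power_Suc)?
  then have "(\<integral>y. qq x y ^ Suc n \<partial>sigma_X) * (real n + 2) = 1"
    by (subst (asm) mult_right_cancel) auto
  then show ?case by (simp add: eq_divide_eq add.commute del: power_Suc)
qed

text \<open>The kernels $(n+1)q^n$ are an approximate identity: $q = 1$ only on the diagonal.\<close>

lemma approx_identity:
  fixes f :: "real^3 \<Rightarrow> real"
  assumes f: "continuous_on X f" and x: "x \<in> X"
  shows "(\<lambda>n. (real n + 1) * (\<integral>y. qq x y ^ n * f y \<partial>sigma_X)) \<longlonglongrightarrow> f x"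
proof (rule LIMSEQ_I)
  fix r :: real assume r: "0 < r"
  obtain B where B: "0 \<le> B" "\<And>y. y \<in> X \<Longrightarrow> norm (f y) \<le> B" using contX_bounded[OF f] by metis
  obtain d where d: "0 < d" "\<And>y. y \<in> X \<Longrightarrow> dist y x < d \<Longrightarrow> dist (f y) (f x) < r / 2"
    using f x r unfolding continuous_on_iff by (meson half_gt_zero)
  \<comment> \<open>At distance at least d from x one has 1 - q = |x - y|^2/4 >= d^2/4, so M (1 - q)
    reaches 2 B, the largest possible increment of f.\<close>
  define M where "M = 8 * B / d\<^sup>2"
  have pt: "\<bar>f y - f x\<bar> \<le> r / 2 + M * (1 - qq x y)" if y: "y \<in> X" for y
  proof (cases "dist y x < d")
    case True
    have "0 \<le> M * (1 - qq x y)" using B d qq_bounds[OF x y] by (auto simp: M_def)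
    then show ?thesis using d(2)[OF y True] by (simp add: dist_real_def)
  next
    case False
    then have "d\<^sup>2 \<le> (norm (x - y))\<^sup>2" using d(1) by (intro power_mono) (auto simp: dist_norm norm_minus_commute)
    then have "d\<^sup>2 / 4 \<le> 1 - qq x y" using qq_eq_norm[OF x y] by simp
    then have "M * (d\<^sup>2 / 4) \<le> M * (1 - qq x y)" using B d by (intro mult_left_mono) (auto simp: M_def)
    moreover have "M * (d\<^sup>2 / 4) = 2 * B" using d(1) by (simp add: M_def)
    moreover have "\<bar>f y - f x\<bar> \<le> 2 * B" using B(2)[OF y] B(2)[OF x] by (simp add: abs_le_iff)
    ultimately show ?thesis using r by linarith
  qed
  have M0: "0 \<le> M" using B d by (simp add: M_def)
  have c: "continuous_on X (\<lambda>y. qq x y ^ n)" for n using continuous_qq by (intro continuous_intros)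
  have bound: "\<bar>(real n + 1) * (\<integral>y. qq x y ^ n * f y \<partial>sigma_X) - f x\<bar> \<le> r / 2 + M / (real n + 2)" for n
  proof -
    have I: "integrable sigma_X (\<lambda>y. qq x y ^ n * f y)" "integrable sigma_X (\<lambda>y. qq x y ^ n * f x)"
      "integrable sigma_X (\<lambda>y. qq x y ^ n * \<bar>f y - f x\<bar>)" "integrable sigma_X (\<lambda>y. qq x y ^ m)" for m
      by (auto intro!: integrable_contX continuous_intros c f)
    have e: "(real n + 1) * (\<integral>y. qq x y ^ n * f x \<partial>sigma_X) = f x"
      using moments[OF x, of n] by (simp add: mult.commute)
    have "\<bar>(real n + 1) * (\<integral>y. qq x y ^ n * f y \<partial>sigma_X) - f x\<bar>
       = \<bar>(real n + 1) * (\<integral>y. qq x y ^ n * f y \<partial>sigma_X) - (real n + 1) * (\<integral>y. qq x y ^ n * f x \<partial>sigma_X)\<bar>" by (simp only: e)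
    also have "\<dots> = (real n + 1) * \<bar>\<integral>y. qq x y ^ n * (f y - f x) \<partial>sigma_X\<bar>"
      using I(1,2) by (simp only: right_diff_distrib[symmetric] abs_mult Bochner_Integration.integral_diff[symmetric])
    also have "\<dots> \<le> (real n + 1) * (\<integral>y. (r / 2) * qq x y ^ n + M * (qq x y ^ n - qq x y ^ Suc n) \<partial>sigma_X)"
    proof (intro mult_left_mono order_trans[OF integral_abs_bound] integral_mono)
      show "integrable sigma_X (\<lambda>y. \<bar>qq x y ^ n * (f y - f x)\<bar>)"
        "integrable sigma_X (\<lambda>y. (r / 2) * qq x y ^ n + M * (qq x y ^ n - qq x y ^ Suc n))"
        by (auto intro!: integrable_contX continuous_intros c f continuous_qq)
      fix y assume "y \<in> space sigma_X"
      then have y: "y \<in> X" by simp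
      have q: "0 \<le> qq x y ^ n" using qq_bounds[OF x y] by simp
      have "\<bar>qq x y ^ n * (f y - f x)\<bar> = qq x y ^ n * \<bar>f y - f x\<bar>" using q by (simp add: abs_mult)
      also have "\<dots> \<le> qq x y ^ n * (r / 2 + M * (1 - qq x y))" using q pt[OF y] by (intro mult_left_mono)
      finally show "\<bar>qq x y ^ n * (f y - f x)\<bar> \<le> (r / 2) * qq x y ^ n + M * (qq x y ^ n - qq x y ^ Suc n)"
        by (simp add: algebra_simps)
    qed auto
    also have "(\<integral>y. (r / 2) * qq x y ^ n + M * (qq x y ^ n - qq x y ^ Suc n) \<partial>sigma_X)
      = (r / 2) * (1 / (real n + 1)) + M * (1 / (real n + 1) - 1 / (real (Suc n) + 1))"
      using I(4)[of n] I(4)[of "Suc n"] moments[OF x, of n] moments[OF x, of "Suc n"] by (simp del: power_Suc of_nat_Suc)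
    also have "(real n + 1) * \<dots> = r / 2 + M * (1 - (real n + 1) / (real (Suc n) + 1))"
    proof -
      have "a * ((r / 2) * (1 / a) + M * (1 / a - 1 / b)) = r / 2 + M * (1 - a / b)" if "a \<noteq> 0" for a b :: real
        using that by (simp add: algebra_simps)
      from this[of "real n + 1" "real (Suc n) + 1"] show ?thesis by (simp del: of_nat_Suc)
    qed
    also have "1 - (real n + 1) / (real (Suc n) + 1) = 1 / (real n + 2)" by (simp add: field_simps)
    finally show ?thesis by simp
  qed
  obtain no :: nat where no: "2 * M / r < real no" using reals_Archimedean2 by blast
  have "norm ((real n + 1) * (\<integral>y. qq x y ^ n * f y \<partial>sigma_X) - f x) < r" if "no \<le> n" for n
  proof -
    have "2 * M / r < real n + 2" using no that by linarith
    then have "M / (real n + 2) < r / 2" using r by (simp add: field_simps)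
    then show ?thesis using bound[of n] unfolding real_norm_def by linarith
  qed
  then show "\<exists>no. \<forall>n\<ge>no. norm ((real n + 1) * (\<integral>y. qq x y ^ n * f y \<partial>sigma_X) - f x) < r" by blast
qed

lemma eigenspace_cont: "\<phi> \<in> eigenspace lam \<Longrightarrow> continuous_on X \<phi>"
  by (auto simp: eigenspace_def intro: smooth_continuous)

lemma lam_inj: "real n * (real n + 1) = real l * (real l + 1) \<longleftrightarrow> n = l"
proof
  assume "real n * (real n + 1) = real l * (real l + 1)"
  then have "(real n - real l) * (real n + real l + 1) = 0" by (simp add: algebra_simps)
  moreover have "real n + real l + 1 \<noteq> 0" by linarith
  ultimately show "n = l" by simp
qed simp

text \<open>If the eigenvalue is not of this form, the recursion of \<open>green\<close> never
  degenerates and forces all moments of the eigenfunction against the powers of q(x, .) to vanish;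
  the approximate identity then makes the eigenfunction vanish at x.\<close>

lemma spectrum_X_subset:
  assumes "lam \<in> spectrum_X"
  obtains l where "lam = real l * (real l + 1)"
proof (rule ccontr)
  assume "\<not> thesis"
  then have ne: "lam \<noteq> real l * (real l + 1)" for l using that by blast
  from assms obtain \<phi> x where \<phi>: "\<phi> \<in> eigenspace lam" and x: "x \<in> X" "\<phi> x \<noteq> 0"
    by (auto simp: spectrum_X_def)
  have z: "(\<integral>y. qq x y ^ n * \<phi> y \<partial>sigma_X) = 0" for n
  proof (induction n)
    case 0
    show ?case using green[OF x(1) \<phi>, of 0] ne[of 0] by simp
  next
    case (Suc n)
    then show ?case using green[OF x(1) \<phi>, of "Suc n"] ne[of "Suc n"] by (simp del: power_Suc)
  qed
  have "(\<lambda>n. (real n + 1) * (\<integral>y. qq x y ^ n * \<phi> y \<partial>sigma_X)) \<longlonglongrightarrow> \<phi> x"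
    by (rule approx_identity[OF eigenspace_cont[OF \<phi>] x(1)])
  then have "\<phi> x = 0" unfolding z by (simp add: LIMSEQ_const_iff)
  with x(2) show False by simp
qed

lemma K_tendsto: "(\<lambda>n. (real n + 1) * kap l n) \<longlonglongrightarrow> 1"
proof (rule tendsto_sandwich)
  show "\<forall>\<^sub>F n in sequentially. 1 - real l * (real l + 1) / (real n + 2) \<le> (real n + 1) * kap l n"
    using kap_lower by simp
  show "\<forall>\<^sub>F n in sequentially. (real n + 1) * kap l n \<le> 1"
    using kap_le by (simp add: field_simps)
  have "filterlim (\<lambda>n. real n + 2) at_top sequentially"
    using filterlim_tendsto_add_at_top[OF tendsto_const[of "2::real"] filterlim_real_sequentially]
    by (simp add: add.commute)
  then have "(\<lambda>n. real l * (real l + 1) / (real n + 2)) \<longlonglongrightarrow> 0"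
    by (rule tendsto_divide_0[OF tendsto_const filterlim_at_top_imp_at_infinity])
  from tendsto_diff[OF tendsto_const[of 1] this]
  show "(\<lambda>n. 1 - real l * (real l + 1) / (real n + 2)) \<longlonglongrightarrow> 1" by simp
qed simp

text \<open>Funk--Hecke formula: Green's identity fixes the ratios of the moments,
  and the approximate identity fixes the constant.\<close>

lemma funk_hecke:
  assumes x: "x \<in> X" and \<phi>: "\<phi> \<in> eigenspace (real l * (real l + 1))"
  shows "(\<integral>y. qq x y ^ n * \<phi> y \<partial>sigma_X) = kap l n * \<phi> x"
proof -
  define c where "c = (\<lambda>n. \<integral>y. qq x y ^ n * \<phi> y \<partial>sigma_X)"
  \<comment> \<open>At n = l the recursion degenerates, so the moment there is a free parameter. It
    is normalized by \<open>kap l l\<close> and identified with the value of \<phi> at x through the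
    limit below.\<close>
  define r where "r = c l / kap l l"
  have g: "c n * (real n * (real n + 1) - real l * (real l + 1)) = (real n)\<^sup>2 * c (n - 1)" for n
    using green[OF x \<phi>, of n] by (simp add: c_def)
  have cl: "c l = kap l l * r" using kap_pos[of l l] by (simp add: r_def)
  have c: "c n = kap l n * r" for n
  proof (induction n)
    case 0
    show ?case
    proof (cases "l = 0")
      case False
      then have "c 0 = 0" using g[of 0] by simp
      then show ?thesis using False by (simp add: kap_eq_0)
    qed (use cl in simp)
  next
    case (Suc n)
    show ?case
    proof (cases "Suc n = l")
      case False
      have "c (Suc n) * (real (Suc n) * (real (Suc n) + 1) - real l * (real l + 1))
        = kap l (Suc n) * r * (real (Suc n) * (real (Suc n) + 1) - real l * (real l + 1))"
        using g[of "Suc n"] kap_rec[of l n] Suc by (simp add: mult_ac del: of_nat_Suc)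
      moreover have "real (Suc n) * (real (Suc n) + 1) - real l * (real l + 1) \<noteq> 0"
        using False lam_inj[of "Suc n" l] by simp
      ultimately show ?thesis by (metis mult_right_cancel)
    qed (use cl in simp)
  qed
  have "(\<lambda>n. (real n + 1) * c n) \<longlonglongrightarrow> \<phi> x"
    unfolding c_def by (rule approx_identity[OF eigenspace_cont[OF \<phi>] x])
  moreover have "(\<lambda>n. (real n + 1) * c n) \<longlonglongrightarrow> r"
    using tendsto_mult[OF K_tendsto[of l] tendsto_const[of r]] by (simp add: c mult.assoc)
  ultimately have "r = \<phi> x" using LIMSEQ_unique by blast
  then show ?thesis using c by (simp add: c_def)
qed

lemma Zl_cont: "continuous_on S (\<lambda>y. Zl l (qq x y))"
proof -
  have "continuous_on S (\<lambda>y. qq x y)" unfolding qq_def by (intro continuous_intros) auto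
  then show ?thesis by (intro continuous_on_compose2[OF Zl_continuous]) auto
qed

text \<open>\<open>Zl l\<close> is the reproducing kernel of the eigenspace of degree l and
  annihilates the others. Pairing \<phi> with the expansion of q^l gives a triangular system for
  these pairings, whose left side is known from \<open>funk_hecke\<close>.\<close>

lemma Zl_reproduce:
  assumes x: "x \<in> X" and \<phi>: "\<phi> \<in> eigenspace (real k * (real k + 1))"
  shows "(\<integral>y. Zl l (qq x y) * \<phi> y \<partial>sigma_X) = (if l = k then \<phi> x else 0)"
proof (induction l rule: less_induct)
  case (less l)
  define J where "J = (\<lambda>l. \<integral>y. Zl l (qq x y) * \<phi> y \<partial>sigma_X)"
  have int: "integrable sigma_X (\<lambda>y. kap j l * Zl j (qq x y) * \<phi> y)" for j
    by (intro integrable_contX continuous_intros Zl_cont eigenspace_cont[OF \<phi>])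
  have "kap k l * \<phi> x = (\<integral>y. (\<Sum>j\<le>l. kap j l * Zl j (qq x y) * \<phi> y) \<partial>sigma_X)"
    unfolding funk_hecke[OF x \<phi>, symmetric] power_eq_sum_Zl[of _ l] sum_distrib_right ..
  also have "\<dots> = (\<Sum>j\<le>l. kap j l * J j)"
    using int by (simp add: J_def mult.assoc)
  also have "\<dots> = (\<Sum>j<l. kap j l * J j) + kap l l * J l"
    by (simp add: lessThan_Suc_atMost[symmetric])
  also have "(\<Sum>j<l. kap j l * J j) = (\<Sum>j<l. if j = k then kap k l * \<phi> x else 0)"
    using less by (intro sum.cong) (auto simp: J_def)
  also have "\<dots> = (if k < l then kap k l * \<phi> x else 0)"
    by simp
  finally have e: "kap k l * \<phi> x = (if k < l then kap k l * \<phi> x else 0) + kap l l * J l" .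
  consider "k < l" | "k = l" | "l < k" by linarith
  then have "J l = (if l = k then \<phi> x else 0)"
    using e kap_pos[of l l] by cases (auto simp: kap_eq_0)
  then show ?case by (simp add: J_def)
qed

section \<open>Finite-rank kernels and feature maps\<close>

definition sep :: "(real^3 \<Rightarrow> real^3 \<Rightarrow> real) \<Rightarrow> bool" where
  "sep K \<longleftrightarrow> (\<exists>(m::nat) g h. (\<forall>i<m. spoly (g i) \<and> spoly (h i)) \<and> (\<forall>x y. K x y = (\<Sum>i<m. g i x * h i y)))"

lemma sum_lessThan_add:
  fixes a b :: "nat \<Rightarrow> real"
  shows "(\<Sum>i<m + n. if i < m then a i else b (i - m)) = (\<Sum>i<m. a i) + (\<Sum>i<n. b i)"
  by (induction n) auto

lemma sum_lessThan_mult: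
  fixes a b :: "nat \<Rightarrow> real"
  shows "(\<Sum>i<m * n. a (i div n) * b (i mod n)) = (\<Sum>i<m. a i) * (\<Sum>j<n. b j)"
proof (cases "n = 0")
  case False
  show ?thesis
  proof (induction m)
    case (Suc m)
    have "(\<Sum>i<Suc m * n. a (i div n) * b (i mod n)) = (\<Sum>i<m * n + n. if i < m * n then a (i div n) * b (i mod n) else a m * b (i - m * n))"
    proof (rule sum.cong)
      fix i assume "i \<in> {..<m * n + n}"
      moreover have "i div n = m \<and> i mod n = i - m * n" if "\<not> i < m * n" "i < m * n + n"
      proof -
        obtain j where "i = m * n + j" "j < n" using \<open>\<not> i < m * n\<close> \<open>i < m * n + n\<close> by (metis add_less_cancel_left le_add_diff_inverse not_less)
        then show ?thesis by simp
      qed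
      ultimately show "a (i div n) * b (i mod n) = (if i < m * n then a (i div n) * b (i mod n) else a m * b (i - m * n))" by auto
    qed (simp add: add.commute)
    then show ?case using Suc sum_lessThan_add[where m = "m * n" and n = n and a = "\<lambda>i. a (i div n) * b (i mod n)" and b = "\<lambda>i. a m * b i"]
      by (simp add: sum_distrib_left algebra_simps)
  qed simp
qed simp

lemma sepI:
  fixes m :: nat
  assumes "\<And>i. i < m \<Longrightarrow> spoly (g i)" "\<And>i. i < m \<Longrightarrow> spoly (h i)" "\<And>x y. K x y = (\<Sum>i<m. g i x * h i y)"
  shows "sep K"
  using assms unfolding sep_def by blast

lemma sepE:
  assumes "sep K"
  obtains m :: nat and g h where "\<And>i. i < m \<Longrightarrow> spoly (g i)" "\<And>i. i < m \<Longrightarrow> spoly (h i)" "\<And>x y. K x y = (\<Sum>i<m. g i x * h i y)"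
  using assms unfolding sep_def by blast

lemma sep_add: assumes "sep K" "sep L" shows "sep (\<lambda>x y. K x y + L x y)"
proof -
  obtain m :: nat and g h where K: "\<And>i. i < m \<Longrightarrow> spoly (g i)" "\<And>i. i < m \<Longrightarrow> spoly (h i)" "\<And>x y. K x y = (\<Sum>i<m. g i x * h i y)"
    using sepE[OF assms(1)] by metis
  obtain n :: nat and g' h' where L: "\<And>i. i < n \<Longrightarrow> spoly (g' i)" "\<And>i. i < n \<Longrightarrow> spoly (h' i)" "\<And>x y. L x y = (\<Sum>i<n. g' i x * h' i y)"
    using sepE[OF assms(2)] by metis
  show ?thesis
  proof (rule sepI[where m = "m + n" and g = "\<lambda>i. if i < m then g i else g' (i - m)" and h = "\<lambda>i. if i < m then h i else h' (i - m)"])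
    show "K x y + L x y = (\<Sum>i<m+n. (if i < m then g i else g' (i - m)) x * (if i < m then h i else h' (i - m)) y)" for x y
      unfolding K(3) L(3) sum_lessThan_add[symmetric] by (intro sum.cong) auto
  qed (use K L in auto)
qed

lemma sep_cmult: assumes "sep K" shows "sep (\<lambda>x y. c * K x y)"
proof -
  obtain m :: nat and g h where K: "\<And>i. i < m \<Longrightarrow> spoly (g i)" "\<And>i. i < m \<Longrightarrow> spoly (h i)" "\<And>x y. K x y = (\<Sum>i<m. g i x * h i y)"
    using sepE[OF assms(1)] by metis
  show ?thesis
  proof (rule sepI[where m = m and g = "\<lambda>i x. c * g i x" and h = h])
    show "c * K x y = (\<Sum>i<m. c * g i x * h i y)" for x y
      unfolding K(3) by (simp add: sum_distrib_left mult.assoc)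
  qed (use K in \<open>auto intro: spoly_mult spoly_const\<close>)
qed

text \<open>A finite-dimensional feature map with kernel K. Unlike \<open>sep\<close> this class
  records positive definiteness; it is closed under sums, nonnegative multiples and products, hence
  contains the powers of q and their nonnegative combinations.\<close>

definition feat :: "(real^3 \<Rightarrow> real^3 \<Rightarrow> real) \<Rightarrow> bool" where
  "feat K \<longleftrightarrow> (\<exists>(m::nat) g. (\<forall>i<m. spoly (g i)) \<and> (\<forall>x y. K x y = (\<Sum>i<m. g i x * g i y)))"

lemma featI:
  fixes m :: nat
  assumes "\<And>i. i < m \<Longrightarrow> spoly (g i)" "\<And>x y. K x y = (\<Sum>i<m. g i x * g i y)"
  shows "feat K"
  using assms unfolding feat_def by blast

lemma featE:
  assumes "feat K"
  obtains m :: nat and g where "\<And>i. i < m \<Longrightarrow> spoly (g i)" "\<And>x y. K x y = (\<Sum>i<m. g i x * g i y)"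
  using assms unfolding feat_def by blast

lemma feat_sep: "feat K \<Longrightarrow> sep K"
  unfolding feat_def sep_def by blast

lemma feat_add: assumes "feat K" "feat L" shows "feat (\<lambda>x y. K x y + L x y)"
proof -
  obtain m :: nat and g where K: "\<And>i. i < m \<Longrightarrow> spoly (g i)" "\<And>x y. K x y = (\<Sum>i<m. g i x * g i y)"
    using featE[OF assms(1)] by metis
  obtain n :: nat and g' where L: "\<And>i. i < n \<Longrightarrow> spoly (g' i)" "\<And>x y. L x y = (\<Sum>i<n. g' i x * g' i y)"
    using featE[OF assms(2)] by metis
  show ?thesis
  proof (rule featI[where m = "m + n" and g = "\<lambda>i. if i < m then g i else g' (i - m)"])
    show "K x y + L x y = (\<Sum>i<m+n. (if i < m then g i else g' (i - m)) x * (if i < m then g i else g' (i - m)) y)" for x y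
      unfolding K(2) L(2) sum_lessThan_add[symmetric] by (intro sum.cong) auto
  qed (use K L in auto)
qed

lemma feat_cmult: assumes "feat K" "0 \<le> c" shows "feat (\<lambda>x y. c * K x y)"
proof -
  obtain m :: nat and g where K: "\<And>i. i < m \<Longrightarrow> spoly (g i)" "\<And>x y. K x y = (\<Sum>i<m. g i x * g i y)"
    using featE[OF assms(1)] by metis
  have c: "(sqrt c * a) * (sqrt c * b) = c * (a * b)" for a b
    using assms(2) real_sqrt_mult_self[of c] by (metis abs_of_nonneg mult.assoc mult.left_commute)
  show ?thesis
  proof (rule featI[where m = m and g = "\<lambda>i x. sqrt c * g i x"])
    show "c * K x y = (\<Sum>i<m. sqrt c * g i x * (sqrt c * g i y))" for x y
      unfolding K(2) by (simp add: sum_distrib_left c)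
  qed (use K in \<open>auto intro: spoly_mult spoly_const\<close>)
qed

text \<open>Schur's product theorem by tensor products of features; the pair of indices is encoded
  by \<open>div\<close> and \<open>mod\<close>.\<close>

lemma feat_mult: assumes "feat K" "feat L" shows "feat (\<lambda>x y. K x y * L x y)"
proof -
  obtain m :: nat and g where K: "\<And>i. i < m \<Longrightarrow> spoly (g i)" "\<And>x y. K x y = (\<Sum>i<m. g i x * g i y)"
    using featE[OF assms(1)] by metis
  obtain n :: nat and g' where L: "\<And>i. i < n \<Longrightarrow> spoly (g' i)" "\<And>x y. L x y = (\<Sum>i<n. g' i x * g' i y)"
    using featE[OF assms(2)] by metis
  show ?thesis
  proof (rule featI[where m = "m * n" and g = "\<lambda>i x. g (i div n) x * g' (i mod n) x"])
    show "K x y * L x y = (\<Sum>i<m * n. (g (i div n) x * g' (i mod n) x) * (g (i div n) y * g' (i mod n) y))" for x y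
      unfolding K(2) L(2) sum_lessThan_mult[symmetric] by (intro sum.cong) (auto simp: mult_ac)
    fix i assume i: "i < m * n"
    then have "0 < n" by (cases n) auto
    then have "i div n < m" "i mod n < n" using i by (auto simp: less_mult_imp_div_less)
    then show "spoly (\<lambda>x. g (i div n) x * g' (i mod n) x)" using K L by (auto intro: spoly_mult)
  qed
qed

lemma feat_rank1: "spoly f \<Longrightarrow> feat (\<lambda>x y. f x * f y)"
  unfolding feat_def by (rule exI[of _ "Suc 0"], rule exI[of _ "\<lambda>_. f"]) auto

lemma feat_qq: "feat qq"
proof -
  have a: "feat (\<lambda>x y. (x$k) * (y$k))" for k by (rule feat_rank1[OF spoly_coord])
  have b: "feat (\<lambda>x y. 1 * 1)" by (rule feat_rank1[OF spoly_const])
  have "feat (\<lambda>x y. (1/2) * (1 * 1 + ((x$1) * (y$1) + ((x$2) * (y$2) + (x$3) * (y$3)))))"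
    by (rule feat_cmult[OF feat_add[OF b feat_add[OF a[of 1] feat_add[OF a[of 2] a[of 3]]]]]) simp
  moreover have "(\<lambda>x y. (1/2) * (1 * 1 + ((x$1) * (y$1) + ((x$2) * (y$2) + (x$3) * (y$3))))) = qq"
    by (auto simp: qq_def fun_eq_iff inner_vec_def sum_3)
  ultimately show ?thesis by (simp only:)
qed

lemma feat_qq_power: "feat (\<lambda>x y. qq x y ^ n)"
proof (induction n)
  case 0
  have "feat (\<lambda>x y. 1 * 1)" by (rule feat_rank1[OF spoly_const])
  then show ?case by simp
next
  case (Suc n)
  then show ?case using feat_mult[OF feat_qq Suc] by simp
qed

lemma feat_zero: "feat (\<lambda>x y. 0)"
  unfolding feat_def by (rule exI[of _ 0]) auto

lemma feat_sum: "finite I \<Longrightarrow> (\<And>i. i \<in> I \<Longrightarrow> feat (K i)) \<Longrightarrow> feat (\<lambda>x y. \<Sum>i\<in>I. K i x y)"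
  by (induction I rule: finite_induct) (auto simp: feat_zero intro: feat_add)

text \<open>Solving for \<open>Zl\<close> involves subtraction, so the induction yields a separable
  kernel without positivity. Separability is what lets the Laplacian pass under the integral in
  \<open>pr_eigen\<close>.\<close>

lemma sep_Zl: "sep (\<lambda>x y. Zl l (qq x y))"
proof (induction l rule: less_induct)
  case (less l)
  have s: "sep (\<lambda>x y. \<Sum>j\<in>J. kap j l * Zl j (qq x y))" if "finite J" "J \<subseteq> {..<l}" for J
    using that
  proof (induction J rule: finite_induct)
    case empty
    show ?case using feat_sep[OF feat_zero] by simp
  next
    case (insert j J)
    have "sep (\<lambda>x y. kap j l * Zl j (qq x y) + (\<Sum>j\<in>J. kap j l * Zl j (qq x y)))"
      using insert less[of j] by (intro sep_add sep_cmult) auto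
    then show ?case using insert by simp
  qed
  have "sep (\<lambda>x y. (1 / kap l l) * (qq x y ^ l + (-1) * (\<Sum>j<l. kap j l * Zl j (qq x y))))"
    by (rule sep_cmult[OF sep_add[OF feat_sep[OF feat_qq_power] sep_cmult[OF s]]]) auto
  moreover have "(\<lambda>x y. (1 / kap l l) * (qq x y ^ l + (-1) * (\<Sum>j<l. kap j l * Zl j (qq x y)))) = (\<lambda>x y. Zl l (qq x y))"
    by (subst (2) Zl.simps) (simp add: fun_eq_iff)
  ultimately show ?case by (simp only:)
qed

section \<open>Projections to the eigenspaces\<close>

definition pr :: "nat \<Rightarrow> (real^3 \<Rightarrow> real) \<Rightarrow> real^3 \<Rightarrow> real" where
  "pr l f x = (\<integral>y. Zl l (qq x y) * f y \<partial>sigma_X)"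

lemma integrable_cont_mult:
  fixes f g :: "real^3 \<Rightarrow> real"
  assumes "continuous_on X g" "integrable sigma_X f"
  shows "integrable sigma_X (\<lambda>x. g x * f x)"
proof -
  obtain B where B: "0 \<le> B" "\<And>x. x \<in> X \<Longrightarrow> norm (g x) \<le> B" using contX_bounded[OF assms(1)] by metis
  show ?thesis
  proof (rule Bochner_Integration.integrable_bound)
    show "integrable sigma_X (\<lambda>x. B * norm (f x))" using assms(2) by simp
    show "(\<lambda>x. g x * f x) \<in> borel_measurable sigma_X"
      using measurable_contX_sigma[OF assms(1)] assms(2) by simp
    show "AE x in sigma_X. norm (g x * f x) \<le> norm (B * norm (f x))"
      using B by (intro AE_I2) (auto simp: abs_mult intro!: mult_right_mono)
  qed
qed

text \<open>By separability \<open>pr l f\<close> is a finite combination of functions in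
  \<open>spoly\<close> whose coefficients are integrals of f, so the Laplacian acts termwise and
  recombines to the eigenvalue times the kernel. The second claim exchanges the two integrals at
  finite rank and uses that \<open>Zl\<close> reproduces \<phi>.\<close>

lemma pr_eigen:
  assumes f: "integrable sigma_X f"
  shows "pr l f \<in> eigenspace (real l * (real l + 1))"
    and "\<And>\<phi>. \<phi> \<in> eigenspace (real l * (real l + 1)) \<Longrightarrow> (\<integral>x. pr l f x * \<phi> x \<partial>sigma_X) = (\<integral>x. f x * \<phi> x \<partial>sigma_X)"
proof -
  obtain m :: nat and g h where S: "\<And>i. i < m \<Longrightarrow> spoly (g i)" "\<And>i. i < m \<Longrightarrow> spoly (h i)" "\<And>x y. Zl l (qq x y) = (\<Sum>i<m. g i x * h i y)"
    using sepE[OF sep_Zl[of l]] by metis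
  define c where "c = (\<lambda>i. \<integral>y. h i y * f y \<partial>sigma_X)"
  have ih: "integrable sigma_X (\<lambda>y. a * (h i y * f y))" if "i < m" for i a
    using S that f by (intro integrable_mult_right integrable_cont_mult spoly_continuous) auto
  have pr: "pr l f = (\<lambda>x. \<Sum>i<m. c i * g i x)"
  proof
    fix x
    have "pr l f x = (\<integral>y. (\<Sum>i<m. g i x * (h i y * f y)) \<partial>sigma_X)"
      by (simp add: pr_def S(3) sum_distrib_right mult.assoc)
    also have "\<dots> = (\<Sum>i<m. \<integral>y. g i x * (h i y * f y) \<partial>sigma_X)"
      using ih by (intro Bochner_Integration.integral_sum) auto
    finally show "pr l f x = (\<Sum>i<m. c i * g i x)" by (simp add: c_def mult.commute)
  qed
  have "spoly (pr l f)" unfolding pr using S by (intro spoly_sum spoly_mult spoly_const) auto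
  moreover have "laplace_X (pr l f) x = real l * (real l + 1) * pr l f x" if x: "x \<in> X" for x
  proof -
    have lz: "(\<Sum>i<m. h i y * laplace_X (g i) x) = real l * (real l + 1) * Zl l (qq x y)" if y: "y \<in> X" for y
    proof -
      have "(\<Sum>i<m. h i y * laplace_X (g i) x) = laplace_X (\<lambda>x. \<Sum>i<m. h i y * g i x) x"
        using S x by (intro laplace_X_sum[symmetric]) auto
      also have "(\<lambda>x. \<Sum>i<m. h i y * g i x) = (\<lambda>x. Zl l (qq y x))"
        by (simp add: fun_eq_iff S(3)[symmetric] qq_commute[of y]) (simp add: S(3) mult.commute)
      also have "laplace_X (\<lambda>x. Zl l (qq y x)) x = real l * (real l + 1) * Zl l (qq x y)"
        using laplace_X_Zl[OF y x] by (simp add: qq_commute)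
      finally show ?thesis .
    qed
    have "laplace_X (pr l f) x = (\<Sum>i<m. c i * laplace_X (g i) x)"
      unfolding pr using S x by (intro laplace_X_sum) auto
    also have "\<dots> = (\<Sum>i<m. \<integral>y. laplace_X (g i) x * (h i y * f y) \<partial>sigma_X)"
      by (simp add: c_def mult.commute)
    also have "\<dots> = (\<integral>y. (\<Sum>i<m. laplace_X (g i) x * (h i y * f y)) \<partial>sigma_X)"
      using ih by (intro Bochner_Integration.integral_sum[symmetric]) auto
    also have "\<dots> = (\<integral>y. real l * (real l + 1) * (Zl l (qq x y) * f y) \<partial>sigma_X)"
    proof (rule Bochner_Integration.integral_cong)
      fix y assume "y \<in> space sigma_X"
      then have "(\<Sum>i<m. h i y * laplace_X (g i) x) * f y = real l * (real l + 1) * Zl l (qq x y) * f y" by (simp add: lz)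
      moreover have "(\<Sum>i<m. laplace_X (g i) x * (h i y * f y)) = (\<Sum>i<m. h i y * laplace_X (g i) x) * f y"
        by (simp add: sum_distrib_right sum_distrib_left mult_ac)
      ultimately show "(\<Sum>i<m. laplace_X (g i) x * (h i y * f y)) = real l * (real l + 1) * (Zl l (qq x y) * f y)"
        by (simp only: mult.assoc)
    qed simp
    finally show ?thesis by (simp add: pr_def)
  qed
  ultimately show "pr l f \<in> eigenspace (real l * (real l + 1))" by (simp add: eigenspace_def spoly_smooth)
  fix \<phi> assume \<phi>: "\<phi> \<in> eigenspace (real l * (real l + 1))"
  have ig: "integrable sigma_X (\<lambda>x. a * (g i x * \<phi> x))" if "i < m" for i a
    using S that by (intro integrable_contX continuous_intros spoly_continuous eigenspace_cont[OF \<phi>]) auto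
  define d where "d = (\<lambda>i. \<integral>x. g i x * \<phi> x \<partial>sigma_X)"
  have "(\<integral>x. pr l f x * \<phi> x \<partial>sigma_X) = (\<integral>x. (\<Sum>i<m. c i * (g i x * \<phi> x)) \<partial>sigma_X)"
    by (simp add: pr sum_distrib_right mult.assoc)
  also have "\<dots> = (\<Sum>i<m. \<integral>x. c i * (g i x * \<phi> x) \<partial>sigma_X)"
    using ig by (intro Bochner_Integration.integral_sum) auto
  also have "\<dots> = (\<Sum>i<m. \<integral>y. d i * (h i y * f y) \<partial>sigma_X)"
    by (simp add: d_def c_def mult.commute)
  also have "\<dots> = (\<integral>y. (\<Sum>i<m. d i * (h i y * f y)) \<partial>sigma_X)"
    using ih by (intro Bochner_Integration.integral_sum[symmetric]) auto
  also have "\<dots> = (\<integral>y. f y * \<phi> y \<partial>sigma_X)"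
  proof (rule Bochner_Integration.integral_cong)
    fix y assume "y \<in> space sigma_X"
    then have y: "y \<in> X" by simp
    have "\<phi> y = (\<integral>x. Zl l (qq y x) * \<phi> x \<partial>sigma_X)" using Zl_reproduce[OF y \<phi>, of l] by simp
    also have "\<dots> = (\<integral>x. (\<Sum>i<m. h i y * (g i x * \<phi> x)) \<partial>sigma_X)"
      by (simp add: qq_commute[of y] S(3) sum_distrib_right sum_distrib_left mult_ac)
    also have "\<dots> = (\<Sum>i<m. \<integral>x. h i y * (g i x * \<phi> x) \<partial>sigma_X)"
      using ig by (intro Bochner_Integration.integral_sum) auto
    finally have "\<phi> y = (\<Sum>i<m. h i y * d i)" by (simp add: d_def)
    then show "(\<Sum>i<m. d i * (h i y * f y)) = f y * \<phi> y" by (simp add: sum_distrib_left mult_ac)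
  qed simp
  finally show "(\<integral>x. pr l f x * \<phi> x \<partial>sigma_X) = (\<integral>x. f x * \<phi> x \<partial>sigma_X)" .
qed

section \<open>Worst-case error and discrepancy energies\<close>

lemma Cauchy_Schwarz_X:
  fixes f g :: "real^3 \<Rightarrow> real"
  assumes f: "continuous_on X f" and g: "continuous_on X g"
  shows "(\<integral>x. f x * g x \<partial>sigma_X)\<^sup>2 \<le> (\<integral>x. (f x)\<^sup>2 \<partial>sigma_X) * (\<integral>x. (g x)\<^sup>2 \<partial>sigma_X)"
proof -
  define a b c where "a = (\<integral>x. (f x)\<^sup>2 \<partial>sigma_X)" and "b = (\<integral>x. f x * g x \<partial>sigma_X)" and "c = (\<integral>x. (g x)\<^sup>2 \<partial>sigma_X)"
  have nn: "0 \<le> a - 2 * t * b + t\<^sup>2 * c" for t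
  proof -
    have "0 \<le> (\<integral>x. (f x - t * g x)\<^sup>2 \<partial>sigma_X)" by simp
    also have "\<dots> = (\<integral>x. ((f x)\<^sup>2 - 2 * t * (f x * g x)) + t\<^sup>2 * (g x)\<^sup>2 \<partial>sigma_X)"
      by (simp add: power2_eq_square algebra_simps)
    also have "\<dots> = a - 2 * t * b + t\<^sup>2 * c"
      unfolding a_def b_def c_def
      by (subst Bochner_Integration.integral_add, (intro integrable_contX continuous_intros f g)+,
          subst Bochner_Integration.integral_diff, (intro integrable_contX continuous_intros f g)+) simp
    finally show ?thesis .
  qed
  have c0: "0 \<le> c" unfolding c_def by simp
  have "b\<^sup>2 \<le> a * c"
  proof (cases "c = 0")
    case True
    have "b = 0"
    proof (rule ccontr)
      assume "b \<noteq> 0"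
      then show False using nn[of "(a + 1) / (2 * b)"] True by simp
    qed
    then show ?thesis using True by simp
  next
    case False
    then have "0 \<le> c * (a - 2 * (b / c) * b + (b / c)\<^sup>2 * c)" using nn[of "b / c"] c0 by (intro mult_nonneg_nonneg)
    also have "\<dots> = a * c - b\<^sup>2" using False by (simp add: power2_eq_square algebra_simps)
    finally show ?thesis by simp
  qed
  then show ?thesis by (simp add: a_def b_def c_def)
qed

lemma L2_X_integrable:
  assumes "f \<in> L2_X"
  shows "f \<in> borel_measurable (restrict_space borel X)" "integrable sigma_X f"
proof -
  have m: "f \<in> borel_measurable dVg" and i: "integrable dVg (\<lambda>x. (f x)\<^sup>2)" using assms by (auto simp: L2_X_def)
  show m': "f \<in> borel_measurable (restrict_space borel X)" using m sets_dVg measurable_cong_sets by blast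
  have ms: "f \<in> borel_measurable sigma_X" using m' sets_sigma_X measurable_cong_sets by blast
  have i2: "integrable sigma_X (\<lambda>x. (f x)\<^sup>2)"
    unfolding sigma_X_def scale_measure_eq_density using m i by (subst integrable_density) auto
  show "integrable sigma_X f"
  proof (rule Bochner_Integration.integrable_bound)
    show "integrable sigma_X (\<lambda>x. 1 + (f x)\<^sup>2)" using i2 by simp
    show "AE x in sigma_X. norm (f x) \<le> norm (1 + (f x)\<^sup>2)"
    proof (rule AE_I2)
      fix x
      have "0 \<le> (\<bar>f x\<bar> - 1)\<^sup>2" "0 \<le> \<bar>f x\<bar>" by auto
      then have "\<bar>f x\<bar> \<le> 1 + (f x)\<^sup>2" by (simp add: power2_diff)
      then show "norm (f x) \<le> norm (1 + (f x)\<^sup>2)" by simp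
    qed
  qed (rule ms)
qed

lemma inner_X_sigma:
  assumes "f \<in> borel_measurable (restrict_space borel X)" "continuous_on X \<phi>"
  shows "inner_X f \<phi> = 4 * pi * (\<integral>x. f x * \<phi> x \<partial>sigma_X)"
  unfolding inner_X_def using assms measurable_contX by (intro integral_sigma_X borel_measurable_times) auto

lemma pr_cont: "integrable sigma_X f \<Longrightarrow> continuous_on X (pr l f)"
  using pr_eigen(1) eigenspace_cont by blast

text \<open>\<open>eigenproj\<close> is an arbitrary choice among functions on the ambient space.
  Testing its orthogonality condition against the zonal eigenfunctions \<open>Zl l (qq x y)\<close>
  in y shows that every choice agrees with \<open>pr l f\<close> on X. The factor 4 pi converts the
  normalized measure to the area form.\<close>

lemma eigenproj_eq:
  assumes f: "f \<in> L2_X" and lam: "real l * (real l + 1) \<in> spectrum_X"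
  shows "inner_X f (eigenproj (real l * (real l + 1)) f) = 4 * pi * (\<integral>x. (pr l f x)\<^sup>2 \<partial>sigma_X)"
proof -
  let ?lam = "real l * (real l + 1)"
  note fm = L2_X_integrable[OF f]
  have diffm: "(\<lambda>x. f x - h x) \<in> borel_measurable (restrict_space borel X)" if "h \<in> eigenspace ?lam" for h
    using fm(1) measurable_contX[OF eigenspace_cont[OF that]] by (rule borel_measurable_diff)
  have split: "inner_X (\<lambda>x. f x - h x) \<phi> = 4 * pi * ((\<integral>x. \<phi> x * f x \<partial>sigma_X) - (\<integral>x. \<phi> x * h x \<partial>sigma_X))"
    if "h \<in> eigenspace ?lam" "\<phi> \<in> eigenspace ?lam" for h \<phi>
  proof -
    have "(\<integral>x. (f x - h x) * \<phi> x \<partial>sigma_X) = (\<integral>x. \<phi> x * f x - \<phi> x * h x \<partial>sigma_X)"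
      by (simp add: algebra_simps)
    also have "\<dots> = (\<integral>x. \<phi> x * f x \<partial>sigma_X) - (\<integral>x. \<phi> x * h x \<partial>sigma_X)"
      by (intro Bochner_Integration.integral_diff integrable_cont_mult[OF eigenspace_cont[OF that(2)] fm(2)]
          integrable_contX continuous_on_mult eigenspace_cont[OF that(1)] eigenspace_cont[OF that(2)])
    finally show ?thesis
      unfolding inner_X_sigma[OF diffm[OF that(1)] eigenspace_cont[OF that(2)]] by simp
  qed
  define h where "h = eigenproj ?lam f"
  define P where "P = (\<lambda>h. h \<in> eigenspace ?lam \<and> (\<forall>\<phi>\<in>eigenspace ?lam. inner_X (\<lambda>x. f x - h x) \<phi> = 0))"
  have prE: "pr l f \<in> eigenspace ?lam" by (rule pr_eigen(1)[OF fm(2)])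
  have "inner_X (\<lambda>x. f x - pr l f x) \<phi> = 0" if "\<phi> \<in> eigenspace ?lam" for \<phi>
    using split[OF prE that] pr_eigen(2)[OF fm(2) that] by (simp add: mult.commute)
  then have "P (pr l f)" using prE unfolding P_def by blast
  then have "P (SOME h. P h)" using someI[of P] by blast
  then have "P h" unfolding h_def eigenproj_def P_def .
  then have h: "h \<in> eigenspace ?lam" "\<And>\<phi>. \<phi> \<in> eigenspace ?lam \<Longrightarrow> inner_X (\<lambda>x. f x - h x) \<phi> = 0"
    unfolding P_def by blast+
  have e: "(\<integral>x. \<phi> x * f x \<partial>sigma_X) = (\<integral>x. \<phi> x * h x \<partial>sigma_X)" if "\<phi> \<in> eigenspace ?lam" for \<phi>
    using h(2)[OF that] split[OF h(1) that] by simp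
  have hx: "h x = pr l f x" if x: "x \<in> X" for x
    using e[OF eigenspace_Zl[OF x]] Zl_reproduce[OF x h(1), of l] by (simp add: pr_def)
  have "inner_X f h = 4 * pi * (\<integral>x. f x * h x \<partial>sigma_X)"
    by (intro inner_X_sigma fm eigenspace_cont[OF h(1)])
  also have "(\<integral>x. f x * h x \<partial>sigma_X) = (\<integral>x. pr l f x * h x \<partial>sigma_X)"
    using pr_eigen(2)[OF fm(2) h(1)] by simp
  also have "\<dots> = (\<integral>x. (pr l f x)\<^sup>2 \<partial>sigma_X)"
    by (rule Bochner_Integration.integral_cong) (auto simp: hx power2_eq_square)
  finally show ?thesis by (simp add: h_def)
qed

text \<open>Every spectral value is some l(l + 1). If conversely l(l + 1) should not be in the
  spectrum, \<open>pr l f\<close> vanishes on X and its term is zero. The other terms form a finite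
  partial sum of a nonnegative series.\<close>

lemma sobolev_partial_sum:
  assumes f: "f \<in> sobolev_space s" and n: "sobolev_norm s f \<le> 1"
  shows "(\<Sum>l=1..L. (real l * (real l + 1)) powr s * (4 * pi * (\<integral>x. (pr l f x)\<^sup>2 \<partial>sigma_X))) \<le> 1"
proof -
  let ?lam = "\<lambda>l::nat. real l * (real l + 1)"
  let ?t = "\<lambda>lam. lam powr s * inner_X f (eigenproj lam f)"
  have L2: "f \<in> L2_X" and sm: "?t summable_on spectrum_X" using f by (auto simp: sobolev_space_def)
  note fm = L2_X_integrable[OF L2]
  have inj: "inj ?lam" using lam_inj by (auto simp: inj_on_def)
  define A where "A = {l \<in> {1..L}. ?lam l \<in> spectrum_X}"
  have nn: "0 \<le> ?t lam" if lam: "lam \<in> spectrum_X" for lam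
  proof -
    obtain l where l: "lam = ?lam l" using spectrum_X_subset[OF lam] by blast
    then show ?thesis using eigenproj_eq[OF L2, of l] lam by simp
  qed
  have z: "(\<integral>x. (pr l f x)\<^sup>2 \<partial>sigma_X) = 0" if "?lam l \<notin> spectrum_X" for l
  proof -
    have "pr l f x = 0" if "x \<in> X" for x
      using pr_eigen(1)[OF fm(2), where l = l] \<open>?lam l \<notin> spectrum_X\<close> that by (auto simp: spectrum_X_def)
    then have "(\<integral>x. (pr l f x)\<^sup>2 \<partial>sigma_X) = (\<integral>x. 0 \<partial>sigma_X)"
      by (intro Bochner_Integration.integral_cong) auto
    then show ?thesis by simp
  qed
  have "(\<Sum>l=1..L. ?lam l powr s * (4 * pi * (\<integral>x. (pr l f x)\<^sup>2 \<partial>sigma_X)))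
      = (\<Sum>l\<in>A. ?lam l powr s * (4 * pi * (\<integral>x. (pr l f x)\<^sup>2 \<partial>sigma_X)))"
    unfolding A_def by (intro sum.mono_neutral_right) (auto simp: z)
  also have "\<dots> = (\<Sum>l\<in>A. ?t (?lam l))"
    using eigenproj_eq[OF L2] by (intro sum.cong) (auto simp: A_def)
  also have "\<dots> = sum ?t (?lam ` A)"
    using inj by (subst sum.reindex) (auto intro: inj_on_subset)
  also have "\<dots> \<le> infsum ?t spectrum_X"
    using sm by (rule finite_sum_le_infsum) (auto simp: A_def intro!: nn)
  also have "\<dots> \<le> 1"
    using n unfolding sobolev_norm_def by simp
  finally show ?thesis .
qed

section \<open>Energies of a configuration and their spectral decomposition\<close>

definition En :: "nat \<Rightarrow> (nat \<Rightarrow> real^3) \<Rightarrow> nat \<Rightarrow> real" where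
  "En N x n = 1 / (real N)\<^sup>2 * (\<Sum>i=1..N. \<Sum>j=1..N. qq (x i) (x j) ^ n) - 1 / (real n + 1)"

text \<open>\<open>Bl N x l\<close> is the component of degree \<open>l\<close> of the empirical measure of \<open>x\<close>, and \<open>Wl N x l\<close> its
  squared norm.\<close>

definition Wl :: "nat \<Rightarrow> (nat \<Rightarrow> real^3) \<Rightarrow> nat \<Rightarrow> real" where
  "Wl N x l = 1 / (real N)\<^sup>2 * (\<Sum>i=1..N. \<Sum>j=1..N. Zl l (qq (x i) (x j)))"

definition Bl :: "nat \<Rightarrow> (nat \<Rightarrow> real^3) \<Rightarrow> nat \<Rightarrow> real^3 \<Rightarrow> real" where
  "Bl N x l y = 1 / real N * (\<Sum>i=1..N. Zl l (qq (x i) y))"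

lemma Bl_cont: "continuous_on S (Bl N x l)"
  unfolding Bl_def by (intro continuous_intros Zl_cont)

lemma Bl_inner:
  assumes x: "x \<in> {1..N} \<rightarrow> X" and \<phi>: "\<phi> \<in> eigenspace (real k * (real k + 1))"
  shows "(\<integral>y. Bl N x l y * \<phi> y \<partial>sigma_X) = (if l = k then 1 / real N * (\<Sum>i=1..N. \<phi> (x i)) else 0)"
proof -
  have "(\<integral>y. Bl N x l y * \<phi> y \<partial>sigma_X) = (\<integral>y. 1 / real N * (\<Sum>i=1..N. Zl l (qq (x i) y) * \<phi> y) \<partial>sigma_X)"
    by (simp add: Bl_def sum_distrib_right mult.assoc)
  also have "\<dots> = 1 / real N * (\<Sum>i=1..N. \<integral>y. Zl l (qq (x i) y) * \<phi> y \<partial>sigma_X)"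
    by (subst integral_mult_right_zero, subst Bochner_Integration.integral_sum)
       (auto intro!: integrable_contX continuous_intros Zl_cont eigenspace_cont[OF \<phi>])
  also have "\<dots> = 1 / real N * (\<Sum>i=1..N. if l = k then \<phi> (x i) else 0)"
    using Zl_reproduce[OF Pi_mem[OF x] \<phi>] by simp
  finally show ?thesis by simp
qed

lemma Bl_eigen:
  assumes x: "x \<in> {1..N} \<rightarrow> X"
  shows "Bl N x l \<in> eigenspace (real l * (real l + 1))"
proof -
  have "spoly (\<lambda>y. \<Sum>i\<in>{1..N}. (1 / real N) * Zl l (qq (x i) y))"
    by (intro spoly_sum spoly_mult spoly_const spoly_Zl)
  moreover have B: "Bl N x l = (\<lambda>y. \<Sum>i\<in>{1..N}. (1 / real N) * Zl l (qq (x i) y))"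
    by (simp add: Bl_def fun_eq_iff sum_distrib_left)
  moreover have "laplace_X (\<lambda>y. \<Sum>i\<in>{1..N}. (1 / real N) * Zl l (qq (x i) y)) y
     = real l * (real l + 1) * (\<Sum>i\<in>{1..N}. (1 / real N) * Zl l (qq (x i) y))" if y: "y \<in> X" for y
  proof -
    have "laplace_X (\<lambda>y. \<Sum>i\<in>{1..N}. (1 / real N) * Zl l (qq (x i) y)) y
      = (\<Sum>i\<in>{1..N}. (1 / real N) * laplace_X (\<lambda>y. Zl l (qq (x i) y)) y)"
      using y by (intro laplace_X_sum spoly_Zl) auto
    also have "\<dots> = (\<Sum>i\<in>{1..N}. (1 / real N) * (real l * (real l + 1) * Zl l (qq (x i) y)))"
      using laplace_X_Zl[OF Pi_mem[OF x] y] by simp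
    finally show ?thesis by (simp add: sum_distrib_left mult_ac)
  qed
  ultimately show ?thesis by (simp only: eigenspace_def mem_Collect_eq spoly_smooth) blast
qed

lemma Bl_Bl:
  assumes x: "x \<in> {1..N} \<rightarrow> X"
  shows "(\<integral>y. Bl N x l y * Bl N x k y \<partial>sigma_X) = (if l = k then Wl N x l else 0)"
proof -
  have "1 / real N * (\<Sum>i=1..N. Bl N x l (x i)) = Wl N x l"
    by (simp add: Bl_def Wl_def sum_distrib_left power2_eq_square) (simp add: qq_commute)
  then show ?thesis using Bl_inner[OF x Bl_eigen[OF x, of k], of l] by auto
qed

lemma Wl_nonneg: "x \<in> {1..N} \<rightarrow> X \<Longrightarrow> 0 \<le> Wl N x l"
proof -
  assume x: "x \<in> {1..N} \<rightarrow> X"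
  have "0 \<le> (\<integral>y. (Bl N x l y)\<^sup>2 \<partial>sigma_X)" by simp
  then show ?thesis using Bl_Bl[OF x, where l = l and k = l] by (simp add: power2_eq_square)
qed

text \<open>The term of degree 0 equals 1/(n + 1), the mean that \<open>En\<close> subtracts;
  degrees above n do not occur since \<open>kap l n\<close> vanishes there.\<close>

lemma En_eq_sum:
  assumes N: "1 \<le> N"
  shows "En N x n = (\<Sum>l=1..n. kap l n * Wl N x l)"
proof -
  have W0: "Wl N x 0 = 1" using N by (simp add: Wl_def power2_eq_square)
  have "1 / (real N)\<^sup>2 * (\<Sum>i=1..N. \<Sum>j=1..N. qq (x i) (x j) ^ n) = (\<Sum>l\<le>n. kap l n * Wl N x l)"
  proof -
    have "(\<Sum>i=1..N. \<Sum>j=1..N. qq (x i) (x j) ^ n) = (\<Sum>i=1..N. \<Sum>j=1..N. \<Sum>l\<le>n. kap l n * Zl l (qq (x i) (x j)))"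
      by (simp add: power_eq_sum_Zl[symmetric])
    also have "\<dots> = (\<Sum>i=1..N. \<Sum>l\<le>n. \<Sum>j=1..N. kap l n * Zl l (qq (x i) (x j)))"
      by (rule sum.cong[OF refl], rule sum.swap)
    also have "\<dots> = (\<Sum>l\<le>n. \<Sum>i=1..N. \<Sum>j=1..N. kap l n * Zl l (qq (x i) (x j)))"
      by (rule sum.swap)
    finally show ?thesis by (simp add: Wl_def sum_distrib_left mult_ac)
  qed
  also have "\<dots> = kap 0 n * Wl N x 0 + (\<Sum>l=1..n. kap l n * Wl N x l)"
    by (simp add: atMost_atLeast0 sum.atLeast_Suc_atMost)
  finally show ?thesis by (simp add: En_def W0)
qed

lemma En_nonneg: "1 \<le> N \<Longrightarrow> x \<in> {1..N} \<rightarrow> X \<Longrightarrow> 0 \<le> En N x n"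
  by (simp add: En_eq_sum sum_nonneg kap_nonneg Wl_nonneg)

lemma En_le_1: assumes "1 \<le> N" "x \<in> {1..N} \<rightarrow> X" shows "En N x n \<le> 1"
proof -
  have "(\<Sum>i=1..N. \<Sum>j=1..N. qq (x i) (x j) ^ n) \<le> (\<Sum>i=1..N. \<Sum>j=1..N. 1)"
    using assms(2) by (intro sum_mono power_le_one qq_bounds) (auto simp: Pi_iff)
  then have "1 / (real N)\<^sup>2 * (\<Sum>i=1..N. \<Sum>j=1..N. qq (x i) (x j) ^ n) \<le> 1"
    using assms(1) by (simp add: power2_eq_square pos_divide_le_eq)
  moreover have "0 \<le> 1 / (real n + 1)" by simp
  ultimately show ?thesis unfolding En_def by linarith
qed

text \<open>As q lies in [0, 1], the uncentred averages decrease in the exponent; only the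
  subtracted mean 1/(m + 1) is lost. With this substitute for monotonicity a single good index
  controls all later ones.\<close>

lemma En_mono:
  assumes "1 \<le> N" "x \<in> {1..N} \<rightarrow> X" "m \<le> n"
  shows "En N x n \<le> En N x m + 1 / (real m + 1)"
proof -
  have "(\<Sum>i=1..N. \<Sum>j=1..N. qq (x i) (x j) ^ n) \<le> (\<Sum>i=1..N. \<Sum>j=1..N. qq (x i) (x j) ^ m)"
    using assms(2,3) by (intro sum_mono power_decreasing qq_bounds) (auto simp: Pi_iff)
  then have "1 / (real N)\<^sup>2 * (\<Sum>i=1..N. \<Sum>j=1..N. qq (x i) (x j) ^ n) \<le> 1 / (real N)\<^sup>2 * (\<Sum>i=1..N. \<Sum>j=1..N. qq (x i) (x j) ^ m)"
    by (intro mult_left_mono) auto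
  moreover have "0 \<le> 1 / (real n + 1)" by simp
  ultimately show ?thesis unfolding En_def by linarith
qed

section \<open>The worst-case error in terms of the energies\<close>

lemma K_bounds: "0 \<le> (real n + 1) * kap l n" "(real n + 1) * kap l n \<le> 1"
proof -
  show "0 \<le> (real n + 1) * kap l n" using kap_nonneg[of l n] by simp
  have "(real n + 1) * kap l n \<le> (real n + 1) * (1 / (real n + 1))"
    by (intro mult_left_mono kap_le) simp
  then show "(real n + 1) * kap l n \<le> 1" by simp
qed

text \<open>Point values of f are limits of (n + 1) times the integral of q^n f, a combination of
  the projections of degree at most n with coefficients in [0, 1]. For fixed n the error is
  therefore a finite sum, to which Cauchy--Schwarz with the weights (l(l + 1))^s and (l(l + 1))^(-s)
  applies, and the bound passes to the limit.\<close>

lemma wce_le_sqrt: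
  assumes N: "1 \<le> N" and x: "x \<in> {1..N} \<rightarrow> X"
    and M: "\<And>L. (\<Sum>l=1..L. (real l * (real l + 1)) powr (- s) * Wl N x l) \<le> M"
  shows "wce N x s \<le> ereal (sqrt M)"
  unfolding wce_def
proof (rule SUP_least)
  fix f assume "f \<in> {f \<in> sobolev_space s. continuous_on X f \<and> sobolev_norm s f \<le> 1}"
  then have f: "f \<in> sobolev_space s" "continuous_on X f" "sobolev_norm s f \<le> 1" by auto
  have fi: "integrable sigma_X f" using f(2) by (rule integrable_contX)
  define p where "p = (\<lambda>l. \<integral>x. (pr l f x)\<^sup>2 \<partial>sigma_X)"
  have p0: "0 \<le> p l" for l by (simp add: p_def)
  have M0: "0 \<le> M" using M[of 0] by simp
  define A where "A = (\<lambda>l. 1 / real N * (\<Sum>i=1..N. pr l f (x i)))"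
  have A: "\<bar>A l\<bar> \<le> sqrt (p l) * sqrt (Wl N x l)" for l
  proof -
    have "pr l f \<in> eigenspace (real l * (real l + 1))" using fi by (rule pr_eigen(1))
    from Bl_inner[OF x this]
    have "A l = (\<integral>y. Bl N x l y * pr l f y \<partial>sigma_X)"
      by (simp add: A_def)
    moreover have "(\<integral>y. Bl N x l y * pr l f y \<partial>sigma_X)\<^sup>2 \<le> (\<integral>y. (Bl N x l y)\<^sup>2 \<partial>sigma_X) * p l"
      unfolding p_def by (rule Cauchy_Schwarz_X[OF Bl_cont pr_cont[OF fi]])
    moreover have "(\<integral>y. (Bl N x l y)\<^sup>2 \<partial>sigma_X) = Wl N x l"
      using Bl_Bl[OF x, where l = l and k = l] by (simp add: power2_eq_square)
    ultimately have "(A l)\<^sup>2 \<le> p l * Wl N x l" by (simp add: mult.commute)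
    then have "\<bar>A l\<bar> \<le> sqrt (p l * Wl N x l)" by (intro real_le_rsqrt) simp
    then show ?thesis by (simp add: real_sqrt_mult)
  qed
  have fin: "\<bar>\<Sum>l=1..n. (real n + 1) * kap l n * A l\<bar> \<le> sqrt M" for n
  proof -
    let ?w = "\<lambda>l. (real l * (real l + 1)) powr s"
    have w: "0 < ?w l" if "1 \<le> l" for l using that by simp
    have e1: "(\<Sum>l=1..n. (sqrt (?w l * p l))\<^sup>2) = (\<Sum>l=1..n. ?w l * p l)"
      using p0 by (intro sum.cong) auto
    have e2: "(\<Sum>l=1..n. (sqrt (?w l powr (-1) * Wl N x l))\<^sup>2) = (\<Sum>l=1..n. (real l * (real l + 1)) powr (- s) * Wl N x l)"
      using Wl_nonneg[OF x] by (intro sum.cong) (auto simp: powr_powr powr_minus divide_inverse mult.commute)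
    have "\<bar>\<Sum>l=1..n. (real n + 1) * kap l n * A l\<bar> \<le> (\<Sum>l=1..n. \<bar>(real n + 1) * kap l n * A l\<bar>)" by (rule sum_abs)
    also have "\<dots> \<le> (\<Sum>l=1..n. \<bar>A l\<bar>)"
    proof (rule sum_mono)
      fix l
      have "\<bar>(real n + 1) * kap l n\<bar> * \<bar>A l\<bar> \<le> 1 * \<bar>A l\<bar>"
        using K_bounds[of n l] by (intro mult_right_mono) auto
      then show "\<bar>(real n + 1) * kap l n * A l\<bar> \<le> \<bar>A l\<bar>" unfolding abs_mult[of _ "A l"] by simp
    qed
    also have "\<dots> \<le> (\<Sum>l=1..n. sqrt (?w l * p l) * sqrt (?w l powr (-1) * Wl N x l))"
    proof (rule sum_mono)
      fix l assume l: "l \<in> {1..n}"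
      have "sqrt (?w l * p l) * sqrt (?w l powr (-1) * Wl N x l) = sqrt ((?w l * ?w l powr (-1)) * (p l * Wl N x l))"
        by (simp add: real_sqrt_mult[symmetric] mult_ac)
      moreover have "?w l * ?w l powr (-1) = 1" using w[of l] l by (simp add: powr_minus_divide)
      ultimately have "sqrt (?w l * p l) * sqrt (?w l powr (-1) * Wl N x l) = sqrt (p l) * sqrt (Wl N x l)"
        by (simp only: mult_1_left real_sqrt_mult)
      then show "\<bar>A l\<bar> \<le> sqrt (?w l * p l) * sqrt (?w l powr (-1) * Wl N x l)" using A[of l] by linarith
    qed
    also have "\<dots> \<le> sqrt (\<Sum>l=1..n. (sqrt (?w l * p l))\<^sup>2) * sqrt (\<Sum>l=1..n. (sqrt (?w l powr (-1) * Wl N x l))\<^sup>2)"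
      unfolding real_sqrt_mult[symmetric, of "sum _ _"]
      by (rule real_le_rsqrt[OF Cauchy_Schwarz_ineq_sum])
    also have "\<dots> = sqrt (\<Sum>l=1..n. ?w l * p l) * sqrt (\<Sum>l=1..n. (real l * (real l + 1)) powr (- s) * Wl N x l)"
      by (simp only: e1 e2)
    also have "\<dots> \<le> 1 * sqrt M"
    proof (intro mult_mono)
      have "(\<Sum>l=1..n. ?w l * p l) \<le> (\<Sum>l=1..n. ?w l * (4 * pi * p l))"
      proof (intro sum_mono mult_left_mono)
        show "p l \<le> 4 * pi * p l" for l
          using mult_right_mono[of 1 "4 * pi" "p l"] p0[of l] pi_gt3 by simp
      qed simp
      also have "\<dots> \<le> 1" using sobolev_partial_sum[OF f(1,3), of n] by (simp add: p_def)
      finally show "sqrt (\<Sum>l=1..n. ?w l * p l) \<le> 1" by simp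
      show "sqrt (\<Sum>l=1..n. (real l * (real l + 1)) powr (- s) * Wl N x l) \<le> sqrt M" using M by simp
      show "0 \<le> sqrt (\<Sum>l=1..n. (real l * (real l + 1)) powr (- s) * Wl N x l)"
        using Wl_nonneg[OF x] by (auto intro!: sum_nonneg)
    qed simp
    finally show ?thesis by simp
  qed
  have Q: "(real n + 1) * (\<integral>y. qq z y ^ n * f y \<partial>sigma_X) = (\<Sum>l\<le>n. (real n + 1) * kap l n * pr l f z)" for n z
  proof -
    have "(\<integral>y. qq z y ^ n * f y \<partial>sigma_X) = (\<integral>y. (\<Sum>l\<le>n. kap l n * (Zl l (qq z y) * f y)) \<partial>sigma_X)"
      by (simp add: power_eq_sum_Zl[of _ n] sum_distrib_right mult.assoc)
    also have "\<dots> = (\<Sum>l\<le>n. kap l n * pr l f z)"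
      unfolding pr_def by (subst Bochner_Integration.integral_sum)
        (auto intro!: integrable_contX continuous_intros Zl_cont f(2))
    finally show ?thesis by (simp add: sum_distrib_left mult.assoc)
  qed
  have pr0: "pr 0 f z = (\<integral>y. f y \<partial>sigma_X)" for z by (simp add: pr_def)
  have "(\<lambda>n. 1 / real N * (\<Sum>i=1..N. (real n + 1) * (\<integral>y. qq (x i) y ^ n * f y \<partial>sigma_X))) \<longlonglongrightarrow> 1 / real N * (\<Sum>i=1..N. f (x i))"
    by (intro tendsto_mult tendsto_const tendsto_sum approx_identity f(2) Pi_mem[OF x])
  moreover have "1 / real N * (\<Sum>i=1..N. (real n + 1) * (\<integral>y. qq (x i) y ^ n * f y \<partial>sigma_X))
     = (\<integral>y. f y \<partial>sigma_X) + (\<Sum>l=1..n. (real n + 1) * kap l n * A l)" for n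
  proof -
    have "1 / real N * (\<Sum>i=1..N. (real n + 1) * (\<integral>y. qq (x i) y ^ n * f y \<partial>sigma_X))
      = (\<Sum>l\<le>n. (real n + 1) * kap l n * A l)"
      unfolding Q by (subst sum.swap) (simp add: A_def sum_distrib_left mult_ac)
    also have "\<dots> = (real n + 1) * kap 0 n * A 0 + (\<Sum>l=1..n. (real n + 1) * kap l n * A l)"
      by (simp add: atMost_atLeast0 sum.atLeast_Suc_atMost)
    also have "(real n + 1) * kap 0 n * A 0 = (\<integral>y. f y \<partial>sigma_X)"
      using N by (simp add: A_def pr0)
    finally show ?thesis .
  qed
  ultimately have "(\<lambda>n. (\<integral>y. f y \<partial>sigma_X) + (\<Sum>l=1..n. (real n + 1) * kap l n * A l)) \<longlonglongrightarrow> 1 / real N * (\<Sum>i=1..N. f (x i))"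
    by simp
  from tendsto_rabs[OF tendsto_diff[OF this tendsto_const[of "\<integral>y. f y \<partial>sigma_X"]]]
  have "(\<lambda>n. \<bar>\<Sum>l=1..n. (real n + 1) * kap l n * A l\<bar>) \<longlonglongrightarrow> \<bar>1 / real N * (\<Sum>i=1..N. f (x i)) - (\<integral>y. f y \<partial>sigma_X)\<bar>"
    by simp
  then have "\<bar>1 / real N * (\<Sum>i=1..N. f (x i)) - (\<integral>y. f y \<partial>sigma_X)\<bar> \<le> sqrt M"
    by (rule LIMSEQ_le_const2) (use fin in blast)
  then show "ereal \<bar>(\<integral>y. f y \<partial>sigma_X) - 1 / real N * (\<Sum>i=1..N. f (x i))\<bar> \<le> ereal (sqrt M)"
    by (simp add: abs_minus_commute)
qed

text \<open>Comparison with the integral in telescoping form: the mean value theorem for t^(1-s) on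
  [n, n + 1].\<close>

lemma powr_tail_step:
  assumes s: "1 < s" and n: "1 \<le> n"
  shows "(real (Suc n)) powr (- s) \<le> ((real n) powr (1 - s) - (real (Suc n)) powr (1 - s)) / (s - 1)"
proof -
  have "\<exists>z>real n. z < real (Suc n) \<and> (real (Suc n)) powr (1 - s) - (real n) powr (1 - s) = (real (Suc n) - real n) * ((1 - s) * z powr (1 - s - 1))"
  proof (rule MVT2)
    fix t assume "real n \<le> t" "t \<le> real (Suc n)"
    then have "0 < t" using n by linarith
    then show "((\<lambda>t. t powr (1 - s)) has_real_derivative (1 - s) * t powr (1 - s - 1)) (at t)"
      by (intro has_real_derivative_powr)
  qed simp
  then obtain z where z: "real n < z" "z < real (Suc n)"
    and e: "(real (Suc n)) powr (1 - s) - (real n) powr (1 - s) = (1 - s) * z powr (- s)" by auto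
  have "(real (Suc n)) powr (- s) \<le> z powr (- s)"
    using z n s by (intro powr_mono2') auto
  moreover have "z powr (- s) = ((real n) powr (1 - s) - (real (Suc n)) powr (1 - s)) / (s - 1)"
    using e s by (simp add: field_simps)
  ultimately show ?thesis by simp
qed

lemma powr_tail:
  assumes s: "1 < s" and k: "1 \<le> k"
  shows "(\<Sum>n=Suc k..M. real n powr (- s)) \<le> (real k) powr (1 - s) / (s - 1)"
proof -
  have "(\<Sum>n=Suc k..M. real n powr (- s)) \<le> ((real k) powr (1 - s) - (real (max k M)) powr (1 - s)) / (s - 1)"
  proof (induction M)
    case 0
    then show ?case by simp
  next
    case (Suc M)
    show ?case
    proof (cases "k \<le> M")
      case True
      have "(\<Sum>n=Suc k..Suc M. real n powr (- s)) = (\<Sum>n=Suc k..M. real n powr (- s)) + real (Suc M) powr (- s)"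
        using True by simp
      also have "\<dots> \<le> ((real k) powr (1 - s) - (real M) powr (1 - s)) / (s - 1) + ((real M) powr (1 - s) - (real (Suc M)) powr (1 - s)) / (s - 1)"
        using Suc True k s by (intro add_mono powr_tail_step) (auto simp: max_def split: if_splits)
      also have "\<dots> = ((real k) powr (1 - s) - (real (max k (Suc M))) powr (1 - s)) / (s - 1)"
        using True by (simp add: diff_divide_distrib[symmetric] add_divide_distrib[symmetric] max_def)
      finally show ?thesis .
    next
      case False
      then have "{Suc k..Suc M} = {}" by auto
      moreover have "max k (Suc M) = k" using False by simp
      ultimately show ?thesis by simp
    qed
  qed
  also have "\<dots> \<le> (real k) powr (1 - s) / (s - 1)"
    using s by (intro divide_right_mono) auto
  finally show ?thesis .
qed

text \<open>Only the window 2 L <= n <= 4 L with L = l(l + 1) is used. There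
  \<open>kap_lower\<close> gives \<open>kap l n\<close> >= 1/(10 L), and n^(-s) >= L^(-s)/16 because
  s <= 2. The window has at least 2 L elements, and 10 * 16 / 2 = 80.\<close>

lemma lam_powr_le:
  fixes l :: nat
  assumes l: "1 \<le> l" and s: "1 \<le> s" "s \<le> 2" and M: "4 * (l * (l + 1)) \<le> M"
  shows "(real l * (real l + 1)) powr (- s) \<le> 80 * (\<Sum>n=1..M. kap l n * real n powr (- s))"
proof -
  define L where "L = l * (l + 1)"
  have Lr: "real L = real l * (real l + 1)" by (simp add: L_def algebra_simps)
  have L1: "1 \<le> L" using l by (simp add: L_def)
  have each: "real L powr (- s) / (160 * real L) \<le> kap l n * real n powr (- s)" if n: "n \<in> {2*L..4*L}" for n
  proof -
    have "real L / (real n + 2) \<le> 1 / 2" using n by (simp add: field_simps)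
    then have "1 / 2 \<le> (real n + 1) * kap l n" using kap_lower[of l n] unfolding Lr[symmetric] by linarith
    then have "(1 / 2) / (real n + 1) \<le> kap l n" by (simp add: field_simps)
    moreover have "1 / (10 * real L) \<le> (1 / 2) / (real n + 1)"
    proof -
      have "real n + 1 \<le> 5 * real L" using n L1 by auto
      then show ?thesis using L1 by (simp add: field_simps)
    qed
    ultimately have k: "1 / (10 * real L) \<le> kap l n" by linarith
    have "real L powr (- s) / 16 \<le> (4 * real L) powr (- s)"
    proof -
      have "(4::real) powr (- 2) \<le> 4 powr (- s)" using s by (intro powr_mono) auto
      then have "1 / 16 \<le> (4::real) powr (- s)" by (simp add: powr_minus powr_numeral)
      then have "real L powr (- s) * (1 / 16) \<le> real L powr (- s) * 4 powr (- s)" by (intro mult_left_mono) auto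
      then show ?thesis by (simp add: powr_mult mult.commute)
    qed
    also have "\<dots> \<le> real n powr (- s)" using n L1 s by (intro powr_mono2') auto
    finally have "real L powr (- s) / 16 \<le> real n powr (- s)" .
    then have "1 / (10 * real L) * (real L powr (- s) / 16) \<le> kap l n * real n powr (- s)"
      using k kap_nonneg[of l n] by (intro mult_mono) auto
    then show ?thesis by (simp add: mult.commute)
  qed
  have "real L powr (- s) / 80 = (2 * real L) * (real L powr (- s) / (160 * real L))"
    using L1 by simp
  also have "\<dots> \<le> real (card {2*L..4*L}) * (real L powr (- s) / (160 * real L))"
    using L1 by (intro mult_right_mono) auto
  also have "\<dots> \<le> (\<Sum>n\<in>{2*L..4*L}. kap l n * real n powr (- s))"
    using each by (intro sum_bounded_below) auto
  also have "\<dots> \<le> (\<Sum>n=1..M. kap l n * real n powr (- s))"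
    using M L1 by (intro sum_mono2) (auto simp: L_def intro!: mult_nonneg_nonneg kap_nonneg)
  finally show ?thesis by (simp add: Lr)
qed

lemma wce_le_En:
  assumes N: "1 \<le> N" and x: "x \<in> {1..N} \<rightarrow> X" and s: "1 \<le> s" "s \<le> 2"
    and D: "\<And>M. (\<Sum>n=1..M. En N x n * real n powr (- s)) \<le> D"
  shows "wce N x s \<le> ereal (sqrt (80 * D))"
proof (rule wce_le_sqrt[OF N x])
  fix L :: nat
  define M where "M = 4 * (L * (L + 1))"
  have "(\<Sum>l=1..L. (real l * (real l + 1)) powr (- s) * Wl N x l)
     \<le> (\<Sum>l=1..L. (80 * (\<Sum>n=1..M. kap l n * real n powr (- s))) * Wl N x l)"
  proof (intro sum_mono mult_right_mono Wl_nonneg[OF x] lam_powr_le s)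
    fix l assume "l \<in> {1..L}"
    then have "l \<le> L" "l + 1 \<le> L + 1" "1 \<le> l" by auto
    then show "4 * (l * (l + 1)) \<le> M" "1 \<le> l" unfolding M_def by (auto intro: mult_mono simp del: mult_Suc_right)
  qed
  also have "\<dots> = 80 * (\<Sum>n=1..M. (\<Sum>l=1..L. kap l n * Wl N x l) * real n powr (- s))"
    by (simp add: sum_distrib_left sum_distrib_right, subst sum.swap) (simp add: mult_ac)
  also have "\<dots> \<le> 80 * (\<Sum>n=1..M. En N x n * real n powr (- s))"
  proof (intro mult_left_mono sum_mono mult_right_mono)
    fix n
    have "(\<Sum>l=1..L. kap l n * Wl N x l) \<le> (\<Sum>l=1..max L n. kap l n * Wl N x l)"
      by (intro sum_mono2) (auto intro!: mult_nonneg_nonneg kap_nonneg Wl_nonneg[OF x])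
    also have "\<dots> = (\<Sum>l=1..n. kap l n * Wl N x l)"
      by (intro sum.mono_neutral_right) (auto simp: kap_eq_0)
    also have "\<dots> = En N x n" using En_eq_sum[OF N] by simp
    finally show "(\<Sum>l=1..L. kap l n * Wl N x l) \<le> En N x n" .
  qed auto
  also have "\<dots> \<le> 80 * D" using D by simp
  finally show "(\<Sum>l=1..L. (real l * (real l + 1)) powr (- s) * Wl N x l) \<le> 80 * D" .
qed

text \<open>This rests on the near-monotonicity of the energies, lemma \<open>En_mono\<close>.\<close>

lemma En_interpolation:
  assumes N: "1 \<le> N" and x: "x \<in> {1..N} \<rightarrow> X" and s: "1 < s" "s \<le> 2" and r: "0 < r"
    and D: "\<And>M. (\<Sum>n=1..M. En N x n * real n powr (- 2)) \<le> r\<^sup>2"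
  shows "(\<Sum>n=1..M. En N x n * real n powr (- s)) \<le> (16 + 9 / (s - 1)) * r powr s"
proof -
  have En: "0 \<le> En N x n" "En N x n \<le> 1" for n using En_nonneg[OF N x] En_le_1[OF N x] by auto
  show ?thesis
  proof (cases "1 \<le> r")
    case True
    have "(\<Sum>n=1..M. En N x n * real n powr (- s)) \<le> (\<Sum>n=1..Suc M. En N x n * real n powr (- s))"
      using En by (intro sum_mono2) auto
    also have "\<dots> \<le> (\<Sum>n=1..Suc M. real n powr (- s))"
      using En by (intro sum_mono) (simp add: mult_left_le_one_le)
    also have "\<dots> = 1 + (\<Sum>n=Suc 1..Suc M. real n powr (- s))"
      by (simp add: sum.atLeast_Suc_atMost)
    also have "\<dots> \<le> 1 + 1 / (s - 1)"
      using powr_tail[OF s(1), of 1 "Suc M"] by simp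
    also have "\<dots> \<le> (16 + 9 / (s - 1)) * 1"
      using s divide_right_mono[of 1 9 "s - 1"] by simp
    also have "\<dots> \<le> (16 + 9 / (s - 1)) * r powr s"
      using s True by (intro mult_left_mono ge_one_powr_ge_zero) auto
    finally show ?thesis .
  next
    case False
    then have r1: "r < 1" by simp
    \<comment> \<open>The scale 1/r is where the two estimates meet: below it the assumption for the
      exponent 2 is effective, beyond it the loss 1/(m + 1) in \<open>En_mono\<close> is at most
      r.\<close>
    define k where "k = nat \<lceil>1 / r\<rceil>"
    have k: "1 / r \<le> real k" "real k \<le> 2 / r" "1 \<le> k"
    proof -
      have "1 < 1 / r" using r r1 by simp
      then show "1 / r \<le> real k" "1 \<le> k" unfolding k_def by linarith+
      have "real k \<le> 1 / r + 1" using \<open>1 < 1 / r\<close> unfolding k_def by linarith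
      also have "\<dots> \<le> 2 / r" using r r1 by (simp add: field_simps)
      finally show "real k \<le> 2 / r" .
    qed
    \<comment> \<open>Pigeonhole: if all these energies exceeded 8 r, the k + 1 terms would sum to
      at least (k + 1) 2 r/k^2, which is more than r^2 because r k <= 2.\<close>
    have "\<exists>m\<in>{k..2*k}. En N x m \<le> 8 * r"
    proof (rule ccontr)
      assume "\<not> ?thesis"
      then have c: "8 * r < En N x m" if "m \<in> {k..2*k}" for m
        using that \<open>\<not> (\<exists>m\<in>{k..2*k}. En N x m \<le> 8 * r)\<close> not_le by blast
      have "(8 * r) * (2 * real k) powr (- 2) \<le> En N x m * real m powr (- 2)" if m: "m \<in> {k..2*k}" for m
        using c[OF m] m k(3) r by (intro mult_mono powr_mono2') auto
      then have "real (card {k..2*k}) * ((8 * r) * (2 * real k) powr (- 2)) \<le> (\<Sum>m\<in>{k..2*k}. En N x m * real m powr (- 2))"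
        by (intro sum_bounded_below) auto
      also have "\<dots> \<le> (\<Sum>m=1..2*k. En N x m * real m powr (- 2))"
        using k(3) En by (intro sum_mono2) auto
      also have "\<dots> \<le> r\<^sup>2" by (rule D)
      finally have "(real k + 1) * ((8 * r) * (2 * real k) powr (- 2)) \<le> r\<^sup>2" by (simp add: add.commute)
      moreover have "(2 * real k) powr (- 2) = 1 / (4 * (real k)\<^sup>2)"
        unfolding powr_minus_divide using k(3) by (simp add: powr_numeral power_mult_distrib)
      ultimately have "((real k + 1) * ((8 * r) * (1 / (4 * (real k)\<^sup>2)))) * (real k)\<^sup>2 \<le> r\<^sup>2 * (real k)\<^sup>2"
        by (intro mult_right_mono) auto
      moreover have "((real k + 1) * ((8 * r) * (1 / (4 * (real k)\<^sup>2)))) * (real k)\<^sup>2 = (real k + 1) * (2 * r)"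
        using k(3) by simp
      ultimately have "(real k + 1) * (2 * r) \<le> r\<^sup>2 * (real k)\<^sup>2" by linarith
      also have "\<dots> \<le> r\<^sup>2 * (real k * (2 / r))"
        unfolding power2_eq_square[of "real k"] using k by (intro mult_left_mono) auto
      also have "\<dots> = real k * (2 * r)" using r by (simp add: power2_eq_square)
      finally have "2 * r \<le> 0" unfolding distrib_right by linarith
      then show False using r by linarith
    qed
    then obtain m where m: "k \<le> m" "m \<le> 2 * k" "En N x m \<le> 8 * r" by auto
    have big: "En N x n \<le> 9 * r" if n: "2 * k < n" for n
    proof -
      have "En N x n \<le> En N x m + 1 / (real m + 1)" using m n by (intro En_mono[OF N x]) auto
      also have "1 / (real m + 1) \<le> 1 / (1 / r)" using m(1) k(1) r by (intro divide_left_mono) auto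
      finally show ?thesis using m(3) by simp
    qed
    \<comment> \<open>For n <= 2 k <= 4/r the weight n^(-s) is at most (4/r)^(2-s) n^(-2), and
      4^(2-s) <= 16.\<close>
    have low: "(\<Sum>n=1..2*k. En N x n * real n powr (- s)) \<le> 16 * r powr s"
    proof -
      have "(\<Sum>n=1..2*k. En N x n * real n powr (- s)) \<le> (\<Sum>n=1..2*k. (16 * r powr (s - 2)) * (En N x n * real n powr (- 2)))"
      proof (rule sum_mono)
        fix n assume n: "n \<in> {1..2*k}"
        have "real n powr (- s) = real n powr (2 - s) * real n powr (- 2)" by (simp add: powr_add[symmetric])
        also have "\<dots> \<le> (16 * r powr (s - 2)) * real n powr (- 2)"
        proof (rule mult_right_mono)
          have "real n \<le> 4 / r" using n k(2) by auto
          then have "real n powr (2 - s) \<le> (4 / r) powr (2 - s)" using s by (intro powr_mono2) auto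
          also have "\<dots> = 4 powr (2 - s) * r powr (s - 2)"
          proof -
            have "(4 / r) powr t = 4 powr t * r powr (- t)" for t
              using r by (simp only: powr_minus_divide) (simp add: powr_divide)
            from this[of "2 - s"] show ?thesis by simp
          qed
          also have "(4::real) powr (2 - s) \<le> 4 powr 2" using s by (intro powr_mono) auto
          finally show "real n powr (2 - s) \<le> 16 * r powr (s - 2)" by (simp add: powr_numeral mult_right_mono)
        qed simp
        finally have "En N x n * real n powr (- s) \<le> En N x n * ((16 * r powr (s - 2)) * real n powr (- 2))"
          using En by (intro mult_left_mono) auto
        then show "En N x n * real n powr (- s) \<le> (16 * r powr (s - 2)) * (En N x n * real n powr (- 2))"
          by (simp only: mult.left_commute)
      qed
      also have "\<dots> = (16 * r powr (s - 2)) * (\<Sum>n=1..2*k. En N x n * real n powr (- 2))" by (simp add: sum_distrib_left)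
      also have "\<dots> \<le> (16 * r powr (s - 2)) * r\<^sup>2" using D by (intro mult_left_mono) auto
      also have "\<dots> = 16 * (r powr (s - 2) * r powr 2)" using r by (simp add: powr_numeral)
      also have "\<dots> = 16 * r powr s" unfolding powr_add[symmetric] by simp
      finally show ?thesis .
    qed
    have high: "(\<Sum>n=Suc (2*k)..M. En N x n * real n powr (- s)) \<le> 9 / (s - 1) * r powr s"
    proof -
      have "(\<Sum>n=Suc (2*k)..M. En N x n * real n powr (- s)) \<le> (\<Sum>n=Suc (2*k)..M. (9 * r) * real n powr (- s))"
        using big by (intro sum_mono mult_right_mono) auto
      also have "\<dots> \<le> (9 * r) * ((real (2 * k)) powr (1 - s) / (s - 1))"
        unfolding sum_distrib_left[symmetric] using r k(3) s by (intro mult_left_mono powr_tail) auto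
      also have "\<dots> \<le> (9 * r) * ((1 / r) powr (1 - s) / (s - 1))"
        using r k s by (intro mult_left_mono divide_right_mono powr_mono2') auto
      also have "(1 / r) powr (1 - s) = r powr (s - 1)"
      proof -
        have "(1 / r) powr t = r powr (- t)" for t
          using r by (simp only: powr_minus_divide) (simp add: powr_divide)
        from this[of "1 - s"] show ?thesis by simp
      qed
      also have "(9 * r) * (r powr (s - 1) / (s - 1)) = 9 / (s - 1) * r powr s"
      proof -
        have "r * r powr (s - 1) = r powr s" using r powr_add[of r 1 "s - 1"] by simp
        then have "9 * (r * r powr (s - 1)) / (s - 1) = 9 / (s - 1) * r powr s" by simp
        then show ?thesis by (simp only: times_divide_eq_right mult.assoc)
      qed
      finally show ?thesis .
    qed
    have "(\<Sum>n=1..M. En N x n * real n powr (- s)) \<le> (\<Sum>n\<in>{1..2*k} \<union> {Suc (2*k)..M}. En N x n * real n powr (- s))"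
      using En by (intro sum_mono2) auto
    also have "\<dots> = (\<Sum>n=1..2*k. En N x n * real n powr (- s)) + (\<Sum>n=Suc (2*k)..M. En N x n * real n powr (- s))"
      by (intro sum.union_disjoint) auto
    also have "\<dots> \<le> 16 * r powr s + 9 / (s - 1) * r powr s" using low high by linarith
    finally show ?thesis by (simp add: distrib_right)
  qed
qed

section \<open>Determinants of positive definite matrices\<close>

definition qform :: "nat \<Rightarrow> (nat \<Rightarrow> nat \<Rightarrow> complex) \<Rightarrow> (nat \<Rightarrow> complex) \<Rightarrow> complex" where
  "qform n a v = (\<Sum>i<n. \<Sum>j<n. cnj (v i) * a i j * v j)"

text \<open>The form is required to take positive real values; over the complex numbers this
  includes that the matrix is Hermitian.\<close>

definition pd :: "nat \<Rightarrow> (nat \<Rightarrow> nat \<Rightarrow> complex) \<Rightarrow> bool" where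
  "pd n a \<longleftrightarrow> (\<forall>v. (\<exists>i<n. v i \<noteq> 0) \<longrightarrow> (\<exists>r>0. qform n a v = of_real r))"

abbreviation fmat :: "nat \<Rightarrow> (nat \<Rightarrow> nat \<Rightarrow> complex) \<Rightarrow> complex mat" where
  "fmat n a \<equiv> Matrix.mat n n (\<lambda>(i, j). a i j)"

text \<open>The product ab is not Hermitian in general, but for an eigenvector v of ab and w = bv
  the form of a at w equals z times the form of b at v, and both forms are positive.\<close>

lemma pd_eigenvalue:
  assumes a: "pd n a" and b: "pd n b" and v: "\<exists>i<n. v i \<noteq> 0"
    and ev: "\<And>i. i < n \<Longrightarrow> (\<Sum>k<n. a i k * (\<Sum>j<n. b k j * v j)) = z * v i"
  shows "\<exists>r>0. z = of_real r"
proof -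
  define w where "w = (\<lambda>k. \<Sum>j<n. b k j * v j)"
  obtain rb where rb: "0 < rb" "qform n b v = of_real rb" using b v unfolding pd_def by blast
  have qb: "qform n b v = (\<Sum>i<n. cnj (v i) * w i)"
    by (simp add: qform_def w_def sum_distrib_left mult.assoc)
  have "\<exists>i<n. w i \<noteq> 0"
  proof (rule ccontr)
    assume "\<not> ?thesis"
    then have "qform n b v = 0" unfolding qb by simp
    then show False using rb by simp
  qed
  then obtain ra where ra: "0 < ra" "qform n a w = of_real ra" using a unfolding pd_def by blast
  have "qform n a w = (\<Sum>i<n. cnj (w i) * (\<Sum>j<n. a i j * w j))"
    by (simp add: qform_def sum_distrib_left mult.assoc)
  also have "\<dots> = (\<Sum>i<n. cnj (w i) * (z * v i))"
    using ev by (intro sum.cong) (auto simp: w_def)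
  also have "\<dots> = z * cnj (\<Sum>i<n. cnj (v i) * w i)"
    by (simp add: sum_distrib_left mult_ac)
  also have "\<dots> = z * of_real rb" unfolding qb[symmetric] rb(2) by simp
  finally have "z = of_real (ra / rb)" using ra rb by (simp add: field_simps)
  then show ?thesis using ra rb by (intro exI[of _ "ra / rb"]) auto
qed

lemma trace_mult_commute:
  fixes A B :: "'a::comm_ring_1 mat"
  assumes "A \<in> carrier_mat n n" "B \<in> carrier_mat n n"
  shows "(\<Sum>i<n. (A * B) $$ (i, i)) = (\<Sum>i<n. (B * A) $$ (i, i))"
proof -
  have "(\<Sum>i<n. (A * B) $$ (i, i)) = (\<Sum>i<n. \<Sum>k<n. A $$ (i, k) * B $$ (k, i))"
    using assms by (intro sum.cong) (auto simp: scalar_prod_def lessThan_atLeast0)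
  also have "\<dots> = (\<Sum>k<n. \<Sum>i<n. B $$ (k, i) * A $$ (i, k))"
    by (subst sum.swap) (simp add: mult.commute)
  also have "\<dots> = (\<Sum>i<n. (B * A) $$ (i, i))"
    using assms by (intro sum.cong) (auto simp: scalar_prod_def lessThan_atLeast0)
  finally show ?thesis .
qed

text \<open>Schur decomposition: the triangular form carries the eigenvalues on its diagonal, and
  determinant and trace are invariant under similarity.\<close>

lemma det_trace_eigenvalues:
  fixes A :: "complex mat"
  assumes A: "A \<in> carrier_mat n n"
  obtains es where "length es = n" "\<And>e. e \<in> set es \<Longrightarrow> eigenvalue A e"
    "Determinant.det A = prod_list es" "(\<Sum>i<n. A $$ (i, i)) = sum_list es"
proof -
  obtain es where es: "char_poly A = (\<Prod>e\<leftarrow>es. [:- e, 1:])" "length es = n"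
    using char_poly_factorized[OF A] by blast
  obtain B P Q where s: "schur_decomposition A es = (B, P, Q)" by (metis prod_cases3)
  from schur_decomposition[OF A es(1) s]
  have w: "similar_mat_wit A B P Q" and u: "upper_triangular B" and d: "diag_mat B = es" by auto
  note c = similar_mat_witD2[OF A w]
  have "Determinant.det A = Determinant.det B"
    using w by (intro det_similar) (auto simp: similar_mat_def)
  also have "\<dots> = prod_list es" using det_upper_triangular[OF u c(5)] d by simp
  finally have 1: "Determinant.det A = prod_list es" .
  have "(\<Sum>i<n. A $$ (i, i)) = (\<Sum>i<n. (P * (B * Q)) $$ (i, i))" using c by simp
  also have "\<dots> = (\<Sum>i<n. ((B * Q) * P) $$ (i, i))" using c by (intro trace_mult_commute) auto
  also have "(B * Q) * P = B" using c by simp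
  also have "(\<Sum>i<n. B $$ (i, i)) = sum_list es"
    unfolding d[symmetric] using c(5)
    by (simp add: diag_mat_def interv_sum_list_conv_sum_set_nat atLeast0LessThan)
  finally have 2: "(\<Sum>i<n. A $$ (i, i)) = sum_list es" .
  have 3: "eigenvalue A e" if "e \<in> set es" for e
  proof -
    have "poly (char_poly A) e = 0" unfolding es(1) poly_prod_list using that
      by (auto simp: prod_list_zero_iff)
    then show ?thesis using eigenvalue_root_char_poly[OF A] by simp
  qed
  show ?thesis using that[OF es(2) 3 1 2] .
qed

lemma pd_det_trace:
  assumes a: "pd n a" and b: "pd n b"
  obtains rs where "length rs = n" "\<And>r. r \<in> set rs \<Longrightarrow> 0 < r"
    "Determinant.det (fmat n a) * Determinant.det (fmat n b) = of_real (prod_list rs)"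
    "(\<Sum>i<n. \<Sum>k<n. a i k * b k i) = of_real (sum_list rs)"
proof -
  let ?C = "fmat n a * fmat n b"
  have C: "?C \<in> carrier_mat n n" by (rule mult_carrier_mat[where n = n]) auto
  obtain es where es: "length es = n" "\<And>e. e \<in> set es \<Longrightarrow> eigenvalue ?C e"
    "Determinant.det ?C = prod_list es" "(\<Sum>i<n. ?C $$ (i, i)) = sum_list es"
    by (rule det_trace_eigenvalues[OF C]) blast
  have pos: "\<exists>r>0. e = of_real r" if e: "e \<in> set es" for e
  proof -
    obtain u where u: "u \<in> carrier_vec n" "u \<noteq> 0\<^sub>v n" "?C *\<^sub>v u = e \<cdot>\<^sub>v u"
      using es(2)[OF e] C unfolding eigenvalue_def eigenvector_def by auto
    define v where "v = vec_index u"
    have nz: "\<exists>i<n. v i \<noteq> 0"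
    proof (rule ccontr)
      assume "\<not> ?thesis"
      then have "u = 0\<^sub>v n" using u(1) by (intro eq_vecI) (auto simp: v_def)
      then show False using u(2) by simp
    qed
    have "(\<Sum>k<n. a i k * (\<Sum>j<n. b k j * v j)) = e * v i" if i: "i < n" for i
    proof -
      have "?C *\<^sub>v u = fmat n a *\<^sub>v (fmat n b *\<^sub>v u)"
        using u(1) by (intro assoc_mult_mat_vec) auto
      then have "vec_index (fmat n a *\<^sub>v (fmat n b *\<^sub>v u)) i = vec_index (e \<cdot>\<^sub>v u) i" using u(3) by simp
      moreover have "vec_index (fmat n a *\<^sub>v (fmat n b *\<^sub>v u)) i = (\<Sum>k<n. a i k * (\<Sum>j<n. b k j * v j))"
        using u(1) i by (simp add: scalar_prod_def lessThan_atLeast0 v_def)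
      ultimately show ?thesis using i u(1) by (simp add: v_def)
    qed
    then show ?thesis using pd_eigenvalue[OF a b nz] by blast
  qed
  have posRe: "e = of_real (Re e) \<and> 0 < Re e" if "e \<in> set es" for e
    using pos[OF that] by auto
  define rs where "rs = map Re es"
  have es_rs: "es = map of_real rs"
    unfolding rs_def map_map by (rule map_idI[symmetric]) (use posRe in \<open>simp add: o_def\<close>)
  have "prod_list es = of_real (prod_list rs)" "sum_list es = of_real (sum_list rs)"
    unfolding es_rs by (induction rs) auto
  moreover have "Determinant.det ?C = Determinant.det (fmat n a) * Determinant.det (fmat n b)"
    by (rule det_mult) auto
  moreover have "(\<Sum>i<n. ?C $$ (i, i)) = (\<Sum>i<n. \<Sum>k<n. a i k * b k i)"
    by (intro sum.cong) (auto simp: scalar_prod_def lessThan_atLeast0)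
  moreover have "0 < r" if "r \<in> set rs" for r
    using that posRe unfolding rs_def by (metis imageE list.set_map)
  moreover have "length rs = n" using es(1) by (simp add: rs_def)
  ultimately show ?thesis using that[of rs] es(3,4) by simp
qed

text \<open>Apply r <= exp (r - 1) to each factor. Together with \<open>pd_det_trace\<close> it
  bounds a product of two determinants by the exponential of a trace minus the dimension.\<close>

lemma prod_list_le_exp:
  fixes rs :: "real list"
  assumes "\<And>r. r \<in> set rs \<Longrightarrow> 0 < r"
  shows "prod_list rs \<le> exp (sum_list rs - real (length rs))"
  using assms
proof (induction rs)
  case (Cons r rs)
  have "r \<le> exp (r - 1)" using exp_ge_add_one_self[of "r - 1"] by simp
  moreover have "0 \<le> prod_list rs" using Cons.prems by (intro prod_list_nonneg) force
  ultimately have "r * prod_list rs \<le> exp (r - 1) * exp (sum_list rs - real (length rs))"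
    using Cons by (intro mult_mono) auto
  also have "\<dots> = exp ((r - 1) + (sum_list rs - real (length rs)))" by (simp only: exp_add)
  finally show ?case by (simp add: algebra_simps)
qed simp

section \<open>The determinantal structure of the spherical ensemble\<close>

text \<open>Spinor coordinates: (\<open>spa x\<close>, \<open>spb x\<close>) is a unit vector of $C^2$ over \<open>x\<close> in the Hopf
  fibration, so $|x - y|$ becomes a determinant. The north pole is treated apart, as \<open>spa\<close> vanishes there.\<close>

definition spa :: "real^3 \<Rightarrow> complex" where
  "spa x = of_real (sqrt ((1 - x$3) / 2))"

definition spb :: "real^3 \<Rightarrow> complex" where
  "spb x = (if x$3 = 1 then 1 else Complex (x$1) (x$2) / (2 * spa x))"

lemma X_coords: "x \<in> X \<Longrightarrow> (x$1)\<^sup>2 + (x$2)\<^sup>2 + (x$3)\<^sup>2 = 1"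
  by (simp add: norm_vec_def L2_set_def sum_3)

lemma X_third: assumes "x \<in> X" shows "-1 \<le> x$3" "x$3 \<le> 1"
  using component_le_norm_cart[of x 3] assms by auto

lemma spa_norm: "x \<in> X \<Longrightarrow> (cmod (spa x))\<^sup>2 = (1 - x$3) / 2"
  using X_third[of x] by (simp add: spa_def)

lemma spa_cnj [simp]: "cnj (spa x) = spa x"
  by (simp add: spa_def)

lemma spb_spa: assumes "x \<in> X" shows "spb x * spa x = Complex (x$1) (x$2) / 2"
proof (cases "x$3 = 1")
  case True
  then have "(x$1)\<^sup>2 + (x$2)\<^sup>2 = 0" using X_coords[OF assms] by simp
  then have "x$1 = 0" "x$2 = 0" by (auto simp: sum_power2_eq_zero_iff)
  then show ?thesis using True by (simp add: spa_def complex_eq_iff)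
next
  case False
  then have "spa x \<noteq> 0" using X_third[OF assms] by (auto simp: spa_def)
  then show ?thesis using False by (simp add: spb_def)
qed

lemma spb_norm: assumes "x \<in> X" shows "(cmod (spb x))\<^sup>2 = (1 + x$3) / 2"
proof (cases "x$3 = 1")
  case True then show ?thesis by (simp add: spb_def)
next
  case False
  have c: "(x$1)\<^sup>2 + (x$2)\<^sup>2 = (1 - x$3) * (1 + x$3)" using X_coords[OF assms] by (simp add: algebra_simps power2_eq_square)
  have "(cmod (spb x))\<^sup>2 * (cmod (spa x))\<^sup>2 = (cmod (spb x * spa x))\<^sup>2"
    by (simp add: norm_mult power_mult_distrib)
  also have "\<dots> = ((x$1)\<^sup>2 + (x$2)\<^sup>2) / 4"
    unfolding spb_spa[OF assms] by (simp add: norm_divide power_divide cmod_power2)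
  also have "\<dots> = ((1 + x$3) / 2) * ((1 - x$3) / 2)" unfolding c by simp
  finally have "(cmod (spb x))\<^sup>2 * ((1 - x$3) / 2) = ((1 + x$3) / 2) * ((1 - x$3) / 2)"
    by (simp add: spa_norm[OF assms])
  moreover have "(1 - x$3) / 2 \<noteq> 0" using False by simp
  ultimately show ?thesis by (metis mult_right_cancel)
qed

lemma sp_inner: assumes x: "x \<in> X" and y: "y \<in> X"
  shows "(cmod (spa x * cnj (spa y) + spb x * cnj (spb y)))\<^sup>2 = qq x y"
proof -
  have "(cmod (spa x * cnj (spa y) + spb x * cnj (spb y)))\<^sup>2
     = (cmod (spa x))\<^sup>2 * (cmod (spa y))\<^sup>2 + (cmod (spb x))\<^sup>2 * (cmod (spb y))\<^sup>2
      + 2 * Re ((spb x * spa x) * cnj (spb y * spa y))"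
  proof -
    have "complex_of_real ((cmod (spa x * cnj (spa y) + spb x * cnj (spb y)))\<^sup>2)
      = complex_of_real ((cmod (spa x))\<^sup>2 * (cmod (spa y))\<^sup>2 + (cmod (spb x))\<^sup>2 * (cmod (spb y))\<^sup>2)
        + ((spb x * spa x) * cnj (spb y * spa y) + cnj ((spb x * spa x) * cnj (spb y * spa y)))"
      unfolding of_real_add of_real_mult complex_norm_square by (simp add: algebra_simps)
    also have "\<dots> = complex_of_real ((cmod (spa x))\<^sup>2 * (cmod (spa y))\<^sup>2 + (cmod (spb x))\<^sup>2 * (cmod (spb y))\<^sup>2
        + 2 * Re ((spb x * spa x) * cnj (spb y * spa y)))"
      unfolding complex_add_cnj by simp
    finally show ?thesis by (simp only: of_real_eq_iff)
  qed
  also have "\<dots> = qq x y"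
    unfolding spb_spa[OF x] spb_spa[OF y] spa_norm[OF x] spa_norm[OF y] spb_norm[OF x] spb_norm[OF y]
    by (simp add: qq_def inner_vec_def sum_3 field_simps)
  finally show ?thesis .
qed

text \<open>Lagrange's identity in C^2: the squared moduli of the determinant and of the Hermitian
  product of two unit vectors add up to 1.\<close>

lemma sp_det: assumes x: "x \<in> X" and y: "y \<in> X"
  shows "(cmod (spa x * spb y - spa y * spb x))\<^sup>2 = 1 - qq x y"
proof -
  have "complex_of_real ((cmod (spa x * spb y - spa y * spb x))\<^sup>2 + (cmod (spa x * cnj (spa y) + spb x * cnj (spb y)))\<^sup>2)
    = complex_of_real (((cmod (spa x))\<^sup>2 + (cmod (spb x))\<^sup>2) * ((cmod (spa y))\<^sup>2 + (cmod (spb y))\<^sup>2))"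
    unfolding of_real_add of_real_mult complex_norm_square by (simp add: algebra_simps)
  then have "(cmod (spa x * spb y - spa y * spb x))\<^sup>2 + qq x y = 1"
    unfolding sp_inner[OF x y, symmetric] of_real_eq_iff spa_norm[OF x] spa_norm[OF y] spb_norm[OF x] spb_norm[OF y]
    by (simp add: field_simps)
  then show ?thesis by simp
qed

lemma sp_le_1: assumes "x \<in> X" shows "cmod (spa x) \<le> 1" "cmod (spb x) \<le> 1"
proof -
  have "(cmod (spa x))\<^sup>2 \<le> 1" "(cmod (spb x))\<^sup>2 \<le> 1"
    unfolding spa_norm[OF assms] spb_norm[OF assms] using X_third[OF assms] by auto
  then show "cmod (spa x) \<le> 1" "cmod (spb x) \<le> 1" by (auto simp: power2_le_imp_le abs_square_le_1)
qed

lemma measurable_nth [measurable]: "(\<lambda>x::real^3. x $ k) \<in> borel_measurable (restrict_space borel X)"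
  by (intro measurable_contX continuous_intros)

lemma measurable_sp [measurable]: "spa \<in> borel_measurable (restrict_space borel X)" "spb \<in> borel_measurable (restrict_space borel X)"
proof -
  show a [measurable]: "spa \<in> borel_measurable (restrict_space borel X)" unfolding spa_def by measurable
  have "spb = (\<lambda>x. if x$3 = 1 then 1 else (of_real (x$1) + \<i> * of_real (x$2)) / (2 * spa x))"
    by (simp add: spb_def fun_eq_iff complex_eq_iff Complex_eq)
  also have "\<dots> \<in> borel_measurable (restrict_space borel X)" by measurable
  finally show "spb \<in> borel_measurable (restrict_space borel X)" .
qed

lemma sp_stereo: "spa (stereo 1 u) = of_real (sqrt (rw u))"
  "spb (stereo 1 u) = of_real (sqrt (rw u)) * Complex (u$1) (u$2)"
proof -
  show a: "spa (stereo 1 u) = of_real (sqrt (rw u))" by (simp add: spa_def stereo_components)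
  have w: "0 < rw u" by (rule rw_pos)
  have "Complex (2 * (u$1) * rw u) (2 * (u$2) * rw u) = of_real (sqrt (rw u)) * Complex (u$1) (u$2) * (2 * of_real (sqrt (rw u)))"
    using w by (simp add: complex_eq_iff power2_eq_square[symmetric])
  then show "spb (stereo 1 u) = of_real (sqrt (rw u)) * Complex (u$1) (u$2)"
    using w unfolding spb_def a by (simp add: stereo_components)
qed

section \<open>Orthonormal spinor monomials and their kernel\<close>

lemma integral_sigma_X_chart':
  fixes f :: "real^3 \<Rightarrow> complex"
  assumes f [measurable]: "f \<in> borel_measurable (restrict_space borel X)"
  shows "(\<integral>x. f x \<partial>sigma_X) = (1 / (4 * pi)) *\<^sub>R (\<integral>u. (4 * (rw u)\<^sup>2) *\<^sub>R f (stereo 1 u) \<partial>lborel)"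
proof -
  have d: "f \<in> borel_measurable dVg" using assms sets_dVg measurable_cong_sets by blast
  have "(\<integral>x. f x \<partial>sigma_X) = (\<integral>x. (1 / (4 * pi)) *\<^sub>R f x \<partial>dVg)"
    unfolding sigma_X_def scale_measure_eq_density using d by (subst integral_density) auto
  also have "\<dots> = (1 / (4 * pi)) *\<^sub>R (\<integral>x. f x \<partial>dVg)" by simp
  also have "(\<integral>x. f x \<partial>dVg) = (\<integral>u. (4 * (rw u)\<^sup>2) *\<^sub>R f (stereo 1 u) \<partial>lborel)"
    unfolding dVg_eq by (subst integral_distr) (auto simp: integral_density)
  finally show ?thesis .
qed

lemma measurable_orthogonal:
  fixes T :: "real^2 \<Rightarrow> real^2"
  assumes T: "orthogonal_transformation T"
  shows "T \<in> borel_measurable borel"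
proof (intro borel_measurable_continuous_onI linear_continuous_on)
  show "bounded_linear T" using orthogonal_transformation_linear[OF T] linear_conv_bounded_linear by blast
qed

lemma lborel_orthogonal:
  fixes T :: "real^2 \<Rightarrow> real^2"
  assumes T: "orthogonal_transformation T"
  shows "distr lborel borel T = lborel"
proof (rule sym, rule lborel_eqI)
  have cT: "T \<in> borel_measurable borel" using T by (rule measurable_orthogonal)
  fix l u :: "real^2" assume lu: "\<And>b. b \<in> Basis \<Longrightarrow> l \<bullet> b \<le> u \<bullet> b"
  have S: "inv_into UNIV T ` box l u \<in> lmeasurable" "measure lebesgue (inv_into UNIV T ` box l u) = measure lebesgue (box l u)"
    using measurable_orthogonal_image[OF orthogonal_transformation_inv[OF T] lmeasurable_box]
      measure_orthogonal_image[OF orthogonal_transformation_inv[OF T] lmeasurable_box] by blast+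
  have e: "T -` box l u = inv_into UNIV T ` box l u"
    using orthogonal_transformation_bij[OF T] by (simp add: bij_vimage_eq_inv_image)
  have b: "T -` box l u \<in> sets borel" using measurable_sets[OF cT, of "box l u"] by simp
  have "emeasure (distr lborel borel T) (box l u) = emeasure lborel (T -` box l u)"
    using cT by (subst emeasure_distr) auto
  also have "\<dots> = emeasure lebesgue (T -` box l u)" using b by simp
  also have "\<dots> = ennreal (measure lebesgue (inv_into UNIV T ` box l u))"
    unfolding e by (rule emeasure_eq_measure2[OF S(1)])
  also have "\<dots> = emeasure lborel (box l u)"
    unfolding S(2) by (simp add: emeasure_eq_measure2)
  also have "\<dots> = ennreal (\<Prod>b\<in>Basis. (u - l) \<bullet> b)"
    using lu by (rule emeasure_lborel_box)
  finally show "emeasure (distr lborel borel T) (box l u) = ennreal (\<Prod>b\<in>Basis. (u - l) \<bullet> b)" .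
qed simp

definition rot :: "real \<Rightarrow> real^2 \<Rightarrow> real^2" where
  "rot t u = v2 (cos t * u$1 - sin t * u$2) (sin t * u$1 + cos t * u$2)"

lemma rot_orthogonal: "orthogonal_transformation (rot t)"
proof -
  have "linear (rot t)"
    by (rule linearI) (simp_all add: rot_def Finite_Cartesian_Product.vec_eq_iff forall_2 algebra_simps)
  moreover have "rot t u \<bullet> rot t v = u \<bullet> v" for u v
  proof -
    have "(c * a - s * b) * (c * a' - s * b') + (s * a + c * b) * (s * a' + c * b') = (s\<^sup>2 + c\<^sup>2) * (a * a' + b * b')"
      for a b a' b' c s :: real by (simp add: algebra_simps power2_eq_square)
    then show ?thesis by (simp add: rot_def inner_vec_def sum_2)
  qed
  ultimately show ?thesis unfolding orthogonal_transformation_def by blast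
qed

lemma rw_rot: "rw (rot t u) = rw u"
  using rot_orthogonal[of t] by (simp add: rw_def orthogonal_transformation_norm)

lemma Complex_rot: "Complex (rot t u $ 1) (rot t u $ 2) = cis t * Complex (u$1) (u$2)"
  by (simp add: rot_def complex_eq_iff)

text \<open>The monomials of degree n in the spinor coordinates, normalized by the beta integral
  below. There are n + 1 of them: the ensemble has N = \<open>Suc n\<close> points, and the degree n
  is N - 1.\<close>

definition psi :: "nat \<Rightarrow> nat \<Rightarrow> real^3 \<Rightarrow> complex" where
  "psi n k x = of_real (sqrt (real (Suc n) * real (n choose k))) * (spa x ^ (n - k) * spb x ^ k)"

lemma measurable_cnj [measurable]: "cnj \<in> borel_measurable borel"
  by (intro borel_measurable_continuous_onI continuous_intros)

lemma psi_measurable [measurable]: "psi n k \<in> borel_measurable (restrict_space borel X)"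
  unfolding psi_def by measurable

lemma psi_bounded: "x \<in> X \<Longrightarrow> cmod (psi n k x) \<le> sqrt (real (Suc n) * real (n choose k))"
proof -
  assume x: "x \<in> X"
  have "cmod (spa x ^ (n - k) * spb x ^ k) \<le> 1 * 1"
    unfolding norm_mult norm_power using sp_le_1[OF x] by (intro mult_mono power_le_one) auto
  then show ?thesis unfolding psi_def norm_mult by (simp add: mult_left_le)
qed

lemma integrable_bounded_sigma:
  fixes f :: "real^3 \<Rightarrow> 'b::{banach, second_countable_topology}"
  assumes "f \<in> borel_measurable (restrict_space borel X)" "\<And>x. x \<in> X \<Longrightarrow> norm (f x) \<le> B"
  shows "integrable sigma_X f"
  using assms by (intro sigma.integrable_const_bound[where B = B]) auto

text \<open>Induction on j by splitting off a factor 1 - q. For z the north pole, q and 1 - q are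
  the squared moduli of \<open>spb\<close> and \<open>spa\<close>, so these integrals give the norms
  of the monomials.\<close>

lemma beta_moments:
  assumes z: "z \<in> X"
  shows "(\<integral>x. qq z x ^ k * (1 - qq z x) ^ j \<partial>sigma_X) = fact k * fact j / fact (k + j + 1)"
proof (induction j arbitrary: k)
  case 0
  have f: "(fact (k + 0 + 1) :: real) = (real k + 1) * fact k" by (simp add: algebra_simps)
  show ?case unfolding f using moments[OF z, of k] by simp
next
  case (Suc j)
  have i: "integrable sigma_X (\<lambda>x. qq z x ^ k * (1 - qq z x) ^ j)" for k
    by (intro integrable_contX continuous_intros continuous_qq)
  have "(\<integral>x. qq z x ^ k * (1 - qq z x) ^ Suc j \<partial>sigma_X)
     = (\<integral>x. qq z x ^ k * (1 - qq z x) ^ j - qq z x ^ Suc k * (1 - qq z x) ^ j \<partial>sigma_X)"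
    by (simp add: algebra_simps)
  also have "\<dots> = fact k * fact j / fact (k + j + 1) - fact (Suc k) * fact j / fact (Suc k + j + 1)"
    by (subst Bochner_Integration.integral_diff[OF i i]) (simp only: Suc)
  also have "\<dots> = fact k * fact j * (real (k + j + 2) - real (k + 1)) / fact (k + j + 2)"
  proof -
    have f: "(fact (Suc k + j + 1) :: real) = real (k + j + 2) * fact (k + j + 1)"
      "(fact (k + j + 2) :: real) = real (k + j + 2) * fact (k + j + 1)"
      "(fact (Suc k) :: real) = real (k + 1) * fact k"
      by (simp_all add: algebra_simps)
    have g: "a / G - c * a / (m * G) = a * (m - c) / (m * G)" if "G \<noteq> 0" "m \<noteq> 0" for a c m G :: real
      using that by (simp add: field_simps)
    from g[of "fact (k + j + 1)" "real (k + j + 2)" "fact k * fact j" "real (k + 1)"]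
    show ?thesis unfolding f by (simp only: mult.assoc) simp
  qed
  also have "\<dots> = fact k * fact (Suc j) / fact (k + Suc j + 1)"
    by (simp add: algebra_simps)
  finally show ?case .
qed

text \<open>The diagonal case is \<open>beta_moments\<close> at the north pole. Off the diagonal,
  rotating the chart by t multiplies the integrand by the phase exp (i (j - k) t); the angle t =
  pi/(j - k) makes it -1, so the integral equals its negative.\<close>

lemma psi_orthonormal:
  assumes j: "j \<le> n" and k: "k \<le> n"
  shows "(\<integral>x. psi n j x * cnj (psi n k x) \<partial>sigma_X) = (if j = k then 1 else 0)"
proof (cases "j = k")
  case True
  define z :: "real^3" where "z = axis 3 1"
  have z: "z \<in> X" by (simp add: z_def)
  have q: "qq z x = (1 + x$3) / 2" for x by (simp add: qq_def z_def inner_axis')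
  have "(\<integral>x. psi n k x * cnj (psi n k x) \<partial>sigma_X)
      = (\<integral>x. of_real ((real (Suc n) * real (n choose k)) * (qq z x ^ k * (1 - qq z x) ^ (n - k))) \<partial>sigma_X)"
  proof (rule Bochner_Integration.integral_cong)
    fix x assume "x \<in> space sigma_X"
    then have x: "x \<in> X" by simp
    have "psi n k x * cnj (psi n k x) = of_real ((cmod (psi n k x))\<^sup>2)" by (simp only: complex_norm_square)
    also have "(cmod (psi n k x))\<^sup>2 = (real (Suc n) * real (n choose k)) * (((cmod (spb x))\<^sup>2) ^ k * ((cmod (spa x))\<^sup>2) ^ (n - k))"
      by (simp add: psi_def norm_mult norm_power power_mult_distrib power_mult[symmetric] mult.commute)
    also have "((cmod (spb x))\<^sup>2) ^ k * ((cmod (spa x))\<^sup>2) ^ (n - k) = qq z x ^ k * (1 - qq z x) ^ (n - k)"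
      unfolding spa_norm[OF x] spb_norm[OF x] q by (simp add: field_simps)
    finally show "psi n k x * cnj (psi n k x) = of_real ((real (Suc n) * real (n choose k)) * (qq z x ^ k * (1 - qq z x) ^ (n - k)))" .
  qed simp
  also have "\<dots> = of_real ((real (Suc n) * real (n choose k)) * (fact k * fact (n - k) / fact (k + (n - k) + 1)))"
    by (simp only: integral_complex_of_real integral_mult_right_zero beta_moments[OF z])
  also have "(real (Suc n) * real (n choose k)) * (fact k * fact (n - k) / fact (k + (n - k) + 1)) = 1"
  proof -
    have "real (n choose k) = fact n / (fact k * fact (n - k))" using k by (rule binomial_fact)
    moreover have "(fact (k + (n - k) + 1) :: real) = real (Suc n) * fact n" using k by (simp add: algebra_simps)
    ultimately show ?thesis by (simp del: of_nat_Suc)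
  qed
  finally show ?thesis using True by simp
next
  case False
  define t where "t = pi / (real j - real k)"
  define g where "g = (\<lambda>u. (4 * (rw u)\<^sup>2) *\<^sub>R (psi n j (stereo 1 u) * cnj (psi n k (stereo 1 u))))"
  have gm: "g \<in> borel_measurable borel" unfolding g_def by measurable
  have rm: "rot t \<in> borel_measurable borel"
    by (rule measurable_orthogonal[OF rot_orthogonal])
  have ph: "cis t ^ j * cnj (cis t ^ k) = -1"
  proof -
    have "cis t ^ j * cnj (cis t ^ k) = cis (real j * t - real k * t)"
    proof -
      have "cis t ^ j * cnj (cis t ^ k) = cis (real j * t) * cis (real k * (- t))"
        by (simp only: complex_cnj_power cis_cnj Complex.DeMoivre mult_minus_right)
      then show ?thesis unfolding cis_mult by simp
    qed
    also have "real j * t - real k * t = (real j - real k) * t" by (simp add: left_diff_distrib)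
    also have "\<dots> = pi" using False by (simp add: t_def)
    finally show ?thesis by simp
  qed
  have gr: "g (rot t u) = - g u" for u
  proof -
    define c d where "c = complex_of_real (sqrt (real (Suc n) * real (n choose j)))" and "d = complex_of_real (sqrt (real (Suc n) * real (n choose k)))"
    define w z where "w = complex_of_real (sqrt (rw u))" and "z = Complex (u$1) (u$2)"
    have gu: "g v = (4 * (rw v)\<^sup>2) *\<^sub>R ((c * (complex_of_real (sqrt (rw v)) ^ (n - j) * (complex_of_real (sqrt (rw v)) * Complex (v$1) (v$2)) ^ j))
       * cnj (d * (complex_of_real (sqrt (rw v)) ^ (n - k) * (complex_of_real (sqrt (rw v)) * Complex (v$1) (v$2)) ^ k)))" for v
      unfolding g_def psi_def sp_stereo c_def d_def ..
    have "g (rot t u) = (4 * (rw u)\<^sup>2) *\<^sub>R ((c * (w ^ (n - j) * (w * (cis t * z)) ^ j)) * cnj (d * (w ^ (n - k) * (w * (cis t * z)) ^ k)))"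
      unfolding gu rw_rot Complex_rot w_def z_def ..
    also have "(c * (w ^ (n - j) * (w * (cis t * z)) ^ j)) * cnj (d * (w ^ (n - k) * (w * (cis t * z)) ^ k))
      = (cis t ^ j * cnj (cis t ^ k)) * ((c * (w ^ (n - j) * (w * z) ^ j)) * cnj (d * (w ^ (n - k) * (w * z) ^ k)))"
      by (simp add: power_mult_distrib mult_ac)
    also have "(4 * (rw u)\<^sup>2) *\<^sub>R \<dots> = - g u" unfolding ph gu w_def z_def by simp
    finally show ?thesis .
  qed
  have "(\<integral>u. g u \<partial>lborel) = (\<integral>u. g u \<partial>(distr lborel borel (rot t)))"
    by (simp add: lborel_orthogonal[OF rot_orthogonal])
  also have "\<dots> = (\<integral>u. g (rot t u) \<partial>lborel)" using gm rm by (subst integral_distr) auto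
  also have "\<dots> = - (\<integral>u. g u \<partial>lborel)" by (simp add: gr)
  finally have "(\<integral>u. g u \<partial>lborel) = 0" by simp
  moreover have "(\<integral>x. psi n j x * cnj (psi n k x) \<partial>sigma_X) = (1 / (4 * pi)) *\<^sub>R (\<integral>u. g u \<partial>lborel)"
    unfolding g_def by (rule integral_sigma_X_chart') measurable
  ultimately show ?thesis using False by simp
qed

text \<open>The binomial theorem. By \<open>sp_inner\<close> the squared modulus of this kernel is
  (n + 1)^2 q^n, which is how powers of q enter the ensemble.\<close>

lemma psi_kernel:
  assumes x: "x \<in> X" and y: "y \<in> X"
  shows "(\<Sum>k<Suc n. psi n k x * cnj (psi n k y)) = of_nat (Suc n) * (spa x * cnj (spa y) + spb x * cnj (spb y)) ^ n"
proof -
  have "psi n k x * cnj (psi n k y) = of_nat (Suc n) * (of_nat (n choose k) * (spb x * cnj (spb y)) ^ k * (spa x * cnj (spa y)) ^ (n - k))" for k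
  proof -
    define c where "c = complex_of_real (sqrt (real (Suc n) * real (n choose k)))"
    define p r p' r' where "p = spa x ^ (n - k)" and "r = spb x ^ k" and "p' = cnj (spa y) ^ (n - k)" and "r' = cnj (spb y) ^ k"
    have cc: "c * c = of_nat (Suc n) * of_nat (n choose k)"
      unfolding c_def of_real_mult[symmetric] real_sqrt_mult_self by (simp del: of_nat_Suc)
    have "psi n k x * cnj (psi n k y) = (c * (p * r)) * (c * (p' * r'))"
      by (simp add: psi_def c_def p_def r_def p'_def r'_def)
    also have "\<dots> = (c * c) * ((r * r') * (p * p'))" by (simp only: mult_ac)
    also have "\<dots> = of_nat (Suc n) * (of_nat (n choose k) * (r * r') * (p * p'))"
      unfolding cc by (simp only: mult.assoc)
    finally show ?thesis by (simp only: p_def r_def p'_def r'_def power_mult_distrib)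
  qed
  then have "(\<Sum>k<Suc n. psi n k x * cnj (psi n k y))
     = of_nat (Suc n) * (\<Sum>k\<le>n. of_nat (n choose k) * (spb x * cnj (spb y)) ^ k * (spa x * cnj (spa y)) ^ (n - k))"
    by (simp only: sum_distrib_left lessThan_Suc_atMost)
  also have "\<dots> = of_nat (Suc n) * (spb x * cnj (spb y) + spa x * cnj (spa y)) ^ n"
    by (simp only: binomial_ring)
  finally show ?thesis by (simp add: add.commute)
qed

section \<open>Determinantal integrals over the product measure\<close>

interpretation PS: product_sigma_finite "\<lambda>_::nat. sigma_X"
  by standard

definition PN :: "nat \<Rightarrow> (nat \<Rightarrow> real^3) measure" where
  "PN N = (\<Pi>\<^sub>M i\<in>{1..N}. sigma_X)"

lemma space_PN: "space (PN N) = ({1..N} \<rightarrow>\<^sub>E X)"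
  by (simp add: PN_def space_PiM)

lemma space_PN_D: "x \<in> space (PN N) \<Longrightarrow> x \<in> {1..N} \<rightarrow> X"
  unfolding space_PN PiE_def by blast

lemma emeasure_PN: "emeasure (PN N) (space (PN N)) = 1"
proof -
  have "emeasure (PN N) (space (PN N)) = emeasure (PN N) ({1..N} \<rightarrow>\<^sub>E space sigma_X)"
    by (simp add: space_PN)
  also have "\<dots> = 1" unfolding PN_def
    by (subst PS.emeasure_PiM) (auto simp del: space_sigma_X, simp add: prob_sigma_X)
  finally show ?thesis .
qed

interpretation PN: finite_measure "PN N"
  by standard (simp add: emeasure_PN)

lemma measure_PN [simp]: "measure (PN N) (space (PN N)) = 1"
  by (simp add: measure_def emeasure_PN)

lemma prod_integral_PN:
  fixes f :: "nat \<Rightarrow> real^3 \<Rightarrow> complex"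
  assumes "\<And>i. i < N \<Longrightarrow> integrable sigma_X (f i)"
  shows "integrable (PN N) (\<lambda>x. \<Prod>i<N. f i (x (Suc i)))"
    and "(\<integral>x. (\<Prod>i<N. f i (x (Suc i))) \<partial>(PN N)) = (\<Prod>i<N. \<integral>y. f i y \<partial>sigma_X)"
proof -
  have e: "(\<Prod>i<N. f i (x (Suc i))) = (\<Prod>i\<in>{1..N}. f (i - 1) (x i))" for x
    by (simp add: prod.atLeast1_atMost_eq)
  have i: "integrable sigma_X (f (i - 1))" if "i \<in> {1..N}" for i using assms that by auto
  show "integrable (PN N) (\<lambda>x. \<Prod>i<N. f i (x (Suc i)))"
    unfolding e PN_def by (rule PS.product_integrable_prod) (use i in auto)
  show "(\<integral>x. (\<Prod>i<N. f i (x (Suc i))) \<partial>(PN N)) = (\<Prod>i<N. \<integral>y. f i y \<partial>sigma_X)"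
    unfolding e PN_def by (subst PS.product_integral_prod) (use i in \<open>auto simp: prod.atLeast1_atMost_eq\<close>)
qed

text \<open>Matrix indices start at 0 and points are numbered from 1, hence the shift
  \<open>Suc i\<close>.\<close>

definition vdm :: "nat \<Rightarrow> (nat \<Rightarrow> real^3) \<Rightarrow> complex" where
  "vdm n x = Determinant.det (fmat (Suc n) (\<lambda>i j. psi n j (x (Suc i))))"

lemma det_fmat: "Determinant.det (fmat N a) = (\<Sum>p | p permutes {0..<N}. signof p * (\<Prod>i<N. a i (p i)))"
proof -
  have "Determinant.det (fmat N a) = (\<Sum>p | p permutes {0..<N}. signof p * (\<Prod>i = 0..<N. fmat N a $$ (i, p i)))"
    by (rule det_def') auto
  also have "\<dots> = (\<Sum>p | p permutes {0..<N}. signof p * (\<Prod>i<N. a i (p i)))"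
  proof (intro sum.cong refl arg_cong2[where f = "(*)"] prod.cong)
    fix p i assume "p \<in> {p. p permutes {0..<N}}" "i \<in> {..<N}"
    then have "p i < N" "i < N" using permutes_in_image[of p "{0..<N}" i] by auto
    then show "fmat N a $$ (i, p i) = a i (p i)" by simp
  qed auto
  finally show ?thesis .
qed

lemma cnj_signof [simp]: "cnj (signof p) = signof p"
  by (simp add: sign_def)

lemma signof_square [simp]: "signof p * signof p = (1 :: complex)"
  by (simp add: sign_def)

text \<open>Both determinants are expanded over permutations, and each integral factors over the
  points. The weight may depend on the index because \<open>first_moment\<close> inserts a function
  at one point and 1 at all others.\<close>

lemma andreief_general:
  fixes w :: "nat \<Rightarrow> real^3 \<Rightarrow> complex" and n :: nat
  assumes w [measurable]: "\<And>i. w i \<in> borel_measurable (restrict_space borel X)" and B: "\<And>i x. x \<in> X \<Longrightarrow> cmod (w i x) \<le> B"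
  defines "T \<equiv> \<lambda>i j k. \<integral>y. w i y * (psi n j y * cnj (psi n k y)) \<partial>sigma_X"
  shows "(\<integral>x. (\<Prod>i<Suc n. w i (x (Suc i))) * (vdm n x * cnj (vdm n x)) \<partial>(PN (Suc n)))
     = (\<Sum>p | p permutes {0..<Suc n}. \<Sum>r | r permutes {0..<Suc n}. signof p * signof r * (\<Prod>i<Suc n. T i (p i) (r i)))"
    and "integrable (PN (Suc n)) (\<lambda>x. (\<Prod>i<Suc n. w i (x (Suc i))) * (vdm n x * cnj (vdm n x)))"
proof -
  let ?S = "{p. p permutes {0..<Suc n}}"
  have int: "integrable sigma_X (\<lambda>y. w i y * (psi n j y * cnj (psi n k y)))" for i j k
  proof (rule integrable_bounded_sigma)
    show "(\<lambda>y. w i y * (psi n j y * cnj (psi n k y))) \<in> borel_measurable (restrict_space borel X)" by measurable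
    fix x assume x: "x \<in> X"
    have "0 \<le> B" using B[OF x, of i] norm_ge_zero order_trans by blast
    then show "norm (w i x * (psi n j x * cnj (psi n k x))) \<le> B * (sqrt (real (Suc n) * real (n choose j)) * sqrt (real (Suc n) * real (n choose k)))"
      unfolding norm_mult complex_mod_cnj using B[OF x] psi_bounded[OF x] by (intro mult_mono) auto
  qed
  have e: "(\<Prod>i<Suc n. w i (x (Suc i))) * (vdm n x * cnj (vdm n x))
     = (\<Sum>p\<in>?S. \<Sum>r\<in>?S. (signof p * signof r) * (\<Prod>i<Suc n. w i (x (Suc i)) * (psi n (p i) (x (Suc i)) * cnj (psi n (r i) (x (Suc i))))))" for x
  proof -
    have "(\<Prod>i<Suc n. w i (x (Suc i))) * (vdm n x * cnj (vdm n x))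
      = (\<Prod>i<Suc n. w i (x (Suc i))) * ((\<Sum>p\<in>?S. signof p * (\<Prod>i<Suc n. psi n (p i) (x (Suc i)))) * (\<Sum>r\<in>?S. signof r * (\<Prod>i<Suc n. cnj (psi n (r i) (x (Suc i))))))"
      unfolding vdm_def det_fmat by (simp only: cnj_sum complex_cnj_mult cnj_prod cnj_signof)
    also have "\<dots> = (\<Sum>p\<in>?S. \<Sum>r\<in>?S. (\<Prod>i<Suc n. w i (x (Suc i))) * ((signof p * (\<Prod>i<Suc n. psi n (p i) (x (Suc i)))) * (signof r * (\<Prod>i<Suc n. cnj (psi n (r i) (x (Suc i)))))))"
      by (subst sum_product) (simp only: sum_distrib_left)
    also have "\<dots> = (\<Sum>p\<in>?S. \<Sum>r\<in>?S. (signof p * signof r) * (\<Prod>i<Suc n. w i (x (Suc i)) * (psi n (p i) (x (Suc i)) * cnj (psi n (r i) (x (Suc i))))))"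
      by (simp only: prod.distrib mult_ac)
    finally show ?thesis .
  qed
  have i1: "integrable (PN (Suc n)) (\<lambda>x. c * (\<Prod>i<Suc n. w i (x (Suc i)) * (psi n (p i) (x (Suc i)) * cnj (psi n (r i) (x (Suc i))))))" for p r c
    by (intro integrable_mult_right prod_integral_PN(1)[of "Suc n" "\<lambda>i y. w i y * (psi n (p i) y * cnj (psi n (r i) y))"] int)
  show "integrable (PN (Suc n)) (\<lambda>x. (\<Prod>i<Suc n. w i (x (Suc i))) * (vdm n x * cnj (vdm n x)))"
    unfolding e by (intro Bochner_Integration.integrable_sum i1)
  have "(\<integral>x. (\<Prod>i<Suc n. w i (x (Suc i))) * (vdm n x * cnj (vdm n x)) \<partial>(PN (Suc n)))
     = (\<Sum>p\<in>?S. \<Sum>r\<in>?S. \<integral>x. (signof p * signof r) * (\<Prod>i<Suc n. w i (x (Suc i)) * (psi n (p i) (x (Suc i)) * cnj (psi n (r i) (x (Suc i))))) \<partial>(PN (Suc n)))"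
    unfolding e by (subst Bochner_Integration.integral_sum, intro Bochner_Integration.integrable_sum i1)
       (intro sum.cong refl Bochner_Integration.integral_sum i1)
  also have "\<dots> = (\<Sum>p\<in>?S. \<Sum>r\<in>?S. signof p * signof r * (\<Prod>i<Suc n. T i (p i) (r i)))"
    unfolding T_def
    by (intro sum.cong refl, subst integral_mult_right_zero,
        subst prod_integral_PN(2)[of "Suc n" "\<lambda>i y. w i y * (psi n (p i) y * cnj (psi n (r i) y))" for p r, OF int]) (rule refl)
  finally show "(\<integral>x. (\<Prod>i<Suc n. w i (x (Suc i))) * (vdm n x * cnj (vdm n x)) \<partial>(PN (Suc n)))
     = (\<Sum>p\<in>?S. \<Sum>r\<in>?S. signof p * signof r * (\<Prod>i<Suc n. T i (p i) (r i)))" .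
qed

lemma card_perms: "card {p. p permutes {0..<N}} = fact N"
  using card_permutations[of "{0..<N}" N] by simp

lemma finite_perms: "finite {p. p permutes {0..<N::nat}}"
  by (rule finite_permutations) simp

text \<open>Andreief's identity. With equal weights the inner sum over r is the determinant with its
  rows permuted by p, which cancels the sign of p, so all N! permutations contribute
  equally.\<close>

lemma andreief:
  fixes w :: "real^3 \<Rightarrow> complex" and n :: nat
  assumes w: "w \<in> borel_measurable (restrict_space borel X)" and B: "\<And>x. x \<in> X \<Longrightarrow> cmod (w x) \<le> B"
  defines "T \<equiv> \<lambda>j k. \<integral>y. w y * (psi n j y * cnj (psi n k y)) \<partial>sigma_X"
  shows "(\<integral>x. (\<Prod>i<Suc n. w (x (Suc i))) * (vdm n x * cnj (vdm n x)) \<partial>(PN (Suc n)))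
     = of_nat (fact (Suc n)) * Determinant.det (fmat (Suc n) T)"
proof -
  let ?S = "{p. p permutes {0..<Suc n}}"
  have "(\<integral>x. (\<Prod>i<Suc n. w (x (Suc i))) * (vdm n x * cnj (vdm n x)) \<partial>(PN (Suc n)))
     = (\<Sum>p\<in>?S. \<Sum>r\<in>?S. signof p * signof r * (\<Prod>i<Suc n. T (p i) (r i)))"
    unfolding T_def by (rule andreief_general(1)[of "\<lambda>_. w" B]) (use w B in auto)
  also have "\<dots> = (\<Sum>p\<in>?S. signof p * (\<Sum>r\<in>?S. signof r * (\<Prod>i<Suc n. T (p i) (r i))))"
    by (simp only: sum_distrib_left mult.assoc)
  also have "\<dots> = (\<Sum>p\<in>?S. Determinant.det (fmat (Suc n) T))"
  proof (rule sum.cong)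
    fix p assume p: "p \<in> ?S"
    then have pi: "p i < Suc n \<longleftrightarrow> i < Suc n" for i using permutes_in_image[of p "{0..<Suc n}" i] by (simp only: mem_Collect_eq atLeastLessThan_iff) simp
    have "signof p * Determinant.det (fmat (Suc n) T) = Determinant.det (fmat (Suc n) (\<lambda>i j. fmat (Suc n) T $$ (p i, j)))"
      using p by (intro det_permute_rows[symmetric]) auto
    also have "fmat (Suc n) (\<lambda>i j. fmat (Suc n) T $$ (p i, j)) = fmat (Suc n) (\<lambda>i j. T (p i) j)"
      by (rule eq_matI) (auto simp: pi)
    also have "Determinant.det (fmat (Suc n) (\<lambda>i j. T (p i) j)) = (\<Sum>r\<in>?S. signof r * (\<Prod>i<Suc n. T (p i) (r i)))"
      by (rule det_fmat)
    finally show "signof p * (\<Sum>r\<in>?S. signof r * (\<Prod>i<Suc n. T (p i) (r i))) = Determinant.det (fmat (Suc n) T)"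
      by (metis (no_types, lifting) mult.assoc mult_1_left signof_square)
  qed simp
  also have "\<dots> = of_nat (fact (Suc n)) * Determinant.det (fmat (Suc n) T)"
    unfolding sum_constant card_perms by simp
  finally show ?thesis .
qed

text \<open>The sum over points is split into integrals with a single nontrivial weight. At every
  other index orthonormality forces p and r to agree, and permutations that agree off one index
  coincide; only p = r survives and yields a trace.\<close>

lemma first_moment:
  fixes u :: "real^3 \<Rightarrow> complex" and n :: nat
  assumes u: "u \<in> borel_measurable (restrict_space borel X)" and B: "\<And>x. x \<in> X \<Longrightarrow> cmod (u x) \<le> B"
  shows "(\<integral>x. (\<Sum>i<Suc n. u (x (Suc i))) * (vdm n x * cnj (vdm n x)) \<partial>(PN (Suc n)))
     = of_nat (fact (Suc n)) * (\<Sum>j<Suc n. \<integral>y. u y * (psi n j y * cnj (psi n j y)) \<partial>sigma_X)"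
    and "\<And>i. i < Suc n \<Longrightarrow> integrable (PN (Suc n)) (\<lambda>x. u (x (Suc i)) * (vdm n x * cnj (vdm n x)))"
proof -
  let ?S = "{p. p permutes {0..<Suc n}}"
  define U where "U = (\<lambda>j k. \<integral>y. u y * (psi n j y * cnj (psi n k y)) \<partial>sigma_X)"
  define w :: "nat \<Rightarrow> nat \<Rightarrow> real^3 \<Rightarrow> complex" where "w = (\<lambda>m i y. if i = m then u y else 1)"
  have wm: "w m i \<in> borel_measurable (restrict_space borel X)" for m i using u by (auto simp: w_def)
  have wB: "cmod (w m i x) \<le> max B 1" if "x \<in> X" for m i x using B[OF that] by (auto simp: w_def le_max_iff_disj)
  have we: "(\<Prod>i<Suc n. w m i (x (Suc i))) = u (x (Suc m))" if "m < Suc n" for m x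
    using that by (simp add: w_def prod.delta del: prod.lessThan_Suc)
  show int: "integrable (PN (Suc n)) (\<lambda>x. u (x (Suc m)) * (vdm n x * cnj (vdm n x)))" if "m < Suc n" for m
    using andreief_general(2)[of "w m" "max B 1" n, OF wm wB] unfolding we[OF that] .
  have one: "(\<integral>x. u (x (Suc m)) * (vdm n x * cnj (vdm n x)) \<partial>(PN (Suc n))) = (\<Sum>p\<in>?S. U (p m) (p m))" if m: "m < Suc n" for m
  proof -
    define T where "T = (\<lambda>i j k. \<integral>y. w m i y * (psi n j y * cnj (psi n k y)) \<partial>sigma_X)"
    have T: "T i j k = (if i = m then U j k else if j = k then 1 else 0)" if "j \<le> n" "k \<le> n" for i j k
      using psi_orthonormal[OF that] by (auto simp: T_def U_def w_def)
    have "(\<integral>x. u (x (Suc m)) * (vdm n x * cnj (vdm n x)) \<partial>(PN (Suc n)))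
       = (\<Sum>p\<in>?S. \<Sum>r\<in>?S. signof p * signof r * (\<Prod>i<Suc n. T i (p i) (r i)))"
      using andreief_general(1)[of "w m" "max B 1" n, OF wm wB] unfolding we[OF m] T_def .
    also have "\<dots> = (\<Sum>p\<in>?S. \<Sum>r\<in>?S. if r = p then U (p m) (p m) else 0)"
    proof (intro sum.cong refl)
      fix p r assume p: "p \<in> ?S" and r: "r \<in> ?S"
      have pi: "p i \<le> n" "r i \<le> n" if "i < Suc n" for i
        using permutes_in_image[of p "{0..<Suc n}" i] permutes_in_image[of r "{0..<Suc n}" i] p r that
        by (simp_all only: mem_Collect_eq atLeastLessThan_iff less_Suc_eq_le) simp_all
      show "signof p * signof r * (\<Prod>i<Suc n. T i (p i) (r i)) = (if r = p then U (p m) (p m) else 0)"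
      proof (cases "r = p")
        case True
        have "(\<Prod>i<Suc n. T i (p i) (p i)) = (\<Prod>i<Suc n. if i = m then U (p m) (p m) else 1)"
          using pi by (intro prod.cong) (auto simp: T)
        also have "\<dots> = U (p m) (p m)" using m by (simp add: prod.delta del: prod.lessThan_Suc)
        finally show ?thesis using True by simp
      next
        case False
        have "\<exists>i<Suc n. i \<noteq> m \<and> p i \<noteq> r i"
        proof (rule ccontr)
          assume "\<not> ?thesis"
          then have eq: "p i = r i" if "i < Suc n" "i \<noteq> m" for i using that by blast
          have "p m = r m"
          proof -
            obtain i where i: "i < Suc n" "r i = p m"
              using r m pi(1)[OF m] permutes_surj[of r "{0..<Suc n}"] permutes_in_image[of r "{0..<Suc n}"]
              by (metis (no_types, lifting) atLeastLessThan_iff le_imp_less_Suc mem_Collect_eq surjD zero_le)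
            show ?thesis
            proof (cases "i = m")
              case False
              then have "p i = p m" using eq i by simp
              then show ?thesis using False permutes_inj[of p "{0..<Suc n}"] p by (auto dest: injD)
            qed (use i in simp)
          qed
          then have a: "p i = r i" if "i < Suc n" for i using eq that by (cases "i = m") auto
          have b: "p i = r i" if "\<not> i < Suc n" for i
            using p r that by (auto simp: permutes_def)
          have "p = r" using a b by blast
          then show False using False by simp
        qed
        then obtain i where i: "i < Suc n" "i \<noteq> m" "p i \<noteq> r i" by blast
        then have "T i (p i) (r i) = 0" using T[OF pi[OF i(1)]] by simp
        then have "(\<Prod>i<Suc n. T i (p i) (r i)) = 0" using i(1) by (intro prod_zero) auto
        then show ?thesis using False by simp
      qed
    qed
    also have "\<dots> = (\<Sum>p\<in>?S. U (p m) (p m))"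
      using finite_perms[of "Suc n"] by (intro sum.cong) (auto simp: sum.delta)
    finally show ?thesis .
  qed
  have "(\<integral>x. (\<Sum>i<Suc n. u (x (Suc i))) * (vdm n x * cnj (vdm n x)) \<partial>(PN (Suc n)))
     = (\<Sum>i<Suc n. \<integral>x. u (x (Suc i)) * (vdm n x * cnj (vdm n x)) \<partial>(PN (Suc n)))"
    unfolding sum_distrib_right by (rule Bochner_Integration.integral_sum) (use int in auto)
  also have "\<dots> = (\<Sum>p\<in>?S. \<Sum>i<Suc n. U (p i) (p i))"
    using one by (subst sum.swap) (auto intro!: sum.cong simp del: sum.lessThan_Suc)
  also have "\<dots> = (\<Sum>p\<in>?S. \<Sum>j<Suc n. U j j)"
  proof (rule sum.cong)
    fix p assume "p \<in> ?S"
    then have "p permutes {..<Suc n}" by (simp add: lessThan_atLeast0)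
    from sum.permute[OF this, of "\<lambda>j. U j j"] show "(\<Sum>i<Suc n. U (p i) (p i)) = (\<Sum>j<Suc n. U j j)" by (simp add: o_def)
  qed simp
  also have "\<dots> = of_nat (fact (Suc n)) * (\<Sum>j<Suc n. U j j)"
    unfolding sum_constant card_perms by simp
  finally show "(\<integral>x. (\<Sum>i<Suc n. u (x (Suc i))) * (vdm n x * cnj (vdm n x)) \<partial>(PN (Suc n)))
     = of_nat (fact (Suc n)) * (\<Sum>j<Suc n. \<integral>y. u y * (psi n j y * cnj (psi n j y)) \<partial>sigma_X)"
    by (simp add: U_def)
qed

section \<open>Vandermonde determinants and the density of the ensemble\<close>

lemma det_vandermonde:
  fixes t :: "nat \<Rightarrow> complex"
  shows "Determinant.det (fmat N (\<lambda>i j. t i ^ j)) = (\<Prod>i<N. \<Prod>l<i. t i - t l)"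
proof -
  \<comment> \<open>The Newton basis: multiplication by the unipotent upper triangular matrix of the
    coefficients of these polynomials makes the Vandermonde matrix lower triangular.\<close>
  define p :: "nat \<Rightarrow> complex poly" where "p k = (\<Prod>l<k. [:- t l, 1:])" for k
  have dl: "degree (p k) = k \<and> coeff (p k) k = 1 \<and> p k \<noteq> 0" for k
  proof (induction k)
    case (Suc k)
    have e: "p (Suc k) = p k * [:- t k, 1:]" by (simp add: p_def)
    have "degree (p (Suc k)) = Suc k" unfolding e using Suc by (subst degree_mult_eq) auto
    moreover have "lead_coeff (p (Suc k)) = 1" unfolding e lead_coeff_mult using Suc by simp
    ultimately show ?case by auto
  qed (simp add: p_def)
  define U where "U = fmat N (\<lambda>j k. coeff (p k) j)"
  define V where "V = fmat N (\<lambda>i j. t i ^ j)"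
  have c: "U \<in> carrier_mat N N" "V \<in> carrier_mat N N" by (auto simp: U_def V_def)
  have VU: "(V * U) $$ (i, k) = (\<Prod>l<k. t i - t l)" if "i < N" "k < N" for i k
  proof -
    have "(V * U) $$ (i, k) = (\<Sum>j<N. t i ^ j * coeff (p k) j)"
      using that by (simp add: U_def V_def scalar_prod_def lessThan_atLeast0)
    also have "\<dots> = (\<Sum>j\<le>degree (p k). coeff (p k) j * t i ^ j)"
      using dl[of k] that by (intro sum.mono_neutral_cong_right) (auto simp: coeff_eq_0 mult.commute)
    also have "\<dots> = poly (p k) (t i)" by (simp add: poly_altdef)
    also have "\<dots> = (\<Prod>l<k. t i - t l)" by (simp add: p_def poly_prod)
    finally show ?thesis .
  qed
  have "Determinant.det U = prod_list (diag_mat U)"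
  proof (rule det_upper_triangular[OF _ c(1)])
    show "upper_triangular U" using dl by (auto simp: upper_triangular_def U_def coeff_eq_0)
  qed
  also have "\<dots> = 1" using dl by (subst prod_list_diag_prod) (simp add: U_def)
  finally have U: "Determinant.det U = 1" .
  have "Determinant.det V = Determinant.det (V * U)" using det_mult[OF c(2,1)] U by simp
  also have "\<dots> = prod_list (diag_mat (V * U))"
  proof (rule det_lower_triangular)
    fix i j assume "i < j" "j < N"
    then show "(V * U) $$ (i, j) = 0" using VU[of i j] by (auto simp: prod_zero_iff)
  qed (use c in auto)
  also have "\<dots> = (\<Prod>i<N. \<Prod>l<i. t i - t l)"
  proof -
    have "dim_row (V * U) = N" using c by simp
    then show ?thesis using VU by (subst prod_list_diag_prod) (simp add: lessThan_atLeast0)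
  qed
  finally show ?thesis by (simp add: V_def)
qed

lemma prod_pairs_power:
  fixes a :: "nat \<Rightarrow> complex" and n :: nat
  shows "(\<Prod>i<Suc n. \<Prod>l<i. a l * a i) = (\<Prod>i<Suc n. a i ^ n)"
proof (induction n)
  case (Suc n)
  have "(\<Prod>i<Suc (Suc n). \<Prod>l<i. a l * a i) = (\<Prod>i<Suc n. a i ^ n) * (\<Prod>l<Suc n. a l * a (Suc n))"
    by (subst prod.lessThan_Suc) (simp only: Suc)
  also have "\<dots> = (\<Prod>i<Suc n. a i ^ n * a i) * a (Suc n) ^ Suc n"
    by (simp only: prod.distrib prod_constant card_lessThan mult.assoc)
  finally show ?case by (simp only: prod.lessThan_Suc[of _ "Suc n"] power_Suc2)
qed simp

text \<open>Dividing by the a_i reduces to the ordinary Vandermonde determinant. Since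
  \<open>spa\<close> vanishes at the north pole, a_i = 0 must be allowed: both sides are continuous
  in a, and a_i + e is nonzero for all small e other than 0.\<close>

lemma det_homogeneous_vandermonde:
  fixes a b c :: "nat \<Rightarrow> complex" and n :: nat
  shows "Determinant.det (fmat (Suc n) (\<lambda>i j. c j * (a i ^ (n - j) * b i ^ j)))
    = (\<Prod>j<Suc n. c j) * (\<Prod>i<Suc n. \<Prod>l<i. a l * b i - a i * b l)"
proof -
  define D where "D = (\<lambda>a. Determinant.det (fmat (Suc n) (\<lambda>i j. c j * (a i ^ (n - j) * b i ^ j))))"
  define P where "P = (\<lambda>a. (\<Prod>j<Suc n. c j) * (\<Prod>i<Suc n. \<Prod>l<i. a l * b i - a i * b l))"
  let ?S = "{p. p permutes {0..<Suc n}}"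
  have *: "D a = P a" if nz: "\<And>i. i < Suc n \<Longrightarrow> a i \<noteq> 0" for a :: "nat \<Rightarrow> complex"
  proof -
    define t where "t i = b i / a i" for i
    have "D a = (\<Sum>p\<in>?S. signof p * (\<Prod>i<Suc n. c (p i) * (a i ^ (n - p i) * b i ^ p i)))"
      unfolding D_def det_fmat ..
    also have "\<dots> = (\<Sum>p\<in>?S. ((\<Prod>j<Suc n. c j) * (\<Prod>i<Suc n. a i ^ n)) * (signof p * (\<Prod>i<Suc n. t i ^ p i)))"
    proof (rule sum.cong[OF refl])
      fix p assume p: "p \<in> ?S"
      have "(\<Prod>i<Suc n. c (p i) * (a i ^ (n - p i) * b i ^ p i)) = (\<Prod>i<Suc n. c (p i) * (a i ^ n * t i ^ p i))"
      proof (rule prod.cong[OF refl])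
        fix i assume i: "i \<in> {..<Suc n}"
        have "p i \<le> n" using permutes_in_image[of p "{0..<Suc n}" i] p i
          by (simp only: mem_Collect_eq atLeastLessThan_iff less_Suc_eq_le lessThan_iff) simp
        then have "a i ^ n = a i ^ (n - p i) * a i ^ p i" by (simp flip: power_add)
        then show "c (p i) * (a i ^ (n - p i) * b i ^ p i) = c (p i) * (a i ^ n * t i ^ p i)"
          using nz[of i] i by (simp add: t_def power_divide)
      qed
      also have "\<dots> = (\<Prod>i<Suc n. c (p i)) * ((\<Prod>i<Suc n. a i ^ n) * (\<Prod>i<Suc n. t i ^ p i))"
        by (simp only: prod.distrib)
      also have "(\<Prod>i<Suc n. c (p i)) = (\<Prod>i<Suc n. c i)"
        using prod.permute[of p "{..<Suc n}" c] p by (simp add: lessThan_atLeast0 o_def)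
      finally show "signof p * (\<Prod>i<Suc n. c (p i) * (a i ^ (n - p i) * b i ^ p i))
         = ((\<Prod>j<Suc n. c j) * (\<Prod>i<Suc n. a i ^ n)) * (signof p * (\<Prod>i<Suc n. t i ^ p i))"
        by (simp only: mult_ac)
    qed
    also have "\<dots> = ((\<Prod>j<Suc n. c j) * (\<Prod>i<Suc n. a i ^ n)) * (\<Sum>p\<in>?S. signof p * (\<Prod>i<Suc n. t i ^ p i))"
      by (simp only: sum_distrib_left)
    also have "(\<Sum>p\<in>?S. signof p * (\<Prod>i<Suc n. t i ^ p i)) = (\<Prod>i<Suc n. \<Prod>l<i. t i - t l)"
      unfolding det_vandermonde[symmetric] by (rule det_fmat[symmetric])
    also have "(\<Prod>i<Suc n. a i ^ n) = (\<Prod>i<Suc n. \<Prod>l<i. a l * a i)" by (rule prod_pairs_power[symmetric])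
    also have "(\<Prod>j<Suc n. c j) * (\<Prod>i<Suc n. \<Prod>l<i. a l * a i) * (\<Prod>i<Suc n. \<Prod>l<i. t i - t l)
      = (\<Prod>j<Suc n. c j) * (\<Prod>i<Suc n. \<Prod>l<i. (a l * a i) * (t i - t l))"
      by (simp only: prod.distrib mult.assoc)
    also have "(\<Prod>i<Suc n. \<Prod>l<i. (a l * a i) * (t i - t l)) = (\<Prod>i<Suc n. \<Prod>l<i. a l * b i - a i * b l)"
    proof (intro prod.cong refl)
      fix i l assume "i \<in> {..<Suc n}" "l \<in> {..<i}"
      then have "a i \<noteq> 0" "a l \<noteq> 0" using nz[of i] nz[of l] by auto
      then show "(a l * a i) * (t i - t l) = a l * b i - a i * b l" by (simp add: t_def field_simps)
    qed
    finally show ?thesis by (simp add: P_def)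
  qed
  define A where "A e = (\<lambda>i. a i + complex_of_real e)" for e
  have "eventually (\<lambda>e. D (A e) = P (A e)) (at (0::real))"
  proof -
    have "eventually (\<lambda>e. \<forall>i\<in>{..<Suc n}. a i + complex_of_real e \<noteq> 0) (at (0::real))"
    proof (rule eventually_ball_finite, simp, rule ballI)
      fix i
      show "eventually (\<lambda>e. a i + complex_of_real e \<noteq> 0) (at (0::real))"
      proof (cases "a i = 0")
        case True then show ?thesis by (auto simp: eventually_at_filter)
      next
        case False
        have "((\<lambda>e. a i + complex_of_real e) \<longlongrightarrow> a i + complex_of_real 0) (at (0::real))"
          by (intro tendsto_intros)
        then show ?thesis using False by (intro tendsto_imp_eventually_ne) auto
      qed
    qed
    then show ?thesis by eventually_elim (rule *, auto simp: A_def)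
  qed
  moreover have 1: "((\<lambda>e. D (A e)) \<longlongrightarrow> D (A 0)) (at 0)" unfolding D_def A_def det_fmat by (intro tendsto_intros)
  ultimately have "((\<lambda>e. P (A e)) \<longlongrightarrow> D (A 0)) (at 0)" by (rule Lim_transform_eventually[rotated])
  moreover have "((\<lambda>e. P (A e)) \<longlongrightarrow> P (A 0)) (at 0)" unfolding P_def A_def by (intro tendsto_intros)
  ultimately have "D (A 0) = P (A 0)" by (rule tendsto_unique[OF trivial_limit_at])
  then show ?thesis by (simp add: A_def D_def P_def)
qed

lemma vdm_square:
  assumes x: "x \<in> {1..Suc n} \<rightarrow> X"
  shows "(cmod (vdm n x))\<^sup>2 = (\<Prod>k<Suc n. real (Suc n) * real (n choose k)) * (\<Prod>i<Suc n. \<Prod>l<i. 1 - qq (x (Suc l)) (x (Suc i)))"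
proof -
  have "vdm n x = (\<Prod>k<Suc n. complex_of_real (sqrt (real (Suc n) * real (n choose k))))
     * (\<Prod>i<Suc n. \<Prod>l<i. spa (x (Suc l)) * spb (x (Suc i)) - spa (x (Suc i)) * spb (x (Suc l)))"
    unfolding vdm_def psi_def
    by (rule det_homogeneous_vandermonde[of n "\<lambda>k. complex_of_real (sqrt (real (Suc n) * real (n choose k)))" "\<lambda>i. spa (x (Suc i))" "\<lambda>i. spb (x (Suc i))"])
  then have "(cmod (vdm n x))\<^sup>2 = (\<Prod>k<Suc n. (cmod (complex_of_real (sqrt (real (Suc n) * real (n choose k)))))\<^sup>2)
     * (\<Prod>i<Suc n. \<Prod>l<i. (cmod (spa (x (Suc l)) * spb (x (Suc i)) - spa (x (Suc i)) * spb (x (Suc l))))\<^sup>2)"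
    by (simp only: norm_mult power_mult_distrib prod_norm[symmetric] prod_power_distrib)
  also have "(\<Prod>k<Suc n. (cmod (complex_of_real (sqrt (real (Suc n) * real (n choose k)))))\<^sup>2) = (\<Prod>k<Suc n. real (Suc n) * real (n choose k))"
    by (intro prod.cong refl) (simp only: norm_of_real power2_abs real_sqrt_pow2_iff, simp)
  also have "(\<Prod>i<Suc n. \<Prod>l<i. (cmod (spa (x (Suc l)) * spb (x (Suc i)) - spa (x (Suc i)) * spb (x (Suc l))))\<^sup>2)
     = (\<Prod>i<Suc n. \<Prod>l<i. 1 - qq (x (Suc l)) (x (Suc i)))"
  proof (intro prod.cong refl sp_det)
    fix i l assume "i \<in> {..<Suc n}" "l \<in> {..<i}"
    then have "Suc i \<in> {1..Suc n}" "Suc l \<in> {1..Suc n}" by auto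
    then show "x (Suc l) \<in> X" "x (Suc i) \<in> X" using Pi_mem[OF x] by blast+
  qed
  finally show ?thesis .
qed

lemma pair_product_eq:
  assumes x: "x \<in> {1..Suc n} \<rightarrow> X"
  shows "pair_product (Suc n) x = (\<Prod>i<Suc n. \<Prod>l<i. 4 * (1 - qq (x (Suc l)) (x (Suc i))))"
proof -
  have "(\<Prod>i<Suc n. \<Prod>l<i. 4 * (1 - qq (x (Suc l)) (x (Suc i)))) = (\<Prod>(i, l)\<in>Sigma {..<Suc n} (\<lambda>i. {..<i}). 4 * (1 - qq (x (Suc l)) (x (Suc i))))"
    by (rule prod.Sigma) auto
  also have "\<dots> = (\<Prod>(i, j)\<in>{(i, j). 1 \<le> i \<and> i < j \<and> j \<le> Suc n}. (norm (x i - x j))\<^sup>2)"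
  proof (rule prod.reindex_bij_witness[of _ "\<lambda>(i, j). (j - 1, i - 1)" "\<lambda>(i, l). (Suc l, Suc i)"], goal_cases)
    case (5 a)
    obtain i l where a: "a = (i, l)" by force
    then have "Suc i \<in> {1..Suc n}" "Suc l \<in> {1..Suc n}" using 5 by auto
    then have "x (Suc l) \<in> X" "x (Suc i) \<in> X" using Pi_mem[OF x] by blast+
    then show ?case using qq_eq_norm[of "x (Suc l)" "x (Suc i)"] by (simp add: a)
  qed auto
  finally show ?thesis by (simp add: pair_product_def)
qed

definition cN :: "nat \<Rightarrow> real" where
  "cN n = (\<Prod>i<Suc n. \<Prod>l<i. 4) / (\<Prod>k<Suc n. real (Suc n) * real (n choose k))"

lemma cN_pos: "0 < cN n"
  unfolding cN_def by (intro divide_pos_pos prod_pos ballI mult_pos_pos) auto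

lemma pair_product_vdm:
  assumes x: "x \<in> {1..Suc n} \<rightarrow> X"
  shows "pair_product (Suc n) x = cN n * (cmod (vdm n x))\<^sup>2"
proof -
  have "(\<Prod>k<Suc n. real (Suc n) * real (n choose k)) > 0"
    by (intro prod_pos ballI mult_pos_pos) auto
  then show ?thesis unfolding pair_product_eq[OF x] vdm_square[OF x] cN_def prod.distrib by simp
qed

text \<open>Weight 1 turns the matrix of integrals into the identity by orthonormality. This makes
  the normalizing constant explicit.\<close>

lemma vdm_total:
  shows "integrable (PN (Suc n)) (\<lambda>x. (cmod (vdm n x))\<^sup>2)" and "(\<integral>x. (cmod (vdm n x))\<^sup>2 \<partial>(PN (Suc n))) = fact (Suc n)"
proof -
  have e: "vdm n x * cnj (vdm n x) = complex_of_real ((cmod (vdm n x))\<^sup>2)" for x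
    by (rule complex_norm_square[symmetric])
  have "integrable (PN (Suc n)) (\<lambda>x. complex_of_real ((cmod (vdm n x))\<^sup>2))"
    using andreief_general(2)[of "\<lambda>_ _. 1" 1 n] by (simp add: e)
  then show "integrable (PN (Suc n)) (\<lambda>x. (cmod (vdm n x))\<^sup>2)" by (subst (asm) complex_of_real_integrable_eq)
  have "(\<integral>x. complex_of_real ((cmod (vdm n x))\<^sup>2) \<partial>(PN (Suc n))) = of_nat (fact (Suc n)) * Determinant.det (fmat (Suc n) (\<lambda>j k. \<integral>y. 1 * (psi n j y * cnj (psi n k y)) \<partial>sigma_X))"
    using andreief[of "\<lambda>_. 1" 1 n] by (simp add: e)
  also have "fmat (Suc n) (\<lambda>j k. \<integral>y. 1 * (psi n j y * cnj (psi n k y)) \<partial>sigma_X) = 1\<^sub>m (Suc n)"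
    by (rule eq_matI) (auto simp: psi_orthonormal)
  also have "Determinant.det (1\<^sub>m (Suc n)) = (1 :: complex)" by simp
  finally have "complex_of_real (\<integral>x. (cmod (vdm n x))\<^sup>2 \<partial>(PN (Suc n))) = complex_of_real (fact (Suc n))"
    unfolding integral_complex_of_real by (simp del: fact_Suc)
  then show "(\<integral>x. (cmod (vdm n x))\<^sup>2 \<partial>(PN (Suc n))) = fact (Suc n)" using of_real_eq_iff by blast
qed

lemma Z_N_eq: "Z_N (Suc n) = cN n * fact (Suc n)"
proof -
  have "Z_N (Suc n) = (\<integral>x. cN n * (cmod (vdm n x))\<^sup>2 \<partial>(PN (Suc n)))"
    unfolding Z_N_def PN_def[symmetric]
    by (intro Bochner_Integration.integral_cong refl pair_product_vdm space_PN_D)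
  then show ?thesis by (simp add: vdm_total del: fact_Suc)
qed

definition dens :: "nat \<Rightarrow> (nat \<Rightarrow> real^3) \<Rightarrow> real" where
  "dens n x = (cmod (vdm n x))\<^sup>2 / fact (Suc n)"

lemma dens_nonneg: "0 \<le> dens n x" by (simp add: dens_def)

lemma dens_integrable: "integrable (PN (Suc n)) (dens n)"
  unfolding dens_def by (intro integrable_divide vdm_total)

lemma dens_measurable [measurable]: "dens n \<in> borel_measurable (PN (Suc n))"
  using dens_integrable by blast

lemma dens_eq:
  assumes "x \<in> {1..Suc n} \<rightarrow> X"
  shows "1 / Z_N (Suc n) * pair_product (Suc n) x = dens n x"
  unfolding Z_N_eq pair_product_vdm[OF assms] dens_def using cN_pos[of n] by simp

lemma spherical_ensemble_eq: "spherical_ensemble (Suc n) = density (PN (Suc n)) (\<lambda>x. ennreal (dens n x))"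
  unfolding spherical_ensemble_def PN_def[symmetric]
proof (rule density_cong)
  have e: "AE x in PN (Suc n). dens n x = 1 / Z_N (Suc n) * pair_product (Suc n) x"
    using dens_eq[OF space_PN_D] by (intro AE_I2) simp
  show "AE x in PN (Suc n). ennreal (1 / Z_N (Suc n) * pair_product (Suc n) x) = ennreal (dens n x)"
    using e by eventually_elim simp
  have "(\<lambda>x. 1 / Z_N (Suc n) * pair_product (Suc n) x) \<in> borel_measurable (PN (Suc n)) \<longleftrightarrow> dens n \<in> borel_measurable (PN (Suc n))"
    by (rule measurable_cong, rule dens_eq, rule space_PN_D)
  then show "(\<lambda>x. ennreal (1 / Z_N (Suc n) * pair_product (Suc n) x)) \<in> borel_measurable (PN (Suc n))" by simp
qed measurable

definition SE :: "nat \<Rightarrow> (nat \<Rightarrow> real^3) measure" where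
  "SE n = spherical_ensemble (Suc n)"

lemma SE_eq: "SE n = density (PN (Suc n)) (\<lambda>x. ennreal (dens n x))"
  by (simp add: SE_def spherical_ensemble_eq)

lemma space_SE [simp]: "space (SE n) = space (PN (Suc n))" and sets_SE [simp, measurable_cong]: "sets (SE n) = sets (PN (Suc n))"
  by (simp_all add: SE_eq)

lemma emeasure_SE: "emeasure (SE n) (space (PN (Suc n))) = 1"
proof -
  have "emeasure (SE n) (space (PN (Suc n))) = (\<integral>\<^sup>+ x. ennreal (dens n x) * indicator (space (PN (Suc n))) x \<partial>PN (Suc n))"
    unfolding SE_eq by (rule emeasure_density) auto
  also have "\<dots> = (\<integral>\<^sup>+ x. ennreal (dens n x) \<partial>PN (Suc n))"
    by (rule nn_integral_cong) auto
  also have "\<dots> = ennreal (\<integral>x. dens n x \<partial>PN (Suc n))"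
    by (rule nn_integral_eq_integral[OF dens_integrable]) (simp add: dens_nonneg)
  also have "\<dots> = 1" by (simp add: dens_def vdm_total del: fact_Suc)
  finally show ?thesis .
qed

interpretation SE: finite_measure "SE n"
  by standard (simp add: emeasure_SE)

lemma measure_SE [simp]: "measure (SE n) (space (PN (Suc n))) = 1"
  by (simp add: measure_def emeasure_SE)

lemma integral_SE:
  fixes f :: "(nat \<Rightarrow> real^3) \<Rightarrow> real"
  assumes "f \<in> borel_measurable (PN (Suc n))"
  shows "(\<integral>x. f x \<partial>SE n) = (\<integral>x. dens n x * f x \<partial>PN (Suc n))"
  unfolding SE_eq using assms by (subst integral_real_density) (auto simp: dens_nonneg)

section \<open>Double integrals, weighted Gram matrices and exponential moments\<close>

definition I2 :: "(real^3 \<Rightarrow> real^3 \<Rightarrow> real) \<Rightarrow> real" where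
  "I2 F = (\<integral>x. (\<integral>y. F x y \<partial>sigma_X) \<partial>sigma_X)"

abbreviation cont2 :: "(real^3 \<Rightarrow> real^3 \<Rightarrow> real) \<Rightarrow> bool" where
  "cont2 F \<equiv> continuous_on (X \<times> X) (\<lambda>z. F (fst z) (snd z))"

lemma cont2_right: "cont2 F \<Longrightarrow> x \<in> X \<Longrightarrow> continuous_on X (F x)"
  by (rule continuous_on_compose2[of "X \<times> X" "\<lambda>z. F (fst z) (snd z)" X "\<lambda>y. (x, y)", simplified])
     (auto intro!: continuous_intros)

lemma cont2_integral:
  assumes F: "cont2 F"
  shows "continuous_on X (\<lambda>x. \<integral>y. F x y \<partial>sigma_X)"
  unfolding continuous_on_iff
proof (intro ballI allI impI)
  fix x e assume x: "x \<in> X" and e: "(0::real) < e"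
  have "uniformly_continuous_on (X \<times> X) (\<lambda>z. F (fst z) (snd z))"
    using F by (intro compact_uniformly_continuous compact_Times) auto
  then obtain d where d: "0 < d" "\<And>z z'. z \<in> X \<times> X \<Longrightarrow> z' \<in> X \<times> X \<Longrightarrow> dist z' z < d \<Longrightarrow> dist (F (fst z') (snd z')) (F (fst z) (snd z)) < e / 2"
    using e unfolding uniformly_continuous_on_def by (metis half_gt_zero)
  have "dist (\<integral>y. F x' y \<partial>sigma_X) (\<integral>y. F x y \<partial>sigma_X) < e" if x': "x' \<in> X" "dist x' x < d" for x'
  proof -
    have i: "integrable sigma_X (F x)" "integrable sigma_X (F x')"
      using integrable_contX cont2_right F x x' by blast+
    have "dist (\<integral>y. F x' y \<partial>sigma_X) (\<integral>y. F x y \<partial>sigma_X) = \<bar>\<integral>y. F x' y - F x y \<partial>sigma_X\<bar>"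
      using i by (simp add: dist_real_def)
    also have "\<dots> \<le> (\<integral>y. \<bar>F x' y - F x y\<bar> \<partial>sigma_X)" by (rule integral_abs_bound)
    also have "\<dots> \<le> (\<integral>y. e / 2 \<partial>sigma_X)"
    proof (intro integral_mono integrable_abs Bochner_Integration.integrable_diff i)
      fix y assume "y \<in> space sigma_X"
      then show "\<bar>F x' y - F x y\<bar> \<le> e / 2"
        using d(2)[of "(x, y)" "(x', y)"] x x' by (simp add: dist_real_def dist_Pair_Pair)
    qed simp
    also have "\<dots> < e" using e by simp
    finally show ?thesis .
  qed
  then show "\<exists>d>0. \<forall>x'\<in>X. dist x' x < d \<longrightarrow> dist (\<integral>y. F x' y \<partial>sigma_X) (\<integral>y. F x y \<partial>sigma_X) < e"
    using d(1) by blast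
qed

lemma I2_cong: "(\<And>x y. x \<in> X \<Longrightarrow> y \<in> X \<Longrightarrow> F x y = G x y) \<Longrightarrow> I2 F = I2 G"
  unfolding I2_def by (intro Bochner_Integration.integral_cong refl) auto

lemma I2_add:
  assumes "cont2 F" "cont2 G" shows "I2 (\<lambda>x y. F x y + G x y) = I2 F + I2 G"
proof -
  have "I2 (\<lambda>x y. F x y + G x y) = (\<integral>x. (\<integral>y. F x y \<partial>sigma_X) + (\<integral>y. G x y \<partial>sigma_X) \<partial>sigma_X)"
    unfolding I2_def using assms
    by (intro Bochner_Integration.integral_cong refl Bochner_Integration.integral_add integrable_contX cont2_right) auto
  also have "\<dots> = I2 F + I2 G" unfolding I2_def
    by (intro Bochner_Integration.integral_add integrable_contX cont2_integral assms)
  finally show ?thesis .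
qed

lemma I2_cmult: "I2 (\<lambda>x y. c * F x y) = c * I2 F"
  by (simp add: I2_def)

lemma I2_sum:
  assumes "finite I" "\<And>i. i \<in> I \<Longrightarrow> cont2 (F i)" shows "I2 (\<lambda>x y. \<Sum>i\<in>I. F i x y) = (\<Sum>i\<in>I. I2 (F i))"
  using assms
proof (induction I rule: finite_induct)
  case (insert i I)
  have "I2 (\<lambda>x y. F i x y + (\<Sum>i\<in>I. F i x y)) = I2 (F i) + I2 (\<lambda>x y. \<Sum>i\<in>I. F i x y)"
    using insert by (intro I2_add continuous_on_sum) auto
  then show ?case using insert by simp
qed (simp add: I2_def)

lemma I2_mono:
  assumes "cont2 F" "cont2 G" "\<And>x y. x \<in> X \<Longrightarrow> y \<in> X \<Longrightarrow> F x y \<le> G x y" shows "I2 F \<le> I2 G"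
  unfolding I2_def using assms
  by (intro integral_mono integrable_contX cont2_integral cont2_right) auto

lemma cont2_qq: "cont2 qq"
  unfolding qq_def by (intro continuous_intros) auto

lemma cont2_fst: "continuous_on X u \<Longrightarrow> cont2 (\<lambda>x y. u x)"
  by (rule continuous_on_compose2[of X u "X \<times> X" fst]) (auto intro!: continuous_intros)

lemma cont2_snd: "continuous_on X u \<Longrightarrow> cont2 (\<lambda>x y. u y)"
  by (rule continuous_on_compose2[of X u "X \<times> X" snd]) (auto intro!: continuous_intros)

lemma I2_qq_power: "I2 (\<lambda>x y. qq x y ^ k) = 1 / (real k + 1)"
proof -
  have "I2 (\<lambda>x y. qq x y ^ k) = (\<integral>x. 1 / (real k + 1) \<partial>sigma_X)"
    unfolding I2_def by (intro Bochner_Integration.integral_cong refl) (use moments in \<open>auto simp: add.commute\<close>)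
  then show ?thesis by simp
qed

text \<open>The Gram matrix of the \<open>psi n k\<close> with weight w, that is, a Toeplitz matrix
  on the space of dimension n + 1 that they span.\<close>

definition tmat :: "nat \<Rightarrow> (real^3 \<Rightarrow> real) \<Rightarrow> nat \<Rightarrow> nat \<Rightarrow> complex" where
  "tmat n w j k = (\<integral>y. of_real (w y) * (psi n j y * cnj (psi n k y)) \<partial>sigma_X)"

lemma integrable_weight_psi:
  assumes w: "continuous_on X w"
  shows "integrable sigma_X (\<lambda>y. complex_of_real (w y) * (psi n j y * cnj (psi n k y)))"
proof -
  obtain B where B: "0 \<le> B" "\<And>x. x \<in> X \<Longrightarrow> norm (w x) \<le> B" using contX_bounded[OF w] by metis
  note [measurable] = measurable_contX[OF w]
  show ?thesis
  proof (rule integrable_bounded_sigma)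
    fix x assume x: "x \<in> X"
    show "norm (of_real (w x) * (psi n j x * cnj (psi n k x))) \<le> B * (sqrt (real (Suc n) * real (n choose j)) * sqrt (real (Suc n) * real (n choose k)))"
      unfolding norm_mult complex_mod_cnj norm_of_real using B(1) B(2)[OF x] psi_bounded[OF x] by (intro mult_mono) auto
  qed measurable
qed

lemma expectation_prod:
  assumes w: "continuous_on X w"
  shows "complex_of_real (\<integral>x. (\<Prod>i<Suc n. w (x (Suc i))) \<partial>SE n) = Determinant.det (fmat (Suc n) (tmat n w))"
proof -
  obtain B where B: "0 \<le> B" "\<And>x. x \<in> X \<Longrightarrow> norm (w x) \<le> B" using contX_bounded[OF w] by metis
  note [measurable] = measurable_contX_sigma[OF w]
  have m: "(\<lambda>x. \<Prod>i<Suc n. w (x (Suc i))) \<in> borel_measurable (PN (Suc n))"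
    unfolding PN_def by (intro borel_measurable_prod measurable_compose[OF measurable_component_singleton]) auto
  have "complex_of_real (\<integral>x. (\<Prod>i<Suc n. w (x (Suc i))) \<partial>SE n)
     = (\<integral>x. complex_of_real (dens n x * (\<Prod>i<Suc n. w (x (Suc i)))) \<partial>PN (Suc n))"
    unfolding integral_complex_of_real integral_SE[OF m] ..
  also have "\<dots> = (\<integral>x. (1 / of_nat (fact (Suc n))) * ((\<Prod>i<Suc n. of_real (w (x (Suc i)))) * (vdm n x * cnj (vdm n x))) \<partial>PN (Suc n))"
  proof (intro Bochner_Integration.integral_cong refl)
    fix x
    have "complex_of_real (dens n x) = (1 / of_nat (fact (Suc n))) * (vdm n x * cnj (vdm n x))"
      unfolding dens_def complex_norm_square[symmetric] by (simp del: fact_Suc)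
    then show "complex_of_real (dens n x * (\<Prod>i<Suc n. w (x (Suc i)))) = (1 / of_nat (fact (Suc n))) * ((\<Prod>i<Suc n. of_real (w (x (Suc i)))) * (vdm n x * cnj (vdm n x)))"
      by (simp only: of_real_mult of_real_prod mult_ac)
  qed
  also have "\<dots> = (1 / of_nat (fact (Suc n))) * (\<integral>x. (\<Prod>i<Suc n. of_real (w (x (Suc i)))) * (vdm n x * cnj (vdm n x)) \<partial>PN (Suc n))"
    by (rule integral_mult_right_zero)
  also have "(\<integral>x. (\<Prod>i<Suc n. of_real (w (x (Suc i)))) * (vdm n x * cnj (vdm n x)) \<partial>PN (Suc n))
     = of_nat (fact (Suc n)) * Determinant.det (fmat (Suc n) (tmat n w))"
    unfolding tmat_def[abs_def]
    by (rule andreief[of "\<lambda>y. complex_of_real (w y)" B]) (use measurable_contX[OF w] B in auto)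
  finally show ?thesis by (simp del: fact_Suc)
qed

text \<open>The density of a single point is constant: on the diagonal the kernel equals n + 1,
  because spinors are unit vectors.\<close>

lemma expectation_sum:
  assumes w: "continuous_on X w"
  shows "(\<integral>x. (\<Sum>i<Suc n. w (x (Suc i))) \<partial>SE n) = real (Suc n) * (\<integral>y. w y \<partial>sigma_X)"
proof -
  obtain B where B: "0 \<le> B" "\<And>x. x \<in> X \<Longrightarrow> norm (w x) \<le> B" using contX_bounded[OF w] by metis
  note [measurable] = measurable_contX_sigma[OF w]
  have m: "(\<lambda>x. \<Sum>i<Suc n. w (x (Suc i))) \<in> borel_measurable (PN (Suc n))"
    unfolding PN_def by (intro borel_measurable_sum measurable_compose[OF measurable_component_singleton]) auto
  have "complex_of_real (\<integral>x. (\<Sum>i<Suc n. w (x (Suc i))) \<partial>SE n)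
     = (\<integral>x. complex_of_real (dens n x * (\<Sum>i<Suc n. w (x (Suc i)))) \<partial>PN (Suc n))"
    unfolding integral_complex_of_real integral_SE[OF m] ..
  also have "\<dots> = (\<integral>x. (1 / of_nat (fact (Suc n))) * ((\<Sum>i<Suc n. of_real (w (x (Suc i)))) * (vdm n x * cnj (vdm n x))) \<partial>PN (Suc n))"
  proof (intro Bochner_Integration.integral_cong refl)
    fix x
    have "complex_of_real (dens n x) = (1 / of_nat (fact (Suc n))) * (vdm n x * cnj (vdm n x))"
      unfolding dens_def complex_norm_square[symmetric] by (simp del: fact_Suc)
    then show "complex_of_real (dens n x * (\<Sum>i<Suc n. w (x (Suc i)))) = (1 / of_nat (fact (Suc n))) * ((\<Sum>i<Suc n. of_real (w (x (Suc i)))) * (vdm n x * cnj (vdm n x)))"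
      by (simp only: of_real_mult of_real_sum mult_ac)
  qed
  also have "\<dots> = (1 / of_nat (fact (Suc n))) * (\<integral>x. (\<Sum>i<Suc n. of_real (w (x (Suc i)))) * (vdm n x * cnj (vdm n x)) \<partial>PN (Suc n))"
    by (rule integral_mult_right_zero)
  also have "(\<integral>x. (\<Sum>i<Suc n. of_real (w (x (Suc i)))) * (vdm n x * cnj (vdm n x)) \<partial>PN (Suc n))
     = of_nat (fact (Suc n)) * (\<Sum>j<Suc n. tmat n w j j)"
    unfolding tmat_def
    by (rule first_moment(1)[of "\<lambda>y. complex_of_real (w y)" B]) (use measurable_contX[OF w] B in auto)
  also have "(\<Sum>j<Suc n. tmat n w j j) = (\<integral>y. (\<Sum>j<Suc n. of_real (w y) * (psi n j y * cnj (psi n j y))) \<partial>sigma_X)"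
    unfolding tmat_def by (rule Bochner_Integration.integral_sum[symmetric]) (rule integrable_weight_psi[OF w])
  also have "\<dots> = (\<integral>y. of_real (real (Suc n) * w y) \<partial>sigma_X)"
  proof (intro Bochner_Integration.integral_cong refl)
    fix y assume "y \<in> space sigma_X"
    then have y: "y \<in> X" by simp
    have "spa y * cnj (spa y) + spb y * cnj (spb y) = of_real ((cmod (spa y))\<^sup>2 + (cmod (spb y))\<^sup>2)"
      by (simp only: complex_norm_square of_real_add)
    also have "\<dots> = 1" unfolding spa_norm[OF y] spb_norm[OF y] by (simp add: field_simps)
    finally show "(\<Sum>j<Suc n. of_real (w y) * (psi n j y * cnj (psi n j y))) = complex_of_real (real (Suc n) * w y)"
      unfolding sum_distrib_left[symmetric] psi_kernel[OF y y] by (simp add: mult.commute)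
  qed
  also have "\<dots> = complex_of_real (real (Suc n) * (\<integral>y. w y \<partial>sigma_X))"
    unfolding integral_complex_of_real by simp
  finally have "complex_of_real (\<integral>x. (\<Sum>i<Suc n. w (x (Suc i))) \<partial>SE n) = complex_of_real (real (Suc n) * (\<integral>y. w y \<partial>sigma_X))"
    by (simp del: fact_Suc of_nat_Suc sum.lessThan_Suc)
  then show ?thesis using of_real_eq_iff by blast
qed

text \<open>The form at v is the integral of exp u times |g|^2 for a combination g of the
  \<open>psi n i\<close>. Bounding exp u below by exp (- B) and using orthonormality leaves a
  positive multiple of the squared norm of v, with no discussion of the zeros of g.\<close>

lemma pd_tmat:
  assumes u: "continuous_on X u"
  shows "pd (Suc n) (tmat n (\<lambda>x. exp (u x)))"
  unfolding pd_def
proof (intro allI impI)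
  fix v :: "nat \<Rightarrow> complex" assume v: "\<exists>i<Suc n. v i \<noteq> 0"
  obtain B where B: "0 \<le> B" "\<And>x. x \<in> X \<Longrightarrow> norm (u x) \<le> B" using contX_bounded[OF u] by metis
  define g where "g y = (\<Sum>i<Suc n. cnj (v i) * psi n i y)" for y
  have g2: "complex_of_real ((cmod (g y))\<^sup>2) = (\<Sum>i<Suc n. \<Sum>j<Suc n. cnj (v i) * (psi n i y * cnj (psi n j y)) * v j)" for y
    unfolding complex_norm_square g_def cnj_sum sum_product by (intro sum.cong refl) (simp add: mult_ac)
  have q: "qform (Suc n) (tmat n w) v = of_real (\<integral>y. w y * (cmod (g y))\<^sup>2 \<partial>sigma_X)" and iw: "integrable sigma_X (\<lambda>y. w y * (cmod (g y))\<^sup>2)"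
    if w: "continuous_on X w" for w
  proof -
    have I: "integrable sigma_X (\<lambda>y. cnj (v i) * (complex_of_real (w y) * (psi n i y * cnj (psi n j y))) * v j)" for i j
      by (intro integrable_mult_left integrable_mult_right integrable_weight_psi w)
    have e: "complex_of_real (w y * (cmod (g y))\<^sup>2) = (\<Sum>i<Suc n. \<Sum>j<Suc n. cnj (v i) * (complex_of_real (w y) * (psi n i y * cnj (psi n j y))) * v j)" for y
      unfolding of_real_mult g2 sum_distrib_left by (intro sum.cong refl) (simp add: mult_ac)
    have "integrable sigma_X (\<lambda>y. complex_of_real (w y * (cmod (g y))\<^sup>2))"
      unfolding e by (intro Bochner_Integration.integrable_sum I)
    then show "integrable sigma_X (\<lambda>y. w y * (cmod (g y))\<^sup>2)" by (simp only: complex_of_real_integrable_eq)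
    have "qform (Suc n) (tmat n w) v = (\<Sum>i<Suc n. \<Sum>j<Suc n. \<integral>y. cnj (v i) * (complex_of_real (w y) * (psi n i y * cnj (psi n j y))) * v j \<partial>sigma_X)"
      unfolding qform_def tmat_def integral_mult_left_zero integral_mult_right_zero ..
    also have "\<dots> = (\<Sum>i<Suc n. \<integral>y. (\<Sum>j<Suc n. cnj (v i) * (complex_of_real (w y) * (psi n i y * cnj (psi n j y))) * v j) \<partial>sigma_X)"
      by (intro sum.cong refl Bochner_Integration.integral_sum[symmetric] I)
    also have "\<dots> = (\<integral>y. (\<Sum>i<Suc n. \<Sum>j<Suc n. cnj (v i) * (complex_of_real (w y) * (psi n i y * cnj (psi n j y))) * v j) \<partial>sigma_X)"
      by (intro Bochner_Integration.integral_sum[symmetric] Bochner_Integration.integrable_sum I)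
    also have "\<dots> = of_real (\<integral>y. w y * (cmod (g y))\<^sup>2 \<partial>sigma_X)"
      unfolding e[symmetric] integral_complex_of_real ..
    finally show "qform (Suc n) (tmat n w) v = of_real (\<integral>y. w y * (cmod (g y))\<^sup>2 \<partial>sigma_X)" .
  qed
  have "complex_of_real (\<integral>y. 1 * (cmod (g y))\<^sup>2 \<partial>sigma_X) = qform (Suc n) (tmat n (\<lambda>_. 1)) v"
    by (rule q[symmetric]) simp
  also have "\<dots> = (\<Sum>i<Suc n. \<Sum>j<Suc n. if j = i then cnj (v i) * v i else 0)"
    unfolding qform_def tmat_def by (intro sum.cong refl) (auto simp: psi_orthonormal)
  also have "\<dots> = (\<Sum>i<Suc n. cnj (v i) * v i)" by (intro sum.cong refl) (simp add: sum.delta del: sum.lessThan_Suc)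
  also have "\<dots> = of_real (\<Sum>i<Suc n. (cmod (v i))\<^sup>2)"
    by (simp only: of_real_sum complex_norm_square mult.commute)
  finally have n: "(\<integral>y. 1 * (cmod (g y))\<^sup>2 \<partial>sigma_X) = (\<Sum>i<Suc n. (cmod (v i))\<^sup>2)" using of_real_eq_iff by blast
  obtain i where i: "i < Suc n" "v i \<noteq> 0" using v by blast
  have "0 < (\<Sum>i<Suc n. (cmod (v i))\<^sup>2)"
    using i by (intro sum_pos2[of _ i]) auto
  then have "0 < exp (- B) * (\<integral>y. 1 * (cmod (g y))\<^sup>2 \<partial>sigma_X)" unfolding n by simp
  also have "\<dots> = (\<integral>y. exp (- B) * (cmod (g y))\<^sup>2 \<partial>sigma_X)" by simp
  also have "\<dots> \<le> (\<integral>y. exp (u y) * (cmod (g y))\<^sup>2 \<partial>sigma_X)"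
  proof (rule integral_mono)
    show "integrable sigma_X (\<lambda>y. exp (- B) * (cmod (g y))\<^sup>2)" by (rule iw) simp
    show "integrable sigma_X (\<lambda>y. exp (u y) * (cmod (g y))\<^sup>2)" by (rule iw) (intro continuous_intros u)
    fix y assume "y \<in> space sigma_X"
    then have "- B \<le> u y" using B(2)[of y] by (simp add: abs_le_iff)
    then show "exp (- B) * (cmod (g y))\<^sup>2 \<le> exp (u y) * (cmod (g y))\<^sup>2" by (intro mult_right_mono) auto
  qed
  finally have "0 < (\<integral>y. exp (u y) * (cmod (g y))\<^sup>2 \<partial>sigma_X)" .
  then show "\<exists>r>0. qform (Suc n) (tmat n (\<lambda>x. exp (u x))) v = complex_of_real r"
    using q[of "\<lambda>x. exp (u x)"] u by (auto intro!: continuous_intros)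
qed

text \<open>Summation over both indices produces the squared modulus of the kernel in
  \<open>psi_kernel\<close>.\<close>

lemma trace_tmat:
  assumes a: "continuous_on X a" and b: "continuous_on X b"
  shows "(\<Sum>i<Suc n. \<Sum>k<Suc n. tmat n a i k * tmat n b k i)
    = of_real ((real (Suc n))\<^sup>2 * I2 (\<lambda>x y. qq x y ^ n * (a x * b y)))"
proof -
  have inner: "(\<Sum>i<Suc n. \<Sum>k<Suc n. (psi n i x * cnj (psi n k x)) * tmat n b k i)
     = of_real ((real (Suc n))\<^sup>2 * (\<integral>y. qq x y ^ n * b y \<partial>sigma_X))" if x: "x \<in> X" for x
  proof -
    have I: "integrable sigma_X (\<lambda>y. (psi n i x * cnj (psi n k x)) * (complex_of_real (b y) * (psi n k y * cnj (psi n i y))))" for i k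
      by (intro integrable_mult_right integrable_weight_psi b)
    have "(\<Sum>i<Suc n. \<Sum>k<Suc n. (psi n i x * cnj (psi n k x)) * tmat n b k i)
       = (\<Sum>i<Suc n. \<Sum>k<Suc n. \<integral>y. (psi n i x * cnj (psi n k x)) * (complex_of_real (b y) * (psi n k y * cnj (psi n i y))) \<partial>sigma_X)"
      unfolding tmat_def integral_mult_right_zero ..
    also have "\<dots> = (\<Sum>i<Suc n. \<integral>y. (\<Sum>k<Suc n. (psi n i x * cnj (psi n k x)) * (complex_of_real (b y) * (psi n k y * cnj (psi n i y)))) \<partial>sigma_X)"
      by (intro sum.cong refl Bochner_Integration.integral_sum[symmetric] I)
    also have "\<dots> = (\<integral>y. (\<Sum>i<Suc n. \<Sum>k<Suc n. (psi n i x * cnj (psi n k x)) * (complex_of_real (b y) * (psi n k y * cnj (psi n i y)))) \<partial>sigma_X)"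
      by (intro Bochner_Integration.integral_sum[symmetric] Bochner_Integration.integrable_sum I)
    also have "\<dots> = (\<integral>y. complex_of_real ((real (Suc n))\<^sup>2 * (qq x y ^ n * b y)) \<partial>sigma_X)"
    proof (intro Bochner_Integration.integral_cong refl)
      fix y assume "y \<in> space sigma_X"
      then have y: "y \<in> X" by simp
      let ?K = "\<Sum>k<Suc n. psi n k x * cnj (psi n k y)"
      have "(\<Sum>i<Suc n. \<Sum>k<Suc n. (psi n i x * cnj (psi n k x)) * (complex_of_real (b y) * (psi n k y * cnj (psi n i y))))
         = complex_of_real (b y) * (\<Sum>i<Suc n. \<Sum>k<Suc n. (psi n i x * cnj (psi n i y)) * cnj (psi n k x * cnj (psi n k y)))"
        unfolding sum_distrib_left by (intro sum.cong refl) (simp add: mult_ac)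
      also have "(\<Sum>i<Suc n. \<Sum>k<Suc n. (psi n i x * cnj (psi n i y)) * cnj (psi n k x * cnj (psi n k y))) = ?K * cnj ?K"
        unfolding cnj_sum sum_product ..
      also have "?K * cnj ?K = of_real ((cmod ?K)\<^sup>2)" by (rule complex_norm_square[symmetric])
      also have "(cmod ?K)\<^sup>2 = (real (Suc n))\<^sup>2 * qq x y ^ n"
        unfolding psi_kernel[OF x y] norm_mult norm_power power_mult_distrib sp_inner[OF x y, symmetric] norm_of_nat
        by (simp only: power_mult[symmetric] mult.commute)
      finally show "(\<Sum>i<Suc n. \<Sum>k<Suc n. (psi n i x * cnj (psi n k x)) * (complex_of_real (b y) * (psi n k y * cnj (psi n i y))))
         = complex_of_real ((real (Suc n))\<^sup>2 * (qq x y ^ n * b y))"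
        by (simp only: of_real_mult mult_ac)
    qed
    also have "\<dots> = of_real ((real (Suc n))\<^sup>2 * (\<integral>y. qq x y ^ n * b y \<partial>sigma_X))"
      unfolding integral_complex_of_real by simp
    finally show ?thesis .
  qed
  have I: "integrable sigma_X (\<lambda>x. (complex_of_real (a x) * (psi n i x * cnj (psi n k x))) * tmat n b k i)" for i k
    by (intro integrable_mult_left integrable_weight_psi a)
  have "(\<Sum>i<Suc n. \<Sum>k<Suc n. tmat n a i k * tmat n b k i)
     = (\<Sum>i<Suc n. \<Sum>k<Suc n. \<integral>x. (complex_of_real (a x) * (psi n i x * cnj (psi n k x))) * tmat n b k i \<partial>sigma_X)"
    unfolding integral_mult_left_zero tmat_def[of n a] ..
  also have "\<dots> = (\<Sum>i<Suc n. \<integral>x. (\<Sum>k<Suc n. (complex_of_real (a x) * (psi n i x * cnj (psi n k x))) * tmat n b k i) \<partial>sigma_X)"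
    by (intro sum.cong refl Bochner_Integration.integral_sum[symmetric] I)
  also have "\<dots> = (\<integral>x. (\<Sum>i<Suc n. \<Sum>k<Suc n. (complex_of_real (a x) * (psi n i x * cnj (psi n k x))) * tmat n b k i) \<partial>sigma_X)"
    by (intro Bochner_Integration.integral_sum[symmetric] Bochner_Integration.integrable_sum I)
  also have "\<dots> = (\<integral>x. complex_of_real ((real (Suc n))\<^sup>2 * (\<integral>y. qq x y ^ n * (a x * b y) \<partial>sigma_X)) \<partial>sigma_X)"
  proof (intro Bochner_Integration.integral_cong refl)
    fix x assume "x \<in> space sigma_X"
    then have x: "x \<in> X" by simp
    have e: "(\<integral>y. qq x y ^ n * (a x * b y) \<partial>sigma_X) = a x * (\<integral>y. qq x y ^ n * b y \<partial>sigma_X)"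
      unfolding mult.left_commute[of _ "a x"] by simp
    have "(\<Sum>i<Suc n. \<Sum>k<Suc n. (complex_of_real (a x) * (psi n i x * cnj (psi n k x))) * tmat n b k i)
       = of_real (a x) * (\<Sum>i<Suc n. \<Sum>k<Suc n. (psi n i x * cnj (psi n k x)) * tmat n b k i)"
      by (simp only: sum_distrib_left mult.assoc)
    then show "(\<Sum>i<Suc n. \<Sum>k<Suc n. (complex_of_real (a x) * (psi n i x * cnj (psi n k x))) * tmat n b k i)
       = complex_of_real ((real (Suc n))\<^sup>2 * (\<integral>y. qq x y ^ n * (a x * b y) \<partial>sigma_X))"
      unfolding inner[OF x] e by (simp only: of_real_mult mult_ac)
  qed
  also have "\<dots> = of_real ((real (Suc n))\<^sup>2 * I2 (\<lambda>x y. qq x y ^ n * (a x * b y)))"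
    unfolding integral_complex_of_real I2_def by simp
  finally show ?thesis .
qed

definition J :: "nat \<Rightarrow> (real^3 \<Rightarrow> real) \<Rightarrow> real" where
  "J n u = (real (Suc n))\<^sup>2 * I2 (\<lambda>x y. qq x y ^ n * (cosh (u x - u y) - 1))"

text \<open>The trace of a product is symmetric in its factors, so exp (u(x) - u(y)) may be averaged
  with exp (u(y) - u(x)), which gives cosh. The subtracted 1, integrated against N^2 q^n, gives N,
  the dimension subtracted in \<open>prod_list_le_exp\<close>.\<close>

lemma J_eq:
  assumes u: "continuous_on X u"
  shows "J n u = (real (Suc n))\<^sup>2 * I2 (\<lambda>x y. qq x y ^ n * (exp (u x) * exp (- u y))) - real (Suc n)"
proof -
  define S where "S = I2 (\<lambda>x y. qq x y ^ n * (exp (u x) * exp (- u y)))"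
  define S' where "S' = I2 (\<lambda>x y. qq x y ^ n * (exp (- u x) * exp (u y)))"
  have eu: "continuous_on X (\<lambda>x. exp (u x))" "continuous_on X (\<lambda>x. exp (- u x))" by (intro continuous_intros u)+
  have "(\<Sum>i<Suc n. \<Sum>k<Suc n. tmat n (\<lambda>x. exp (u x)) i k * tmat n (\<lambda>x. exp (- u x)) k i)
     = (\<Sum>i<Suc n. \<Sum>k<Suc n. tmat n (\<lambda>x. exp (- u x)) i k * tmat n (\<lambda>x. exp (u x)) k i)"
    by (subst sum.swap) (simp only: mult.commute)
  then have "complex_of_real ((real (Suc n))\<^sup>2 * S) = complex_of_real ((real (Suc n))\<^sup>2 * S')"
    unfolding trace_tmat[OF eu] trace_tmat[OF eu(2,1)] S_def S'_def .
  then have SS: "S = S'" unfolding of_real_eq_iff by (auto simp del: of_nat_Suc)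
  have c1: "cont2 (\<lambda>x y. qq x y ^ n * (exp (u x) * exp (- u y)))" and c2: "cont2 (\<lambda>x y. qq x y ^ n * (exp (- u x) * exp (u y)))"
    and c3: "cont2 (\<lambda>x y. qq x y ^ n)"
    by (intro continuous_intros cont2_qq cont2_fst[OF u] cont2_snd[OF u])+
  have "I2 (\<lambda>x y. qq x y ^ n * (cosh (u x - u y) - 1)) = I2 (\<lambda>x y. (1/2) * (qq x y ^ n * (exp (u x) * exp (- u y)))
     + ((1/2) * (qq x y ^ n * (exp (- u x) * exp (u y))) + (-1) * qq x y ^ n))"
  proof (rule I2_cong)
    fix x y
    have "cosh (u x - u y) = (exp (u x) * exp (- u y) + exp (- u x) * exp (u y)) / 2"
      unfolding cosh_field_def exp_add[symmetric] by simp
    then show "qq x y ^ n * (cosh (u x - u y) - 1) = (1/2) * (qq x y ^ n * (exp (u x) * exp (- u y)))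
     + ((1/2) * (qq x y ^ n * (exp (- u x) * exp (u y))) + (-1) * qq x y ^ n)"
      by (simp only:) (simp add: algebra_simps)
  qed
  also have "\<dots> = (1/2) * S + ((1/2) * S' + (-1) * (1 / (real n + 1)))"
    unfolding S_def S'_def I2_qq_power[symmetric] I2_cmult[symmetric]
    using I2_add[OF continuous_on_mult_left[OF c1, of "1/2"] continuous_on_add[OF continuous_on_mult_left[OF c2, of "1/2"] continuous_on_mult_left[OF c3, of "-1"]]]
      I2_add[OF continuous_on_mult_left[OF c2, of "1/2"] continuous_on_mult_left[OF c3, of "-1"]]
    by (simp only:)
  also have "\<dots> = S - 1 / real (Suc n)" unfolding SS by simp
  finally have e: "I2 (\<lambda>x y. qq x y ^ n * (cosh (u x - u y) - 1)) = S - 1 / real (Suc n)" .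
  show ?thesis unfolding J_def e S_def[symmetric] by (simp add: right_diff_distrib power2_eq_square)
qed

lemma SE_integrable_bounded:
  fixes f :: "(nat \<Rightarrow> real^3) \<Rightarrow> real"
  assumes "f \<in> borel_measurable (PN (Suc n))" "\<And>x. x \<in> {1..Suc n} \<rightarrow> X \<Longrightarrow> \<bar>f x\<bar> \<le> B"
  shows "integrable (SE n) f"
proof (rule SE.integrable_const_bound[where B = B])
  show "AE x in SE n. norm (f x) \<le> B" using assms(2)[OF space_PN_D] by (intro AE_I2) simp
  show "f \<in> borel_measurable (SE n)" using assms(1) by (simp cong: measurable_cong_sets)
qed

lemma sum_measurable:
  fixes w :: "real^3 \<Rightarrow> real"
  assumes w: "continuous_on X w"
  shows "(\<lambda>x. \<Sum>i<Suc n. w (x (Suc i))) \<in> borel_measurable (PN (Suc n))"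
proof -
  note [measurable] = measurable_contX_sigma[OF w]
  show ?thesis unfolding PN_def by (intro borel_measurable_sum measurable_compose[OF measurable_component_singleton]) auto
qed

lemma sum_bounded_X:
  assumes x: "x \<in> {1..Suc n} \<rightarrow> X" and B: "\<And>y. y \<in> X \<Longrightarrow> \<bar>w y\<bar> \<le> (B::real)"
  shows "\<bar>\<Sum>i<Suc n. w (x (Suc i))\<bar> \<le> real (Suc n) * B"
proof -
  have "\<bar>\<Sum>i<Suc n. w (x (Suc i))\<bar> \<le> (\<Sum>i<Suc n. B)"
  proof (rule order_trans[OF sum_abs], rule sum_mono)
    fix i assume "i \<in> {..<Suc n}"
    then have "Suc i \<in> {1..Suc n}" by auto
    then show "\<bar>w (x (Suc i))\<bar> \<le> B" using Pi_mem[OF x] B by blast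
  qed
  then show ?thesis by simp
qed

text \<open>The expectations of \<open>exp (\<Sum> u)\<close> and \<open>exp (- \<Sum> u)\<close> are determinants of positive definite
  matrices; their product is at most \<open>exp\<close> of a trace, and the second one is bounded below by Jensen's
  inequality.\<close>

theorem exponential_moment:
  assumes u: "continuous_on X u"
  shows "(\<integral>x. exp ((\<Sum>i<Suc n. u (x (Suc i))) - real (Suc n) * (\<integral>y. u y \<partial>sigma_X)) \<partial>SE n) \<le> exp (J n u)"
proof -
  let ?S = "\<lambda>x. \<Sum>i<Suc n. u (x (Suc i))"
  define m where "m = real (Suc n) * (\<integral>y. u y \<partial>sigma_X)"
  define A where "A = (\<integral>x. exp (?S x) \<partial>SE n)"
  define B where "B = (\<integral>x. exp (- ?S x) \<partial>SE n)"
  have eu: "continuous_on X (\<lambda>x. exp (u x))" "continuous_on X (\<lambda>x. exp (- u x))" by (intro continuous_intros u)+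
  have u': "continuous_on X (\<lambda>x. - u x)" by (intro continuous_intros u)
  have A: "complex_of_real A = Determinant.det (fmat (Suc n) (tmat n (\<lambda>x. exp (u x))))"
    unfolding expectation_prod[OF eu(1), symmetric] A_def exp_sum[OF finite_lessThan] ..
  have B: "complex_of_real B = Determinant.det (fmat (Suc n) (tmat n (\<lambda>x. exp (- u x))))"
    unfolding expectation_prod[OF eu(2), symmetric] B_def sum_negf[symmetric] exp_sum[OF finite_lessThan] ..
  obtain rs where rs: "length rs = Suc n" "\<And>r. r \<in> set rs \<Longrightarrow> 0 < r"
    "Determinant.det (fmat (Suc n) (tmat n (\<lambda>x. exp (u x)))) * Determinant.det (fmat (Suc n) (tmat n (\<lambda>x. exp (- u x)))) = of_real (prod_list rs)"
    "(\<Sum>i<Suc n. \<Sum>k<Suc n. tmat n (\<lambda>x. exp (u x)) i k * tmat n (\<lambda>x. exp (- u x)) k i) = of_real (sum_list rs)"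
    using pd_det_trace[OF pd_tmat[OF u, of n] pd_tmat[OF u', of n]] by blast
  have "complex_of_real (A * B) = of_real (prod_list rs)" unfolding of_real_mult A B by (rule rs(3))
  then have AB: "A * B = prod_list rs" using of_real_eq_iff by blast
  have "(real (Suc n))\<^sup>2 * I2 (\<lambda>x y. qq x y ^ n * (exp (u x) * exp (- u y))) = sum_list rs"
    using rs(4) unfolding trace_tmat[OF eu] of_real_eq_iff .
  then have "sum_list rs - real (length rs) = J n u" unfolding J_eq[OF u] rs(1) by simp
  then have ABJ: "A * B \<le> exp (J n u)" using prod_list_le_exp[of rs] rs(2) AB by auto
  obtain M where M: "0 \<le> M" "\<And>x. x \<in> X \<Longrightarrow> norm (u x) \<le> M" using contX_bounded[OF u] by metis
  note Sm = sum_measurable[OF u, of n]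
  have Sb: "\<bar>?S x\<bar> \<le> real (Suc n) * M" if "x \<in> {1..Suc n} \<rightarrow> X" for x
    by (rule sum_bounded_X[OF that]) (use M in auto)
  have iS: "integrable (SE n) ?S"
    by (rule SE_integrable_bounded[where B = "real (Suc n) * M"], rule Sm) (rule Sb)
  have iE: "integrable (SE n) (\<lambda>x. exp (- ?S x))"
  proof (rule SE_integrable_bounded[where B = "exp (real (Suc n) * M)"])
    show "(\<lambda>x. exp (- ?S x)) \<in> borel_measurable (PN (Suc n))"
      by (intro measurable_compose[OF Sm, of "\<lambda>t. exp (- t)"]) simp
    fix x assume "x \<in> {1..Suc n} \<rightarrow> X"
    from Sb[OF this] show "\<bar>exp (- ?S x)\<bar> \<le> exp (real (Suc n) * M)" by (simp add: abs_le_iff del: sum.lessThan_Suc of_nat_Suc)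
  qed
  \<comment> \<open>Jensen's inequality through the tangent of the exponential at - m; the linear
    term has mean zero by \<open>expectation_sum\<close>.\<close>
  have "exp (- m) = exp (- m) * (1 + m - (\<integral>x. ?S x \<partial>SE n))"
    unfolding expectation_sum[OF u] m_def by simp
  also have "\<dots> = (\<integral>x. exp (- m) * (1 + m - ?S x) \<partial>SE n)"
    using iS by (simp del: sum.lessThan_Suc)
  also have "\<dots> \<le> B" unfolding B_def
  proof (rule integral_mono)
    show "integrable (SE n) (\<lambda>x. exp (- m) * (1 + m - ?S x))"
      using iS by (intro integrable_mult_right Bochner_Integration.integrable_diff) auto
    fix x
    have "1 + (m - ?S x) \<le> exp (m - ?S x)" by (rule exp_ge_add_one_self)
    then have "exp (- m) * (1 + (m - ?S x)) \<le> exp (- m) * exp (m - ?S x)" by (rule mult_left_mono) simp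
    then show "exp (- m) * (1 + m - ?S x) \<le> exp (- ?S x)"
      by (simp add: exp_add[symmetric] add_diff_eq del: sum.lessThan_Suc)
  qed (rule iE)
  finally have "exp (- m) \<le> B" .
  moreover have "0 \<le> A" unfolding A_def by (rule Bochner_Integration.integral_nonneg) simp
  ultimately have "A * exp (- m) \<le> exp (J n u)" using ABJ by (meson mult_left_mono order_trans)
  moreover have "(\<integral>x. exp (?S x - m) \<partial>SE n) = A * exp (- m)"
    unfolding A_def diff_conv_add_uminus exp_add by (rule integral_mult_left_zero)
  ultimately show ?thesis unfolding m_def by simp
qed

section \<open>Energy bound for the density\<close>

lemma midpoint_ln:
  fixes x :: real
  assumes "0 \<le> x" "x < 1"
  shows "(1 + x) * ln (1 + x) - (1 - x) * ln (1 - x) \<le> 2 * x"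
proof -
  define g where "g x = (1 + x) * ln (1 + x) - (1 - x) * ln (1 - x) - 2 * x" for x :: real
  have "g x \<le> g 0"
  proof (rule DERIV_nonpos_imp_nonincreasing[OF assms(1)])
    fix t assume t: "0 \<le> t" "t \<le> x"
    have t1: "0 < 1 + t" "0 < 1 - t" using t assms by auto
    have "(g has_real_derivative (ln (1 + t) + ln (1 - t))) (at t)"
      unfolding g_def using t1 by (auto intro!: derivative_eq_intros)
    moreover have "ln (1 + t) + ln (1 - t) \<le> 0"
      using ln_le_minus_one[OF t1(1)] ln_le_minus_one[OF t1(2)] by simp
    ultimately show "\<exists>y. (g has_real_derivative y) (at t) \<and> y \<le> 0" by blast
  qed
  then show ?thesis by (simp add: g_def)
qed

text \<open>The induction runs on the integral of ln from 1/2 to n + 1/2, which by concavity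
  (\<open>midpoint_ln\<close>) is at most ln (n!). The term ln n / 2 must be kept: through
  \<open>ln_binprod_le\<close> it cancels the harmonic sum in \<open>dens_le_energy\<close>.\<close>

lemma ln_fact_lower:
  assumes "0 < n"
  shows "(real n + 1/2) * ln (real n) - real n \<le> ln (fact n)"
proof -
  have "(real n + 1/2) * ln (real n + 1/2) - real n - 1/2 * ln (1/2) \<le> ln (fact n)" for n
  proof (induction n)
    case (Suc n)
    define k where "k = real n + 1"
    define x where "x = 1 / (2 * k)"
    have k: "1 \<le> k" by (simp add: k_def)
    have x: "0 \<le> x" "x < 1" using k by (auto simp: x_def field_simps)
    have "k * ((1 + x) * ln (1 + x) - (1 - x) * ln (1 - x)) \<le> k * (2 * x)"
      using midpoint_ln[OF x] k by (intro mult_left_mono) auto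
    moreover have "k * (2 * x) = 1" using k by (simp add: x_def)
    moreover have "k * (1 + x) = k + 1/2" "k * (1 - x) = k - 1/2" using k by (auto simp: x_def field_simps)
    ultimately have 1: "(k + 1/2) * ln (1 + x) - (k - 1/2) * ln (1 - x) \<le> 1"
      unfolding right_diff_distrib mult.assoc[symmetric] by (simp only:)
    have "ln (k + 1/2) = ln k + ln (1 + x)" using k x \<open>k * (1 + x) = k + 1/2\<close> by (simp flip: ln_mult_pos)
    moreover have "ln (k - 1/2) = ln k + ln (1 - x)" using k x \<open>k * (1 - x) = k - 1/2\<close> by (simp flip: ln_mult_pos)
    ultimately have "(k + 1/2) * ln (k + 1/2) - (k - 1/2) * ln (k - 1/2) \<le> 1 + ln k"
      using 1 by (simp add: algebra_simps)
    moreover have "ln (fact (Suc n)) = ln k + ln (fact n)"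
      unfolding fact_Suc using k by (subst ln_mult_pos) (auto simp: k_def add.commute)
    ultimately show ?case using Suc by (simp add: k_def algebra_simps)
  qed simp
  from this[of n] have "(real n + 1/2) * ln (real n + 1/2) - real n - 1/2 * ln (1/2) \<le> ln (fact n)" .
  moreover have "(real n + 1/2) * ln (real n) \<le> (real n + 1/2) * ln (real n + 1/2)"
    using assms by (intro mult_left_mono) auto
  moreover have "ln (1/2 :: real) \<le> 0" by (subst ln_le_zero_iff) auto
  ultimately show ?thesis by linarith
qed

definition binprod :: "nat \<Rightarrow> real" where
  "binprod n = (\<Prod>k<Suc n. real (n choose k))"

lemma binprod_Suc: "binprod (Suc n) = binprod n * (real (Suc n) ^ Suc n / fact (Suc n))"
proof -
  have "binprod (Suc n) * fact (Suc n) = (\<Prod>k<Suc n. real (Suc n choose k)) * (\<Prod>k<Suc n. real (Suc n - k))"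
  proof -
    have "fact (Suc n) = (\<Prod>k<Suc n. real (Suc n - k))"
      by (simp add: fact_prod_rev lessThan_atLeast0 del: fact_Suc prod.lessThan_Suc prod.op_ivl_Suc)
    then show ?thesis unfolding binprod_def by (subst prod.lessThan_Suc) simp
  qed
  also have "\<dots> = (\<Prod>k<Suc n. real ((Suc n - k) * (Suc n choose k)))"
    unfolding prod.distrib[symmetric] by (intro prod.cong refl) simp
  also have "\<dots> = (\<Prod>k<Suc n. real (Suc n) * real (n choose k))"
    unfolding binomial_absorb_comp by (simp only: diff_Suc_1 of_nat_mult)
  also have "\<dots> = real (Suc n) ^ Suc n * binprod n"
    unfolding binprod_def prod.distrib by (simp only: prod_constant card_lessThan)
  finally show ?thesis by (simp add: field_simps del: fact_Suc)
qed

lemma binprod_pos: "0 < binprod n"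
  unfolding binprod_def by (intro prod_pos ballI) auto

text \<open>Along the steps of \<open>binprod_Suc\<close> the half logarithms of
  \<open>ln_fact_lower\<close> accumulate to ln (n!)/2.\<close>

lemma ln_binprod_le: "ln (binprod n) \<le> real n * (real n + 1) / 2 - ln (fact n) / 2"
proof (induction n)
  case (Suc n)
  have "ln (binprod (Suc n)) = ln (binprod n) + (real (Suc n) * ln (real (Suc n)) - ln (fact (Suc n)))"
    unfolding binprod_Suc using binprod_pos[of n]
    by (simp only: ln_mult_pos ln_div ln_realpow fact_gt_zero zero_less_power of_nat_0_less_iff zero_less_Suc divide_pos_pos) simp
  moreover have "ln (fact (Suc n)) = ln (real (Suc n)) + ln (fact n)"
    unfolding fact_Suc by (subst ln_mult_pos) auto
  moreover have "(real (Suc n) + 1/2) * ln (real (Suc n)) - real (Suc n) \<le> ln (fact (Suc n))"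
    by (rule ln_fact_lower) simp
  moreover have "(real (Suc n) + 1/2) * ln (real (Suc n)) = real (Suc n) * ln (real (Suc n)) + ln (real (Suc n)) / 2"
    by (simp add: distrib_right)
  moreover have "real (Suc n) * (real (Suc n) + 1) / 2 = real n * (real n + 1) / 2 + real (Suc n)"
    by (simp add: algebra_simps)
  ultimately show ?case using Suc by linarith
qed (simp add: binprod_def)

lemma binprod_le:
  assumes "0 < n"
  shows "binprod n \<le> exp ((real n)\<^sup>2 / 2 + real n - real n * ln (real n) / 2)"
proof -
  have "0 \<le> ln (real n)" using assms by (intro ln_ge_zero) auto
  then have "real n * ln (real n) - real n \<le> ln (fact n)"
    using ln_fact_lower[OF assms] by (simp add: algebra_simps)
  then have "ln (binprod n) \<le> (real n)\<^sup>2 / 2 + real n - real n * ln (real n) / 2"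
    using ln_binprod_le[of n] by (simp add: power2_eq_square field_simps)
  then show ?thesis using binprod_pos[of n] by (simp add: ln_le_cancel_iff[symmetric] ln_ge_iff)
qed

text \<open>A partial sum of the series of - ln (1 - q). The truncation keeps the diagonal value q =
  1 finite when the sum over pairs is completed to a double sum.\<close>

lemma one_minus_le_exp:
  fixes q :: real
  assumes "0 \<le> q" "q \<le> 1"
  shows "1 - q \<le> exp (- (\<Sum>m=1..M. q ^ m / real m))"
proof (cases "q = 1")
  case False
  then have q: "q < 1" using assms by simp
  define g where "g q = ln (1 - q) + (\<Sum>m=1..M. q ^ m / real m)" for q :: real
  have "g q \<le> g 0"
  proof (rule DERIV_nonpos_imp_nonincreasing[OF assms(1)])
    fix t assume t: "0 \<le> t" "t \<le> q"
    have t1: "0 < 1 - t" using t q by auto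
    have "(g has_real_derivative ((-1) / (1 - t) + (\<Sum>m=1..M. t ^ (m - 1)))) (at t)"
      unfolding g_def
    proof (intro DERIV_add DERIV_sum)
      show "((\<lambda>q. ln (1 - q)) has_real_derivative (-1) / (1 - t)) (at t)"
        using t1 by (auto intro!: derivative_eq_intros)
      fix m assume "m \<in> {1..M}"
      then show "((\<lambda>q. q ^ m / real m) has_real_derivative t ^ (m - 1)) (at t)"
        by (auto intro!: derivative_eq_intros)
    qed
    moreover have "(-1) / (1 - t) + (\<Sum>m=1..M. t ^ (m - 1)) \<le> 0"
    proof -
      have "(\<Sum>m=1..M. t ^ (m - 1)) = (\<Sum>m<M. t ^ m)" by (simp add: sum.atLeast1_atMost_eq)
      then have "(1 - t) * (\<Sum>m=1..M. t ^ (m - 1)) = 1 - t ^ M" by (simp add: one_diff_power_eq)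
      also have "\<dots> \<le> 1" using t by simp
      finally have "(\<Sum>m=1..M. t ^ (m - 1)) \<le> 1 / (1 - t)" using t1 by (simp add: field_simps)
      then show ?thesis by simp
    qed
    ultimately show "\<exists>y. (g has_real_derivative y) (at t) \<and> y \<le> 0" by blast
  qed
  also have "g 0 = 0" by (auto simp: g_def power_0_left)
  finally have "ln (1 - q) \<le> - (\<Sum>m=1..M. q ^ m / real m)" by (simp add: g_def)
  then show ?thesis using q by (metis diff_gt_0_iff_gt exp_le_cancel_iff exp_ln)
qed auto

lemma sum_pairs_symmetric:
  fixes f :: "nat \<Rightarrow> nat \<Rightarrow> real"
  assumes "\<And>i l. f i l = f l i"
  shows "(\<Sum>i<N. \<Sum>l<N. f i l) = 2 * (\<Sum>i<N. \<Sum>l<i. f l i) + (\<Sum>i<N. f i i)"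
proof (induction N)
  case (Suc N)
  have "(\<Sum>i<Suc N. \<Sum>l<Suc N. f i l) = (\<Sum>i<N. \<Sum>l<N. f i l) + (\<Sum>i<N. f i N) + (\<Sum>l<N. f N l) + f N N"
    by (simp add: sum.distrib)
  also have "(\<Sum>l<N. f N l) = (\<Sum>l<N. f l N)" by (intro sum.cong refl assms)
  finally show ?case using Suc by simp
qed simp

lemma harmonic_le: "1 \<le> N \<Longrightarrow> (\<Sum>m=1..N. 1 / real m) \<le> ln (real N) + 1"
proof (induction N rule: dec_induct)
  case (step N)
  have p: "0 < real N" using step by simp
  have "ln (real N / real (Suc N)) \<le> real N / real (Suc N) - 1" using p by (intro ln_le_minus_one) auto
  moreover have "real N / real (Suc N) - 1 = - (1 / real (Suc N))" by (simp add: field_simps)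
  moreover have "ln (real N / real (Suc N)) = ln (real N) - ln (real (Suc N))" using p by (subst ln_div) auto
  ultimately show ?case using step by simp
qed simp

text \<open>The centred logarithmic energy with its power series cut at m = N. At this cut-off the
  diagonal of the double sum costs N/2 times a harmonic sum, that is N ln N / 2 up to O(N).\<close>

definition Energy :: "nat \<Rightarrow> (nat \<Rightarrow> real^3) \<Rightarrow> real" where
  "Energy N x = (real N)\<^sup>2 / 2 * (\<Sum>m=1..N. En N x m / real m)"

text \<open>With N = \<open>Suc n\<close>, the factors N^N and N! of the normalization combine with
  \<open>binprod n\<close> to \<open>binprod N\<close>.\<close>

lemma dens_product:
  assumes x: "x \<in> {1..Suc n} \<rightarrow> X"
  shows "dens n x = binprod (Suc n) * (\<Prod>i<Suc n. \<Prod>l<i. 1 - qq (x (Suc l)) (x (Suc i)))"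
proof -
  have "(\<Prod>k<Suc n. real (Suc n) * real (n choose k)) = real (Suc n) ^ Suc n * binprod n"
    unfolding binprod_def prod.distrib by (simp only: prod_constant card_lessThan)
  then show ?thesis unfolding dens_def vdm_square[OF x] binprod_Suc by (simp add: mult_ac del: fact_Suc)
qed

text \<open>The terms of order N^2 and N ln N cancel: R^2/2 against the sum of the means 1/(m + 1)
  weighted by 1/m, and R ln R / 2 against the diagonal. Only 2 N is left over.\<close>

theorem dens_le_energy:
  assumes x: "x \<in> {1..Suc n} \<rightarrow> X"
  shows "dens n x \<le> exp (2 * real (Suc n) - Energy (Suc n) x)"
proof -
  define N where "N = Suc n"
  define R where "R = real N"
  have R: "1 \<le> R" by (simp add: R_def N_def)
  define q where "q i l = qq (x (Suc i)) (x (Suc l))" for i l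
  have xX: "x (Suc i) \<in> X" if "i < N" for i
  proof -
    have "Suc i \<in> {1..Suc n}" using that by (auto simp: N_def)
    then show ?thesis using Pi_mem[OF x] by blast
  qed
  define Q where "Q m = (\<Sum>i<N. \<Sum>l<i. q l i ^ m)" for m
  have Q: "Q m = (R\<^sup>2 * En N x m + R\<^sup>2 / (real m + 1) - R) / 2" for m
  proof -
    have "(\<Sum>i<N. \<Sum>l<N. q i l ^ m) = 2 * Q m + (\<Sum>i<N. q i i ^ m)"
      unfolding Q_def by (rule sum_pairs_symmetric) (simp add: q_def qq_commute)
    moreover have "(\<Sum>i<N. q i i ^ m) = R" using xX by (simp add: q_def R_def)
    moreover have "(\<Sum>i<N. \<Sum>l<N. q i l ^ m) = (\<Sum>i=1..N. \<Sum>j=1..N. qq (x i) (x j) ^ m)"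
      by (simp add: q_def sum.atLeast1_atMost_eq)
    moreover have "R\<^sup>2 * En N x m = (\<Sum>i=1..N. \<Sum>j=1..N. qq (x i) (x j) ^ m) - R\<^sup>2 / (real m + 1)"
      using R unfolding En_def R_def[symmetric] right_diff_distrib mult.assoc[symmetric] by simp
    ultimately show ?thesis by simp
  qed
  have pr: "(\<Prod>i<N. \<Prod>l<i. 1 - q l i) \<le> exp (- (\<Sum>m=1..N. Q m / real m))"
  proof -
    have b: "0 \<le> q l i" "q l i \<le> 1" if "i < N" "l < i" for i l
      using qq_bounds[of "x (Suc l)" "x (Suc i)"] xX[of i] xX[of l] that by (auto simp: q_def)
    have "(\<Prod>i<N. \<Prod>l<i. 1 - q l i) \<le> (\<Prod>i<N. \<Prod>l<i. exp (- (\<Sum>m=1..N. q l i ^ m / real m)))"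
      by (intro prod_mono conjI prod_nonneg one_minus_le_exp) (use b in auto)
    also have "\<dots> = exp (\<Sum>i<N. \<Sum>l<i. - (\<Sum>m=1..N. q l i ^ m / real m))"
      by (simp add: exp_sum)
    also have "(\<Sum>i<N. \<Sum>l<i. - (\<Sum>m=1..N. q l i ^ m / real m)) = - (\<Sum>i<N. \<Sum>m=1..N. \<Sum>l<i. q l i ^ m / real m)"
      by (simp add: sum_negf) (intro sum.cong refl sum.swap)
    also have "\<dots> = - (\<Sum>m=1..N. Q m / real m)"
      unfolding Q_def sum_divide_distrib by (subst sum.swap) (rule refl)
    finally show ?thesis .
  qed
  have S: "(\<Sum>m=1..N. Q m / real m) = Energy N x + R\<^sup>2 / 2 * (1 - 1 / (R + 1)) - R / 2 * (\<Sum>m=1..N. 1 / real m)"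
  proof -
    have t: "(\<Sum>m=1..N. 1 / (real m * (real m + 1))) = 1 - 1 / (real N + 1)" for N
    proof (induction N)
      case (Suc N)
      have "1 - 1 / (a + 1) + 1 / ((a + 1) * (a + 1 + 1)) = 1 - 1 / (a + 1 + 1)" if "0 \<le> a" for a :: real
        using that by (simp add: divide_simps) (simp add: algebra_simps)
      from this[of "real N"] show ?case using Suc by (simp add: add.commute)
    qed simp
    have "(\<Sum>m=1..N. Q m / real m) = (\<Sum>m=1..N. R\<^sup>2 / 2 * (En N x m / real m) + R\<^sup>2 / 2 * (1 / (real m * (real m + 1))) - R / 2 * (1 / real m))"
    proof (intro sum.cong refl)
      fix m :: nat assume "m \<in> {1..N}"
      have "(A * e + A / (s + 1) - r) / 2 / s = A / 2 * (e / s) + A / 2 * (1 / (s * (s + 1))) - r / 2 * (1 / s)" for A e s r :: real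
        by (simp add: diff_divide_distrib add_divide_distrib mult.commute)
      then show "Q m / real m = R\<^sup>2 / 2 * (En N x m / real m) + R\<^sup>2 / 2 * (1 / (real m * (real m + 1))) - R / 2 * (1 / real m)"
        unfolding Q .
    qed
    also have "\<dots> = R\<^sup>2 / 2 * (\<Sum>m=1..N. En N x m / real m) + R\<^sup>2 / 2 * (\<Sum>m=1..N. 1 / (real m * (real m + 1))) - R / 2 * (\<Sum>m=1..N. 1 / real m)"
      by (simp only: sum.distrib sum_subtractf sum_distrib_left)
    finally show ?thesis unfolding t Energy_def R_def .
  qed
  have h: "(\<Sum>m=1..N. 1 / real m) \<le> ln R + 1"
    using harmonic_le[of N] by (simp add: R_def N_def)
  have h': "R / 2 * (\<Sum>m=1..N. 1 / real m) \<le> R / 2 * (ln R + 1)"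
    by (rule mult_left_mono[OF h]) (use R in simp)
  have k: "R\<^sup>2 / 2 - R / 2 \<le> R\<^sup>2 / 2 * (1 - 1 / (R + 1))" using R by (simp add: field_simps power2_eq_square)
  have l: "R / 2 * (ln R + 1) = R * ln R / 2 + R / 2" by (simp add: algebra_simps)
  have "dens n x \<le> exp (R\<^sup>2 / 2 + R - R * ln R / 2) * exp (- (\<Sum>m=1..N. Q m / real m))"
    unfolding dens_product[OF x] N_def[symmetric] R_def q_def[symmetric]
    by (intro mult_mono binprod_le pr prod_nonneg) (use qq_bounds xX in \<open>auto simp: q_def N_def\<close>)
  also have "\<dots> = exp (R\<^sup>2 / 2 + R - R * ln R / 2 - (\<Sum>m=1..N. Q m / real m))" by (simp add: exp_add[symmetric])
  also have "\<dots> \<le> exp (2 * R - Energy N x)"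
    unfolding S exp_le_cancel_iff using h' k l by linarith
  finally show ?thesis by (simp add: R_def N_def)
qed

section \<open>Averaging the exponential moments over signs\<close>

definition signs :: "nat \<Rightarrow> (nat \<Rightarrow> real) set" where
  "signs p = ({..<p} \<rightarrow>\<^sub>E {-1, 1})"

lemma finite_signs [simp]: "finite (signs p)"
  unfolding signs_def by (intro finite_PiE) auto

lemma signs_prod:
  "(\<Sum>\<xi>\<in>signs p. \<Prod>i<p. h i (\<xi> i)) = (\<Prod>i<p. h i 1 + h i (-1) :: real)"
proof -
  have "(\<Prod>i<p. h i 1 + h i (-1)) = (\<Prod>i<p. \<Sum>s\<in>{-1, 1::real}. h i s)" by (simp add: add.commute)
  also have "\<dots> = (\<Sum>\<xi>\<in>signs p. \<Prod>i<p. h i (\<xi> i))"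
    unfolding signs_def by (rule prod_sum_PiE) auto
  finally show ?thesis by simp
qed

text \<open>The law of independent signs with means \<open>m i\<close>, as a weight on sign vectors;
  it is nonnegative when all |m i| are at most 1.\<close>

definition bernoulli :: "nat \<Rightarrow> (nat \<Rightarrow> real) \<Rightarrow> (nat \<Rightarrow> real) \<Rightarrow> real" where
  "bernoulli p m \<xi> = (\<Prod>i<p. (1 + m i * \<xi> i) / 2)"

lemma signs_cases: "\<xi> \<in> signs p \<Longrightarrow> i < p \<Longrightarrow> \<xi> i = -1 \<or> \<xi> i = 1"
  unfolding signs_def by (auto simp: PiE_iff)

lemma bernoulli_bounds:
  assumes "\<xi> \<in> signs p" "\<And>i. i < p \<Longrightarrow> \<bar>m i\<bar> \<le> 1"
  shows "0 \<le> bernoulli p m \<xi>" "bernoulli p m \<xi> \<le> (1/2) ^ p * exp (\<Sum>i<p. m i * \<xi> i)"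
proof -
  have b: "0 \<le> 1 + m i * \<xi> i" if "i < p" for i
    using signs_cases[OF assms(1) that] assms(2)[OF that] by (auto simp: abs_le_iff)
  show "0 \<le> bernoulli p m \<xi>" unfolding bernoulli_def by (intro prod_nonneg) (use b in auto)
  have "bernoulli p m \<xi> \<le> (\<Prod>i<p. (1/2) * exp (m i * \<xi> i))"
    unfolding bernoulli_def
  proof (intro prod_mono conjI)
    fix i assume "i \<in> {..<p}"
    then show "0 \<le> (1 + m i * \<xi> i) / 2" using b[of i] by simp
    show "(1 + m i * \<xi> i) / 2 \<le> (1/2) * exp (m i * \<xi> i)" using exp_ge_add_one_self[of "m i * \<xi> i"] unfolding add_divide_distrib by linarith
  qed
  also have "\<dots> = (1/2) ^ p * exp (\<Sum>i<p. m i * \<xi> i)"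
    by (simp only: prod.distrib prod_constant card_lessThan exp_sum finite_lessThan)
  finally show "bernoulli p m \<xi> \<le> (1/2) ^ p * exp (\<Sum>i<p. m i * \<xi> i)" .
qed

lemma bernoulli_exp:
  "(\<Sum>\<xi>\<in>signs p. bernoulli p m \<xi> * exp (\<Sum>i<p. \<xi> i * d i)) = (\<Prod>i<p. ((1 + m i) * exp (d i) + (1 - m i) * exp (- d i)) / 2)"
proof -
  have "(\<Sum>\<xi>\<in>signs p. bernoulli p m \<xi> * exp (\<Sum>i<p. \<xi> i * d i)) = (\<Sum>\<xi>\<in>signs p. \<Prod>i<p. (1 + m i * \<xi> i) / 2 * exp (\<xi> i * d i))"
    unfolding bernoulli_def by (simp only: prod.distrib exp_sum finite_lessThan)
  also have "\<dots> = (\<Prod>i<p. (1 + m i * 1) / 2 * exp (1 * d i) + (1 + m i * (-1)) / 2 * exp ((-1) * d i))"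
    by (rule signs_prod)
  also have "\<dots> = (\<Prod>i<p. ((1 + m i) * exp (d i) + (1 - m i) * exp (- d i)) / 2)"
    by (intro prod.cong refl) (simp add: add_divide_distrib)
  finally show ?thesis .
qed

lemma bernoulli_total: "(\<Sum>\<xi>\<in>signs p. bernoulli p m \<xi>) = 1"
  using bernoulli_exp[of p m "\<lambda>_. 0"] by simp

lemma bernoulli_mean:
  assumes j: "j < p"
  shows "(\<Sum>\<xi>\<in>signs p. bernoulli p m \<xi> * \<xi> j) = m j"
proof -
  have "(\<Sum>\<xi>\<in>signs p. bernoulli p m \<xi> * \<xi> j) = (\<Sum>\<xi>\<in>signs p. \<Prod>i<p. (1 + m i * \<xi> i) / 2 * (if i = j then \<xi> i else 1))"
    unfolding bernoulli_def prod.distrib using j by (intro sum.cong refl) (simp add: prod.delta)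
  also have "\<dots> = (\<Prod>i<p. (1 + m i * 1) / 2 * (if i = j then 1 else 1) + (1 + m i * (-1)) / 2 * (if i = j then -1 else 1))"
    by (rule signs_prod)
  also have "\<dots> = (\<Prod>i<p. if i = j then m i else 1)"
    by (intro prod.cong refl) (simp add: field_simps)
  also have "\<dots> = m j" using j by (simp add: prod.delta)
  finally show ?thesis .
qed

lemma exp_le_quadratic:
  fixes s :: real
  assumes "\<bar>s\<bar> \<le> 1"
  shows "exp s \<le> 1 + s + s\<^sup>2"
proof (cases "0 \<le> s")
  case True then show ?thesis using assms exp_bound[of s] by simp
next
  case False
  then have s: "s < 0" by simp
  have "1 - s \<le> exp (- s)" using exp_ge_add_one_self[of "- s"] by simp
  then have "exp s * (1 - s) \<le> exp s * exp (- s)" by (intro mult_left_mono) auto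
  then have "exp s * (1 - s) \<le> 1" by (simp flip: exp_add)
  moreover have "1 \<le> (1 + s + s\<^sup>2) * (1 - s)"
  proof -
    have "(1 + s + s\<^sup>2) * (1 - s) = 1 + (- s) * s\<^sup>2" by (simp add: algebra_simps power2_eq_square)
    moreover have "0 \<le> (- s) * s\<^sup>2" using s by (intro mult_nonneg_nonneg) auto
    ultimately show ?thesis by simp
  qed
  ultimately have "exp s * (1 - s) \<le> (1 + s + s\<^sup>2) * (1 - s)" by simp
  then show ?thesis using s by simp
qed

lemma two_point_exp:
  fixes m d :: real
  assumes "\<bar>m\<bar> \<le> 1" "\<bar>d\<bar> \<le> 1"
  shows "((1 + m) * exp d + (1 - m) * exp (- d)) / 2 \<le> exp (m * d + d\<^sup>2)"
proof -
  have "(1 + m) * exp d \<le> (1 + m) * (1 + d + d\<^sup>2)" using exp_le_quadratic[of d] assms by (intro mult_left_mono) auto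
  moreover have "(1 - m) * exp (- d) \<le> (1 - m) * (1 - d + d\<^sup>2)" using exp_le_quadratic[of "- d"] assms by (intro mult_left_mono) auto
  ultimately have "((1 + m) * exp d + (1 - m) * exp (- d)) / 2 \<le> ((1 + m) * (1 + d + d\<^sup>2) + (1 - m) * (1 - d + d\<^sup>2)) / 2" by simp
  also have "\<dots> = 1 + (m * d + d\<^sup>2)" by (simp add: algebra_simps)
  also have "\<dots> \<le> exp (m * d + d\<^sup>2)" by (rule exp_ge_add_one_self)
  finally show ?thesis .
qed

lemma cosh_le_exp_square: "cosh (t :: real) \<le> exp (t\<^sup>2)"
proof (cases "\<bar>t\<bar> \<le> 1")
  case True
  have "cosh t = (exp t + exp (- t)) / 2" by (simp add: cosh_field_def)
  also have "\<dots> \<le> ((1 + t + t\<^sup>2) + (1 - t + t\<^sup>2)) / 2"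
    using exp_le_quadratic[of t] exp_le_quadratic[of "- t"] True by simp
  also have "\<dots> \<le> exp (t\<^sup>2)" using exp_ge_add_one_self[of "t\<^sup>2"] unfolding add_divide_distrib diff_divide_distrib by linarith
  finally show ?thesis .
next
  case False
  have "exp t \<le> exp \<bar>t\<bar>" "exp (- t) \<le> exp \<bar>t\<bar>" by auto
  then have "cosh t \<le> exp \<bar>t\<bar>" unfolding cosh_field_def add_divide_distrib by linarith
  also have "\<bar>t\<bar> * 1 \<le> \<bar>t\<bar> * \<bar>t\<bar>" using False by (intro mult_left_mono) auto
  then have "exp \<bar>t\<bar> \<le> exp (t\<^sup>2)" by (simp add: power2_eq_square)
  finally show ?thesis .
qed

text \<open>cosh splits into two exponentials, each bounded by \<open>two_point_exp\<close>. The
  variance part is even in d and factors out, the mean parts recombine to a cosh of the mean; so the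
  exponent is quadratic in the mean as well.\<close>

lemma bernoulli_cosh:
  assumes m: "\<And>i. i < p \<Longrightarrow> \<bar>m i\<bar> \<le> 1" and d: "\<And>i. i < p \<Longrightarrow> \<bar>d i\<bar> \<le> 1"
  shows "(\<Sum>\<xi>\<in>signs p. bernoulli p m \<xi> * cosh (\<Sum>i<p. \<xi> i * d i)) \<le> exp ((\<Sum>i<p. m i * d i)\<^sup>2 + (\<Sum>i<p. (d i)\<^sup>2))"
proof -
  have e: "(\<Sum>\<xi>\<in>signs p. bernoulli p m \<xi> * exp (\<Sum>i<p. \<xi> i * d i)) \<le> exp ((\<Sum>i<p. m i * d i) + (\<Sum>i<p. (d i)\<^sup>2))"
    if d: "\<And>i. i < p \<Longrightarrow> \<bar>d i\<bar> \<le> 1" for d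
  proof -
    have "0 \<le> ((1 + m i) * exp (d i) + (1 - m i) * exp (- d i)) / 2" if "i < p" for i
    proof -
      have "0 \<le> 1 + m i" "0 \<le> 1 - m i" using m[OF that] by (auto simp: abs_le_iff)
      then show ?thesis by simp
    qed
    then have "(\<Prod>i<p. ((1 + m i) * exp (d i) + (1 - m i) * exp (- d i)) / 2) \<le> (\<Prod>i<p. exp (m i * d i + (d i)\<^sup>2))"
      using m d by (intro prod_mono conjI two_point_exp) auto
    also have "\<dots> = exp (\<Sum>i<p. m i * d i + (d i)\<^sup>2)" by (simp only: exp_sum finite_lessThan)
    finally show ?thesis unfolding bernoulli_exp sum.distrib .
  qed
  have "(\<Sum>\<xi>\<in>signs p. bernoulli p m \<xi> * cosh (\<Sum>i<p. \<xi> i * d i))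
     = ((\<Sum>\<xi>\<in>signs p. bernoulli p m \<xi> * exp (\<Sum>i<p. \<xi> i * d i)) + (\<Sum>\<xi>\<in>signs p. bernoulli p m \<xi> * exp (\<Sum>i<p. \<xi> i * (- d i)))) / 2"
    unfolding cosh_field_def sum.distrib[symmetric] sum_divide_distrib by (intro sum.cong refl) (simp add: sum_negf distrib_left)
  also have "\<dots> \<le> (exp ((\<Sum>i<p. m i * d i) + (\<Sum>i<p. (d i)\<^sup>2)) + exp ((\<Sum>i<p. m i * (- d i)) + (\<Sum>i<p. (- d i)\<^sup>2))) / 2"
    using e[of d] e[of "\<lambda>i. - d i"] d by simp
  also have "\<dots> = cosh (\<Sum>i<p. m i * d i) * exp (\<Sum>i<p. (d i)\<^sup>2)"
    by (simp only: exp_add cosh_field_def sum_negf mult_minus_right power2_minus add_divide_distrib distrib_right)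
  also have "\<dots> \<le> exp ((\<Sum>i<p. m i * d i)\<^sup>2) * exp (\<Sum>i<p. (d i)\<^sup>2)"
    by (intro mult_right_mono cosh_le_exp_square) simp
  finally show ?thesis by (simp add: exp_add)
qed

text \<open>Tilting the uniform signs to the product measure with means \<open>v i / 2\<close> costs at most
  \<open>(\<Sum>i<p. (v i)\<^sup>2) / 4\<close> in relative entropy and gains twice as much.\<close>

lemma sign_average_lower:
  fixes v j :: "_ \<Rightarrow> real"
  assumes v: "\<And>i. i < p \<Longrightarrow> \<bar>v i\<bar> \<le> 2"
  defines "m \<equiv> \<lambda>i. v i / 2"
  shows "exp ((\<Sum>i<p. (v i)\<^sup>2) / 4 - (\<Sum>\<xi>\<in>signs p. bernoulli p m \<xi> * j \<xi>))
    \<le> (\<Sum>\<xi>\<in>signs p. (1/2) ^ p * exp ((\<Sum>i<p. \<xi> i * v i) - j \<xi>))"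
proof -
  have m: "\<And>i. i < p \<Longrightarrow> \<bar>m i\<bar> \<le> 1" using v by (simp add: m_def)
  \<comment> \<open>The exponent that is left when the density of the tilted law relative to the
    uniform one is bounded by exp of the sum of \<open>m i * \<xi> i\<close>. As m = v/2, its tilted
    mean is the sum of the (v i)^2/4 minus the mean of j; Jensen's inequality follows.\<close>
  define A where "A \<xi> = (\<Sum>i<p. \<xi> i * (v i - m i)) - j \<xi>" for \<xi>
  define a where "a = (\<Sum>\<xi>\<in>signs p. bernoulli p m \<xi> * A \<xi>)"
  have a: "a = (\<Sum>i<p. (v i)\<^sup>2) / 4 - (\<Sum>\<xi>\<in>signs p. bernoulli p m \<xi> * j \<xi>)"
  proof -
    have "(\<Sum>\<xi>\<in>signs p. bernoulli p m \<xi> * (\<Sum>i<p. \<xi> i * (v i - m i))) = (\<Sum>i<p. (\<Sum>\<xi>\<in>signs p. bernoulli p m \<xi> * \<xi> i) * (v i - m i))"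
      unfolding sum_distrib_left sum_distrib_right mult.assoc by (rule sum.swap)
    also have "\<dots> = (\<Sum>i<p. (v i)\<^sup>2 / 4)"
      by (intro sum.cong refl) (simp add: bernoulli_mean m_def power2_eq_square)
    finally show ?thesis unfolding a_def A_def right_diff_distrib sum_subtractf by (simp add: sum_divide_distrib)
  qed
  have "exp a = exp a * (\<Sum>\<xi>\<in>signs p. bernoulli p m \<xi> * (1 + (A \<xi> - a)))"
  proof -
    have "(\<Sum>\<xi>\<in>signs p. bernoulli p m \<xi> * (1 + (A \<xi> - a))) = (\<Sum>\<xi>\<in>signs p. bernoulli p m \<xi>) * (1 - a) + a"
      unfolding a_def sum_distrib_right sum.distrib[symmetric] by (intro sum.cong refl) (simp add: algebra_simps)
    then show ?thesis by (simp add: bernoulli_total)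
  qed
  also have "\<dots> \<le> exp a * (\<Sum>\<xi>\<in>signs p. bernoulli p m \<xi> * exp (A \<xi> - a))"
    by (intro mult_left_mono sum_mono bernoulli_bounds(1) m exp_ge_add_one_self) auto
  also have "\<dots> = (\<Sum>\<xi>\<in>signs p. bernoulli p m \<xi> * exp (A \<xi>))"
    unfolding sum_distrib_left by (intro sum.cong refl) (simp add: exp_diff)
  also have "\<dots> \<le> (\<Sum>\<xi>\<in>signs p. (1/2) ^ p * exp (\<Sum>i<p. m i * \<xi> i) * exp (A \<xi>))"
    by (intro sum_mono mult_right_mono bernoulli_bounds(2) m) auto
  also have "\<dots> = (\<Sum>\<xi>\<in>signs p. (1/2) ^ p * exp ((\<Sum>i<p. \<xi> i * v i) - j \<xi>))"
  proof (intro sum.cong refl)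
    fix \<xi>
    have "(\<Sum>i<p. m i * \<xi> i) + A \<xi> = (\<Sum>i<p. \<xi> i * v i) - j \<xi>"
      unfolding A_def by (simp add: right_diff_distrib sum_subtractf mult.commute)
    then show "(1/2) ^ p * exp (\<Sum>i<p. m i * \<xi> i) * exp (A \<xi>) = (1/2) ^ p * exp ((\<Sum>i<p. \<xi> i * v i) - j \<xi>)"
      by (simp only: mult.assoc exp_add[symmetric])
  qed
  finally show ?thesis unfolding a .
qed

text \<open>The average over signs is taken inside the double integral, where
  \<open>bernoulli_cosh\<close> applies pointwise: |f i| <= 1/2 makes all increments at most
  1.\<close>

lemma bernoulli_J:
  assumes f: "\<And>i. i < p \<Longrightarrow> continuous_on X (f i)" and fb: "\<And>i x. i < p \<Longrightarrow> x \<in> X \<Longrightarrow> \<bar>f i x\<bar> \<le> 1/2"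
    and m: "\<And>i. i < p \<Longrightarrow> \<bar>m i\<bar> \<le> 1"
  shows "(\<Sum>\<xi>\<in>signs p. bernoulli p m \<xi> * J n (\<lambda>y. \<Sum>i<p. \<xi> i * f i y))
    \<le> (real (Suc n))\<^sup>2 * I2 (\<lambda>x y. qq x y ^ n * (exp ((\<Sum>i<p. m i * (f i x - f i y))\<^sup>2 + (\<Sum>i<p. (f i x - f i y)\<^sup>2)) - 1))"
proof -
  have cf: "cont2 (\<lambda>x y. f i x)" "cont2 (\<lambda>x y. f i y)" if "i < p" for i
    using cont2_fst[OF f[OF that]] cont2_snd[OF f[OF that]] .
  have cd: "cont2 (\<lambda>x y. \<Sum>i<p. c i * (f i x - f i y))" for c
    by (intro continuous_on_sum continuous_on_mult_left continuous_on_diff cf) auto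
  have cJ: "cont2 (\<lambda>x y. bernoulli p m \<xi> * (qq x y ^ n * (cosh (\<Sum>i<p. \<xi> i * (f i x - f i y)) - 1)))" for \<xi>
    by (intro continuous_on_mult_left continuous_on_mult continuous_on_power cont2_qq continuous_on_diff continuous_on_cosh cd continuous_on_const)
  have "(\<Sum>\<xi>\<in>signs p. bernoulli p m \<xi> * J n (\<lambda>y. \<Sum>i<p. \<xi> i * f i y))
     = (real (Suc n))\<^sup>2 * (\<Sum>\<xi>\<in>signs p. I2 (\<lambda>x y. bernoulli p m \<xi> * (qq x y ^ n * (cosh (\<Sum>i<p. \<xi> i * (f i x - f i y)) - 1))))"
    unfolding J_def I2_cmult sum_distrib_left
    by (intro sum.cong refl) (simp add: right_diff_distrib sum_subtractf mult.left_commute del: of_nat_Suc)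
  also have "(\<Sum>\<xi>\<in>signs p. I2 (\<lambda>x y. bernoulli p m \<xi> * (qq x y ^ n * (cosh (\<Sum>i<p. \<xi> i * (f i x - f i y)) - 1))))
     = I2 (\<lambda>x y. \<Sum>\<xi>\<in>signs p. bernoulli p m \<xi> * (qq x y ^ n * (cosh (\<Sum>i<p. \<xi> i * (f i x - f i y)) - 1)))"
    by (rule I2_sum[symmetric]) (auto intro: cJ)
  finally have eq: "(\<Sum>\<xi>\<in>signs p. bernoulli p m \<xi> * J n (\<lambda>y. \<Sum>i<p. \<xi> i * f i y))
     = (real (Suc n))\<^sup>2 * I2 (\<lambda>x y. \<Sum>\<xi>\<in>signs p. bernoulli p m \<xi> * (qq x y ^ n * (cosh (\<Sum>i<p. \<xi> i * (f i x - f i y)) - 1)))" .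
  have "I2 (\<lambda>x y. \<Sum>\<xi>\<in>signs p. bernoulli p m \<xi> * (qq x y ^ n * (cosh (\<Sum>i<p. \<xi> i * (f i x - f i y)) - 1)))
     \<le> I2 (\<lambda>x y. qq x y ^ n * (exp ((\<Sum>i<p. m i * (f i x - f i y))\<^sup>2 + (\<Sum>i<p. (f i x - f i y)\<^sup>2)) - 1))"
  proof (rule I2_mono)
    show "cont2 (\<lambda>x y. \<Sum>\<xi>\<in>signs p. bernoulli p m \<xi> * (qq x y ^ n * (cosh (\<Sum>i<p. \<xi> i * (f i x - f i y)) - 1)))"
      by (intro continuous_on_sum cJ)
    show "cont2 (\<lambda>x y. qq x y ^ n * (exp ((\<Sum>i<p. m i * (f i x - f i y))\<^sup>2 + (\<Sum>i<p. (f i x - f i y)\<^sup>2)) - 1))"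
      by (intro continuous_on_mult continuous_on_power cont2_qq continuous_on_diff continuous_on_exp continuous_on_add cd continuous_on_const continuous_on_sum cf) auto
    fix x y assume x: "x \<in> X" and y: "y \<in> X"
    have d: "\<bar>f i x - f i y\<bar> \<le> 1" if "i < p" for i
      using fb[OF that x] fb[OF that y] by linarith
    have "(\<Sum>\<xi>\<in>signs p. bernoulli p m \<xi> * (qq x y ^ n * (cosh (\<Sum>i<p. \<xi> i * (f i x - f i y)) - 1)))
       = qq x y ^ n * ((\<Sum>\<xi>\<in>signs p. bernoulli p m \<xi> * cosh (\<Sum>i<p. \<xi> i * (f i x - f i y))) - (\<Sum>\<xi>\<in>signs p. bernoulli p m \<xi>))"
      unfolding sum_subtractf[symmetric] sum_distrib_left by (intro sum.cong refl) (simp add: algebra_simps)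
    also have "\<dots> \<le> qq x y ^ n * (exp ((\<Sum>i<p. m i * (f i x - f i y))\<^sup>2 + (\<Sum>i<p. (f i x - f i y)\<^sup>2)) - 1)"
      unfolding bernoulli_total
      by (intro mult_left_mono diff_right_mono bernoulli_cosh m d) (use qq_bounds[OF x y] in auto)
    finally show "(\<Sum>\<xi>\<in>signs p. bernoulli p m \<xi> * (qq x y ^ n * (cosh (\<Sum>i<p. \<xi> i * (f i x - f i y)) - 1)))
       \<le> qq x y ^ n * (exp ((\<Sum>i<p. m i * (f i x - f i y))\<^sup>2 + (\<Sum>i<p. (f i x - f i y)\<^sup>2)) - 1)" .
  qed
  then show ?thesis unfolding eq by (rule mult_left_mono) simp
qed

text \<open>For each sign vector \<open>exponential_moment\<close>, divided by exp J, gives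
  expectation at most 1, and the uniform weights add up to 1.\<close>

lemma sign_average_expectation:
  fixes f :: "nat \<Rightarrow> real^3 \<Rightarrow> real" and n p :: nat
  assumes f: "\<And>i. i < p \<Longrightarrow> continuous_on X (f i)"
  defines "v \<equiv> \<lambda>x i. (\<Sum>k<Suc n. f i (x (Suc k))) - real (Suc n) * (\<integral>y. f i y \<partial>sigma_X)"
  defines "\<Phi> \<equiv> \<lambda>x. \<Sum>\<xi>\<in>signs p. (1/2) ^ p * exp ((\<Sum>i<p. \<xi> i * v x i) - J n (\<lambda>y. \<Sum>i<p. \<xi> i * f i y))"
  shows "integrable (SE n) \<Phi>" "(\<integral>x. \<Phi> x \<partial>SE n) \<le> 1"
proof -
  define u where "u \<xi> y = (\<Sum>i<p. \<xi> i * f i y)" for \<xi> y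
  have u: "continuous_on X (u \<xi>)" for \<xi>
    unfolding u_def by (intro continuous_on_sum continuous_on_mult_left f) auto
  define e where "e \<xi> x = exp ((\<Sum>k<Suc n. u \<xi> (x (Suc k))) - real (Suc n) * (\<integral>y. u \<xi> y \<partial>sigma_X))" for \<xi> x
  have uv: "(\<Sum>i<p. \<xi> i * v x i) = (\<Sum>k<Suc n. u \<xi> (x (Suc k))) - real (Suc n) * (\<integral>y. u \<xi> y \<partial>sigma_X)" for \<xi> x
  proof -
    have "(\<integral>y. u \<xi> y \<partial>sigma_X) = (\<Sum>i<p. \<xi> i * (\<integral>y. f i y \<partial>sigma_X))"
      unfolding u_def by (subst Bochner_Integration.integral_sum) (auto intro!: integrable_contX f)
    moreover have "(\<Sum>k<Suc n. u \<xi> (x (Suc k))) = (\<Sum>i<p. \<xi> i * (\<Sum>k<Suc n. f i (x (Suc k))))"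
      unfolding u_def sum_distrib_left by (rule sum.swap)
    ultimately show ?thesis
      unfolding v_def right_diff_distrib sum_subtractf by (simp only: sum_distrib_left mult.left_commute)
  qed
  have uu: "(\<lambda>y. \<Sum>i<p. \<xi> i * f i y) = u \<xi>" for \<xi> by (simp add: u_def fun_eq_iff)
  have \<Phi>: "\<Phi> x = (\<Sum>\<xi>\<in>signs p. (1/2) ^ p * exp (- J n (u \<xi>)) * e \<xi> x)" for x
  proof -
    have "exp (a - b) = exp (- b) * exp a" for a b :: real by (simp add: exp_diff exp_minus divide_inverse)
    then have "exp ((\<Sum>i<p. \<xi> i * v x i) - j) = exp (- j) * e \<xi> x" for \<xi> j unfolding uv e_def .
    then show ?thesis unfolding \<Phi>_def uu mult.assoc by (simp only:)
  qed
  have ie: "integrable (SE n) (e \<xi>)" for \<xi>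
  proof -
    obtain B where B: "0 \<le> B" "\<And>x. x \<in> X \<Longrightarrow> norm (u \<xi> x) \<le> B" using contX_bounded[OF u] by metis
    show ?thesis
    proof (rule SE_integrable_bounded)
      show "e \<xi> \<in> borel_measurable (PN (Suc n))"
        unfolding e_def by (intro measurable_compose[OF sum_measurable[OF u], of "\<lambda>t. exp (t - _)"]) measurable
      fix x assume "x \<in> {1..Suc n} \<rightarrow> X"
      then have "\<bar>\<Sum>k<Suc n. u \<xi> (x (Suc k))\<bar> \<le> real (Suc n) * B" by (rule sum_bounded_X) (use B in auto)
      then show "\<bar>e \<xi> x\<bar> \<le> exp (real (Suc n) * B - real (Suc n) * (\<integral>y. u \<xi> y \<partial>sigma_X))"
        by (simp add: e_def abs_le_iff del: sum.lessThan_Suc of_nat_Suc)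
    qed
  qed
  show "integrable (SE n) \<Phi>" unfolding \<Phi>[abs_def] by (intro Bochner_Integration.integrable_sum integrable_mult_right ie)
  have "(\<integral>x. \<Phi> x \<partial>SE n) = (\<Sum>\<xi>\<in>signs p. (1/2) ^ p * exp (- J n (u \<xi>)) * (\<integral>x. e \<xi> x \<partial>SE n))"
    unfolding \<Phi> by (subst Bochner_Integration.integral_sum) (intro integrable_mult_right ie, simp only: integral_mult_right_zero)
  also have "\<dots> \<le> (\<Sum>\<xi>\<in>signs p. (1/2) ^ p * exp (- J n (u \<xi>)) * exp (J n (u \<xi>)))"
    unfolding e_def by (intro sum_mono mult_left_mono exponential_moment u) auto
  also have "\<dots> = (\<Sum>\<xi>\<in>signs p. \<Prod>i<p. 1/2)" by (simp add: mult.assoc flip: exp_add)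
  also have "\<dots> = 1" by (subst signs_prod) simp
  finally show "(\<integral>x. \<Phi> x \<partial>SE n) \<le> 1" .
qed

section \<open>Discrepancy functions and Cauchy--Schwarz in feature space\<close>

definition An :: "nat \<Rightarrow> (nat \<Rightarrow> real^3) \<Rightarrow> nat \<Rightarrow> real^3 \<Rightarrow> real" where
  "An N x m y = 1 / real N * (\<Sum>k=1..N. qq (x k) y ^ m) - 1 / (real m + 1)"

lemma An_cont: "continuous_on S (An N x m)"
  unfolding An_def qq_def by (intro continuous_intros) auto

lemma An_integral:
  assumes N: "1 \<le> N" and x: "x \<in> {1..N} \<rightarrow> X"
  shows "(\<integral>y. An N x m y \<partial>sigma_X) = 0"
proof -
  have i: "integrable sigma_X (\<lambda>y. qq (x k) y ^ m)" for k
    unfolding qq_def by (intro integrable_contX continuous_intros) auto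
  have "(\<integral>y. An N x m y \<partial>sigma_X) = 1 / real N * (\<Sum>k=1..N. \<integral>y. qq (x k) y ^ m \<partial>sigma_X) - 1 / (real m + 1)"
    unfolding An_def using i by simp
  also have "(\<Sum>k=1..N. \<integral>y. qq (x k) y ^ m \<partial>sigma_X) = (\<Sum>k=1..N. 1 / (real m + 1))"
    by (intro sum.cong refl moments) (rule Pi_mem[OF x])
  finally show ?thesis using N by simp
qed

lemma An_sum:
  assumes "1 \<le> N"
  shows "(\<Sum>k=1..N. An N x m (x k)) = real N * En N x m"
proof -
  have "(\<Sum>k=1..N. An N x m (x k)) = 1 / real N * (\<Sum>k=1..N. \<Sum>j=1..N. qq (x j) (x k) ^ m) - real N * (1 / (real m + 1))"
    unfolding An_def sum_subtractf sum_distrib_left by simp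
  also have "(\<Sum>k=1..N. \<Sum>j=1..N. qq (x j) (x k) ^ m) = (\<Sum>k=1..N. \<Sum>j=1..N. qq (x k) (x j) ^ m)"
    by (simp only: qq_commute)
  finally show ?thesis using assms unfolding En_def by (simp add: right_diff_distrib power2_eq_square)
qed

lemma An_eq_Bl:
  assumes "1 \<le> N"
  shows "An N x m y = (\<Sum>l=1..m. kap l m * Bl N x l y)"
proof -
  have "1 / real N * (\<Sum>k=1..N. qq (x k) y ^ m) = (\<Sum>l\<le>m. kap l m * Bl N x l y)"
    unfolding power_eq_sum_Zl Bl_def sum_distrib_left by (subst sum.swap) (simp only: mult.left_commute)
  also have "\<dots> = kap 0 m * Bl N x 0 y + (\<Sum>l=1..m. kap l m * Bl N x l y)"
    by (simp add: atMost_atLeast0 sum.atLeast_Suc_atMost del: kap_0)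
  also have "Bl N x 0 y = 1" using assms by (simp add: Bl_def)
  finally show ?thesis by (simp add: An_def)
qed

text \<open>v is the discrepancy of the configuration in feature space. Its pairing with a feature
  vector, and hence its squared norm, can be expressed by the kernel alone.\<close>

lemma feature_pairing:
  fixes g :: "nat \<Rightarrow> real^3 \<Rightarrow> real" and p N :: nat and x :: "nat \<Rightarrow> real^3"
  assumes K: "\<And>y z. K y z = (\<Sum>i<p. g i y * g i z)" and g: "\<And>i. i < p \<Longrightarrow> continuous_on X (g i)"
  defines "v \<equiv> \<lambda>i. (\<Sum>k<N. g i (x (Suc k))) - real N * (\<integral>y. g i y \<partial>sigma_X)"
  shows "(\<Sum>i<p. v i * g i y) = (\<Sum>k=1..N. K (x k) y) - real N * (\<integral>z. K z y \<partial>sigma_X)"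
    and "(\<Sum>i<p. (v i)\<^sup>2) = (\<Sum>k=1..N. \<Sum>i<p. v i * g i (x k)) - real N * (\<integral>z. (\<Sum>i<p. v i * g i z) \<partial>sigma_X)"
proof -
  have "(\<integral>z. K z y \<partial>sigma_X) = (\<Sum>i<p. (\<integral>z. g i z \<partial>sigma_X) * g i y)"
    unfolding K by (subst Bochner_Integration.integral_sum) (auto intro!: integrable_contX g)
  moreover have "(\<Sum>k=1..N. K (x k) y) = (\<Sum>i<p. (\<Sum>k<N. g i (x (Suc k))) * g i y)"
    unfolding K sum_distrib_right One_nat_def sum.atLeast1_atMost_eq by (rule sum.swap)
  ultimately show "(\<Sum>i<p. v i * g i y) = (\<Sum>k=1..N. K (x k) y) - real N * (\<integral>z. K z y \<partial>sigma_X)"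
    unfolding v_def left_diff_distrib sum_subtractf by (simp only: sum_distrib_left mult.assoc)
  have "(\<integral>z. (\<Sum>i<p. v i * g i z) \<partial>sigma_X) = (\<Sum>i<p. v i * (\<integral>z. g i z \<partial>sigma_X))"
    by (subst Bochner_Integration.integral_sum) (auto intro!: integrable_contX g)
  moreover have "(\<Sum>k=1..N. \<Sum>i<p. v i * g i (x k)) = (\<Sum>i<p. v i * (\<Sum>k<N. g i (x (Suc k))))"
    unfolding sum_distrib_left One_nat_def sum.atLeast1_atMost_eq by (rule sum.swap)
  moreover have "(v i)\<^sup>2 = v i * (\<Sum>k<N. g i (x (Suc k))) - real N * (v i * (\<integral>z. g i z \<partial>sigma_X))" for i
    unfolding v_def by (simp only: power2_eq_square right_diff_distrib mult.left_commute)
  ultimately show "(\<Sum>i<p. (v i)\<^sup>2) = (\<Sum>k=1..N. \<Sum>i<p. v i * g i (x k)) - real N * (\<integral>z. (\<Sum>i<p. v i * g i z) \<partial>sigma_X)"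
    by (simp only: sum_subtractf sum_distrib_left)
qed

text \<open>In the feature space of q^m, N times \<open>An\<close> is the pairing with the
  discrepancy vector, whose squared norm is N^2 times \<open>En\<close>, and two feature vectors
  have squared distance 2 (1 - q^m).\<close>

lemma An_difference:
  assumes N: "1 \<le> N" and x: "x \<in> {1..N} \<rightarrow> X" and y: "y \<in> X" and z: "z \<in> X"
  shows "(An N x m y - An N x m z)\<^sup>2 \<le> 2 * (1 - qq y z ^ m) * En N x m"
proof -
  obtain p :: nat and g where g: "\<And>i. i < p \<Longrightarrow> spoly (g i)" "\<And>y z. qq y z ^ m = (\<Sum>i<p. g i y * g i z)"
    using featE[OF feat_qq_power[of m]] by metis
  have gc: "\<And>i. i < p \<Longrightarrow> continuous_on X (g i)" using g(1) spoly_continuous by blast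
  define v where "v i = (\<Sum>k<N. g i (x (Suc k))) - real N * (\<integral>y. g i y \<partial>sigma_X)" for i
  have G: "(\<Sum>i<p. v i * g i y) = real N * An N x m y" if y: "y \<in> X" for y
  proof -
    have "(\<Sum>i<p. v i * g i y) = (\<Sum>k=1..N. qq (x k) y ^ m) - real N * (\<integral>z. qq z y ^ m \<partial>sigma_X)"
      unfolding v_def by (rule feature_pairing(1)[where K = "\<lambda>y z. qq y z ^ m", OF g(2) gc])
    also have "(\<integral>z. qq z y ^ m \<partial>sigma_X) = 1 / (real m + 1)"
      using moments[OF y, of m] by (simp add: qq_commute)
    finally show ?thesis using N by (simp add: An_def right_diff_distrib)
  qed
  have "(\<Sum>i<p. (v i)\<^sup>2) = (\<Sum>k=1..N. \<Sum>i<p. v i * g i (x k)) - real N * (\<integral>z. (\<Sum>i<p. v i * g i z) \<partial>sigma_X)"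
    unfolding v_def by (rule feature_pairing(2)[where K = "\<lambda>y z. qq y z ^ m", OF g(2) gc])
  also have "(\<Sum>k=1..N. \<Sum>i<p. v i * g i (x k)) = (\<Sum>k=1..N. real N * An N x m (x k))"
    by (intro sum.cong refl G) (rule Pi_mem[OF x])
  also have "\<dots> = (real N)\<^sup>2 * En N x m" unfolding sum_distrib_left[symmetric] An_sum[OF N] by (simp add: power2_eq_square)
  also have "(\<integral>z. (\<Sum>i<p. v i * g i z) \<partial>sigma_X) = (\<integral>z. real N * An N x m z \<partial>sigma_X)"
    by (intro Bochner_Integration.integral_cong refl G) simp
  also have "\<dots> = 0" using An_integral[OF N x] by simp
  finally have V: "(\<Sum>i<p. (v i)\<^sup>2) = (real N)\<^sup>2 * En N x m" by simp
  have "(real N * An N x m y - real N * An N x m z)\<^sup>2 = (\<Sum>i<p. v i * (g i y - g i z))\<^sup>2"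
    unfolding G[OF y, symmetric] G[OF z, symmetric] by (simp add: right_diff_distrib sum_subtractf)
  also have "\<dots> \<le> (\<Sum>i<p. (v i)\<^sup>2) * (\<Sum>i<p. (g i y - g i z)\<^sup>2)" by (rule Cauchy_Schwarz_ineq_sum)
  also have "(\<Sum>i<p. (g i y - g i z)\<^sup>2) = qq y y ^ m + qq z z ^ m - 2 * qq y z ^ m"
    unfolding g(2) sum_distrib_left sum.distrib[symmetric] sum_subtractf[symmetric]
    by (intro sum.cong refl) (simp add: power2_eq_square algebra_simps)
  also have "\<dots> = 2 * (1 - qq y z ^ m)" using y z by simp
  finally have "(real N)\<^sup>2 * (An N x m y - An N x m z)\<^sup>2 \<le> (real N)\<^sup>2 * (2 * (1 - qq y z ^ m) * En N x m)"
    unfolding V by (simp add: right_diff_distrib[symmetric] power_mult_distrib mult_ac)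
  then show ?thesis using N by simp
qed

lemma inverse_squares_tail:
  assumes k: "1 \<le> k"
  shows "(\<Sum>m=Suc k..M. 1 / (real m)\<^sup>2) \<le> 1 / real k"
proof -
  have "(\<Sum>m=Suc k..M. 1 / (real m)\<^sup>2) \<le> 1 / real k - 1 / real (max k M)"
  proof (induction M)
    case (Suc M)
    show ?case
    proof (cases "Suc M \<le> k")
      case False
      then have M: "k \<le> M" "1 \<le> M" using k by auto
      have "1 / (a + 1)\<^sup>2 \<le> 1 / a - 1 / (a + 1)" if "1 \<le> a" for a :: real
      proof -
        have "1 / a - 1 / (a + 1) = 1 / (a * (a + 1))" using that by (simp add: field_simps)
        moreover have "1 / (a + 1)\<^sup>2 \<le> 1 / (a * (a + 1))"
          unfolding power2_eq_square using that by (intro divide_left_mono mult_right_mono) auto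
        ultimately show ?thesis by simp
      qed
      from this[of "real M"] have "1 / (real (Suc M))\<^sup>2 \<le> 1 / real M - 1 / real (Suc M)" using M by (simp add: add.commute)
      moreover have "(\<Sum>m=Suc k..Suc M. 1 / (real m)\<^sup>2) = (\<Sum>m=Suc k..M. 1 / (real m)\<^sup>2) + 1 / (real (Suc M))\<^sup>2"
        using M by simp
      ultimately show ?thesis using Suc M by (simp add: max_def split: if_splits)
    qed simp
  qed simp
  also have "\<dots> \<le> 1 / real k" by simp
  finally show ?thesis .
qed

lemma sum_inverse_squares: "(\<Sum>m=1..T. 1 / (real m)\<^sup>2) \<le> 2"
proof (cases "1 \<le> T")
  case True
  then have "(\<Sum>m=1..T. 1 / (real m)\<^sup>2) = 1 + (\<Sum>m=Suc 1..T. 1 / (real m)\<^sup>2)" by (simp add: sum.atLeast_Suc_atMost)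
  then show ?thesis using inverse_squares_tail[of 1 T] by simp
qed simp

lemma Cauchy_Schwarz_weighted:
  fixes a c :: "nat \<Rightarrow> real"
  assumes c: "\<And>m. m \<in> I \<Longrightarrow> 0 \<le> c m"
  shows "(\<Sum>m\<in>I. c m * a m)\<^sup>2 \<le> (\<Sum>m\<in>I. c m) * (\<Sum>m\<in>I. c m * (a m)\<^sup>2)"
proof -
  have "(\<Sum>m\<in>I. c m * a m) = (\<Sum>m\<in>I. sqrt (c m) * (sqrt (c m) * a m))"
    using c by (intro sum.cong refl) (simp add: mult.assoc[symmetric])
  then have "(\<Sum>m\<in>I. c m * a m)\<^sup>2 \<le> (\<Sum>m\<in>I. (sqrt (c m))\<^sup>2) * (\<Sum>m\<in>I. (sqrt (c m) * a m)\<^sup>2)"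
    using Cauchy_Schwarz_ineq_sum[of "\<lambda>m. sqrt (c m)" "\<lambda>m. sqrt (c m) * a m" I] by simp
  also have "\<dots> = (\<Sum>m\<in>I. c m) * (\<Sum>m\<in>I. c m * (a m)\<^sup>2)"
    using c by (simp add: power_mult_distrib)
  finally show ?thesis .
qed

lemma one_minus_power_le:
  fixes q :: real
  assumes "0 \<le> q" "q \<le> 1"
  shows "1 - q ^ m \<le> real m * (1 - q)"
proof (induction m)
  case (Suc m)
  have "1 - q ^ Suc m = (1 - q) + q * (1 - q ^ m)" by (simp add: algebra_simps)
  also have "q * (1 - q ^ m) \<le> 1 * (1 - q ^ m)" using assms by (intro mult_right_mono) (auto intro: power_le_one)
  finally show ?case using Suc by (simp add: algebra_simps)
qed simp

text \<open>The sum is split at m = N. Below, weighted Cauchy--Schwarz and 1 - q^m <= m (1 - q) lead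
  to the sum of \<open>En\<close> / m, at most 6/N by the energy bound: this gives 24 (1 - q)/N.
  Above, \<open>En\<close> <= 1 leaves a tail of m^(-3/2) and gives 8 (1 - q)/N. Finally (a + b)^2
  <= 2 a^2 + 2 b^2.\<close>

lemma An_sum_difference:
  assumes N: "1 \<le> N" and x: "x \<in> {1..N} \<rightarrow> X" and y: "y \<in> X" and z: "z \<in> X"
    and E: "Energy N x \<le> 3 * real N" and NT: "N \<le> T"
  shows "(\<Sum>m=1..T. (An N x m y - An N x m z) / (real m)\<^sup>2)\<^sup>2 \<le> 64 * (1 - qq y z) / real N"
proof -
  define a where "a m = An N x m y - An N x m z" for m
  define q where "q = qq y z"
  have q: "0 \<le> q" "q \<le> 1" using qq_bounds[OF y z] by (auto simp: q_def)
  have En: "0 \<le> En N x m" "En N x m \<le> 1" for m using En_nonneg[OF N x] En_le_1[OF N x] by auto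
  have a: "(a m)\<^sup>2 \<le> 2 * (real m * (1 - q)) * En N x m" for m
  proof -
    have "2 * (1 - q ^ m) * En N x m \<le> 2 * (real m * (1 - q)) * En N x m"
      by (intro mult_right_mono mult_left_mono one_minus_power_le q En) simp
    then show ?thesis using An_difference[OF N x y z, of m] unfolding a_def q_def by linarith
  qed
  define S1 where "S1 = (\<Sum>m=1..N. a m / (real m)\<^sup>2)"
  define S2 where "S2 = (\<Sum>m=Suc N..T. a m / (real m)\<^sup>2)"
  have S: "(\<Sum>m=1..T. a m / (real m)\<^sup>2) = S1 + S2"
  proof -
    have "{1..T} = {1..N} \<union> {Suc N..T}" using NT by auto
    then show ?thesis unfolding S1_def S2_def by (simp only:) (rule sum.union_disjoint, auto)
  qed
  have le: "(\<Sum>m=1..N. 1 / (real m)\<^sup>2 * (a m)\<^sup>2) \<le> (\<Sum>m=1..N. 2 * (1 - q) * (En N x m / real m))"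
  proof (rule sum_mono)
    fix m assume "m \<in> {1..N}"
    then have m: "0 < real m" by simp
    have "1 / (real m)\<^sup>2 * (a m)\<^sup>2 \<le> 1 / (real m)\<^sup>2 * (2 * (real m * (1 - q)) * En N x m)"
      by (intro mult_left_mono a) simp
    also have "\<dots> = 2 * (1 - q) * (En N x m / real m)" using m by (simp add: power2_eq_square mult_ac)
    finally show "1 / (real m)\<^sup>2 * (a m)\<^sup>2 \<le> 2 * (1 - q) * (En N x m / real m)" .
  qed
  have nn: "0 \<le> (\<Sum>m=1..N. 1 / (real m)\<^sup>2 * (a m)\<^sup>2)" by (rule sum_nonneg) simp
  have "S1\<^sup>2 \<le> (\<Sum>m=1..N. 1 / (real m)\<^sup>2) * (\<Sum>m=1..N. 1 / (real m)\<^sup>2 * (a m)\<^sup>2)"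
    using Cauchy_Schwarz_weighted[of "{1..N}" "\<lambda>m. 1 / (real m)\<^sup>2" a] by (simp add: S1_def)
  also have "\<dots> \<le> 2 * (\<Sum>m=1..N. 2 * (1 - q) * (En N x m / real m))"
    by (rule mult_mono[OF sum_inverse_squares le _ nn]) simp
  also have "\<dots> = 4 * (1 - q) * (\<Sum>m=1..N. En N x m / real m)" unfolding sum_distrib_left[symmetric] by simp
  also have "\<dots> \<le> 4 * (1 - q) * (6 / real N)"
  proof (rule mult_left_mono)
    have "real N * (real N * (\<Sum>m=1..N. En N x m / real m)) \<le> real N * 6"
      using E unfolding Energy_def by (simp add: power2_eq_square)
    then have "real N * (\<Sum>m=1..N. En N x m / real m) \<le> 6" using N by simp
    then show "(\<Sum>m=1..N. En N x m / real m) \<le> 6 / real N" using N by (simp add: pos_le_divide_eq mult.commute)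
  qed (use q in simp)
  finally have S1: "S1\<^sup>2 \<le> 24 * ((1 - q) / real N)" by simp
  have "\<bar>S2\<bar> \<le> (\<Sum>m=Suc N..T. sqrt (2 * (1 - q)) * real m powr (- (3/2)))"
    unfolding S2_def
  proof (rule order_trans[OF sum_abs], rule sum_mono)
    fix m assume "m \<in> {Suc N..T}"
    then have m: "0 < real m" by simp
    have "0 \<le> 2 * (real m * (1 - q))" using q by simp
    from order_trans[OF a mult_left_mono[OF En(2) this]] have "(a m)\<^sup>2 \<le> 2 * (real m * (1 - q)) * 1" .
    then have "\<bar>a m\<bar>\<^sup>2 \<le> 2 * (1 - q) * real m" unfolding power2_abs by (simp only: mult_1_right mult_ac)
    then have "\<bar>a m\<bar> \<le> sqrt (2 * (1 - q) * real m)" by (rule real_le_rsqrt)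
    then have "\<bar>a m\<bar> \<le> sqrt (2 * (1 - q)) * sqrt (real m)" by (simp only: real_sqrt_mult)
    then have "\<bar>a m / (real m)\<^sup>2\<bar> \<le> sqrt (2 * (1 - q)) * sqrt (real m) / (real m)\<^sup>2"
      by (simp add: abs_divide divide_right_mono)
    moreover have "sqrt (real m) / (real m)\<^sup>2 = real m powr (- (3/2))"
    proof -
      have "real m powr (- (3/2)) = real m powr (1/2 - 2)" by simp
      also have "\<dots> = real m powr (1/2) / real m powr 2" by (rule powr_diff)
      finally show ?thesis using m by (simp add: powr_half_sqrt)
    qed
    ultimately show "\<bar>a m / (real m)\<^sup>2\<bar> \<le> sqrt (2 * (1 - q)) * real m powr (- (3/2))"
      by (metis times_divide_eq_right)
  qed
  also have "\<dots> \<le> sqrt (2 * (1 - q)) * (real N powr (1 - 3/2) / (3/2 - 1))"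
  proof -
    have "(\<Sum>m=Suc N..T. real m powr (- (3/2))) \<le> real N powr (1 - 3/2) / (3/2 - 1)"
      by (rule powr_tail) (use N in auto)
    then show ?thesis unfolding sum_distrib_left[symmetric] by (rule mult_left_mono) (use q in simp)
  qed
  also have "\<dots> = sqrt (2 * (1 - q)) * (2 / sqrt (real N))"
  proof -
    have "real N powr (1 - 3/2) = real N powr (- (1/2))" by simp
    also have "\<dots> = inverse (sqrt (real N))" using N by (simp only: powr_minus) (simp add: powr_half_sqrt)
    finally have "real N powr (1 - 3/2) = inverse (sqrt (real N))" .
    moreover have "inverse s / (3/2 - 1) = 2 / s" for s :: real by (simp add: inverse_eq_divide)
    ultimately show ?thesis by (simp only:)
  qed
  finally have "\<bar>S2\<bar> \<le> sqrt (2 * (1 - q)) * (2 / sqrt (real N))" .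
  from power_mono[OF this abs_ge_zero, of 2] have "S2\<^sup>2 \<le> (sqrt (2 * (1 - q)) * (2 / sqrt (real N)))\<^sup>2" unfolding power2_abs .
  also have "\<dots> = 8 * ((1 - q) / real N)" using q N by (simp add: power_mult_distrib power_divide)
  finally have S2: "S2\<^sup>2 \<le> 8 * ((1 - q) / real N)" .
  have sq: "(a + b)\<^sup>2 \<le> 64 * t" if "a\<^sup>2 \<le> 24 * t" "b\<^sup>2 \<le> 8 * t" for a b t :: real
  proof -
    have "(a + b)\<^sup>2 + (a - b)\<^sup>2 = 2 * a\<^sup>2 + 2 * b\<^sup>2" by (simp add: power2_eq_square algebra_simps)
    then show ?thesis using that zero_le_power2[of "a - b"] by linarith
  qed
  from sq[OF S1 S2] have "(\<Sum>m=1..T. a m / (real m)\<^sup>2)\<^sup>2 \<le> 64 * ((1 - q) / real N)" unfolding S .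
  then show ?thesis unfolding a_def q_def times_divide_eq_right .
qed

section \<open>Integral estimates for the cost of the tilt\<close>

lemma mult_exp_one_minus_le:
  fixes q :: real
  assumes q: "0 \<le> q" "q \<le> 1" and N: "2 \<le> N"
  shows "q ^ (N - 1) * exp (real N * (1 - q) / 4) \<le> q ^ (N - 1 - N div 2)"
proof -
  \<comment> \<open>About half of the exponent pays for the exponential, by q exp (1 - q) <= 1 and N
    div 2 >= N/4; the other half remains as a weight.\<close>
  define h where "h = N div 2"
  have h: "h \<le> N - 1" "real N / 4 \<le> real h" using N unfolding h_def by linarith+
  have "N - 1 - h + h = N - 1" using h by simp
  then have "q ^ (N - 1) = q ^ (N - 1 - h) * q ^ h" by (metis power_add)
  moreover have "exp (real N * (1 - q) / 4) \<le> exp (1 - q) ^ h"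
  proof -
    have "real N / 4 * (1 - q) \<le> real h * (1 - q)" using h q by (intro mult_right_mono) auto
    then show ?thesis by (simp flip: exp_of_nat_mult)
  qed
  moreover have "q ^ h * exp (1 - q) ^ h \<le> 1"
  proof -
    have "q \<le> exp (q - 1)" using exp_ge_add_one_self[of "q - 1"] by simp
    then have "q * exp (1 - q) \<le> exp (q - 1) * exp (1 - q)" by (intro mult_right_mono) auto
    also have "\<dots> = 1" by (simp flip: exp_add)
    finally show ?thesis unfolding power_mult_distrib[symmetric] using q by (intro power_le_one) auto
  qed
  ultimately have "q ^ (N - 1) * exp (real N * (1 - q) / 4) \<le> q ^ (N - 1 - h) * (q ^ h * exp (1 - q) ^ h)"
    using q by (simp add: mult.assoc mult_left_mono)
  also have "\<dots> \<le> q ^ (N - 1 - h) * 1"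
    using \<open>q ^ h * exp (1 - q) ^ h \<le> 1\<close> q by (intro mult_left_mono) auto
  finally show ?thesis by (simp add: h_def)
qed

text \<open>\<open>I2\<close> is an iterated integral; the order of integration is exchanged through
  the finite feature expansion of q^r.\<close>

lemma I2_qq_power_mixed:
  assumes a: "continuous_on X a"
  shows "I2 (\<lambda>y z. qq y z ^ r * a z) = (\<integral>y. a y \<partial>sigma_X) / (real r + 1)"
    and "I2 (\<lambda>y z. qq y z ^ r * a y) = (\<integral>y. a y \<partial>sigma_X) / (real r + 1)"
proof -
  obtain p :: nat and g where g: "\<And>i. i < p \<Longrightarrow> spoly (g i)" "\<And>y z. qq y z ^ r = (\<Sum>i<p. g i y * g i z)"
    using featE[OF feat_qq_power[of r]] by metis
  have gc: "\<And>i. i < p \<Longrightarrow> continuous_on X (g i)" using g(1) spoly_continuous by blast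
  have i: "integrable sigma_X (g i)" "integrable sigma_X (\<lambda>z. g i z * a z)" if "i < p" for i
    using gc[OF that] a by (auto intro!: integrable_contX continuous_intros)
  then have i': "integrable sigma_X (\<lambda>z. a z * g i z)" if "i < p" for i using that by (simp add: mult.commute)
  have "I2 (\<lambda>y z. qq y z ^ r * a z) = (\<integral>y. (\<Sum>i<p. g i y * (\<integral>z. g i z * a z \<partial>sigma_X)) \<partial>sigma_X)"
    unfolding I2_def g(2) sum_distrib_right mult.assoc
    by (subst Bochner_Integration.integral_sum) (auto intro!: i integrable_mult_right)
  also have "\<dots> = (\<Sum>i<p. (\<integral>y. g i y \<partial>sigma_X) * (\<integral>z. g i z * a z \<partial>sigma_X))"
    by (subst Bochner_Integration.integral_sum) (auto intro!: i)
  also have "\<dots> = (\<integral>y. (\<Sum>i<p. g i y * a y * (\<integral>z. g i z \<partial>sigma_X)) \<partial>sigma_X)"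
    by (subst Bochner_Integration.integral_sum) (auto intro!: i i' simp: mult.commute)
  also have "\<dots> = I2 (\<lambda>y z. qq y z ^ r * a y)"
  proof -
    have "(\<Sum>i<p. g i y * a y * (\<integral>z. g i z \<partial>sigma_X)) = (\<integral>z. qq y z ^ r * a y \<partial>sigma_X)" for y
      unfolding g(2) sum_distrib_right
      by (subst Bochner_Integration.integral_sum) (auto intro!: i i' simp: mult_ac)
    then show ?thesis by (simp add: I2_def)
  qed
  finally have e: "I2 (\<lambda>y z. qq y z ^ r * a z) = I2 (\<lambda>y z. qq y z ^ r * a y)" .
  have "I2 (\<lambda>y z. qq y z ^ r * a y) = (\<integral>y. a y / (real r + 1) \<partial>sigma_X)"
    unfolding I2_def by (intro Bochner_Integration.integral_cong refl) (simp add: moments)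
  then show "I2 (\<lambda>y z. qq y z ^ r * a y) = (\<integral>y. a y \<partial>sigma_X) / (real r + 1)" by simp
  then show "I2 (\<lambda>y z. qq y z ^ r * a z) = (\<integral>y. a y \<partial>sigma_X) / (real r + 1)" using e by simp
qed

text \<open>After expanding the square, each of the two squares contributes with the factor 1/(r +
  1), and the cross term with \<open>kap l r\<close> by Funk--Hecke; orthogonality of the
  \<open>Bl\<close> makes the form diagonal in the degree.\<close>

lemma Bl_combination_quadratic:
  fixes \<omega> :: "nat \<Rightarrow> real" and T :: nat
  assumes N: "1 \<le> N" and x: "x \<in> {1..N} \<rightarrow> X"
  defines "w \<equiv> \<lambda>y. \<Sum>l=1..T. \<omega> l * Bl N x l y"
  shows "I2 (\<lambda>y z. qq y z ^ r * (w y - w z)\<^sup>2) = 2 * (\<Sum>l=1..T. (\<omega> l)\<^sup>2 * Wl N x l * (1 / (real r + 1) - kap l r))"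
proof -
  have wc: "continuous_on X w" unfolding w_def by (intro continuous_intros Bl_cont)
  have pair: "(\<integral>y. (\<Sum>l=1..T. c l * Bl N x l y) * w y \<partial>sigma_X) = (\<Sum>l=1..T. c l * \<omega> l * Wl N x l)" for c
  proof -
    have "(\<integral>y. (\<Sum>l=1..T. c l * Bl N x l y) * w y \<partial>sigma_X)
       = (\<integral>y. (\<Sum>l=1..T. \<Sum>k=1..T. c l * \<omega> k * (Bl N x l y * Bl N x k y)) \<partial>sigma_X)"
      unfolding w_def sum_product by (intro Bochner_Integration.integral_cong refl sum.cong) (simp add: mult_ac)
    also have "\<dots> = (\<Sum>l=1..T. \<integral>y. (\<Sum>k=1..T. c l * \<omega> k * (Bl N x l y * Bl N x k y)) \<partial>sigma_X)"
      by (intro Bochner_Integration.integral_sum integrable_contX continuous_intros Bl_cont)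
    also have "\<dots> = (\<Sum>l=1..T. \<Sum>k=1..T. \<integral>y. c l * \<omega> k * (Bl N x l y * Bl N x k y) \<partial>sigma_X)"
      by (intro sum.cong refl Bochner_Integration.integral_sum integrable_contX continuous_intros Bl_cont)
    also have "\<dots> = (\<Sum>l=1..T. \<Sum>k=1..T. if k = l then c l * \<omega> l * Wl N x l else 0)"
      unfolding integral_mult_right_zero Bl_Bl[OF x] by (intro sum.cong refl) auto
    also have "\<dots> = (\<Sum>l=1..T. c l * \<omega> l * Wl N x l)" by (intro sum.cong refl) (simp add: sum.delta)
    finally show ?thesis .
  qed
  have ww: "(\<integral>y. (w y)\<^sup>2 \<partial>sigma_X) = (\<Sum>l=1..T. (\<omega> l)\<^sup>2 * Wl N x l)"
  proof -
    have "(\<lambda>y. \<Sum>l=1..T. \<omega> l * Bl N x l y) = w" by (simp add: w_def)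
    then show ?thesis using pair[of \<omega>] unfolding power2_eq_square by metis
  qed
  have qw: "(\<integral>z. qq y z ^ r * w z \<partial>sigma_X) = (\<Sum>l=1..T. (\<omega> l * kap l r) * Bl N x l y)" if y: "y \<in> X" for y
  proof -
    have "(\<integral>z. qq y z ^ r * w z \<partial>sigma_X) = (\<integral>z. (\<Sum>l=1..T. \<omega> l * (qq y z ^ r * Bl N x l z)) \<partial>sigma_X)"
      unfolding w_def sum_distrib_left by (simp only: mult.left_commute)
    also have "\<dots> = (\<Sum>l=1..T. \<integral>z. \<omega> l * (qq y z ^ r * Bl N x l z) \<partial>sigma_X)"
      by (intro Bochner_Integration.integral_sum integrable_contX continuous_intros Bl_cont continuous_qq)
    also have "\<dots> = (\<Sum>l=1..T. (\<omega> l * kap l r) * Bl N x l y)"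
      unfolding integral_mult_right_zero funk_hecke[OF y Bl_eigen[OF x]] by (simp only: mult.assoc)
    finally show ?thesis .
  qed
  have cross: "I2 (\<lambda>y z. qq y z ^ r * (w y * w z)) = (\<Sum>l=1..T. (\<omega> l)\<^sup>2 * Wl N x l * kap l r)"
  proof -
    have "I2 (\<lambda>y z. qq y z ^ r * (w y * w z)) = (\<integral>y. (\<Sum>l=1..T. (\<omega> l * kap l r) * Bl N x l y) * w y \<partial>sigma_X)"
      unfolding I2_def
    proof (intro Bochner_Integration.integral_cong refl)
      fix y assume "y \<in> space sigma_X"
      then have y: "y \<in> X" by simp
      have "(\<integral>z. qq y z ^ r * (w y * w z) \<partial>sigma_X) = w y * (\<integral>z. qq y z ^ r * w z \<partial>sigma_X)"
        unfolding mult.left_commute[of _ "w y"] by simp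
      then show "(\<integral>z. qq y z ^ r * (w y * w z) \<partial>sigma_X) = (\<Sum>l=1..T. (\<omega> l * kap l r) * Bl N x l y) * w y"
        unfolding qw[OF y] by (simp only: mult.commute)
    qed
    also have "\<dots> = (\<Sum>l=1..T. (\<omega> l)\<^sup>2 * Wl N x l * kap l r)"
      unfolding pair by (intro sum.cong refl) (simp add: power2_eq_square mult_ac)
    finally show ?thesis .
  qed
  have c: "cont2 (\<lambda>y z. qq y z ^ r * (w y)\<^sup>2)" "cont2 (\<lambda>y z. qq y z ^ r * (w z)\<^sup>2)" "cont2 (\<lambda>y z. qq y z ^ r * (w y * w z))"
    by (intro continuous_on_mult continuous_on_power cont2_qq cont2_fst[OF wc] cont2_snd[OF wc])+
  have w2: "continuous_on X (\<lambda>y. (w y)\<^sup>2)" by (intro continuous_intros wc)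
  have "I2 (\<lambda>y z. qq y z ^ r * (w y - w z)\<^sup>2) = I2 (\<lambda>y z. qq y z ^ r * (w y)\<^sup>2 + (qq y z ^ r * (w z)\<^sup>2 + (-2) * (qq y z ^ r * (w y * w z))))"
    by (intro I2_cong) (simp add: power2_eq_square algebra_simps)
  also have "\<dots> = I2 (\<lambda>y z. qq y z ^ r * (w y)\<^sup>2) + (I2 (\<lambda>y z. qq y z ^ r * (w z)\<^sup>2) + (-2) * I2 (\<lambda>y z. qq y z ^ r * (w y * w z)))"
    using I2_add[OF c(1) continuous_on_add[OF c(2) continuous_on_mult_left[OF c(3), of "-2"]]]
      I2_add[OF c(2) continuous_on_mult_left[OF c(3), of "-2"]] by (simp only: I2_cmult)
  also have "\<dots> = 2 * (\<Sum>l=1..T. (\<omega> l)\<^sup>2 * Wl N x l * (1 / (real r + 1) - kap l r))"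
    unfolding cross I2_qq_power_mixed[OF w2] ww
    by (simp add: right_diff_distrib sum_subtractf sum_divide_distrib)
  finally show ?thesis .
qed

text \<open>For a feature map of the kernel $e \sum_{m \le T} q^m / m^2$: \<open>potential\<close> is half the pairing of the
  feature vector with the discrepancy vector of \<open>x\<close>, \<open>feature_gap\<close> the squared distance of two feature
  vectors, \<open>weighted_energy\<close> the squared norm of the discrepancy vector.\<close>

definition potential :: "real \<Rightarrow> nat \<Rightarrow> nat \<Rightarrow> (nat \<Rightarrow> real^3) \<Rightarrow> real^3 \<Rightarrow> real" where
  "potential e T N x y = e * real N / 2 * (\<Sum>m=1..T. An N x m y / (real m)\<^sup>2)"

definition feature_gap :: "real \<Rightarrow> nat \<Rightarrow> real^3 \<Rightarrow> real^3 \<Rightarrow> real" where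
  "feature_gap e T y z = 2 * e * (\<Sum>m=1..T. (1 - qq y z ^ m) / (real m)\<^sup>2)"

definition weighted_energy :: "real \<Rightarrow> nat \<Rightarrow> nat \<Rightarrow> (nat \<Rightarrow> real^3) \<Rightarrow> real" where
  "weighted_energy e T N x = e * (real N)\<^sup>2 * (\<Sum>m=1..T. En N x m / (real m)\<^sup>2)"

lemma potential_cont: "continuous_on S (potential e T N x)"
  unfolding potential_def divide_inverse by (intro continuous_intros An_cont)

lemma cont2_Dd: "cont2 (feature_gap e T)"
  unfolding feature_gap_def divide_inverse by (intro continuous_intros cont2_qq)

lemma feature_gap_bounds:
  assumes "0 \<le> e" "y \<in> X" "z \<in> X"
  shows "0 \<le> feature_gap e T y z" "feature_gap e T y z \<le> 4 * e"
proof -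
  have q: "0 \<le> 1 - qq y z ^ m" "1 - qq y z ^ m \<le> 1" for m
    using qq_bounds[OF assms(2,3)] by (auto intro: power_le_one)
  show "0 \<le> feature_gap e T y z" unfolding feature_gap_def using assms(1) q by (intro mult_nonneg_nonneg sum_nonneg divide_nonneg_nonneg) auto
  have "(\<Sum>m=1..T. (1 - qq y z ^ m) / (real m)\<^sup>2) \<le> (\<Sum>m=1..T. 1 / (real m)\<^sup>2)"
    by (intro sum_mono divide_right_mono q) simp
  also have "\<dots> \<le> 2" by (rule sum_inverse_squares)
  finally have "2 * e * (\<Sum>m=1..T. (1 - qq y z ^ m) / (real m)\<^sup>2) \<le> 2 * e * 2"
    using assms(1) by (intro mult_left_mono) auto
  then show "feature_gap e T y z \<le> 4 * e" by (simp add: feature_gap_def)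
qed

text \<open>The integral of q^r (1 - q^m) is 1/(r + 1) - 1/(r + m + 1), at most 4 m/N^2, so the
  weights 1/m^2 leave a harmonic sum. This is where the factor ln T comes from.\<close>

lemma feature_gap_integral:
  assumes e: "0 \<le> e" and T: "1 \<le> T" and N: "1 \<le> N" and r: "N \<le> 2 * (r + 1)"
  shows "(real N)\<^sup>2 * I2 (\<lambda>y z. qq y z ^ r * feature_gap e T y z) \<le> 8 * e * (ln (real T) + 1)"
proof -
  define d where "d m = 1 / (real r + 1) - 1 / (real (r + m) + 1)" for m
  have c: "cont2 (\<lambda>y z. 2 * e / (real m)\<^sup>2 * (qq y z ^ r + (-1) * qq y z ^ (r + m)))" for m
    by (intro continuous_intros cont2_qq)
  have "I2 (\<lambda>y z. qq y z ^ r * feature_gap e T y z) = I2 (\<lambda>y z. \<Sum>m=1..T. 2 * e / (real m)\<^sup>2 * (qq y z ^ r + (-1) * qq y z ^ (r + m)))"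
    unfolding feature_gap_def sum_distrib_left
    by (intro I2_cong sum.cong refl) (simp add: power_add right_diff_distrib diff_divide_distrib mult_ac)
  also have "\<dots> = (\<Sum>m=1..T. 2 * e / (real m)\<^sup>2 * I2 (\<lambda>y z. qq y z ^ r + (-1) * qq y z ^ (r + m)))"
    by (subst I2_sum) (auto simp only: I2_cmult finite_atLeastAtMost intro!: c)
  also have "\<dots> = (\<Sum>m=1..T. 2 * e / (real m)\<^sup>2 * d m)"
  proof (intro sum.cong refl)
    fix m
    have "I2 (\<lambda>y z. qq y z ^ r + (-1) * qq y z ^ (r + m)) = I2 (\<lambda>y z. qq y z ^ r) + I2 (\<lambda>y z. (-1) * qq y z ^ (r + m))"
      by (intro I2_add continuous_intros cont2_qq)
    then show "2 * e / (real m)\<^sup>2 * I2 (\<lambda>y z. qq y z ^ r + (-1) * qq y z ^ (r + m)) = 2 * e / (real m)\<^sup>2 * d m"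
      unfolding I2_cmult I2_qq_power d_def by simp
  qed
  finally have I: "I2 (\<lambda>y z. qq y z ^ r * feature_gap e T y z) = (\<Sum>m=1..T. 2 * e / (real m)\<^sup>2 * d m)" .
  have "(real N)\<^sup>2 * (2 * e / (real m)\<^sup>2 * d m) \<le> 8 * e * (1 / real m)" if m: "m \<in> {1..T}" for m
  proof -
    have R: "real N / 2 \<le> real r + 1" using of_nat_mono[OF r, where 'a = real] by simp
    have pos: "0 < real N" "0 < real m" using N m by auto
    have "d m = real m / ((real r + 1) * (real (r + m) + 1))"
      unfolding d_def by (simp add: field_simps)
    also have "\<dots> \<le> real m / ((real N / 2) * (real N / 2))"
      using R pos by (intro divide_left_mono mult_mono) auto
    also have "\<dots> = 4 * real m / (real N)\<^sup>2" by (simp add: power2_eq_square)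
    finally have "(real N)\<^sup>2 * (2 * e / (real m)\<^sup>2 * d m) \<le> (real N)\<^sup>2 * (2 * e / (real m)\<^sup>2 * (4 * real m / (real N)\<^sup>2))"
      using e by (intro mult_left_mono) auto
    also have "\<dots> = 8 * e * (1 / real m)" using pos by (simp add: power2_eq_square)
    finally show ?thesis .
  qed
  then have "(real N)\<^sup>2 * I2 (\<lambda>y z. qq y z ^ r * feature_gap e T y z) \<le> (\<Sum>m=1..T. 8 * e * (1 / real m))"
    unfolding I sum_distrib_left by (rule sum_mono)
  also have "\<dots> = 8 * e * (\<Sum>m=1..T. 1 / real m)" by (simp only: sum_distrib_left)
  also have "\<dots> \<le> 8 * e * (ln (real T) + 1)" using e by (intro mult_left_mono harmonic_le T) auto
  finally show ?thesis .
qed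

text \<open>The form is diagonal in the degree. In degree l the gap 1/(r + 1) -
  \<open>kap l r\<close> costs at most 4 l(l + 1)/N^2. One coefficient \<open>\<omega> l\<close>
  absorbs l(l + 1) by \<open>lam_kap_le\<close>; the other one, paired with \<open>Wl\<close>, sums
  to a multiple of the weighted energy.\<close>

lemma potential_integral:
  assumes e: "0 \<le> e" and N: "1 \<le> N" and x: "x \<in> {1..N} \<rightarrow> X" and r: "N \<le> 2 * (r + 1)"
  shows "(real N)\<^sup>2 * I2 (\<lambda>y z. qq y z ^ r * (potential e T N x y - potential e T N x z)\<^sup>2) \<le> 8 * e * weighted_energy e T N x"
proof -
  define \<omega> where "\<omega> l = e * real N / 2 * (\<Sum>m=1..T. kap l m / (real m)\<^sup>2)" for l
  have kapsum: "(\<Sum>m=1..T. (\<Sum>l=1..m. kap l m * B l) / (real m)\<^sup>2) = (\<Sum>l=1..T. (\<Sum>m=1..T. kap l m / (real m)\<^sup>2) * B l)" for B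
  proof -
    have "(\<Sum>m=1..T. (\<Sum>l=1..m. kap l m * B l) / (real m)\<^sup>2) = (\<Sum>m=1..T. \<Sum>l=1..T. kap l m / (real m)\<^sup>2 * B l)"
    proof (rule sum.cong[OF refl])
      fix m assume "m \<in> {1..T}"
      then have "(\<Sum>l=1..m. kap l m * B l) = (\<Sum>l=1..T. kap l m * B l)"
        by (intro sum.mono_neutral_left) (auto simp: kap_eq_0)
      then show "(\<Sum>l=1..m. kap l m * B l) / (real m)\<^sup>2 = (\<Sum>l=1..T. kap l m / (real m)\<^sup>2 * B l)"
        by (simp add: sum_divide_distrib)
    qed
    also have "\<dots> = (\<Sum>l=1..T. \<Sum>m=1..T. kap l m / (real m)\<^sup>2 * B l)" by (rule sum.swap)
    finally show ?thesis by (simp only: sum_distrib_right)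
  qed
  have w: "potential e T N x y = (\<Sum>l=1..T. \<omega> l * Bl N x l y)" for y
    unfolding potential_def An_eq_Bl[OF N] kapsum \<omega>_def mult.assoc[of "e * real N / 2"] by (simp only: sum_distrib_left[symmetric])
  have V: "e * real N * (\<Sum>l=1..T. \<omega> l * Wl N x l) = e * (weighted_energy e T N x / 2)"
  proof -
    have "(\<Sum>l=1..T. \<omega> l * Wl N x l) = e * real N / 2 * (\<Sum>l=1..T. (\<Sum>m=1..T. kap l m / (real m)\<^sup>2) * Wl N x l)"
      unfolding \<omega>_def mult.assoc[of "e * real N / 2"] by (simp only: sum_distrib_left[symmetric])
    also have "\<dots> = e * real N / 2 * (\<Sum>m=1..T. En N x m / (real m)\<^sup>2)"
      unfolding kapsum[symmetric] En_eq_sum[OF N] ..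
    finally have "e * real N * (\<Sum>l=1..T. \<omega> l * Wl N x l) = e * real N * (e * real N / 2 * (\<Sum>m=1..T. En N x m / (real m)\<^sup>2))" by (simp only:)
    then show ?thesis unfolding weighted_energy_def power2_eq_square[of "real N"] by (simp only: times_divide_eq_left times_divide_eq_right mult_ac)
  qed
  have \<omega>0: "0 \<le> \<omega> l" for l unfolding \<omega>_def using e by (intro mult_nonneg_nonneg sum_nonneg divide_nonneg_nonneg kap_nonneg) auto
  have \<omega>l: "real l * (real l + 1) * \<omega> l \<le> 2 * e * real N" for l
  proof -
    have "real l * (real l + 1) * \<omega> l = e * real N / 2 * (\<Sum>m=1..T. real l * (real l + 1) * kap l m / (real m)\<^sup>2)"
      unfolding \<omega>_def sum_distrib_left by (simp add: mult_ac)
    also have "\<dots> \<le> e * real N / 2 * (\<Sum>m=1..T. 2 / (real m)\<^sup>2)"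
      using e by (intro mult_left_mono sum_mono divide_right_mono lam_kap_le) auto
    also have "(\<Sum>m=1..T. 2 / (real m)\<^sup>2) = 2 * (\<Sum>m=1..T. 1 / (real m)\<^sup>2)" by (simp add: sum_distrib_left)
    also have "e * real N / 2 * (2 * (\<Sum>m=1..T. 1 / (real m)\<^sup>2)) \<le> e * real N / 2 * (2 * 2)"
      using e by (intro mult_left_mono sum_inverse_squares) auto
    finally show ?thesis by simp
  qed
  have R: "real N / 2 \<le> real r + 1" "real N / 2 \<le> real r + 2" using of_nat_mono[OF r, where 'a = real] by simp_all
  have Np: "0 < real N" using N by simp
  have t: "(real N)\<^sup>2 * (2 * ((\<omega> l)\<^sup>2 * Wl N x l * (1 / (real r + 1) - kap l r))) \<le> 16 * (e * real N * (\<omega> l * Wl N x l))" for l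
  proof -
    let ?L = "real l * (real l + 1)"
    have W: "0 \<le> Wl N x l" using Wl_nonneg[OF x] .
    have "1 / (real r + 1) - kap l r \<le> ?L / ((real r + 1) * (real r + 2))" by (rule one_minus_K_le)
    also have "\<dots> \<le> ?L / ((real N / 2) * (real N / 2))" using R Np by (intro divide_left_mono mult_mono) auto
    also have "\<dots> = 4 * ?L / (real N)\<^sup>2" by (simp add: power2_eq_square)
    finally have "(real N)\<^sup>2 * (2 * ((\<omega> l)\<^sup>2 * Wl N x l * (1 / (real r + 1) - kap l r))) \<le> (real N)\<^sup>2 * (2 * ((\<omega> l)\<^sup>2 * Wl N x l * (4 * ?L / (real N)\<^sup>2)))"
      using W by (intro mult_left_mono) auto
    also have "\<dots> = 8 * (\<omega> l * Wl N x l) * (?L * \<omega> l)" using Np by (simp add: power2_eq_square)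
    also have "\<dots> \<le> 8 * (\<omega> l * Wl N x l) * (2 * e * real N)" using W \<omega>0 by (intro mult_left_mono \<omega>l) auto
    finally show ?thesis by (simp add: mult_ac)
  qed
  have "(real N)\<^sup>2 * I2 (\<lambda>y z. qq y z ^ r * (potential e T N x y - potential e T N x z)\<^sup>2)
     = (\<Sum>l=1..T. (real N)\<^sup>2 * (2 * ((\<omega> l)\<^sup>2 * Wl N x l * (1 / (real r + 1) - kap l r))))"
    unfolding w Bl_combination_quadratic[OF N x] by (simp only: sum_distrib_left)
  also have "\<dots> \<le> (\<Sum>l=1..T. 16 * (e * real N * (\<omega> l * Wl N x l)))" by (intro sum_mono t)
  also have "\<dots> = 16 * (e * (weighted_energy e T N x / 2))" unfolding V[symmetric] by (simp only: sum_distrib_left)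
  finally show ?thesis by simp
qed

lemma exp_minus_one_le_mult:
  fixes Y :: real
  shows "exp Y - 1 \<le> Y * exp Y"
proof -
  have "(1 - Y) * exp Y \<le> exp (- Y) * exp Y"
    using exp_ge_add_one_self[of "- Y"] by (intro mult_right_mono) auto
  also have "\<dots> = 1" by (simp flip: exp_add)
  finally show ?thesis by (simp add: left_diff_distrib)
qed

text \<open>The right side is what \<open>mult_exp_one_minus_le\<close> can absorb: e <= 1/8 brings
  the factor 64 (e/2)^2 from \<open>An_sum_difference\<close> below 1/4.\<close>

lemma potential_difference:
  assumes e: "0 \<le> e" "e \<le> 1/8" and N: "1 \<le> N" and x: "x \<in> {1..N} \<rightarrow> X" and y: "y \<in> X" and z: "z \<in> X"
    and E: "Energy N x \<le> 3 * real N" and NT: "N \<le> T"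
  shows "(potential e T N x y - potential e T N x z)\<^sup>2 \<le> real N * (1 - qq y z) / 4"
proof -
  have Np: "0 < real N" using N by simp
  have q: "0 \<le> 1 - qq y z" using qq_bounds[OF y z] by simp
  have "potential e T N x y - potential e T N x z = e * real N / 2 * (\<Sum>m=1..T. (An N x m y - An N x m z) / (real m)\<^sup>2)"
    unfolding potential_def right_diff_distrib[symmetric] sum_subtractf[symmetric] diff_divide_distrib ..
  then have "(potential e T N x y - potential e T N x z)\<^sup>2 = (e * real N / 2)\<^sup>2 * (\<Sum>m=1..T. (An N x m y - An N x m z) / (real m)\<^sup>2)\<^sup>2"
    by (simp only: power_mult_distrib)
  also have "\<dots> \<le> (e * real N / 2)\<^sup>2 * (64 * (1 - qq y z) / real N)"
    by (intro mult_left_mono An_sum_difference N x y z E NT) simp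
  also have "\<dots> = 16 * e\<^sup>2 * (real N * (1 - qq y z))" using Np by (simp add: power2_eq_square)
  also have "\<dots> \<le> (1 / 4) * (real N * (1 - qq y z))"
  proof (rule mult_right_mono)
    have "e\<^sup>2 \<le> (1/8)\<^sup>2" using e by (intro power_mono) auto
    then show "16 * e\<^sup>2 \<le> 1 / 4" by (simp add: power2_eq_square)
  qed (use Np q in simp)
  finally show ?thesis by simp
qed

text \<open>Use exp Y - 1 <= Y exp Y and let half of the weight absorb the growth of exp Y. What
  remains is the quadratic integrand Y against q^r with r about N/2, to which
  \<open>potential_integral\<close> and \<open>feature_gap_integral\<close> apply.\<close>

lemma J_integral_bound:
  assumes e: "0 \<le> e" "e \<le> 1/128" and N: "2 \<le> N" and x: "x \<in> {1..N} \<rightarrow> X"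
    and E: "Energy N x \<le> 3 * real N" and NT: "N \<le> T"
  shows "(real N)\<^sup>2 * I2 (\<lambda>y z. qq y z ^ (N - 1) * (exp ((potential e T N x y - potential e T N x z)\<^sup>2 + feature_gap e T y z) - 1))
    \<le> (ln (real T) + 1) / 8 + weighted_energy e T N x / 8"
proof -
  define r where "r = N - 1 - N div 2"
  have "2 * (N div 2) \<le> N" by simp
  then have r: "N \<le> 2 * (r + 1)" using N unfolding r_def by arith
  define M where "M y z = (potential e T N x y - potential e T N x z)\<^sup>2" for y z
  have N1: "1 \<le> N" "1 \<le> T" using N NT by auto
  have cM: "cont2 M" unfolding M_def
    by (intro continuous_on_power continuous_on_diff cont2_fst[OF potential_cont] cont2_snd[OF potential_cont])
  have c1: "cont2 (\<lambda>y z. qq y z ^ r * M y z)" "cont2 (\<lambda>y z. qq y z ^ r * feature_gap e T y z)"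
    by (intro continuous_on_mult continuous_on_power cont2_qq cM cont2_Dd)+
  have "I2 (\<lambda>y z. qq y z ^ (N - 1) * (exp (M y z + feature_gap e T y z) - 1))
    \<le> I2 (\<lambda>y z. exp (4 * e) * (qq y z ^ r * M y z + qq y z ^ r * feature_gap e T y z))"
  proof (rule I2_mono)
    show "cont2 (\<lambda>y z. qq y z ^ (N - 1) * (exp (M y z + feature_gap e T y z) - 1))"
      by (intro continuous_on_mult continuous_on_power continuous_on_diff continuous_on_exp continuous_on_add cont2_qq cM cont2_Dd continuous_on_const)
    show "cont2 (\<lambda>y z. exp (4 * e) * (qq y z ^ r * M y z + qq y z ^ r * feature_gap e T y z))"
      by (intro continuous_on_mult_left continuous_on_add c1)
    fix y z assume y: "y \<in> X" and z: "z \<in> X"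
    define q where "q = qq y z"
    have q: "0 \<le> q" "q \<le> 1" using qq_bounds[OF y z] by (auto simp: q_def)
    define Y where "Y = M y z + feature_gap e T y z"
    have D: "0 \<le> feature_gap e T y z" "feature_gap e T y z \<le> 4 * e" using feature_gap_bounds[OF e(1) y z] by auto
    have M: "M y z \<le> real N * (1 - q) / 4"
      unfolding M_def q_def by (rule potential_difference) (use e N1 x y z E NT in auto)
    have Y0: "0 \<le> Y" using D by (simp add: Y_def M_def)
    have "exp Y \<le> exp (4 * e) * exp (real N * (1 - q) / 4)"
      unfolding exp_add[symmetric] Y_def using M D by simp
    then have "q ^ (N - 1) * exp Y \<le> q ^ (N - 1) * (exp (4 * e) * exp (real N * (1 - q) / 4))"
      using q by (intro mult_left_mono) auto
    also have "\<dots> = exp (4 * e) * (q ^ (N - 1) * exp (real N * (1 - q) / 4))" by (simp only: mult.left_commute)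
    also have "\<dots> \<le> exp (4 * e) * q ^ r"
      unfolding r_def by (intro mult_left_mono mult_exp_one_minus_le q N) simp
    finally have qe: "q ^ (N - 1) * exp Y \<le> exp (4 * e) * q ^ r" .
    have "q ^ (N - 1) * (exp Y - 1) \<le> q ^ (N - 1) * (Y * exp Y)"
      using q by (intro mult_left_mono exp_minus_one_le_mult) auto
    also have "\<dots> = Y * (q ^ (N - 1) * exp Y)" by (simp only: mult.left_commute)
    also have "\<dots> \<le> Y * (exp (4 * e) * q ^ r)" using Y0 by (intro mult_left_mono qe)
    also have "\<dots> = exp (4 * e) * (q ^ r * M y z + q ^ r * feature_gap e T y z)" by (simp add: Y_def algebra_simps)
    finally show "qq y z ^ (N - 1) * (exp (M y z + feature_gap e T y z) - 1) \<le> exp (4 * e) * (qq y z ^ r * M y z + qq y z ^ r * feature_gap e T y z)"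
      unfolding q_def Y_def .
  qed
  also have "\<dots> = exp (4 * e) * (I2 (\<lambda>y z. qq y z ^ r * M y z) + I2 (\<lambda>y z. qq y z ^ r * feature_gap e T y z))"
    unfolding I2_cmult I2_add[OF c1] ..
  finally have "(real N)\<^sup>2 * I2 (\<lambda>y z. qq y z ^ (N - 1) * (exp (M y z + feature_gap e T y z) - 1))
    \<le> (real N)\<^sup>2 * (exp (4 * e) * (I2 (\<lambda>y z. qq y z ^ r * M y z) + I2 (\<lambda>y z. qq y z ^ r * feature_gap e T y z)))"
    by (rule mult_left_mono) simp
  also have "\<dots> = exp (4 * e) * ((real N)\<^sup>2 * I2 (\<lambda>y z. qq y z ^ r * M y z) + (real N)\<^sup>2 * I2 (\<lambda>y z. qq y z ^ r * feature_gap e T y z))"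
    by (simp only: distrib_left mult.left_commute)
  also have "\<dots> \<le> exp (4 * e) * (8 * e * weighted_energy e T N x + 8 * e * (ln (real T) + 1))"
    unfolding M_def by (intro mult_left_mono add_mono potential_integral feature_gap_integral e(1) N1 x r) simp
  also have "\<dots> = (exp (4 * e) * (8 * e)) * (weighted_energy e T N x + (ln (real T) + 1))" by (simp add: algebra_simps)
  \<comment> \<open>For e <= 1/128 the factor exp (4 e) is below 2, and 16 e <= 1/8. The coefficient
    of the weighted energy has to stay below the 1/4 gained in
    \<open>sign_average_lower\<close>.\<close>
  also have "\<dots> \<le> 1/8 * (weighted_energy e T N x + (ln (real T) + 1))"
  proof (rule mult_right_mono)
    have "exp (4 * e) \<le> exp (1/32)" using e by simp
    also have "\<dots> \<le> 1 + 1/32 + (1/32)\<^sup>2" by (rule exp_le_quadratic) simp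
    also have "\<dots> \<le> (2::real)" by (simp add: power2_eq_square)
    finally have "exp (4 * e) * (8 * e) \<le> 2 * (8 * e)" using e by (intro mult_right_mono) auto
    then show "exp (4 * e) * (8 * e) \<le> 1/8" using e by linarith
    have "0 \<le> weighted_energy e T N x" unfolding weighted_energy_def
      using e En_nonneg[OF N1(1) x] by (intro mult_nonneg_nonneg sum_nonneg divide_nonneg_nonneg) auto
    moreover have "0 \<le> ln (real T)" using N1 by (intro ln_ge_zero) simp
    ultimately show "0 \<le> weighted_energy e T N x + (ln (real T) + 1)" by simp
  qed
  also have "\<dots> = (ln (real T) + 1) / 8 + weighted_energy e T N x / 8" by (simp add: add_divide_distrib)
  finally show ?thesis unfolding M_def .
qed

text \<open>Replacing each feature by many scaled copies makes all features small without changing the kernel.\<close>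

lemma feature_copies:
  fixes g :: "nat \<Rightarrow> 'a \<Rightarrow> real" and p :: nat
  assumes K: "\<And>y z. K y z = (\<Sum>i<p. g i y * g i z)" and k: "1 \<le> k"
  shows "K y z = (\<Sum>i<p * k\<^sup>2. (g (i div k\<^sup>2) y / real k) * (g (i div k\<^sup>2) z / real k))"
proof -
  have "(\<Sum>i<p * k\<^sup>2. (g (i div k\<^sup>2) y / real k) * (g (i div k\<^sup>2) z / real k))
     = (\<Sum>m<p. \<Sum>i=m * k\<^sup>2..<m * k\<^sup>2 + k\<^sup>2. (g (i div k\<^sup>2) y / real k) * (g (i div k\<^sup>2) z / real k))"
    by (rule sum.nat_group[symmetric])
  also have "\<dots> = (\<Sum>m<p. g m y * g m z)"
  proof (rule sum.cong[OF refl])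
    fix m
    have "(\<Sum>i=m * k\<^sup>2..<m * k\<^sup>2 + k\<^sup>2. (g (i div k\<^sup>2) y / real k) * (g (i div k\<^sup>2) z / real k))
       = (\<Sum>i=m * k\<^sup>2..<m * k\<^sup>2 + k\<^sup>2. (g m y / real k) * (g m z / real k))"
    proof (rule sum.cong[OF refl])
      fix i assume "i \<in> {m * k\<^sup>2..<m * k\<^sup>2 + k\<^sup>2}"
      then have "i div k\<^sup>2 = m" by (intro div_nat_eqI) (auto simp: mult.commute)
      then show "(g (i div k\<^sup>2) y / real k) * (g (i div k\<^sup>2) z / real k) = (g m y / real k) * (g m z / real k)" by simp
    qed
    also have "\<dots> = g m y * g m z" using k by (simp add: power2_eq_square)
    finally show "(\<Sum>i=m * k\<^sup>2..<m * k\<^sup>2 + k\<^sup>2. (g (i div k\<^sup>2) y / real k) * (g (i div k\<^sup>2) z / real k)) = g m y * g m z" .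
  qed
  finally show ?thesis unfolding K by simp
qed

lemma potential_features:
  assumes e: "0 \<le> e" "e \<le> 1/2" and N: "1 \<le> N"
  obtains p :: nat and f where "\<And>i. i < p \<Longrightarrow> continuous_on X (f i)"
    "\<And>i y. i < p \<Longrightarrow> y \<in> X \<Longrightarrow> \<bar>f i y\<bar> \<le> 1 / (2 * real N)"
    "\<And>y z. (\<Sum>m=1..T. e / (real m)\<^sup>2 * qq y z ^ m) = (\<Sum>i<p. f i y * f i z)"
proof -
  have "feat (\<lambda>y z. \<Sum>m\<in>{1..T}. e / (real m)\<^sup>2 * qq y z ^ m)"
    by (intro feat_sum feat_cmult feat_qq_power) (use e in auto)
  then obtain p :: nat and g where g: "\<And>i. i < p \<Longrightarrow> spoly (g i)" "\<And>y z. (\<Sum>m=1..T. e / (real m)\<^sup>2 * qq y z ^ m) = (\<Sum>i<p. g i y * g i z)"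
    by (elim featE) blast
  have gb: "\<bar>g i y\<bar> \<le> 1" if i: "i < p" and y: "y \<in> X" for i y
  proof -
    have "(g i y)\<^sup>2 \<le> (\<Sum>i<p. g i y * g i y)"
      using i by (intro member_le_sum[of i "{..<p}" "\<lambda>i. g i y * g i y", THEN order_trans[rotated]]) (auto simp: power2_eq_square)
    also have "\<dots> = (\<Sum>m=1..T. e * (1 / (real m)\<^sup>2))" unfolding g(2)[symmetric] using y by simp
    also have "\<dots> = e * (\<Sum>m=1..T. 1 / (real m)\<^sup>2)" by (simp only: sum_distrib_left)
    also have "\<dots> \<le> e * 2" using e by (intro mult_left_mono sum_inverse_squares) auto
    also have "\<dots> \<le> 1\<^sup>2" using e by simp
    finally show ?thesis using abs_le_square_iff[of "g i y" 1] by simp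
  qed
  \<comment> \<open>With k^2 copies scaled by 1/k the features are at most 1/(2 N), so a sum over N
    points minus N times the mean is at most 1 in absolute value, within the range required by
    \<open>sign_average_lower\<close>.\<close>
  define k where "k = 2 * N"
  have k: "1 \<le> k" using N by (simp add: k_def)
  define f where "f i y = g (i div k\<^sup>2) y / real k" for i y
  have ip: "i div k\<^sup>2 < p" if "i < p * k\<^sup>2" for i using that by (rule less_mult_imp_div_less)
  show ?thesis
  proof (rule that[of "p * k\<^sup>2" f])
    fix i assume i: "i < p * k\<^sup>2"
    show "continuous_on X (f i)" unfolding f_def divide_inverse
      by (intro continuous_on_mult_right spoly_continuous g(1) ip i)
    fix y assume y: "y \<in> X"
    have "\<bar>g (i div k\<^sup>2) y\<bar> / real k \<le> 1 / real k" using k by (intro divide_right_mono gb ip i y) auto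
    then show "\<bar>f i y\<bar> \<le> 1 / (2 * real N)" by (simp add: f_def k_def abs_divide)
  next
    fix y z
    show "(\<Sum>m=1..T. e / (real m)\<^sup>2 * qq y z ^ m) = (\<Sum>i<p * k\<^sup>2. f i y * f i z)"
      unfolding f_def by (rule feature_copies[OF g(2) k])
  qed
qed

section \<open>Tail bounds for the energies under the ensemble\<close>

lemma PN_component [measurable]:
  assumes "1 \<le> i" "i \<le> N"
  shows "(\<lambda>x. x i) \<in> borel_measurable (PN N)"
proof -
  have "(\<lambda>x::real^3. x) \<in> borel_measurable sigma_X" by (intro measurable_contX_sigma continuous_on_id)
  then show ?thesis unfolding PN_def
    using assms by (intro measurable_compose[OF measurable_component_singleton]) auto
qed

lemma En_measurable [measurable]: "(\<lambda>x. En N x m) \<in> borel_measurable (PN N)"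
proof -
  have "(\<lambda>x. qq (x i) (x j)) \<in> borel_measurable (PN N)" if "i \<in> {1..N}" "j \<in> {1..N}" for i j
  proof -
    have [measurable]: "(\<lambda>x. x i) \<in> borel_measurable (PN N)" "(\<lambda>x. x j) \<in> borel_measurable (PN N)"
      using that by (auto intro!: PN_component)
    show ?thesis unfolding qq_def by measurable
  qed
  then show ?thesis unfolding En_def
    by (intro borel_measurable_diff borel_measurable_times borel_measurable_sum borel_measurable_power borel_measurable_const) auto
qed

lemma Energy_measurable [measurable]: "Energy N \<in> borel_measurable (PN N)"
  unfolding Energy_def by measurable

lemma weighted_energy_measurable [measurable]: "weighted_energy e T N \<in> borel_measurable (PN N)"
  unfolding weighted_energy_def by measurable

lemma measure_eq_integral:
  assumes "A \<subseteq> space M" shows "measure M A = (\<integral>x. indicator A x \<partial>M)"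
  using assms by (simp add: Int_absorb2)

text \<open>The product measure has mass 1, so the pointwise bound on the density is also a bound on
  the probability.\<close>

lemma energy_tail:
  "measure (SE n) {x \<in> space (SE n). a \<le> Energy (Suc n) x} \<le> exp (2 * real (Suc n) - a)"
proof -
  let ?A = "{x \<in> space (SE n). a \<le> Energy (Suc n) x}"
  have A: "?A \<in> sets (PN (Suc n))" unfolding space_SE by measurable
  have "measure (SE n) ?A = (\<integral>x. indicator ?A x \<partial>SE n)" by (rule measure_eq_integral) blast
  also have "\<dots> = (\<integral>x. dens n x * indicator ?A x \<partial>PN (Suc n))" by (rule integral_SE) (use A in measurable)
  also have "\<dots> \<le> (\<integral>x. exp (2 * real (Suc n) - a) \<partial>PN (Suc n))"
  proof (rule integral_mono)
    show "integrable (PN (Suc n)) (\<lambda>x. dens n x * indicator ?A x)"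
      using A by (intro integrable_real_mult_indicator dens_integrable)
    fix x assume x: "x \<in> space (PN (Suc n))"
    show "dens n x * indicator ?A x \<le> exp (2 * real (Suc n) - a)"
    proof (cases "x \<in> ?A")
      case True
      have "dens n x \<le> exp (2 * real (Suc n) - Energy (Suc n) x)" by (rule dens_le_energy[OF space_PN_D[OF x]])
      also have "\<dots> \<le> exp (2 * real (Suc n) - a)" using True by simp
      finally show ?thesis using True by simp
    qed simp
  qed simp
  also have "\<dots> = exp (2 * real (Suc n) - a)" by simp
  finally show ?thesis .
qed

text \<open>Markov's inequality for the sign average, whose mean is at most 1. On the event, tilting
  by half of the discrepancy vector gains a quarter of the weighted energy and costs an eighth of it
  plus (ln T + 1)/8.\<close>

lemma discrepancy_tail:
  assumes e: "0 \<le> e" "e \<le> 1/128" and n: "1 \<le> n" and T: "Suc n \<le> T"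
  shows "measure (SE n) {x \<in> space (SE n). Energy (Suc n) x \<le> 3 * real (Suc n) \<and> t \<le> weighted_energy e T (Suc n) x}
    \<le> exp ((ln (real T) + 1) / 8 - t / 8)"
proof -
  define N where "N = Suc n"
  have N: "1 \<le> N" "2 \<le> N" using n by (auto simp: N_def)
  obtain p :: nat and f where f: "\<And>i. i < p \<Longrightarrow> continuous_on X (f i)"
    "\<And>i y. i < p \<Longrightarrow> y \<in> X \<Longrightarrow> \<bar>f i y\<bar> \<le> 1 / (2 * real N)"
    "\<And>y z. (\<Sum>m=1..T. e / (real m)\<^sup>2 * qq y z ^ m) = (\<Sum>i<p. f i y * f i z)"
    by (rule potential_features[OF e(1) _ N(1), of T]) (use e in auto)
  define v where "v x i = (\<Sum>k<N. f i (x (Suc k))) - real N * (\<integral>y. f i y \<partial>sigma_X)" for x i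
  define \<Phi> where "\<Phi> x = (\<Sum>\<xi>\<in>signs p. (1/2) ^ p * exp ((\<Sum>i<p. \<xi> i * v x i) - J n (\<lambda>y. \<Sum>i<p. \<xi> i * f i y)))" for x
  have \<Phi>: "integrable (SE n) \<Phi>" "(\<integral>x. \<Phi> x \<partial>SE n) \<le> 1"
    using sign_average_expectation[of p f n, OF f(1)] unfolding \<Phi>_def[abs_def] v_def N_def by auto
  have \<Phi>0: "0 \<le> \<Phi> x" for x unfolding \<Phi>_def by (intro sum_nonneg mult_nonneg_nonneg) auto
  have lower: "exp (weighted_energy e T N x / 8 - (ln (real T) + 1) / 8) \<le> \<Phi> x" if x: "x \<in> {1..N} \<rightarrow> X" and E: "Energy N x \<le> 3 * real N" for x
  proof -
    have vf: "(\<Sum>i<p. v x i * f i y) = 2 * potential e T N x y" if y: "y \<in> X" for y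
    proof -
      have i: "integrable sigma_X (\<lambda>z. qq z y ^ m)" for m
        unfolding qq_def by (intro integrable_contX continuous_intros) auto
      have "(\<integral>z. (\<Sum>m=1..T. e / (real m)\<^sup>2 * qq z y ^ m) \<partial>sigma_X) = (\<Sum>m=1..T. e / (real m)\<^sup>2 * (\<integral>z. qq z y ^ m \<partial>sigma_X))"
        using i by (subst Bochner_Integration.integral_sum) auto
      also have "\<dots> = (\<Sum>m=1..T. e / (real m)\<^sup>2 * (1 / (real m + 1)))"
        using moments[OF y] by (simp add: qq_commute)
      finally have I: "(\<integral>z. (\<Sum>m=1..T. e / (real m)\<^sup>2 * qq z y ^ m) \<partial>sigma_X) = (\<Sum>m=1..T. e / (real m)\<^sup>2 * (1 / (real m + 1)))" .
      have "(\<Sum>i<p. v x i * f i y) = (\<Sum>k=1..N. \<Sum>m=1..T. e / (real m)\<^sup>2 * qq (x k) y ^ m) - real N * (\<Sum>m=1..T. e / (real m)\<^sup>2 * (1 / (real m + 1)))"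
        unfolding v_def I[symmetric] by (rule feature_pairing(1)[where K = "\<lambda>y z. \<Sum>m=1..T. e / (real m)\<^sup>2 * qq y z ^ m", OF f(3) f(1)])
      also have "(\<Sum>k=1..N. \<Sum>m=1..T. e / (real m)\<^sup>2 * qq (x k) y ^ m) = (\<Sum>m=1..T. e / (real m)\<^sup>2 * (\<Sum>k=1..N. qq (x k) y ^ m))"
        unfolding sum_distrib_left by (rule sum.swap)
      also have "\<dots> - real N * (\<Sum>m=1..T. e / (real m)\<^sup>2 * (1 / (real m + 1))) = (\<Sum>m=1..T. e * real N * (An N x m y / (real m)\<^sup>2))"
        unfolding sum_distrib_left sum_subtractf[symmetric]
      proof (rule sum.cong[OF refl])
        fix m
        have NA: "real N * An N x m y = (\<Sum>k=1..N. qq (x k) y ^ m) - real N * (1 / (real m + 1))"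
          using N unfolding An_def right_diff_distrib mult.assoc[symmetric] by simp
        have "e * real N * (An N x m y / (real m)\<^sup>2) = e / (real m)\<^sup>2 * ((\<Sum>k=1..N. qq (x k) y ^ m) - real N * (1 / (real m + 1)))"
          unfolding NA[symmetric] by (simp only: times_divide_eq_left times_divide_eq_right mult_ac)
        then show "(\<Sum>k=1..N. e / (real m)\<^sup>2 * qq (x k) y ^ m) - real N * (e / (real m)\<^sup>2 * (1 / (real m + 1))) = e * real N * (An N x m y / (real m)\<^sup>2)"
          by (simp only: right_diff_distrib sum_distrib_left mult.left_commute)
      qed
      also have "\<dots> = 2 * potential e T N x y" unfolding potential_def by (simp add: sum_distrib_left)
      finally show ?thesis .
    qed
    have vv: "(\<Sum>i<p. (v x i)\<^sup>2) = weighted_energy e T N x"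
    proof -
      have "(\<Sum>i<p. (v x i)\<^sup>2) = (\<Sum>k=1..N. \<Sum>i<p. v x i * f i (x k)) - real N * (\<integral>z. (\<Sum>i<p. v x i * f i z) \<partial>sigma_X)"
        unfolding v_def by (rule feature_pairing(2)[where K = "\<lambda>y z. \<Sum>m=1..T. e / (real m)\<^sup>2 * qq y z ^ m", OF f(3) f(1)])
      also have "(\<integral>z. (\<Sum>i<p. v x i * f i z) \<partial>sigma_X) = (\<integral>z. 2 * potential e T N x z \<partial>sigma_X)"
        by (intro Bochner_Integration.integral_cong refl vf) simp
      also have "\<dots> = 0"
      proof -
        have "integrable sigma_X (\<lambda>z. An N x m z / (real m)\<^sup>2)" for m
          by (intro integrable_divide integrable_contX An_cont)
        then show ?thesis unfolding potential_def integral_mult_right_zero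
          by (subst Bochner_Integration.integral_sum) (auto simp: An_integral[OF N(1) x])
      qed
      also have "(\<Sum>k=1..N. \<Sum>i<p. v x i * f i (x k)) = (\<Sum>k=1..N. 2 * potential e T N x (x k))"
        by (intro sum.cong refl vf) (rule Pi_mem[OF x])
      also have "\<dots> = e * real N * (\<Sum>k=1..N. \<Sum>m=1..T. An N x m (x k) / (real m)\<^sup>2)"
        unfolding potential_def by (simp add: sum_distrib_left)
      also have "(\<Sum>k=1..N. \<Sum>m=1..T. An N x m (x k) / (real m)\<^sup>2) = (\<Sum>m=1..T. (\<Sum>k=1..N. An N x m (x k)) / (real m)\<^sup>2)"
        unfolding sum_divide_distrib by (rule sum.swap)
      also have "\<dots> = real N * (\<Sum>m=1..T. En N x m / (real m)\<^sup>2)"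
        unfolding An_sum[OF N(1)] sum_distrib_left by simp
      finally show ?thesis unfolding weighted_energy_def by (simp add: power2_eq_square)
    qed
    have fd: "(\<Sum>i<p. (f i y - f i z)\<^sup>2) = feature_gap e T y z" if y: "y \<in> X" and z: "z \<in> X" for y z
    proof -
      have "(\<Sum>i<p. (f i y - f i z)\<^sup>2) = (\<Sum>i<p. f i y * f i y) + (\<Sum>i<p. f i z * f i z) - 2 * (\<Sum>i<p. f i y * f i z)"
        unfolding sum_distrib_left sum.distrib[symmetric] sum_subtractf[symmetric]
        by (intro sum.cong refl) (simp add: power2_eq_square algebra_simps)
      also have "\<dots> = feature_gap e T y z"
        unfolding f(3)[symmetric] feature_gap_def sum_distrib_left sum.distrib[symmetric] sum_subtractf[symmetric]
        using y z by (intro sum.cong refl) (simp add: algebra_simps diff_divide_distrib)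
      finally show ?thesis .
    qed
    have v2: "\<bar>v x i\<bar> \<le> 2" if i: "i < p" for i
    proof -
      have Np: "0 < real N" using N by simp
      have "\<bar>\<Sum>k<Suc n. f i (x (Suc k))\<bar> \<le> real (Suc n) * (1 / (2 * real N))"
        using x f(2)[OF i] unfolding N_def by (intro sum_bounded_X)
      then have 1: "\<bar>\<Sum>k<N. f i (x (Suc k))\<bar> \<le> 1/2" using Np unfolding N_def[symmetric] by simp
      have "\<bar>\<integral>y. f i y \<partial>sigma_X\<bar> \<le> (\<integral>y. \<bar>f i y\<bar> \<partial>sigma_X)" by (rule integral_abs_bound)
      also have "\<dots> \<le> (\<integral>y. 1 / (2 * real N) \<partial>sigma_X)"
        by (intro integral_mono integrable_abs integrable_contX f(1) i) (use f(2)[OF i] in auto)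
      finally have "real N * \<bar>\<integral>y. f i y \<partial>sigma_X\<bar> \<le> real N * (1 / (2 * real N))" by (intro mult_left_mono) auto
      then have 2: "\<bar>real N * (\<integral>y. f i y \<partial>sigma_X)\<bar> \<le> 1/2" using Np by (simp add: abs_mult)
      show ?thesis unfolding v_def using 1 2 by linarith
    qed
    have f12: "\<bar>f i y\<bar> \<le> 1/2" if "i < p" "y \<in> X" for i y
    proof -
      have "1 / (2 * real N) \<le> 1 / 2" using N by (simp add: field_simps)
      then show ?thesis using f(2)[OF that] by linarith
    qed
    define m where "m i = v x i / 2" for i
    have m1: "\<bar>m i\<bar> \<le> 1" if "i < p" for i using v2[OF that] by (simp add: m_def)
    have md: "(\<Sum>i<p. m i * (f i y - f i z)) = potential e T N x y - potential e T N x z" if "y \<in> X" "z \<in> X" for y z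
    proof -
      have "(\<Sum>i<p. m i * (f i y - f i z)) = ((\<Sum>i<p. v x i * f i y) - (\<Sum>i<p. v x i * f i z)) / 2"
        unfolding m_def sum_subtractf[symmetric] sum_divide_distrib by (intro sum.cong refl) (simp add: right_diff_distrib)
      then show ?thesis unfolding vf[OF that(1)] vf[OF that(2)] by simp
    qed
    have "(\<Sum>\<xi>\<in>signs p. bernoulli p m \<xi> * J n (\<lambda>y. \<Sum>i<p. \<xi> i * f i y))
      \<le> (real (Suc n))\<^sup>2 * I2 (\<lambda>y z. qq y z ^ n * (exp ((\<Sum>i<p. m i * (f i y - f i z))\<^sup>2 + (\<Sum>i<p. (f i y - f i z)\<^sup>2)) - 1))"
      by (rule bernoulli_J) (use f(1) f12 m1 in auto)
    also have "\<dots> = (real N)\<^sup>2 * I2 (\<lambda>y z. qq y z ^ (N - 1) * (exp ((potential e T N x y - potential e T N x z)\<^sup>2 + feature_gap e T y z) - 1))"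
    proof -
      have "I2 (\<lambda>y z. qq y z ^ n * (exp ((\<Sum>i<p. m i * (f i y - f i z))\<^sup>2 + (\<Sum>i<p. (f i y - f i z)\<^sup>2)) - 1))
        = I2 (\<lambda>y z. qq y z ^ n * (exp ((potential e T N x y - potential e T N x z)\<^sup>2 + feature_gap e T y z) - 1))"
      proof (rule I2_cong)
        fix y z assume yz: "y \<in> X" "z \<in> X"
        show "qq y z ^ n * (exp ((\<Sum>i<p. m i * (f i y - f i z))\<^sup>2 + (\<Sum>i<p. (f i y - f i z)\<^sup>2)) - 1)
          = qq y z ^ n * (exp ((potential e T N x y - potential e T N x z)\<^sup>2 + feature_gap e T y z) - 1)"
          unfolding md[OF yz] fd[OF yz] ..
      qed
      then show ?thesis by (simp add: N_def)
    qed
    also have "\<dots> \<le> (ln (real T) + 1) / 8 + weighted_energy e T N x / 8"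
      by (rule J_integral_bound) (use e N x E T in \<open>auto simp: N_def\<close>)
    finally have "weighted_energy e T N x / 8 - (ln (real T) + 1) / 8 \<le> weighted_energy e T N x / 4 - (\<Sum>\<xi>\<in>signs p. bernoulli p m \<xi> * J n (\<lambda>y. \<Sum>i<p. \<xi> i * f i y))"
      by linarith
    then have "exp (weighted_energy e T N x / 8 - (ln (real T) + 1) / 8) \<le> exp ((\<Sum>i<p. (v x i)\<^sup>2) / 4 - (\<Sum>\<xi>\<in>signs p. bernoulli p m \<xi> * J n (\<lambda>y. \<Sum>i<p. \<xi> i * f i y)))"
      unfolding vv by simp
    also have "\<dots> \<le> \<Phi> x"
      unfolding \<Phi>_def m_def[abs_def] by (rule sign_average_lower[OF v2])
    finally show ?thesis .
  qed
  let ?A = "{x \<in> space (SE n). Energy (Suc n) x \<le> 3 * real (Suc n) \<and> t \<le> weighted_energy e T (Suc n) x}"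
  have A: "?A \<in> sets (PN (Suc n))" unfolding space_SE by measurable
  define c where "c = exp (t / 8 - (ln (real T) + 1) / 8)"
  have "measure (SE n) ?A * c = (\<integral>x. indicator ?A x * c \<partial>SE n)"
    unfolding integral_mult_left_zero by (subst measure_eq_integral) auto
  also have "\<dots> \<le> (\<integral>x. \<Phi> x \<partial>SE n)"
  proof (rule integral_mono)
    show "integrable (SE n) (\<lambda>x. indicator ?A x * c)"
      using A by (intro integrable_mult_left integrable_real_indicator) (auto simp: SE.emeasure_finite less_top[symmetric])
    fix x assume "x \<in> space (SE n)"
    then have x: "x \<in> {1..N} \<rightarrow> X" using space_PN_D[of x "Suc n"] by (simp add: N_def)
    show "indicator ?A x * c \<le> \<Phi> x"
    proof (cases "x \<in> ?A")
      case True
      then have "c \<le> exp (weighted_energy e T N x / 8 - (ln (real T) + 1) / 8)" by (simp add: c_def N_def)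
      also have "\<dots> \<le> \<Phi> x" by (rule lower[OF x]) (use True in \<open>simp add: N_def\<close>)
      finally show ?thesis using True by simp
    qed (simp add: \<Phi>0)
  qed (rule \<Phi>(1))
  finally have "measure (SE n) ?A * c \<le> 1" using \<Phi>(2) by linarith
  then have "measure (SE n) ?A \<le> 1 / c" by (simp add: c_def pos_le_divide_eq)
  also have "1 / c = exp ((ln (real T) + 1) / 8 - t / 8)"
    unfolding c_def by (simp add: exp_diff)
  finally show ?thesis .
qed

section \<open>Tail bounds for the worst-case error\<close>

text \<open>The supremum runs over an uncountable class, but for each continuous f the condition is
  closed in the configuration, and an intersection of closed sets is closed. Extending
  configurations by 0 moves the question to a countable product, whose product sigma-algebra is the
  Borel one.\<close>

lemma wce_measurable: "{x \<in> space (PN N). wce N x s \<le> ereal c} \<in> sets (PN N)"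
proof -
  define F where "F = {f \<in> sobolev_space s. continuous_on X f \<and> sobolev_norm s f \<le> 1}"
  define P where "P = {y :: nat \<Rightarrow> real^3. \<forall>i\<in>{1..N}. y i \<in> X}"
  define g where "g f y = \<bar>(\<integral>z. f z \<partial>sigma_X) - 1 / real N * (\<Sum>i=1..N. f (y i))\<bar>" for f :: "real^3 \<Rightarrow> real" and y :: "nat \<Rightarrow> real^3"
  define Q where "Q = P \<inter> (\<Inter>f\<in>F. {y \<in> P. g f y \<le> c})"
  have wce: "wce N x s \<le> ereal c \<longleftrightarrow> (\<forall>f\<in>F. g f x \<le> c)" for x
    unfolding wce_def F_def[symmetric] SUP_le_iff g_def[symmetric] by simp
  have "P = (\<Inter>i\<in>{1..N}. (\<lambda>y. y i) -` X)" unfolding P_def by auto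
  then have P: "closed P" by (auto intro!: closed_INT closed_vimage continuous_on_product_coordinates)
  have "closed {y \<in> P. g f y \<le> c}" if f: "f \<in> F" for f
  proof (rule continuous_on_closed_Collect_le[OF _ continuous_on_const P])
    have "continuous_on P (\<lambda>y. f (y i))" if "i \<in> {1..N}" for i
    proof (rule continuous_on_compose2[of X f P "\<lambda>y. y i"])
      show "continuous_on X f" using f by (simp add: F_def)
      show "continuous_on P (\<lambda>y. y i)"
        using continuous_on_product_coordinates by (rule continuous_on_subset) simp
      show "(\<lambda>y. y i) ` P \<subseteq> X" using that by (auto simp: P_def)
    qed
    then show "continuous_on P (g f)" unfolding g_def by (intro continuous_intros) auto
  qed
  then have "closed Q" unfolding Q_def using P by (intro closed_Int closed_INT) auto
  then have Q: "Q \<in> sets (\<Pi>\<^sub>M i\<in>UNIV. (borel :: (real^3) measure))"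
    unfolding sets_PiM_equal_borel by simp
  define h where "h x i = (if i \<in> {1..N} then x i else 0)" for x :: "nat \<Rightarrow> real^3" and i
  have h: "h \<in> measurable (PN N) (\<Pi>\<^sub>M i\<in>UNIV. (borel :: (real^3) measure))"
    unfolding h_def[abs_def]
  proof (rule measurable_PiM_single')
    fix i :: nat
    show "(\<lambda>x. if i \<in> {1..N} then x i else 0) \<in> borel_measurable (PN N)"
      by (cases "i \<in> {1..N}") (auto intro: PN_component)
  qed auto
  have "{x \<in> space (PN N). wce N x s \<le> ereal c} = h -` Q \<inter> space (PN N)"
  proof -
    have "wce N x s \<le> ereal c \<longleftrightarrow> h x \<in> Q" if x: "x \<in> space (PN N)" for x
    proof -
      have "h x \<in> P" using space_PN_D[OF x] by (auto simp: P_def h_def Pi_iff)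
      moreover have "g f (h x) = g f x" for f by (simp add: g_def h_def)
      ultimately show ?thesis unfolding wce Q_def by auto
    qed
    then show ?thesis by auto
  qed
  then show ?thesis using measurable_sets[OF h Q] by simp
qed

text \<open>This serves the regime of large deviations, where the energy alone controls the sum:
  1/m^2 <= 1/m up to N, and beyond N the tail is at most 1/N.\<close>

lemma discrepancy_energy:
  assumes N: "1 \<le> N" and x: "x \<in> {1..N} \<rightarrow> X"
  shows "(\<Sum>m=1..N\<^sup>2. En N x m / (real m)\<^sup>2) \<le> 2 * Energy N x / (real N)\<^sup>2 + 1 / real N"
proof -
  have En: "0 \<le> En N x m" "En N x m \<le> 1" for m using En_nonneg[OF N x] En_le_1[OF N x] by auto
  have "{1..N\<^sup>2} = {1..N} \<union> {Suc N..N\<^sup>2}" using N by (auto simp: power2_eq_square intro: order_trans[OF _ le_square])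
  then have "(\<Sum>m=1..N\<^sup>2. En N x m / (real m)\<^sup>2) = (\<Sum>m=1..N. En N x m / (real m)\<^sup>2) + (\<Sum>m=Suc N..N\<^sup>2. En N x m / (real m)\<^sup>2)"
    by (simp only:) (rule sum.union_disjoint, auto)
  also have "(\<Sum>m=1..N. En N x m / (real m)\<^sup>2) \<le> (\<Sum>m=1..N. En N x m / real m)"
  proof (rule sum_mono)
    fix m assume "m \<in> {1..N}"
    then have "real m \<le> (real m)\<^sup>2" "0 < real m" by (auto simp: power2_eq_square)
    then show "En N x m / (real m)\<^sup>2 \<le> En N x m / real m" using En by (intro divide_left_mono) auto
  qed
  also have "(\<Sum>m=1..N. En N x m / real m) = 2 * Energy N x / (real N)\<^sup>2" using N by (simp add: Energy_def)
  also have "(\<Sum>m=Suc N..N\<^sup>2. En N x m / (real m)\<^sup>2) \<le> (\<Sum>m=Suc N..N\<^sup>2. 1 / (real m)\<^sup>2)"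
    by (intro sum_mono divide_right_mono En) simp
  also have "\<dots> \<le> 1 / real N" by (rule inverse_squares_tail[OF N])
  finally show ?thesis by simp
qed

text \<open>Two regimes for S = r N^2. For S <= 32 N the event of large energy has probability at
  most exp (- N), within the claimed bound, and \<open>discrepancy_tail\<close> handles its
  complement. For S > 32 N a large sum forces an energy of at least S/8, and the density bound alone
  gives exp (2 N - S/8).\<close>

lemma weighted_energy_tail:
  assumes n: "1 \<le> n" and r: "0 \<le> r"
  defines "N \<equiv> Suc n"
  shows "measure (SE n) {x \<in> space (SE n). r / 2 \<le> (\<Sum>m=1..N\<^sup>2. En N x m / (real m)\<^sup>2)}
    \<le> (real N)\<^sup>2 * exp (- (r * (real N)\<^sup>2) / 2048)"
proof -
  define S where "S = r * (real N)\<^sup>2"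
  have N: "2 \<le> N" "1 \<le> N" "0 < real N" using n by (auto simp: N_def)
  have S0: "0 \<le> S" using r by (simp add: S_def)
  define D where "D x = (\<Sum>m=1..N\<^sup>2. En N x m / (real m)\<^sup>2)" for x
  let ?B = "{x \<in> space (SE n). r / 2 \<le> D x}"
  have Dm [measurable]: "D \<in> borel_measurable (PN N)" unfolding D_def by measurable
  have N2: "N \<le> N\<^sup>2" using N by (simp add: power2_eq_square)
  show ?thesis
  proof (cases "S \<le> 32 * real N")
    case True
    \<comment> \<open>With e = 1/128 the event becomes a weighted energy of at least S/256, and the
      factor 1/8 in \<open>discrepancy_tail\<close> turns this into S/2048.\<close>
    let ?e = "1/128 :: real"
    let ?A1 = "{x \<in> space (SE n). Energy (Suc n) x \<le> 3 * real (Suc n) \<and> S / 256 \<le> weighted_energy ?e (N\<^sup>2) (Suc n) x}"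
    let ?A2 = "{x \<in> space (SE n). 3 * real (Suc n) \<le> Energy (Suc n) x}"
    have A: "?A1 \<in> sets (SE n)" "?A2 \<in> sets (SE n)" unfolding space_SE sets_SE by measurable
    have "?B \<subseteq> ?A1 \<union> ?A2"
    proof
      fix x assume x: "x \<in> ?B"
      have "weighted_energy ?e (N\<^sup>2) N x = ?e * ((real N)\<^sup>2 * D x)" by (simp add: weighted_energy_def D_def)
      moreover have "(real N)\<^sup>2 * (r / 2) \<le> (real N)\<^sup>2 * D x" using x by (intro mult_left_mono) auto
      ultimately have "S / 256 \<le> weighted_energy ?e (N\<^sup>2) N x" by (simp add: S_def mult.commute)
      then show "x \<in> ?A1 \<union> ?A2" using x by (auto simp: N_def)
    qed
    then have "measure (SE n) ?B \<le> measure (SE n) (?A1 \<union> ?A2)"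
      by (intro SE.finite_measure_mono sets.Un A)
    also have "\<dots> \<le> measure (SE n) ?A1 + measure (SE n) ?A2" by (intro measure_Un_le A)
    also have "\<dots> \<le> exp ((ln (real (N\<^sup>2)) + 1) / 8 - S / 256 / 8) + exp (2 * real (Suc n) - 3 * real (Suc n))"
      by (intro add_mono discrepancy_tail energy_tail) (use n N2 in \<open>auto simp: N_def\<close>)
    also have "\<dots> \<le> real N * exp (- S / 2048) + 1 * exp (- S / 2048)"
    proof (rule add_mono)
      have "ln 2 \<le> ln (real N)" using N by simp
      moreover have "1/2 \<le> ln (2::real)" using ln_le_minus_one[of "1/2 :: real"] by (simp add: ln_div)
      moreover have "ln (real (N\<^sup>2)) = 2 * ln (real N)" using N by (simp add: ln_realpow)
      ultimately have "(ln (real (N\<^sup>2)) + 1) / 8 - S / 256 / 8 \<le> ln (real N) + (- S / 2048)"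
        unfolding add_divide_distrib by linarith
      then have "exp ((ln (real (N\<^sup>2)) + 1) / 8 - S / 256 / 8) \<le> exp (ln (real N) + (- S / 2048))" by (simp only: exp_le_cancel_iff)
      also have "\<dots> = real N * exp (- S / 2048)" using N by (simp only: exp_add exp_ln)
      finally show "exp ((ln (real (N\<^sup>2)) + 1) / 8 - S / 256 / 8) \<le> real N * exp (- S / 2048)" .
      have "2 * real (Suc n) - 3 * real (Suc n) \<le> - S / 2048" using True S0 unfolding N_def[symmetric] by linarith
      then show "exp (2 * real (Suc n) - 3 * real (Suc n)) \<le> 1 * exp (- S / 2048)" by (simp only: exp_le_cancel_iff mult_1)
    qed
    also have "\<dots> = (real N + 1) * exp (- S / 2048)" by (simp only: distrib_right)
    also have "\<dots> \<le> (real N)\<^sup>2 * exp (- S / 2048)"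
    proof (rule mult_right_mono)
      have "2 * real N \<le> real N * real N" using N by (intro mult_right_mono) auto
      moreover have "2 \<le> real N" using N by simp
      ultimately show "real N + 1 \<le> (real N)\<^sup>2" unfolding power2_eq_square by linarith
    qed simp
    finally show ?thesis unfolding D_def S_def by (simp only: minus_mult_left)
  next
    case False
    let ?A = "{x \<in> space (SE n). S / 8 \<le> Energy (Suc n) x}"
    have "?B \<subseteq> ?A"
    proof
      fix x assume x: "x \<in> ?B"
      then have "x \<in> {1..N} \<rightarrow> X" using space_PN_D[of x N] by (simp add: N_def)
      from discrepancy_energy[OF N(2) this] have "r / 2 \<le> 2 * Energy N x / (real N)\<^sup>2 + 1 / real N"
        using x unfolding D_def by simp
      then have "(real N)\<^sup>2 * (r / 2) \<le> (real N)\<^sup>2 * (2 * Energy N x / (real N)\<^sup>2 + 1 / real N)" by (rule mult_left_mono) simp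
      also have "\<dots> = 2 * Energy N x + real N" using N by (simp add: distrib_left power2_eq_square)
      finally have "S / 2 \<le> 2 * Energy N x + real N" by (simp add: S_def mult.commute)
      then have "S / 8 \<le> Energy N x" using False S0 by linarith
      then show "x \<in> ?A" using x by (simp add: N_def)
    qed
    then have "measure (SE n) ?B \<le> measure (SE n) ?A"
      by (intro SE.finite_measure_mono) (simp, unfold space_SE sets_SE, measurable)
    also have "\<dots> \<le> exp (2 * real (Suc n) - S / 8)" by (rule energy_tail)
    also have "\<dots> \<le> exp (- S / 2048)" using False S0 unfolding exp_le_cancel_iff N_def[symmetric] by linarith
    also have "\<dots> \<le> (real N)\<^sup>2 * exp (- S / 2048)"
    proof -
      have "1 * exp (- S / 2048) \<le> (real N)\<^sup>2 * exp (- S / 2048)"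
        using N by (intro mult_right_mono one_le_power) auto
      then show ?thesis by simp
    qed
    finally show ?thesis unfolding D_def S_def by (simp only: minus_mult_left)
  qed
qed

text \<open>The terms beyond N^2 sum to at most 1/N^2 because \<open>En\<close> <= 1, so the
  truncated sum supplies the hypothesis of \<open>En_interpolation\<close>.\<close>

lemma wce_le_weighted_energy:
  assumes N: "1 \<le> N" and x: "x \<in> {1..N} \<rightarrow> X" and s: "1 < s" "s \<le> 2" and r: "0 < r"
    and D: "(\<Sum>m=1..N\<^sup>2. En N x m / (real m)\<^sup>2) + 1 / (real N)\<^sup>2 \<le> r\<^sup>2"
  shows "wce N x s \<le> ereal (sqrt (80 * ((16 + 9 / (s - 1)) * r powr s)))"
proof (rule wce_le_En[OF N x])
  have En: "0 \<le> En N x m" "En N x m \<le> 1" for m using En_nonneg[OF N x] En_le_1[OF N x] by auto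
  fix M :: nat
  show "(\<Sum>n=1..M. En N x n * real n powr (- s)) \<le> (16 + 9 / (s - 1)) * r powr s"
  proof (rule En_interpolation[OF N x s r])
    fix M :: nat
    have "(\<Sum>n=1..M. En N x n * real n powr (- 2)) = (\<Sum>n=1..M. En N x n / (real n)\<^sup>2)"
      by (intro sum.cong refl) (simp add: powr_minus divide_inverse)
    also have "\<dots> \<le> (\<Sum>n=1..N\<^sup>2 + M. En N x n / (real n)\<^sup>2)"
      by (intro sum_mono2) (use En in auto)
    also have "\<dots> = (\<Sum>n=1..N\<^sup>2. En N x n / (real n)\<^sup>2) + (\<Sum>n=Suc (N\<^sup>2)..N\<^sup>2 + M. En N x n / (real n)\<^sup>2)"
    proof -
      have "{1..N\<^sup>2 + M} = {1..N\<^sup>2} \<union> {Suc (N\<^sup>2)..N\<^sup>2 + M}" using N by auto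
      then show ?thesis by (simp only:) (rule sum.union_disjoint, auto)
    qed
    also have "(\<Sum>n=Suc (N\<^sup>2)..N\<^sup>2 + M. En N x n / (real n)\<^sup>2) \<le> (\<Sum>n=Suc (N\<^sup>2)..N\<^sup>2 + M. 1 / (real n)\<^sup>2)"
      by (intro sum_mono divide_right_mono En) simp
    also have "\<dots> \<le> 1 / real (N\<^sup>2)" by (rule inverse_squares_tail) (use N in simp)
    finally show "(\<Sum>n=1..M. En N x n * real n powr (- 2)) \<le> r\<^sup>2" using D by simp
  qed
qed (use s in auto)

text \<open>The loss 2 in the exponent stems from the prefactor N^2 in
  \<open>weighted_energy_tail\<close> and does not depend on s, as the uniform constant of the
  theorem demands.\<close>

lemma wce_tail:
  assumes s: "1 < s" "s \<le> 2"
  obtains Cs :: real where "0 < Cs"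
    "\<And>(N::nat) (R::real). 2 \<le> N \<Longrightarrow> ln (real N) powr (-1/2) \<le> R \<Longrightarrow>
      1 - 1 / real N powr (R\<^sup>2 / Cs - 2) \<le> measure (spherical_ensemble N)
         {x \<in> space (spherical_ensemble N). wce N x s \<le> ereal (R powr (s/2) * (ln (real N) powr (s/4) / real N powr (s/2)))}"
proof -
  define K where "K = 80 * (16 + 9 / (s - 1))"
  have "0 \<le> 9 / (s - 1)" using s by simp
  then have K: "0 < K" unfolding K_def by (intro mult_pos_pos add_pos_nonneg) auto
  \<comment> \<open>Chosen so that K a^s = 1: the interpolation constant is absorbed into the scale
    r, and the threshold becomes exactly \<tau>^(s/2).\<close>
  define a where "a = K powr (- 1 / s)"
  have a: "0 < a" using K by (simp add: a_def)
  have Ka: "K * a powr s = 1" using K s unfolding a_def powr_powr by (simp add: powr_minus)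
  define Cs where "Cs = 2048 / a\<^sup>2"
  have Cs: "0 < Cs" using a by (simp add: Cs_def)
  show ?thesis
  proof (rule that[OF Cs])
    fix N :: nat and R :: real assume N: "2 \<le> N" and R: "ln (real N) powr (-1/2) \<le> R"
    obtain n where n: "N = Suc n" "1 \<le> n" using N by (cases N) auto
    have Np: "0 < real N" "1 \<le> N" using N by auto
    have L: "0 < ln (real N)" using N by simp
    have "0 < ln (real N) powr (-1/2)" using L by simp
    then have Rp: "0 < R" using R by linarith
    define \<tau> where "\<tau> = R * (ln (real N) powr (1/2) / real N)"
    have \<tau>: "0 < \<tau>" using Rp L Np by (simp add: \<tau>_def)
    define r where "r = a * \<tau>"
    have r: "0 < r" using a \<tau> by (simp add: r_def)
    have S: "r\<^sup>2 * (real N)\<^sup>2 = 2048 * (R\<^sup>2 / Cs * ln (real N))"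
    proof -
      have "(ln (real N) powr (1/2))\<^sup>2 = ln (real N)" using L by (simp add: powr_half_sqrt)
      then have "r\<^sup>2 * (real N)\<^sup>2 = a\<^sup>2 * R\<^sup>2 * ln (real N)"
        using Np by (simp add: r_def \<tau>_def power_mult_distrib power_divide)
      then show ?thesis using a by (simp add: Cs_def)
    qed
    have thr: "sqrt (80 * ((16 + 9 / (s - 1)) * r powr s)) = R powr (s/2) * (ln (real N) powr (s/4) / real N powr (s/2))"
    proof -
      have "80 * ((16 + 9 / (s - 1)) * r powr s) = (K * a powr s) * \<tau> powr s"
        using a \<tau> by (simp add: K_def r_def powr_mult)
      also have "\<dots> = \<tau> powr s" by (simp add: Ka)
      finally have "sqrt (80 * ((16 + 9 / (s - 1)) * r powr s)) = \<tau> powr (s / 2)"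
        using \<tau> by (simp add: powr_half_sqrt[symmetric] powr_powr)
      also have "\<dots> = R powr (s/2) * (ln (real N) powr (s/4) / real N powr (s/2))"
        unfolding \<tau>_def using Rp L Np by (simp add: powr_mult powr_divide powr_powr)
      finally show ?thesis .
    qed
    let ?c = "R powr (s/2) * (ln (real N) powr (s/4) / real N powr (s/2))"
    let ?G = "{x \<in> space (SE n). wce N x s \<le> ereal ?c}"
    let ?B = "{x \<in> space (SE n). r\<^sup>2 / 2 \<le> (\<Sum>m=1..N\<^sup>2. En N x m / (real m)\<^sup>2)}"
    have G: "?G \<in> sets (SE n)" unfolding space_SE sets_SE n(1)[symmetric] by (rule wce_measurable)
    have bound: "1 / real N powr (R\<^sup>2 / Cs - 2) = (real N)\<^sup>2 * exp (- (r\<^sup>2 * (real N)\<^sup>2) / 2048)"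
    proof -
      have "real N powr (R\<^sup>2 / Cs - 2) = exp (R\<^sup>2 / Cs * ln (real N)) / (real N)\<^sup>2"
        using Np by (simp add: powr_diff) (simp add: powr_def)
      moreover have "1 / (exp b / M) = M * exp (- (2048 * b) / 2048)" for b M :: real
        by (simp add: exp_minus inverse_eq_divide)
      ultimately show ?thesis unfolding S by (simp only:)
    qed
    have "1 - 1 / real N powr (R\<^sup>2 / Cs - 2) \<le> measure (SE n) ?G"
    \<comment> \<open>If r^2 N^2 >= 2, the remainder 1/N^2 is at most r^2/2 and can be split off.
      Otherwise the claimed lower bound is not positive, since N^2 >= 4 and 4 exp (-1) >= 1.\<close>
    proof (cases "2 \<le> r\<^sup>2 * (real N)\<^sup>2")
      case True
      have "space (SE n) - ?G \<subseteq> ?B"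
      proof
        fix x assume x: "x \<in> space (SE n) - ?G"
        then have xX: "x \<in> {1..N} \<rightarrow> X" using space_PN_D[of x N] by (simp add: n)
        have "\<not> (\<Sum>m=1..N\<^sup>2. En N x m / (real m)\<^sup>2) + 1 / (real N)\<^sup>2 \<le> r\<^sup>2"
          using wce_le_weighted_energy[OF Np(2) xX s r] x unfolding thr by auto
        moreover have "1 / (real N)\<^sup>2 \<le> r\<^sup>2 / 2" using True Np by (simp add: field_simps)
        ultimately show "x \<in> ?B" using x by simp
      qed
      moreover have "?B \<in> sets (SE n)" unfolding space_SE sets_SE n(1)[symmetric] by measurable
      ultimately have "measure (SE n) (space (SE n) - ?G) \<le> measure (SE n) ?B" by (rule SE.finite_measure_mono)
      also have "\<dots> \<le> 1 / real N powr (R\<^sup>2 / Cs - 2)"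
        unfolding bound by (rule weighted_energy_tail[OF n(2), of "r\<^sup>2", folded n(1)]) simp
      finally show ?thesis using SE.finite_measure_compl[OF G] by simp
    next
      case False
      have "1 \<le> 4 * exp (- 1 :: real)" using exp_le by (simp add: exp_minus field_simps)
      also have "\<dots> \<le> (real N)\<^sup>2 * exp (- (r\<^sup>2 * (real N)\<^sup>2) / 2048)"
      proof (rule mult_mono)
        have "2\<^sup>2 \<le> (real N)\<^sup>2" using N by (intro power_mono) auto
        then show "4 \<le> (real N)\<^sup>2" by simp
        show "exp (- 1) \<le> exp (- (r\<^sup>2 * (real N)\<^sup>2) / 2048)" using False by simp
      qed auto
      finally have "1 - 1 / real N powr (R\<^sup>2 / Cs - 2) \<le> 0" unfolding bound by simp
      also have "0 \<le> measure (SE n) ?G" by simp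
      finally show ?thesis .
    qed
    then show "1 - 1 / real N powr (R\<^sup>2 / Cs - 2) \<le> measure (spherical_ensemble N)
         {x \<in> space (spherical_ensemble N). wce N x s \<le> ereal ?c}"
      by (simp only: SE_def n(1))
  qed
qed

theorem theorem1p1:
  shows "\<exists>C::real. C > 0 \<and>
    (\<forall>(N::nat) (R::real). N \<ge> 2 \<longrightarrow>
       R \<in> {ln (real N) powr (-1/2) .. real N * ln (real N) powr (-1/2)} \<longrightarrow>
       measure (spherical_ensemble N)
         {x \<in> space (spherical_ensemble N).
            wce N x 2 \<le> ereal (R * (ln (real N) powr (1/2) / real N))}
       \<ge> 1 - 1 / real N powr (R\<^sup>2 / C - C)) \<and>
    (\<forall>s::real. s \<in> {1<..2} \<longrightarrow>
       (\<exists>Cs::real. Cs > 0 \<and>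
          (\<forall>(N::nat) (R::real). N \<ge> 2 \<longrightarrow>
             R \<in> {ln (real N) powr (-1/2) .. real N * ln (real N) powr (-1/2)} \<longrightarrow>
             measure (spherical_ensemble N)
               {x \<in> space (spherical_ensemble N).
                  wce N x s \<le> ereal (R powr (s/2) *
                    (ln (real N) powr (s/4) / real N powr (s/2)))}
             \<ge> 1 - 1 / real N powr (R\<^sup>2 / Cs - C))))"
proof -
  obtain C2 :: real where C2: "0 < C2"
    "\<And>(N::nat) (R::real). 2 \<le> N \<Longrightarrow> ln (real N) powr (-1/2) \<le> R \<Longrightarrow>
      1 - 1 / real N powr (R\<^sup>2 / C2 - 2) \<le> measure (spherical_ensemble N)
         {x \<in> space (spherical_ensemble N). wce N x 2 \<le> ereal (R powr (2/2) * (ln (real N) powr (2/4) / real N powr (2/2)))}"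
    by (rule wce_tail[of 2]) auto
  \<comment> \<open>One constant serves as the divisor in (i) and as the loss in the exponent in
    both assertions; enlarging it weakens the claim in either role.\<close>
  define C where "C = max C2 2"
  have C: "0 < C" "2 \<le> C" "C2 \<le> C" by (auto simp: C_def)
  have weaken: "1 - 1 / real N powr b \<le> 1 - 1 / real N powr b'" if "b \<le> b'" "2 \<le> N" for b b' and N :: nat
  proof -
    have "real N powr b \<le> real N powr b'" using that by (intro powr_mono) auto
    moreover have "0 < real N powr b" using that by simp
    ultimately show ?thesis by (simp add: frac_le)
  qed
  show ?thesis
  proof (rule exI[of _ C], intro conjI allI impI)
    show "0 < C" by (rule C(1))
    fix N :: nat and R :: real
    assume N: "2 \<le> N" and R: "R \<in> {ln (real N) powr (-1/2) .. real N * ln (real N) powr (-1/2)}"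
    have R1: "ln (real N) powr (-1/2) \<le> R" using R unfolding atLeastAtMost_iff by (rule conjunct1)
    have "0 < ln (real N) powr (-1/2)" using N by simp
    then have Rp: "0 < R" using R1 by linarith
    have eq: "R powr (2/2) * (ln (real N) powr (2/4) / real N powr (2/2)) = R * (ln (real N) powr (1/2) / real N)"
      using Rp N by simp
    have "1 - 1 / real N powr (R\<^sup>2 / C2 - 2) \<le> measure (spherical_ensemble N)
         {x \<in> space (spherical_ensemble N). wce N x 2 \<le> ereal (R * (ln (real N) powr (1/2) / real N))}"
      using C2(2)[OF N R1] unfolding eq .
    moreover have "R\<^sup>2 / C - C \<le> R\<^sup>2 / C2 - 2"
      using C C2(1) by (intro diff_mono divide_left_mono) auto
    ultimately show "measure (spherical_ensemble N)
         {x \<in> space (spherical_ensemble N). wce N x 2 \<le> ereal (R * (ln (real N) powr (1/2) / real N))}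
       \<ge> 1 - 1 / real N powr (R\<^sup>2 / C - C)"
      using weaken[of "R\<^sup>2 / C - C" "R\<^sup>2 / C2 - 2" N] N by linarith
  next
    fix s :: real assume "s \<in> {1<..2}"
    then have s: "1 < s" "s \<le> 2" by auto
    obtain Cs :: real where Cs: "0 < Cs"
    "\<And>(N::nat) (R::real). 2 \<le> N \<Longrightarrow> ln (real N) powr (-1/2) \<le> R \<Longrightarrow>
      1 - 1 / real N powr (R\<^sup>2 / Cs - 2) \<le> measure (spherical_ensemble N)
         {x \<in> space (spherical_ensemble N). wce N x s \<le> ereal (R powr (s/2) * (ln (real N) powr (s/4) / real N powr (s/2)))}"
      by (rule wce_tail[OF s]) blast
    show "\<exists>Cs::real. Cs > 0 \<and>
          (\<forall>(N::nat) (R::real). N \<ge> 2 \<longrightarrow>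
             R \<in> {ln (real N) powr (-1/2) .. real N * ln (real N) powr (-1/2)} \<longrightarrow>
             measure (spherical_ensemble N)
               {x \<in> space (spherical_ensemble N).
                  wce N x s \<le> ereal (R powr (s/2) *
                    (ln (real N) powr (s/4) / real N powr (s/2)))}
             \<ge> 1 - 1 / real N powr (R\<^sup>2 / Cs - C))"
    proof (rule exI[of _ Cs], intro conjI allI impI Cs(1))
      fix N :: nat and R :: real
      assume N: "2 \<le> N" and R: "R \<in> {ln (real N) powr (-1/2) .. real N * ln (real N) powr (-1/2)}"
      have R1: "ln (real N) powr (-1/2) \<le> R" using R unfolding atLeastAtMost_iff by (rule conjunct1)
      have "R\<^sup>2 / Cs - C \<le> R\<^sup>2 / Cs - 2" using C by simp
      from weaken[OF this N] show "measure (spherical_ensemble N)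
               {x \<in> space (spherical_ensemble N).
                  wce N x s \<le> ereal (R powr (s/2) * (ln (real N) powr (s/4) / real N powr (s/2)))}
             \<ge> 1 - 1 / real N powr (R\<^sup>2 / Cs - C)"
        using Cs(2)[OF N R1] by (rule order_trans)
    qed
  qed
qed

end
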